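(* Let $(X,\mathrm{dist})$ be a geodesic metric space and let $\mathcal A$ be a collection of subsets of $X$. The space $X$ is asymptotically tree-graded with respect to $\mathcal A$ if and only if the following three properties are satisfied: $(\alpha_1)$ for every $\delta>0$ the diameters of the intersections $\mathcal N_\delta(A)\cap\mathcal N_\delta(A')$ are uniformly bounded for all $A\neq A'$ in $\mathcal A$; $(\beta_2)$ there exist $\epsilon>0$ and $M\ge 0$ such that for any geodesic $\mathfrak g:[0,\ell]\to X$ of length $\ell$ and any $A\in\mathcal A$ with $\mathfrak g(0),\mathfrak g(\ell)\in\mathcal N_{\epsilon\ell}(A)$, the middle third $\mathfrak g([\ell/3,2\ell/3])$ is contained in $\mathcal N_M(A)$; $(\beta_3)$ there exist $\theta>0$, $\nu\ge 8$ and $\chi>0$ such that any $(\theta,\nu)$-fat geodesic hexagon is contained in $\mathcal N_\chi(A)$ for some $A\in\mathcal A$.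
   Context: For $Y\subset X$ in a metric space and $r\geq 0$, $\mathcal N_r(Y)=\{x\in X:\mathrm{dist}(x,Y)<r\}$. Fat polygons. A geodesic $k$-gon $P$ is a union of $k$ geodesics (edges) $\mathfrak q_1,\dots,\mathfrak q_k$, the endpoint of $\mathfrak q_i$ being the origin of $\mathfrak q_{i+1}$ (indices mod $k$). For a vertex $x$, common endpoint of the consecutive edges $\mathfrak q,\mathfrak q'$, $\mathcal O_x$ is the polygonal line $P\setminus(\mathfrak q\cup\mathfrak q')$. $P$ is $(\theta,\nu)$-fat ($\theta>0$, $\nu\ge 8$) if $(F_1)$ for every edge $\mathfrak q$ with endpoints $x,y$, $\mathrm{dist}(\mathfrak q\setminus\mathcal N_{2\theta}(\{x,y\}),P\setminus\mathfrak q)\ge\theta$; and $(F_2)$ for every vertex $x$, $\mathrm{dist}(x,\mathcal O_x)\ge\nu\theta$. Asymptotic cones. Let $\omega$ be a non-principal ultrafilter on $\mathbb N$, $e=(e_n)$ a sequence in $X$, $d=(d_n)$ a sequence in $(0,\infty)$ with $\lim_\omega d_n=+\infty$. $\mathrm{Con}_\omega(X;e,d)$ is the quotient of the set of sequences $(x_n)$ in $X$ with $\mathrm{dist}(x_n,e_n)/d_n$ $\omega$-almost surely bounded, by the relation $\lim_\omega \mathrm{dist}(x_n,y_n)/d_n=0$, with metric $\lim_\omega \mathrm{dist}(x_n,y_n)/d_n$. The limit set of a sequence $(A_n)$ of subsets is $\lim_\omega(A_n)=\{\lim_\omega(a_n): a_n\in A_n\ \omega\text{-almost surely}\}$, where $\lim_\omega(a_n)$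 denotes the class of $(a_n)$. A complete geodesic metric space is tree-graded with respect to a (possibly empty) collection of closed geodesic subsets (pieces) if $(T_1)$ every two different pieces have at most one point in common, and $(T_2)$ every simple non-trivial geodesic triangle is contained in one piece. $X$ is asymptotically tree-graded with respect to a collection $\mathcal A$ of subsets if every asymptotic cone $\mathrm{Con}_\omega(X;e,d)$ is tree-graded with respect to the collection $\mathcal A_\omega$ of limit sets $\lim_\omega(A_n)$, $A_n\in\mathcal A$, with $\mathrm{dist}(e_n,A_n)/d_n$ $\omega$-almost surely bounded. Standing convention: for all pairs $(X,\mathcal A)$ considered, $X$ is not contained in any finite radius tubular neighborhood of a set $A\in\mathcal A$.
   Formalization: In (T1) limit sets count as different pieces when A_n≠A'_n ω-almost surely, even if equal as sets (else (α1) can fail: plane with a ray, A={plane, plane plus a ray point}); in (F1),(F2) the complement of edges means the union of the remaining edges. *)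

theory Defs
  imports "HOL-Analysis.Analysis"
begin

text \<open>Metric spaces are given by a carrier and a distance, as in the library locale
  \<^locale>\<open>Metric_space\<close>, because asymptotic cones are quotients of sets of sequences.\<close>

section \<open>Distances between sets, neighborhoods, diameters\<close>

text \<open>Extended values, so that the distance to the empty set is infinite.\<close>

definition set_dist :: "('a \<Rightarrow> 'a \<Rightarrow> real) \<Rightarrow> 'a set \<Rightarrow> 'a set \<Rightarrow> ennreal" where
  "set_dist d S T = (INF x\<in>S. INF y\<in>T. ennreal (d x y))"

definition nbhd :: "'a set \<Rightarrow> ('a \<Rightarrow> 'a \<Rightarrow> real) \<Rightarrow> real \<Rightarrow> 'a set \<Rightarrow> 'a set" where
  "nbhd M d r Y = {x \<in> M. set_dist d {x} Y < ennreal r}"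

definition set_diam :: "('a \<Rightarrow> 'a \<Rightarrow> real) \<Rightarrow> 'a set \<Rightarrow> ennreal" where
  "set_diam d S = (SUP x\<in>S. SUP y\<in>S. ennreal (d x y))"

section \<open>Geodesics and geodesic polygons\<close>

definition geodesic :: "'a set \<Rightarrow> ('a \<Rightarrow> 'a \<Rightarrow> real) \<Rightarrow> (real \<Rightarrow> 'a) \<Rightarrow> real \<Rightarrow> bool" where
  "geodesic M d g l \<longleftrightarrow> 0 \<le> l \<and> g ` {0..l} \<subseteq> M \<and>
     (\<forall>s\<in>{0..l}. \<forall>t\<in>{0..l}. d (g s) (g t) = \<bar>s - t\<bar>)"

definition geodesic_space :: "'a set \<Rightarrow> ('a \<Rightarrow> 'a \<Rightarrow> real) \<Rightarrow> bool" where
  "geodesic_space M d \<longleftrightarrow>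
     (\<forall>x\<in>M. \<forall>y\<in>M. \<exists>g l. geodesic M d g l \<and> g 0 = x \<and> g l = y)"

text \<open>The edges are \<open>g i : [0, l i] \<rightarrow> M\<close> for \<open>i < k\<close>; vertex \<open>i\<close> is
  the common endpoint \<open>g i (l i)\<close> of the edges \<open>i\<close> and \<open>i + 1\<close> (mod \<open>k\<close>).\<close>

definition geodesic_polygon ::
  "'a set \<Rightarrow> ('a \<Rightarrow> 'a \<Rightarrow> real) \<Rightarrow> nat \<Rightarrow> (nat \<Rightarrow> real \<Rightarrow> 'a) \<Rightarrow> (nat \<Rightarrow> real) \<Rightarrow> bool" where
  "geodesic_polygon M d k g l \<longleftrightarrow>
     (\<forall>i<k. geodesic M d (g i) (l i) \<and> g i (l i) = g (Suc i mod k) 0)"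

definition edges :: "(nat \<Rightarrow> real \<Rightarrow> 'a) \<Rightarrow> (nat \<Rightarrow> real) \<Rightarrow> nat set \<Rightarrow> 'a set" where
  "edges g l I = (\<Union>i\<in>I. g i ` {0..l i})"

text \<open>A polygon with some edges removed is understood as the polygonal line formed by the
  remaining edges, endpoints included.  (With the difference of point sets instead, a polygon
  running back and forth along one segment would have empty complements of edges and would
  vacuously be fat.)\<close>

definition fat_polygon ::
  "'a set \<Rightarrow> ('a \<Rightarrow> 'a \<Rightarrow> real) \<Rightarrow> real \<Rightarrow> real \<Rightarrow> nat
     \<Rightarrow> (nat \<Rightarrow> real \<Rightarrow> 'a) \<Rightarrow> (nat \<Rightarrow> real) \<Rightarrow> bool" where
  "fat_polygon M d \<theta> \<nu> k g l \<longleftrightarrow> geodesic_polygon M d k g l \<and>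
     (\<forall>i<k. set_dist d (edges g l {i} - nbhd M d (2 * \<theta>) {g i 0, g i (l i)})
                       (edges g l ({..<k} - {i})) \<ge> ennreal \<theta>) \<and>
     (\<forall>i<k. set_dist d {g i (l i)} (edges g l ({..<k} - {i, Suc i mod k})) \<ge> ennreal (\<nu> * \<theta>))"

text \<open>Simplicity: the closed curve obtained by concatenating the edges, parametrized over the
  half-open intervals \<open>[0, l i)\<close>, is injective.  Non-triviality: it is not constant.\<close>

definition simple_nontrivial_polygon :: "nat \<Rightarrow> (nat \<Rightarrow> real \<Rightarrow> 'a) \<Rightarrow> (nat \<Rightarrow> real) \<Rightarrow> bool" where
  "simple_nontrivial_polygon k g l \<longleftrightarrow>
     inj_on (\<lambda>(i, t). g i t) (SIGMA i:{..<k}. {0..<l i}) \<and> (\<exists>i<k. 0 < l i)"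

section \<open>Tree-graded spaces\<close>

text \<open>The pieces form a family indexed by \<open>I\<close>; an unindexed collection \<open>C\<close> of subsets is
  the family \<open>\<lambda>A. A\<close> over \<open>C\<close>.\<close>

definition tree_graded ::
  "'a set \<Rightarrow> ('a \<Rightarrow> 'a \<Rightarrow> real) \<Rightarrow> 'i set \<Rightarrow> ('i \<Rightarrow> 'a set) \<Rightarrow> bool" where
  "tree_graded M d I P \<longleftrightarrow>
     Metric_space M d \<and> Metric_space.mcomplete M d \<and> geodesic_space M d \<and>
     (\<forall>i\<in>I. closedin (Metric_space.mtopology M d) (P i) \<and> geodesic_space (P i) d) \<and>
     (\<forall>i\<in>I. \<forall>j\<in>I. i \<noteq> j \<longrightarrow> (\<forall>x \<in> P i \<inter> P j. \<forall>y \<in> P i \<inter> P j. x = y)) \<and>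
     (\<forall>g l. geodesic_polygon M d 3 g l \<and> simple_nontrivial_polygon 3 g l \<longrightarrow>
        (\<exists>i\<in>I. edges g l {..<3} \<subseteq> P i))"

section \<open>Asymptotic cones\<close>

definition nonprincipal_ultrafilter :: "nat filter \<Rightarrow> bool" where
  "nonprincipal_ultrafilter \<omega> \<longleftrightarrow> \<omega> \<noteq> bot \<and>
     (\<forall>P. eventually P \<omega> \<or> eventually (\<lambda>n. \<not> P n) \<omega>) \<and> (\<forall>m. \<omega> \<noteq> principal {m})"

definition cone_seqs ::
  "'a set \<Rightarrow> ('a \<Rightarrow> 'a \<Rightarrow> real) \<Rightarrow> nat filter \<Rightarrow> (nat \<Rightarrow> 'a) \<Rightarrow> (nat \<Rightarrow> real) \<Rightarrow> (nat \<Rightarrow> 'a) set" where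
  "cone_seqs X d \<omega> e s =
     {x. (\<forall>n. x n \<in> X) \<and> (\<exists>B. \<forall>\<^sub>F n in \<omega>. d (x n) (e n) / s n \<le> B)}"

definition cone_rel ::
  "'a set \<Rightarrow> ('a \<Rightarrow> 'a \<Rightarrow> real) \<Rightarrow> nat filter \<Rightarrow> (nat \<Rightarrow> 'a) \<Rightarrow> (nat \<Rightarrow> real)
     \<Rightarrow> ((nat \<Rightarrow> 'a) \<times> (nat \<Rightarrow> 'a)) set" where
  "cone_rel X d \<omega> e s = {(x, y). x \<in> cone_seqs X d \<omega> e s \<and> y \<in> cone_seqs X d \<omega> e s \<and>
     ((\<lambda>n. d (x n) (y n) / s n) \<longlongrightarrow> 0) \<omega>}"

definition cone ::
  "'a set \<Rightarrow> ('a \<Rightarrow> 'a \<Rightarrow> real) \<Rightarrow> nat filter \<Rightarrow> (nat \<Rightarrow> 'a) \<Rightarrow> (nat \<Rightarrow> real) \<Rightarrow> (nat \<Rightarrow> 'a) set set" where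
  "cone X d \<omega> e s = cone_seqs X d \<omega> e s // cone_rel X d \<omega> e s"

text \<open>The value 0 outside the carrier is needed because \<^locale>\<open>Metric_space\<close> asks for
  non-negativity of the distance everywhere.\<close>

definition cone_dist ::
  "'a set \<Rightarrow> ('a \<Rightarrow> 'a \<Rightarrow> real) \<Rightarrow> nat filter \<Rightarrow> (nat \<Rightarrow> 'a) \<Rightarrow> (nat \<Rightarrow> real)
     \<Rightarrow> (nat \<Rightarrow> 'a) set \<Rightarrow> (nat \<Rightarrow> 'a) set \<Rightarrow> real" where
  "cone_dist X d \<omega> e s a b =
     (if a \<in> cone X d \<omega> e s \<and> b \<in> cone X d \<omega> e s
      then THE r. \<forall>x\<in>a. \<forall>y\<in>b. ((\<lambda>n. d (x n) (y n) / s n) \<longlongrightarrow> r) \<omega>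
      else 0)"

definition limit_set ::
  "'a set \<Rightarrow> ('a \<Rightarrow> 'a \<Rightarrow> real) \<Rightarrow> nat filter \<Rightarrow> (nat \<Rightarrow> 'a) \<Rightarrow> (nat \<Rightarrow> real)
     \<Rightarrow> (nat \<Rightarrow> 'a set) \<Rightarrow> (nat \<Rightarrow> 'a) set set" where
  "limit_set X d \<omega> e s A =
     {cone_rel X d \<omega> e s `` {a} | a. a \<in> cone_seqs X d \<omega> e s \<and> (\<forall>\<^sub>F n in \<omega>. a n \<in> A n)}"

text \<open>The collection of limit sets is a family whose indices are the sequences \<open>(A n)\<close> of
  members of the given collection with \<open>dist (e n, A n) / s n\<close> almost surely bounded, up to
  almost sure equality.  Two pieces are thus different if \<open>A n \<noteq> A' n\<close> almost surely.
  Comparing limit sets only as sets would make two distinct members at finite Hausdorff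
  distance indistinguishable in every cone.\<close>

definition piece_seqs ::
  "('a \<Rightarrow> 'a \<Rightarrow> real) \<Rightarrow> 'a set set \<Rightarrow> nat filter \<Rightarrow> (nat \<Rightarrow> 'a) \<Rightarrow> (nat \<Rightarrow> real)
     \<Rightarrow> (nat \<Rightarrow> 'a set) set" where
  "piece_seqs d \<A> \<omega> e s =
     {A. (\<forall>n. A n \<in> \<A>) \<and>
         (\<exists>B::real. \<forall>\<^sub>F n in \<omega>. set_dist d {e n} (A n) / ennreal (s n) \<le> ennreal B)}"

definition piece_indices ::
  "('a \<Rightarrow> 'a \<Rightarrow> real) \<Rightarrow> 'a set set \<Rightarrow> nat filter \<Rightarrow> (nat \<Rightarrow> 'a) \<Rightarrow> (nat \<Rightarrow> real)
     \<Rightarrow> (nat \<Rightarrow> 'a set) set set" where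
  "piece_indices d \<A> \<omega> e s =
     piece_seqs d \<A> \<omega> e s //
       {(A, A'). A \<in> piece_seqs d \<A> \<omega> e s \<and> A' \<in> piece_seqs d \<A> \<omega> e s \<and>
                 (\<forall>\<^sub>F n in \<omega>. A n = A' n)}"

text \<open>All representatives of an index have the same limit set, so the union below is that set.\<close>

definition asymptotically_tree_graded :: "'a set \<Rightarrow> ('a \<Rightarrow> 'a \<Rightarrow> real) \<Rightarrow> 'a set set \<Rightarrow> bool" where
  "asymptotically_tree_graded X d \<A> \<longleftrightarrow>
     (\<forall>\<omega> e s. nonprincipal_ultrafilter \<omega> \<and> (\<forall>n. e n \<in> X) \<and> (\<forall>n. 0 < s n) \<and>
        filterlim s at_top \<omega> \<longrightarrow>
        tree_graded (cone X d \<omega> e s) (cone_dist X d \<omega> e s)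
          (piece_indices d \<A> \<omega> e s) (\<lambda>c. \<Union>A\<in>c. limit_set X d \<omega> e s A))"

end

theory Submission
  imports Defs
begin

text \<open>
  Assume the three properties and work in a cone, with limits of geodesics as distinguished segments.
  By \<open>(\<beta>\<^sub>2)\<close> the limit sets are convex, by \<open>(\<alpha>\<^sub>1)\<close> distinct ones share at most one point, and a
  simple triangle of limit segments is approximated by geodesic triangles which, once their
  corners are cut off, become fat hexagons, so that it lies in a limit set by \<open>(\<beta>\<^sub>3)\<close>. A geodesic of
  the cone need not be a limit segment. However, all segments from a point to a piece enter the piece
  at the same point, and this entry point does not change along a path that meets the piece in at
  most one point; it follows that every simple Lipschitz loop, in particular every simple
  geodesic triangle, lies in a piece.

  Conversely, \<open>(\<alpha>\<^sub>1)\<close> and \<open>(\<beta>\<^sub>2)\<close> follow by rescaling potential counterexamples. For \<open>(\<beta>\<^sub>3)\<close>, call two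
  points linked relative to \<open>x\<close> if they are joined by a chain in which consecutive points are
  the ends of a segment avoiding \<open>x\<close> or lie in a common piece. Two segments issuing from \<open>x\<close> whose
  ends are linked either meet again or start in the same piece. If \<open>x\<close> is on an edge of a fat
  hexagon, the other edges link the two directions of the edge at \<open>x\<close>, first at the scale of the
  hexagon and then, by a descent through the scales, at the scale \<open>\<theta>\<close> of its fatness. Since the two
  directions do not meet again, the edge is near a piece. The same argument at the
  point where an edge leaves the piece of the preceding one shows that all edges are near one piece.
\<close>

text \<open>The obstacles are different in the two directions. In a cone, (T2) concerns all geodesic
  triangles, but the hypotheses control only limits of geodesics of \<open>X\<close>. Hence entry
  points are studied for an abstract class \<open>seg\<close> of segments, which is
  \<open>lseg\<close> in one direction and the class \<open>geo_seg\<close> of all geodesics in the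
  other, and the step from simple triangles of segments to simple loops uses only that the loop is
  Lipschitz. In the converse direction, a hexagon may be arbitrarily large compared with \<theta>,
  so that in the cone at scale \<theta> its other edges recede to infinity and no polygon is left.
  What survives is linking. It passes to smaller scales because unlinked points have
  \<open>x\<close> on every segment between them, so their distances to \<open>x\<close> add up,
  while two paths are linked at the smallest scale at which additivity clearly fails. The constants
  of \<open>(\<beta>\<^sub>3)\<close> come from refuting sequences of hexagons with \<theta> tending
  to infinity; \<nu> = 8 leaves room around a vertex for a corner region of radius 4
  \<theta>.\<close>

lemma less_3_cases: "(k::nat) < 3 \<longleftrightarrow> k = 0 \<or> k = 1 \<or> k = 2"
  by (auto simp: numeral_3_eq_3 less_Suc_eq)

lemma less_6_cases: "(k::nat) < 6 \<longleftrightarrow> k = 0 \<or> k = 1 \<or> k = 2 \<or> k = 3 \<or> k = 4 \<or> k = 5"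
  by (auto simp: eval_nat_numeral less_Suc_eq)

section \<open>Closed sets and Lipschitz paths in a metric space\<close>

definition (in Metric_space) sclosed :: "'a set \<Rightarrow> bool" where
  "sclosed T \<longleftrightarrow> T \<subseteq> M \<and> (\<forall>x\<in>M. (\<forall>e>0. \<exists>y\<in>T. d x y < e) \<longrightarrow> x \<in> T)"

text \<open>Constant 1 suffices: geodesics are such paths, and so is a polygon traversed by arc
  length.\<close>

definition (in Metric_space) lip_path :: "(real \<Rightarrow> 'a) \<Rightarrow> real \<Rightarrow> real \<Rightarrow> bool" where
  "lip_path c a b \<longleftrightarrow> (\<forall>t\<in>{a..b}. c t \<in> M) \<and> (\<forall>s\<in>{a..b}. \<forall>t\<in>{a..b}. d (c s) (c t) \<le> \<bar>s - t\<bar>)"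

context Metric_space
begin

lemma geodesic_lip_path: "geodesic M d g l \<Longrightarrow> lip_path g 0 l"
  unfolding geodesic_def lip_path_def by auto

lemma sclosedD: "sclosed T \<Longrightarrow> x \<in> M \<Longrightarrow> (\<And>e. e > 0 \<Longrightarrow> \<exists>y\<in>T. d x y < e) \<Longrightarrow> x \<in> T"
  unfolding sclosed_def by auto

lemma sclosed_subset: "sclosed T \<Longrightarrow> T \<subseteq> M"
  unfolding sclosed_def by auto

lemma lip_path_sub: "lip_path c a b \<Longrightarrow> a \<le> a' \<Longrightarrow> b' \<le> b \<Longrightarrow> lip_path c a' b'"
  unfolding lip_path_def by auto

lemma lip_path_closed_vimage:
  assumes c: "lip_path c a b" and T: "sclosed T"
  shows "closed {t\<in>{a..b}. c t \<in> T}"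
  unfolding closed_sequential_limits
proof (intro allI impI, elim conjE)
  fix x l assume x: "\<forall>n. x n \<in> {t\<in>{a..b}. c t \<in> T}" and lim: "x \<longlonglongrightarrow> l"
  have "l \<in> {a..b}"
    using closed_sequentially[of "{a..b}" x l] x lim by auto
  moreover have "c l \<in> T"
  proof (rule sclosedD[OF T])
    show "c l \<in> M" using c \<open>l \<in> {a..b}\<close> unfolding lip_path_def by auto
    fix e :: real assume "e > 0"
    then obtain n where "\<bar>x n - l\<bar> < e" using LIMSEQ_D[OF lim, of e] by auto
    then show "\<exists>y\<in>T. d (c l) y < e"
      using c x \<open>l \<in> {a..b}\<close> unfolding lip_path_def
      by (intro bexI[of _ "c (x n)"]) (smt (verit) mem_Collect_eq)+
  qed
  ultimately show "l \<in> {t\<in>{a..b}. c t \<in> T}" by auto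
qed

lemma lip_path_first:
  assumes c: "lip_path c a b" and T: "sclosed T" and t: "t \<in> {a..b}" "c t \<in> T"
  obtains u where "u \<in> {a..t}" "c u \<in> T" "\<And>v. v \<in> {a..<u} \<Longrightarrow> c v \<notin> T"
proof -
  let ?K = "{t\<in>{a..b}. c t \<in> T}"
  have K: "closed ?K" "?K \<noteq> {}" "bdd_below ?K"
    using lip_path_closed_vimage[OF c T] t by (auto intro: bdd_belowI[of _ a])
  have "Inf ?K \<in> ?K" by (rule closed_contains_Inf[OF K(2,3,1)])
  moreover have "Inf ?K \<le> v" if "v \<in> ?K" for v using K(3) that by (rule cInf_lower[rotated])
  ultimately show ?thesis
    using t by (intro that[of "Inf ?K"]) force+
qed

lemma lip_path_reverse: "lip_path c a b \<Longrightarrow> lip_path (\<lambda>t. c (a + b - t)) a b"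
  unfolding lip_path_def
proof (intro conjI ballI; elim conjE)
  fix t assume "\<forall>t\<in>{a..b}. c t \<in> M" "t \<in> {a..b}"
  then show "c (a + b - t) \<in> M" by auto
next
  fix s t assume *: "\<forall>s\<in>{a..b}. \<forall>t\<in>{a..b}. d (c s) (c t) \<le> \<bar>s - t\<bar>" "s \<in> {a..b}" "t \<in> {a..b}"
  then have "d (c (a + b - s)) (c (a + b - t)) \<le> \<bar>(a + b - s) - (a + b - t)\<bar>"
    by (intro *(1)[rule_format]) auto
  then show "d (c (a + b - s)) (c (a + b - t)) \<le> \<bar>s - t\<bar>" by linarith
qed

lemma lip_path_last:
  assumes c: "lip_path c a b" and T: "sclosed T" and t: "t \<in> {a..b}" "c t \<in> T"
  obtains u where "u \<in> {t..b}" "c u \<in> T" "\<And>v. v \<in> {u<..b} \<Longrightarrow> c v \<notin> T"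
proof -
  obtain u where u: "u \<in> {a..a+b-t}" "c (a+b-u) \<in> T" "\<And>v. v \<in> {a..<u} \<Longrightarrow> c (a+b-v) \<notin> T"
    using lip_path_first[OF lip_path_reverse[OF c] T, of "a+b-t"] t by auto
  show ?thesis
  proof (rule that[of "a+b-u"])
    show "a+b-u \<in> {t..b}" using u(1) by auto
    show "c (a+b-u) \<in> T" by (rule u)
    fix v assume "v \<in> {a+b-u<..b}"
    then show "c v \<notin> T" using u(3)[of "a+b-v"] by auto
  qed
qed

lemma lip_path_sclosed:
  assumes c: "lip_path c a b"
  shows "sclosed (c ` {a..b})"
  unfolding sclosed_def
proof (intro conjI ballI impI)
  show "c ` {a..b} \<subseteq> M" using c unfolding lip_path_def by auto
  fix x assume x: "x \<in> M" and *: "\<forall>e>0. \<exists>y\<in>c ` {a..b}. d x y < e"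
  \<comment> \<open>Parameters of points converging to \<open>x\<close>; the limit of a convergent
    subsequence of them is a preimage of \<open>x\<close>.\<close>
  have "\<exists>f. \<forall>n. f n \<in> {a..b} \<and> d x (c (f n)) < inverse (real (Suc n))"
  proof (intro choice allI)
    fix n
    obtain y where "y \<in> c ` {a..b}" "d x y < inverse (real (Suc n))"
      using *[rule_format, of "inverse (real (Suc n))"] by auto
    then show "\<exists>t. t \<in> {a..b} \<and> d x (c t) < inverse (real (Suc n))" by auto
  qed
  then obtain f where f: "\<And>n. f n \<in> {a..b}" "\<And>n. d x (c (f n)) < inverse (real (Suc n))" by blast
  obtain l r where l: "l \<in> {a..b}" and r: "strict_mono r" and lim: "(f \<circ> r) \<longlonglongrightarrow> l"
    using f(1) compact_Icc[of a b] unfolding compact_def by metis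
  have "d x (c l) \<le> e" if e: "e > 0" for e :: real
  proof -
    obtain N where N: "\<And>n. n \<ge> N \<Longrightarrow> \<bar>f (r n) - l\<bar> < e/2"
    proof -
      have "\<exists>N. \<forall>n\<ge>N. norm ((f \<circ> r) n - l) < e/2" by (rule LIMSEQ_D[OF lim]) (use \<open>e > 0\<close> in simp)
      then show thesis using that by (auto simp: o_def)
    qed
    obtain m where m: "inverse (real (Suc m)) < e/2" using reals_Archimedean[of "e/2"] e by auto
    define n where "n = max N m"
    have "m \<le> r n" using seq_suble[OF r, of n] unfolding n_def by linarith
    then have "inverse (real (Suc (r n))) \<le> inverse (real (Suc m))"
      by (simp add: le_imp_inverse_le)
    then have "d x (c (f (r n))) < e/2" using f(2)[of "r n"] m by linarith
    moreover have "d (c (f (r n))) (c l) < e/2"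
      using c f(1) l N[of n] unfolding lip_path_def n_def by (smt (verit) max.cobounded1)
    moreover have "d x (c l) \<le> d x (c (f (r n))) + d (c (f (r n))) (c l)"
      using c x f(1) l unfolding lip_path_def by (intro triangle) auto
    ultimately show ?thesis by linarith
  qed
  then have "d x (c l) \<le> 0" by (metis field_le_epsilon add_0)
  then have "x = c l" using c x l nonneg[of x "c l"] zero unfolding lip_path_def by (smt (verit))
  then show "x \<in> c ` {a..b}" using l by auto
qed

end

section \<open>Segments and entry points\<close>

text \<open>Segments are point sets. The relation \<open>seg\<close> stands for all geodesic segments, or, in a cone,
  for limits of geodesic segments only.\<close>

locale segment_space = Metric_space M d for M :: "'a set" and d +
  fixes seg :: "'a set \<Rightarrow> 'a \<Rightarrow> 'a \<Rightarrow> bool"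
  assumes seg_geodesic: "seg S a b \<Longrightarrow> \<exists>g l. geodesic M d g l \<and> g 0 = a \<and> g l = b \<and> S = g ` {0..l}"
    and seg_sym: "seg S a b \<Longrightarrow> seg S b a"
    and seg_sub: "seg S a b \<Longrightarrow> x \<in> S \<Longrightarrow> y \<in> S \<Longrightarrow> d a x \<le> d a y \<Longrightarrow>
      seg {z\<in>S. d a x \<le> d a z \<and> d a z \<le> d a y} x y"
    and seg_ex: "a \<in> M \<Longrightarrow> b \<in> M \<Longrightarrow> \<exists>S. seg S a b"
begin

lemma seg_subset: "seg S a b \<Longrightarrow> S \<subseteq> M"
  using seg_geodesic[of S a b] unfolding geodesic_def by auto

lemma seg_ends: "seg S a b \<Longrightarrow> a \<in> S" "seg S a b \<Longrightarrow> b \<in> S"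
  using seg_geodesic[of S a b] unfolding geodesic_def by force+

lemma seg_in: "seg S a b \<Longrightarrow> a \<in> M" "seg S a b \<Longrightarrow> b \<in> M" "seg S a b \<Longrightarrow> x \<in> S \<Longrightarrow> x \<in> M"
  using seg_ends seg_subset by blast+

lemma seg_dist:
  assumes "seg S a b" "x \<in> S" "y \<in> S"
  shows "d x y = \<bar>d a x - d a y\<bar>"
proof -
  obtain g l where g: "geodesic M d g l" "g 0 = a" "g l = b" "S = g ` {0..l}"
    using seg_geodesic[OF assms(1)] by auto
  obtain s t where st: "s \<in> {0..l}" "x = g s" "t \<in> {0..l}" "y = g t" using g assms by auto
  have "d a x = s" "d a y = t" "d x y = \<bar>s - t\<bar>"
    using g st unfolding geodesic_def by (auto simp flip: g(2))
  then show ?thesis by simp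
qed

lemma seg_add: "seg S a b \<Longrightarrow> x \<in> S \<Longrightarrow> d a x + d x b = d a b"
proof -
  assume S: "seg S a b" and x: "x \<in> S"
  obtain g l where g: "geodesic M d g l" "g 0 = a" "g l = b" "S = g ` {0..l}"
    using seg_geodesic[OF S] by auto
  then obtain s where s: "s \<in> {0..l}" "x = g s" using x by auto
  have "d a x = s" "d x b = l - s" "d a b = l"
    using g s unfolding geodesic_def by (auto simp flip: g(2,3))
  then show ?thesis by simp
qed

lemma seg_le: "seg S a b \<Longrightarrow> x \<in> S \<Longrightarrow> d a x \<le> d a b"
  using seg_add[of S a b x] nonneg[of x b] by linarith

lemma seg_inj: "seg S a b \<Longrightarrow> x \<in> S \<Longrightarrow> y \<in> S \<Longrightarrow> d a x = d a y \<Longrightarrow> x = y"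
  using seg_dist[of S a b x y] seg_in zero by (metis abs_zero diff_self)

lemma seg_at:
  assumes "seg S a b" "0 \<le> t" "t \<le> d a b"
  obtains x where "x \<in> S" "d a x = t"
proof -
  obtain g l where g: "geodesic M d g l" "g 0 = a" "g l = b" "S = g ` {0..l}"
    using seg_geodesic[OF assms(1)] by auto
  have "d a b = l" using g unfolding geodesic_def by (auto simp flip: g(2,3))
  then have "t \<in> {0..l}" using assms by auto
  moreover have "d a (g t) = t" using g \<open>t\<in>{0..l}\<close> unfolding geodesic_def by (auto simp flip: g(2))
  ultimately show ?thesis using that[of "g t"] g by auto
qed

lemma seg_initial: "seg S a b \<Longrightarrow> x \<in> S \<Longrightarrow> seg {z\<in>S. d a z \<le> d a x} a x"
proof -
  assume S: "seg S a b" and x: "x \<in> S"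
  have "d a a \<le> d a x" using seg_in(1)[OF S] zero nonneg by simp
  from seg_sub[OF S seg_ends(1)[OF S] x this] show ?thesis
    using seg_in(1)[OF S] zero nonneg by simp
qed

lemma seg_final: "seg S a b \<Longrightarrow> x \<in> S \<Longrightarrow> seg {z\<in>S. d a x \<le> d a z} x b"
proof -
  assume S: "seg S a b" and x: "x \<in> S"
  from seg_sub[OF S x seg_ends(2)[OF S] seg_le[OF S x]]
  have "seg {z \<in> S. d a x \<le> d a z \<and> d a z \<le> d a b} x b" .
  moreover have "{z \<in> S. d a x \<le> d a z \<and> d a z \<le> d a b} = {z\<in>S. d a x \<le> d a z}"
    using seg_le[OF S] by auto
  ultimately show ?thesis by simp
qed

lemma seg_sclosed: "seg S a b \<Longrightarrow> sclosed S"
  using seg_geodesic[of S a b] lip_path_sclosed[OF geodesic_lip_path] by auto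

lemma seg_between:
  assumes S: "seg S a b" and "x \<in> S" "y \<in> S"
  obtains S' where "seg S' x y" "S' \<subseteq> S"
proof (cases "d a x \<le> d a y")
  case True
  then show ?thesis using that[OF seg_sub[OF S assms(2,3) True]] by auto
next
  case False
  then show ?thesis using that[OF seg_sym[OF seg_sub[OF S assms(3,2)]]] by auto
qed

text \<open>\<open>T\<close> is closed, so a first hit exists. Cutting a segment there leaves one
  that meets \<open>T\<close> in its end only; the simple triangles below get their corners in this
  way.\<close>

lemma first_hit:
  assumes S: "seg S a b" and T: "sclosed T" and y: "y \<in> S" "y \<in> T"
  obtains x where "x \<in> S" "x \<in> T" "d a x \<le> d a y" "seg {z\<in>S. d a z \<le> d a x} a x"
    "{z\<in>S. d a z \<le> d a x} \<inter> T = {x}"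
proof -
  obtain g l where g: "geodesic M d g l" "g 0 = a" "g l = b" "S = g ` {0..l}"
    using seg_geodesic[OF S] by auto
  have dg: "d a (g t) = t" if "t \<in> {0..l}" for t
    using g that unfolding geodesic_def by (auto simp flip: g(2))
  obtain t where t: "t \<in> {0..l}" "y = g t" using g y by auto
  obtain u where u: "u \<in> {0..t}" "g u \<in> T" "\<And>v. v \<in> {0..<u} \<Longrightarrow> g v \<notin> T"
    using lip_path_first[OF geodesic_lip_path[OF g(1)] T t(1)] y t by metis
  have ul: "u \<in> {0..l}" using u t by auto
  show ?thesis
  proof (rule that[of "g u"])
    show gu: "g u \<in> S" using g ul by auto
    show "g u \<in> T" by (rule u)
    show "d a (g u) \<le> d a y" using dg[OF ul] dg[OF t(1)] t u by auto
    show "seg {z\<in>S. d a z \<le> d a (g u)} a (g u)" by (rule seg_initial[OF S gu])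
    show "{z\<in>S. d a z \<le> d a (g u)} \<inter> T = {g u}"
    proof (intro equalityI subsetI)
      fix z assume z: "z \<in> {z\<in>S. d a z \<le> d a (g u)} \<inter> T"
      then obtain v where v: "v \<in> {0..l}" "z = g v" using g by auto
      have "v \<le> u" using z v dg[OF v(1)] dg[OF ul] by auto
      moreover have "\<not> v < u" using u(3)[of v] v z by auto
      ultimately show "z \<in> {g u}" using v by auto
    qed (use gu u in auto)
  qed
qed

text \<open>The last hit before \<open>v\<close> and the first hit after \<open>v\<close> bound the
  sub-segment. Convexity is proved with it: an excursion and a segment inside \<open>T\<close> with
  the same ends form a bigon.\<close>

lemma seg_excursion:
  assumes K: "seg K a b" and T: "sclosed T" "a \<in> T" "b \<in> T" and v: "v \<in> K" "v \<notin> T"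
  obtains m m' K' where "seg K' m m'" "K' \<subseteq> K" "v \<in> K'" "K' \<inter> T = {m, m'}" "m \<noteq> m'"
    "m \<in> K" "m' \<in> K" "d a m < d a v" "d a v < d a m'"
proof -
  have K2: "seg {z\<in>K. d a v \<le> d a z} v b" by (rule seg_final[OF K v(1)])
  obtain m' where m': "m' \<in> {z\<in>K. d a v \<le> d a z}" "m' \<in> T" "d v m' \<le> d v b"
    "seg {z\<in>{z\<in>K. d a v \<le> d a z}. d v z \<le> d v m'} v m'"
    "{z\<in>{z\<in>K. d a v \<le> d a z}. d v z \<le> d v m'} \<inter> T = {m'}"
    by (rule first_hit[OF K2 T(1) seg_ends(2)[OF K2] T(3)])
  have K1: "seg {z\<in>K. d a z \<le> d a v} v a" by (rule seg_sym[OF seg_initial[OF K v(1)]])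
  obtain m where m: "m \<in> {z\<in>K. d a z \<le> d a v}" "m \<in> T" "d v m \<le> d v a"
    "seg {z\<in>{z\<in>K. d a z \<le> d a v}. d v z \<le> d v m} v m"
    "{z\<in>{z\<in>K. d a z \<le> d a v}. d v z \<le> d v m} \<inter> T = {m}"
    by (rule first_hit[OF K1 T(1) seg_ends(2)[OF K1] T(2)])
  have mv: "d a m < d a v" and vm: "d a v < d a m'"
    using m m' v seg_inj[OF K] by force+
  let ?K = "{z\<in>K. d a m \<le> d a z \<and> d a z \<le> d a m'}"
  have dist: "d v z = \<bar>d a v - d a z\<bar>" if "z \<in> K" for z using seg_dist[OF K v(1) that] .
  show ?thesis
  proof (rule that[of ?K m m'])
    show "seg ?K m m'" using seg_sub[OF K, of m m'] m m' mv vm by auto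
    show "?K \<inter> T = {m,m'}"
    proof (intro equalityI subsetI)
      fix z assume z: "z \<in> ?K \<inter> T"
      show "z \<in> {m,m'}"
      proof (cases "d a v \<le> d a z")
        case True
        then have "d v z \<le> d v m'" using dist[of z] dist[of m'] z m' vm by auto
        then have "z \<in> {z\<in>{z\<in>K. d a v \<le> d a z}. d v z \<le> d v m'} \<inter> T" using z True by auto
        then show ?thesis using m' by auto
      next
        case False
        then have "d v z \<le> d v m" using dist[of z] dist[of m] z m mv by auto
        then have "z \<in> {z\<in>{z\<in>K. d a z \<le> d a v}. d v z \<le> d v m} \<inter> T" using z False by auto
        then show ?thesis using m by auto
      qed
    qed (use m m' mv vm in auto)
  qed (use m(1) m'(1) mv vm v in auto)
qed

text \<open>Pieces are good, and so is a segment that meets every piece in at most one point. Entry points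
  are needed for both.\<close>

definition good :: "'a set \<Rightarrow> bool" where
  "good Q \<longleftrightarrow> sclosed Q \<and> (\<forall>S x y. seg S x y \<longrightarrow> x \<in> Q \<longrightarrow> y \<in> Q \<longrightarrow> S \<subseteq> Q) \<and>
     (\<forall>S1 S2 S3 a b c x y. seg S1 a b \<and> seg S2 b c \<and> seg S3 c a \<and> a \<noteq> b \<and> b \<noteq> c \<and> c \<noteq> a \<and>
        S1 \<inter> S2 = {b} \<and> S2 \<inter> S3 = {c} \<and> S3 \<inter> S1 = {a} \<and> x \<noteq> y \<and> x \<in> Q \<and> y \<in> Q \<and>
        x \<in> S1 \<union> S2 \<union> S3 \<and> y \<in> S1 \<union> S2 \<union> S3 \<longrightarrow> S1 \<union> S2 \<union> S3 \<subseteq> Q)"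

lemma good_closed: "good Q \<Longrightarrow> sclosed Q" unfolding good_def by blast

lemma good_subset: "good Q \<Longrightarrow> Q \<subseteq> M" using good_closed sclosed_subset by blast

lemma good_convex: "good Q \<Longrightarrow> seg S x y \<Longrightarrow> x \<in> Q \<Longrightarrow> y \<in> Q \<Longrightarrow> S \<subseteq> Q" unfolding good_def by blast

lemma good_tri:
  assumes "good Q" "seg S1 a b" "seg S2 b c" "seg S3 c a" "a \<noteq> b" "b \<noteq> c" "c \<noteq> a"
    "S1 \<inter> S2 = {b}" "S2 \<inter> S3 = {c}" "S3 \<inter> S1 = {a}" "x \<noteq> y" "x \<in> Q" "y \<in> Q"
    "x \<in> S1 \<union> S2 \<union> S3" "y \<in> S1 \<union> S2 \<union> S3"
  shows "S1 \<union> S2 \<union> S3 \<subseteq> Q"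
  using assms(1) unfolding good_def using assms(2-) by blast

text \<open>Two different entry points would be corners of a simple triangle, formed by the two
  segments after their branching point and a segment in \<open>Q\<close> between \<open>x\<close>
  and \<open>y\<close>. Having two points of it, \<open>Q\<close> would contain the third corner as
  well.\<close>

lemma entry_unique:
  assumes Q: "good Q" and S: "seg S z x" "S \<inter> Q = {x}" and S': "seg S' z y" "S' \<inter> Q = {y}"
  shows "x = y"
proof (rule ccontr)
  assume ne: "x \<noteq> y"
  have xy: "x \<in> Q" "y \<in> Q" using S S' by auto
  obtain H where H: "seg H x y" using seg_ex xy good_subset[OF Q] by blast
  have HQ: "H \<subseteq> Q" using good_convex[OF Q H] xy by auto
  \<comment> \<open>\<open>S\<close> is followed backwards from \<open>x\<close>, so
    \<open>z'\<close> is the branching point nearest to \<open>x\<close>.\<close>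
  obtain z' where z': "z' \<in> S" "z' \<in> S'" "d x z' \<le> d x z" "seg {w\<in>S. d x w \<le> d x z'} x z'"
      "{w\<in>S. d x w \<le> d x z'} \<inter> S' = {z'}"
    by (rule first_hit[OF seg_sym[OF S(1)] seg_sclosed[OF S'(1)] seg_ends(1)[OF S(1)] seg_ends(1)[OF S'(1)]])
  let ?S1 = "{w\<in>S. d x w \<le> d x z'}"
  have S2: "seg {w\<in>S'. d z z' \<le> d z w} z' y" by (rule seg_final[OF S'(1) z'(2)])
  let ?S2 = "{w\<in>S'. d z z' \<le> d z w}"
  have ne': "z' \<noteq> x" "z' \<noteq> y" using z' S S' ne by auto
  have "?S1 \<union> ?S2 \<union> H \<subseteq> Q"
  proof (rule good_tri[OF Q z'(4) S2 seg_sym[OF H] _ _ _ _ _ _ ne xy])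
    show "?S1 \<inter> ?S2 = {z'}" using z' seg_ends[OF S2] by auto
    show "?S2 \<inter> H = {y}" using HQ S' seg_ends[OF S2] seg_ends[OF H] by auto
    show "H \<inter> ?S1 = {x}" using HQ S seg_ends[OF z'(4)] seg_ends[OF H] by auto
  qed (use ne ne' seg_ends[OF H] in auto)
  then have "z' \<in> Q" using seg_ends[OF z'(4)] by auto
  then show False using z' S ne' by auto
qed

text \<open>The projection of \<open>z\<close> to \<open>Q\<close>, described by a segment instead
  of a minimal distance; \<open>entry_nearest\<close> shows that it is the nearest point as
  well.\<close>

definition entry :: "'a set \<Rightarrow> 'a \<Rightarrow> 'a \<Rightarrow> bool" where
  "entry Q z x \<longleftrightarrow> (\<exists>S. seg S z x \<and> S \<inter> Q = {x})"

lemma entry_fun: "good Q \<Longrightarrow> entry Q z x \<Longrightarrow> entry Q z y \<Longrightarrow> x = y"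
  unfolding entry_def using entry_unique by blast

lemma entry_in: "entry Q z x \<Longrightarrow> x \<in> Q" "entry Q z x \<Longrightarrow> z \<in> M"
  unfolding entry_def using seg_in(1) by blast+

lemma entry_self:
  assumes "good Q" "z \<in> Q" shows "entry Q z z"
proof -
  have zM: "z \<in> M" using good_subset assms by blast
  then obtain S where S: "seg S z z" using seg_ex by blast
  have "x = z" if "x \<in> S" for x
  proof -
    have "d z z = 0" using zM by simp
    then have "d z x = d z z" using seg_le[OF S that] nonneg[of z x] by linarith
    then show ?thesis by (rule seg_inj[OF S that seg_ends(1)[OF S]])
  qed
  with seg_ends(1)[OF S] have "S = {z}" by blast
  then show ?thesis unfolding entry_def using S assms by auto
qed

text \<open>The first point of \<open>S\<close> in \<open>Q\<close> is an entry point, and there is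
  only one.\<close>

lemma entry_on_seg:
  assumes Q: "good Q" and S: "seg S z w" and q: "q \<in> S" "q \<in> Q" and e: "entry Q z x"
  shows "x \<in> S" "d z x \<le> d z q"
proof -
  obtain x' where x': "x' \<in> S" "x' \<in> Q" "d z x' \<le> d z q" "seg {u\<in>S. d z u \<le> d z x'} z x'"
    "{u\<in>S. d z u \<le> d z x'} \<inter> Q = {x'}"
    by (rule first_hit[OF S good_closed[OF Q] q])
  have "entry Q z x'" unfolding entry_def using x' by blast
  then have "x' = x" using entry_fun[OF Q _ e] by auto
  then show "x \<in> S" "d z x \<le> d z q" using x' by auto
qed

lemma entry_ex:
  assumes Q: "good Q" and "z \<in> M" "q \<in> Q"
  obtains x where "entry Q z x"
proof -
  obtain S where S: "seg S z q" using seg_ex assms good_subset[OF Q] by blast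
  obtain x' where x': "x' \<in> S" "x' \<in> Q" "d z x' \<le> d z q" "seg {u\<in>S. d z u \<le> d z x'} z x'" "{u\<in>S. d z u \<le> d z x'} \<inter> Q = {x'}"
    by (rule first_hit[OF S good_closed[OF Q] seg_ends(2)[OF S] assms(3)])
  then show ?thesis using that unfolding entry_def by blast
qed

text \<open>A segment from \<open>z\<close> to \<open>q\<close> passes through the entry point, and
  distances add up along it.\<close>

lemma entry_nearest:
  assumes Q: "good Q" and e: "entry Q z x" and q: "q \<in> Q"
  shows "d z q = d z x + d x q"
proof -
  obtain S where S: "seg S z q" using seg_ex q good_subset[OF Q] entry_in[OF e] by blast
  have "x \<in> S" using entry_on_seg[OF Q S seg_ends(2)[OF S] q e] by auto
  then show ?thesis using seg_add[OF S] by auto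
qed

text \<open>If \<open>x\<close> and \<open>y\<close> differed, a part of \<open>G\<close>, a part of
  a segment \<open>K\<close> from \<open>w\<close> to \<open>y\<close> and a part of a segment
  \<open>H\<close> from \<open>z\<close> to \<open>y\<close> would form a simple triangle containing
  \<open>x\<close> and \<open>y\<close>. Then \<open>Q\<close> would contain it, although
  \<open>G\<close> misses \<open>Q\<close>.\<close>

lemma entry_avoid:
  assumes Q: "good Q" and G: "seg G z w" "G \<inter> Q = {}" and ex: "entry Q z x" and ey: "entry Q w y"
  shows "x = y"
proof (rule ccontr)
  assume ne: "x \<noteq> y"
  have xy: "x \<in> Q" "y \<in> Q" using entry_in ex ey by auto
  obtain K where K: "seg K w y" "K \<inter> Q = {y}" using ey unfolding entry_def by auto
  obtain H where H: "seg H z y" using seg_ex seg_in(1)[OF G(1)] xy good_subset[OF Q] by blast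
  have xH: "x \<in> H" using entry_on_seg[OF Q H seg_ends(2)[OF H] xy(2) ex] by auto
  define H1 where "H1 = {u\<in>H. d z u \<le> d z x}"
  have H1: "seg H1 z x" unfolding H1_def by (rule seg_initial[OF H xH])
  have H1Q: "H1 \<inter> Q = {x}"
  proof -
    have "u = x" if "u \<in> H1" "u \<in> Q" for u
    proof -
      have u: "u \<in> H" "d z u \<le> d z x" using that unfolding H1_def by blast+
      have "d z x \<le> d z u" using entry_on_seg(2)[OF Q H u(1) that(2) ex] .
      then have "d z u = d z x" using u by linarith
      then show ?thesis by (rule seg_inj[OF H u(1) xH])
    qed
    with seg_ends(2)[OF H1] xy show ?thesis by blast
  qed
  have H2Q: "{u\<in>H. d z x \<le> d z u} \<subseteq> Q" using good_convex[OF Q seg_final[OF H xH]] xy by auto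
  \<comment> \<open>A common point other than \<open>y\<close> would have both \<open>x\<close> and
    \<open>y\<close> as entry points.\<close>
  have KH: "K \<inter> H = {y}"
  proof -
    have "u = y" if u: "u \<in> K" "u \<in> H" for u
    proof (rule ccontr)
      assume "u \<noteq> y"
      then have "u \<notin> Q" using K u by auto
      then have "u \<in> H1" using H2Q u unfolding H1_def by force
      have a: "seg {v\<in>H1. d z u \<le> d z v} u x" by (rule seg_final[OF H1 \<open>u\<in>H1\<close>])
      then have 1: "entry Q u x" unfolding entry_def using H1Q seg_ends(2)[OF a] xy by blast
      have a: "seg {v\<in>K. d w u \<le> d w v} u y" by (rule seg_final[OF K(1) u(1)])
      then have 2: "entry Q u y" unfolding entry_def using K seg_ends(2)[OF a] xy by blast
      show False using entry_fun[OF Q 1 2] ne by auto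
    qed
    with seg_ends(2)[OF K(1)] seg_ends(2)[OF H] show ?thesis by blast
  qed
  \<comment> \<open>The triangle has the corners \<open>a\<close>, \<open>c\<close>,
    \<open>y\<close>: \<open>a\<close> is the last point of \<open>G\<close> on \<open>H\<close>,
    and \<open>c\<close> the first point of \<open>G\<close> on \<open>K\<close> after it.\<close>
  obtain a where a: "a \<in> G" "a \<in> H" "d w a \<le> d w z" "seg {u\<in>G. d w u \<le> d w a} w a" "{u\<in>G. d w u \<le> d w a} \<inter> H = {a}"
    by (rule first_hit[OF seg_sym[OF G(1)] seg_sclosed[OF H] seg_ends(1)[OF G(1)] seg_ends(1)[OF H]])
  define G1 where "G1 = {u\<in>G. d w u \<le> d w a}"
  have G1: "seg G1 a w" "G1 \<inter> H = {a}" "G1 \<subseteq> G" using a seg_sym unfolding G1_def by auto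
  obtain c where c: "c \<in> G1" "c \<in> K" "d a c \<le> d a w" "seg {u\<in>G1. d a u \<le> d a c} a c" "{u\<in>G1. d a u \<le> d a c} \<inter> K = {c}"
    by (rule first_hit[OF G1(1) seg_sclosed[OF K(1)] seg_ends(2)[OF G1(1)] seg_ends(1)[OF K(1)]])
  define G2 where "G2 = {u\<in>G1. d a u \<le> d a c}"
  have G2: "seg G2 a c" "G2 \<inter> K = {c}" "G2 \<subseteq> G1" using c unfolding G2_def by auto
  have aQ: "a \<notin> Q" and cQ: "c \<notin> Q" using G c G1 a by auto
  then have ac: "a \<noteq> y" "c \<noteq> y" "a \<noteq> c" using xy KH a c by auto
  define K' where "K' = {u\<in>K. d w c \<le> d w u}"
  have K': "seg K' c y" unfolding K'_def by (rule seg_final[OF K(1) c(2)])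
  define H' where "H' = {u\<in>H. d z a \<le> d z u}"
  have H': "seg H' a y" unfolding H'_def by (rule seg_final[OF H a(2)])
  have xH': "x \<in> H'" using H2Q aQ a(2) xH unfolding H'_def by force
  have "G2 \<union> K' \<union> H' \<subseteq> Q"
  proof (rule good_tri[OF Q G2(1) K' seg_sym[OF H'] _ _ _ _ _ _ ne xy])
    show "G2 \<inter> K' = {c}" using G2 seg_ends(1)[OF K'] unfolding K'_def by blast
    show "K' \<inter> H' = {y}" using KH seg_ends[OF K'] seg_ends[OF H'] unfolding K'_def H'_def by auto
    show "H' \<inter> G2 = {a}" using G1 G2 seg_ends(1)[OF H'] seg_ends(1)[OF G2(1)] unfolding H'_def by blast
  qed (use ac xH' seg_ends[OF K'] in auto)
  then show False using aQ seg_ends(1)[OF G2(1)] by auto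
qed

end

lemma interval_local_induct:
  fixes P :: "real \<Rightarrow> bool"
  assumes "s0 \<in> {a..b}" "P s0" "t \<in> {a..b}"
    and loc: "\<And>s. s \<in> {a..b} \<Longrightarrow> \<exists>\<delta>>0. \<forall>x\<in>{a..b}. \<forall>y\<in>{a..b}. \<bar>x - s\<bar> < \<delta> \<longrightarrow> \<bar>y - s\<bar> < \<delta> \<longrightarrow> P x \<longrightarrow> P y"
  shows "P t"
proof (rule connected_induction_simple[of "{a..b}" s0 t P])
  fix s assume s: "s \<in> {a..b}"
  obtain \<delta> where \<delta>: "\<delta> > 0" "\<forall>x\<in>{a..b}. \<forall>y\<in>{a..b}. \<bar>x - s\<bar> < \<delta> \<longrightarrow> \<bar>y - s\<bar> < \<delta> \<longrightarrow> P x \<longrightarrow> P y"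
    using loc[OF s] by blast
  show "\<exists>T. openin (top_of_set {a..b}) T \<and> s \<in> T \<and> (\<forall>x\<in>T. \<forall>y\<in>T. P x \<longrightarrow> P y)"
  proof (intro exI[of _ "{a..b} \<inter> ball s \<delta>"] conjI)
    show "\<forall>x\<in>{a..b} \<inter> ball s \<delta>. \<forall>y\<in>{a..b} \<inter> ball s \<delta>. P x \<longrightarrow> P y"
      using \<delta> by (auto simp: dist_real_def abs_minus_commute)
  qed (use s \<delta> in auto)
qed (use assms in auto)

section \<open>Entry points along Lipschitz paths\<close>

context segment_space
begin

text \<open>Either a segment from \<open>z\<close> to \<open>w\<close> misses \<open>Q\<close> and
  the entry points coincide, or both entry points lie on it.\<close>

lemma entry_lipschitz:
  assumes Q: "good Q" and x: "entry Q z x" and y: "entry Q w y"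
  shows "d x y \<le> d z w"
proof -
  obtain G where G: "seg G z w" using seg_ex entry_in(2)[OF x] entry_in(2)[OF y] by blast
  show ?thesis
  proof (cases "G \<inter> Q = {}")
    case True
    then have "x = y" using entry_avoid[OF Q G _ x y] by blast
    then show ?thesis using entry_in(1)[OF x] good_subset[OF Q] nonneg by auto
  next
    case False
    then obtain u where u: "u \<in> G" "u \<in> Q" by blast
    have "x \<in> G" using entry_on_seg[OF Q G u x] by blast
    moreover have "y \<in> G" using entry_on_seg[OF Q seg_sym[OF G] u y] by blast
    ultimately show ?thesis
      using seg_dist[OF G, of x y] seg_le[OF G, of x] seg_le[OF G, of y] nonneg[of z x] nonneg[of z y]
      by linarith
  qed
qed

text \<open>Extends \<open>entry_avoid\<close> from segments to paths, which may moreover touch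
  \<open>Q\<close> in \<open>q\<close>. A geodesic of a cone need not be a limit of geodesics, so
  entry points have to be followed along mere Lipschitz paths.\<close>

lemma entry_const:
  assumes Q: "good Q" and c: "lip_path c a b" and t: "t \<in> {a..b}" and t0: "t0 \<in> {a..b}"
    and q: "\<And>s. s \<in> {a..b} \<Longrightarrow> c s \<in> Q \<Longrightarrow> c s = q" and e0: "entry Q (c t0) q"
  shows "entry Q (c t) q"
proof -
  have cM: "c s \<in> M" if "s \<in> {a..b}" for s using c that unfolding lip_path_def by blast
  have "\<exists>x. entry Q (c s) x" if "s \<in> {a..b}" for s
    using entry_ex[OF Q cM[OF that] entry_in(1)[OF e0]] by blast
  then obtain E where E: "\<And>s. s \<in> {a..b} \<Longrightarrow> entry Q (c s) (E s)" by metis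
  have EM: "E s \<in> M" if "s \<in> {a..b}" for s using entry_in(1)[OF E[OF that]] good_subset[OF Q] by blast
  have lip: "d (E s) (E s') \<le> \<bar>s - s'\<bar>" if "s \<in> {a..b}" "s' \<in> {a..b}" for s s'
    using entry_lipschitz[OF Q E[OF that(1)] E[OF that(2)]] c that unfolding lip_path_def by force
  have qM: "q \<in> M" using entry_in(1)[OF e0] good_subset[OF Q] by blast
  have "E t = q"
  proof (rule ccontr)
    assume ne: "E t \<noteq> q"
    text \<open>Away from \<open>Q\<close> the entry point is locally constant, and it cannot jump
      to \<open>q\<close> because it depends continuously on the point.\<close>
    have "E t0 = E t"
    proof (rule interval_local_induct[OF t _ t0])
      show "E t = E t" ..
      fix s assume s: "s \<in> {a..b}"
      show "\<exists>\<delta>>0. \<forall>x\<in>{a..b}. \<forall>y\<in>{a..b}. \<bar>x - s\<bar> < \<delta> \<longrightarrow> \<bar>y - s\<bar> < \<delta> \<longrightarrow> E x = E t \<longrightarrow> E y = E t"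
      proof (cases "c s \<in> Q")
        case False
        \<comment> \<open>No segment from \<open>c s\<close> reaches \<open>Q\<close> before this
          distance, so the entry point does not change along shorter ones.\<close>
        define \<delta> where "\<delta> = d (c s) (E s)"
        have "c s \<noteq> E s" using False entry_in(1)[OF E[OF s]] by metis
        then have "\<delta> > 0" unfolding \<delta>_def using cM[OF s] EM[OF s] zero nonneg by (metis less_eq_real_def)
        have "E x = E s" if x: "x \<in> {a..b}" "\<bar>x - s\<bar> < \<delta>" for x
        proof -
          obtain G where G: "seg G (c s) (c x)" using seg_ex cM s x by blast
          have "G \<inter> Q = {}"
          proof (rule ccontr)
            assume "G \<inter> Q \<noteq> {}"
            then obtain u where u: "u \<in> G" "u \<in> Q" by blast
            have "\<delta> \<le> d (c s) u" unfolding \<delta>_def by (rule entry_on_seg(2)[OF Q G u E[OF s]])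
            also have "\<dots> \<le> d (c s) (c x)" by (rule seg_le[OF G u(1)])
            also have "\<dots> \<le> \<bar>s - x\<bar>" using c s x unfolding lip_path_def by blast
            finally show False using x by linarith
          qed
          from entry_avoid[OF Q G this E[OF s] E[OF x(1)]] show ?thesis by simp
        qed
        with \<open>\<delta> > 0\<close> show ?thesis by (metis (full_types))
      next
        case True
        have Es: "E s = q" using entry_fun[OF Q E[OF s]] entry_self[OF Q True] q[OF s True] by metis
        have pos: "d q (E t) > 0" using ne qM EM[OF t] zero nonneg by (metis less_eq_real_def)
        \<comment> \<open>Near \<open>s\<close> the entry point is too close to \<open>q\<close> to
          have the value \<open>E t\<close>; the local implication holds vacuously.\<close>
        have "E x \<noteq> E t" if "x \<in> {a..b}" "\<bar>x - s\<bar> < d q (E t)" for x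
          using lip[OF s that(1)] that(2) Es by (auto simp: abs_minus_commute)
        with pos show ?thesis by (metis (full_types))
      qed
    qed
    then show False using entry_fun[OF Q E[OF t0] e0] ne by simp
  qed
  then show ?thesis using E[OF t] by simp
qed

text \<open>A point \<open>c u\<close> in \<open>Q\<close> is its own entry point, and this spreads
  in both directions. If there is no such \<open>u\<close>, the condition of
  \<open>entry_const\<close> on points in \<open>Q\<close> is empty.\<close>

lemma entry_const2:
  assumes Q: "good Q" and c: "lip_path c a b" and ab: "a \<le> b"
    and one: "\<And>s t. s \<in> {a..b} \<Longrightarrow> t \<in> {a..b} \<Longrightarrow> c s \<in> Q \<Longrightarrow> c t \<in> Q \<Longrightarrow> c s = c t"
    and x: "entry Q (c a) x" and y: "entry Q (c b) y"
  shows "x = y"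
proof (cases "\<exists>u\<in>{a..b}. c u \<in> Q")
  case True
  then obtain u where u: "u \<in> {a..b}" "c u \<in> Q" by blast
  have "entry Q (c t) (c u)" if "t \<in> {a..b}" for t
    using entry_const[OF Q c that u(1) one[OF _ u(1) _ u(2)] entry_self[OF Q u(2)]] by blast
  then show ?thesis using entry_fun[OF Q] x y ab by (metis atLeastAtMost_iff order_refl)
next
  case False
  have "entry Q (c b) x"
    using entry_const[OF Q c _ _ _ x, of b] False ab by auto
  then show ?thesis using entry_fun[OF Q _ y] by blast
qed

text \<open>The ends enter \<open>Q\<close> within distance \<open>R\<close>. If \<open>S\<close>
  missed \<open>Q\<close>, they would enter at the same point and be at most \<open>2 * R\<close>
  apart. So \<open>S\<close> passes through both entry points, and by convexity the part between
  them is in \<open>Q\<close>.\<close>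

lemma mid_in_good:
  assumes Q: "good Q" and S: "seg S a b" and q: "q1 \<in> Q" "q2 \<in> Q" "d a q1 \<le> R" "d b q2 \<le> R"
    and l: "2 * R < d a b" and x: "x \<in> S" "R \<le> d a x" "d a x \<le> d a b - R"
  shows "x \<in> Q"
proof -
  obtain e1 where e1: "entry Q a e1" using entry_ex[OF Q seg_in(1)[OF S] q(1)] by blast
  obtain e2 where e2: "entry Q b e2" using entry_ex[OF Q seg_in(2)[OF S] q(1)] by blast
  have M: "e1 \<in> M" "e2 \<in> M" "q1 \<in> M" "q2 \<in> M" "a \<in> M" "b \<in> M"
    using entry_in(1)[OF e1] entry_in(1)[OF e2] q good_subset[OF Q] seg_in[OF S] by auto
  have d1: "d a e1 \<le> R" using entry_nearest[OF Q e1 q(1)] q(3) nonneg[of e1 q1] by linarith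
  have d2: "d b e2 \<le> R" using entry_nearest[OF Q e2 q(2)] q(4) nonneg[of e2 q2] by linarith
  have "S \<inter> Q \<noteq> {}"
  proof
    assume "S \<inter> Q = {}"
    then have "e1 = e2" using entry_avoid[OF Q S _ e1 e2] by blast
    then show False using triangle[of a e1 b] d1 d2 l M commute[of b e2] by auto
  qed
  then obtain u where u: "u \<in> S" "u \<in> Q" by blast
  have eS: "e1 \<in> S" "e2 \<in> S"
    using entry_on_seg(1)[OF Q S u e1] entry_on_seg(1)[OF Q seg_sym[OF S] u e2] by auto
  have "d a e2 = d a b - d b e2" using seg_add[OF S eS(2)] commute[of b e2] by simp
  then have le: "d a e1 \<le> d a x" "d a x \<le> d a e2" using d1 d2 x by linarith+
  have "seg {z\<in>S. d a e1 \<le> d a z \<and> d a z \<le> d a e2} e1 e2"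
    by (rule seg_sub[OF S eS]) (use le in linarith)
  from good_convex[OF Q this entry_in(1)[OF e1] entry_in(1)[OF e2]] show ?thesis
    using x le by blast
qed

text \<open>Halving one side turns the bigon into a triangle.\<close>

lemma bigon_in_piece:
  assumes tri: "\<And>S1 S2 S3 a b c. seg S1 a b \<Longrightarrow> seg S2 b c \<Longrightarrow> seg S3 c a \<Longrightarrow> a \<noteq> b \<Longrightarrow> b \<noteq> c \<Longrightarrow> c \<noteq> a \<Longrightarrow>
      S1 \<inter> S2 = {b} \<Longrightarrow> S2 \<inter> S3 = {c} \<Longrightarrow> S3 \<inter> S1 = {a} \<Longrightarrow> \<exists>Q\<in>\<P>. S1 \<union> S2 \<union> S3 \<subseteq> Q"
    and S: "seg S1 a b" "seg S2 a b" and ne: "a \<noteq> b" and int: "S1 \<inter> S2 = {a, b}"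
  shows "\<exists>Q\<in>\<P>. S1 \<union> S2 \<subseteq> Q"
proof -
  have pos: "d a b > 0" using seg_in[OF S(1)] ne zero nonneg by (metis less_eq_real_def)
  obtain c where c: "c \<in> S2" "d a c = d a b / 2" using seg_at[OF S(2), of "d a b / 2"] pos by auto
  have c1: "c \<noteq> a" "c \<noteq> b" using c pos seg_in[OF S(1)] by auto
  let ?T1 = "{z\<in>S2. d a z \<le> d a c}" and ?T2 = "{z\<in>S2. d a c \<le> d a z}"
  have T1: "seg ?T1 a c" and T2: "seg ?T2 c b" using seg_initial[OF S(2) c(1)] seg_final[OF S(2) c(1)] by auto
  have da: "d a a = 0" using seg_in[OF S(1)] by simp
  have "\<exists>Q\<in>\<P>. S1 \<union> ?T1 \<union> ?T2 \<subseteq> Q"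
  proof (rule tri[OF seg_sym[OF S(1)] T1 T2])
    show "S1 \<inter> ?T1 = {a}"
    proof -
      have "b \<notin> ?T1" using c pos by auto
      then show ?thesis using int seg_ends(1)[OF T1] by blast
    qed
    show "?T2 \<inter> S1 = {b}"
    proof -
      have "a \<notin> ?T2" using c pos da by auto
      have "z = b" if "z \<in> ?T2 \<inter> S1" for z
      proof -
        have "z \<in> S1 \<inter> S2" using that by blast
        then have "z = a \<or> z = b" unfolding int by blast
        then show ?thesis using that \<open>a \<notin> ?T2\<close> by blast
      qed
      then show ?thesis using int seg_ends(1)[OF T2] seg_ends(2)[OF T2] by blast
    qed
    show "?T1 \<inter> ?T2 = {c}"
    proof -
      have "z = c" if "z \<in> ?T1 \<inter> ?T2" for z
        using that by (intro seg_inj[OF S(2) _ c(1)]) auto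
      then show ?thesis using c by blast
    qed
  qed (use c1 ne in auto)
  moreover have "S2 = ?T1 \<union> ?T2" by auto
  ultimately show ?thesis by (metis Un_assoc)
qed

end

section \<open>Simple loops\<close>

text \<open>(T1), (T2) and convexity relative to a class of segments. Convexity is an axiom because
  it has different sources: \<open>(\<beta>\<^sub>2)\<close> for limit segments, and (T2) with the
  geodesic pieces in a tree-graded space.\<close>

locale pieces = segment_space M d seg for M :: "'a set" and d and seg +
  fixes \<P> :: "'a set set"
  assumes piece_closed: "Q \<in> \<P> \<Longrightarrow> sclosed Q"
    and piece_convex: "Q \<in> \<P> \<Longrightarrow> seg S x y \<Longrightarrow> x \<in> Q \<Longrightarrow> y \<in> Q \<Longrightarrow> S \<subseteq> Q"
    and piece_meet: "Q \<in> \<P> \<Longrightarrow> Q' \<in> \<P> \<Longrightarrow> x \<noteq> y \<Longrightarrow> x \<in> Q \<Longrightarrow> x \<in> Q' \<Longrightarrow> y \<in> Q \<Longrightarrow> y \<in> Q' \<Longrightarrow> Q = Q'"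
    and piece_tri: "seg S1 a b \<Longrightarrow> seg S2 b c \<Longrightarrow> seg S3 c a \<Longrightarrow> a \<noteq> b \<Longrightarrow> b \<noteq> c \<Longrightarrow> c \<noteq> a \<Longrightarrow>
      S1 \<inter> S2 = {b} \<Longrightarrow> S2 \<inter> S3 = {c} \<Longrightarrow> S3 \<inter> S1 = {a} \<Longrightarrow> \<exists>Q\<in>\<P>. S1 \<union> S2 \<union> S3 \<subseteq> Q"
begin

lemma piece_bigon: "seg S1 a b \<Longrightarrow> seg S2 a b \<Longrightarrow> a \<noteq> b \<Longrightarrow> S1 \<inter> S2 = {a, b} \<Longrightarrow> \<exists>Q\<in>\<P>. S1 \<union> S2 \<subseteq> Q"
  by (rule bigon_in_piece[OF piece_tri])

text \<open>The triangle lies in some piece, and by \<open>piece_meet\<close> two distinct points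
  determine which one.\<close>

lemma piece_good:
  assumes "Q \<in> \<P>" shows "good Q"
  unfolding good_def
proof (intro conjI allI impI; (elim conjE)?)
  fix S1 S2 S3 a b c x y
  assume *: "seg S1 a b" "seg S2 b c" "seg S3 c a" "a \<noteq> b" "b \<noteq> c" "c \<noteq> a"
    "S1 \<inter> S2 = {b}" "S2 \<inter> S3 = {c}" "S3 \<inter> S1 = {a}" and xy: "x \<noteq> y" "x \<in> Q" "y \<in> Q"
    "x \<in> S1 \<union> S2 \<union> S3" "y \<in> S1 \<union> S2 \<union> S3"
  obtain Q' where Q': "Q' \<in> \<P>" "S1 \<union> S2 \<union> S3 \<subseteq> Q'" using piece_tri[OF *] by blast
  have "Q = Q'" by (rule piece_meet[OF assms Q'(1) xy(1,2) _ xy(3)]) (use xy Q' in blast)+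
  then show "S1 \<union> S2 \<union> S3 \<subseteq> Q" using Q' by simp
next
  show "sclosed Q" by (rule piece_closed[OF assms])
next
  fix S x y assume "seg S x y" "x \<in> Q" "y \<in> Q"
  then show "S \<subseteq> Q" by (rule piece_convex[OF assms])
qed

text \<open>An excursion off \<open>K\<close> would bound a bigon with \<open>K\<close>, and the
  piece containing it would meet \<open>K\<close> twice. A simple triangle with two points on
  \<open>K\<close> is impossible for the same reason.\<close>

lemma thin_seg_good:
  assumes K: "seg K m m'"
    and thin: "\<And>Q x y. Q \<in> \<P> \<Longrightarrow> x \<in> Q \<Longrightarrow> y \<in> Q \<Longrightarrow> x \<in> K \<Longrightarrow> y \<in> K \<Longrightarrow> x = y"
  shows "good K"
  unfolding good_def
proof (intro conjI allI impI; (elim conjE)?)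
  show "sclosed K" by (rule seg_sclosed[OF K])
next
  fix S x y assume S: "seg S x y" and xy: "x \<in> K" "y \<in> K"
  show "S \<subseteq> K"
  proof
    fix v assume v: "v \<in> S"
    show "v \<in> K"
    proof (rule ccontr)
      assume "v \<notin> K"
      then obtain z z' S' where S': "seg S' z z'" "S' \<inter> K = {z, z'}" "z \<noteq> z'"
        using seg_excursion[OF S seg_sclosed[OF K] xy v] by metis
      then have "z \<in> K" "z' \<in> K" by auto
      then obtain K' where K': "seg K' z z'" "K' \<subseteq> K" using seg_between[OF K] by metis
      have "S' \<inter> K' = {z, z'}" using S' K' seg_ends[OF K'(1)] by blast
      then obtain Q where "Q \<in> \<P>" "S' \<union> K' \<subseteq> Q" using piece_bigon[OF S'(1) K'(1) S'(3)] by blast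
      then show False using thin[of Q z z'] seg_ends[OF K'(1)] \<open>z \<in> K\<close> \<open>z' \<in> K\<close> S'(3) by blast
    qed
  qed
next
  fix S1 S2 S3 a b c x y
  assume *: "seg S1 a b" "seg S2 b c" "seg S3 c a" "a \<noteq> b" "b \<noteq> c" "c \<noteq> a"
    "S1 \<inter> S2 = {b}" "S2 \<inter> S3 = {c}" "S3 \<inter> S1 = {a}" and xy: "x \<noteq> y" "x \<in> K" "y \<in> K"
    "x \<in> S1 \<union> S2 \<union> S3" "y \<in> S1 \<union> S2 \<union> S3"
  obtain Q' where "Q' \<in> \<P>" "S1 \<union> S2 \<union> S3 \<subseteq> Q'" using piece_tri[OF *] by blast
  then show "S1 \<union> S2 \<union> S3 \<subseteq> K" using thin[of Q' x y] xy by blast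
qed

text \<open>Otherwise the segment has an excursion \<open>K\<close> off the arc. No piece meets
  \<open>K\<close> twice, so entry points into \<open>K\<close> itself make sense; following the arc
  from one end of \<open>K\<close> to the other shows that the ends coincide.\<close>

lemma arc_contains_seg:
  assumes c: "lip_path c a b" and ab: "a \<le> b" and inj: "inj_on c {a..b}"
    and thin: "\<And>Q s t. Q \<in> \<P> \<Longrightarrow> s \<in> {a..b} \<Longrightarrow> t \<in> {a..b} \<Longrightarrow> c s \<in> Q \<Longrightarrow> c t \<in> Q \<Longrightarrow> s = t"
    and S: "seg S (c a) (c b)"
  shows "S \<subseteq> c ` {a..b}"
proof
  fix v assume v: "v \<in> S"
  show "v \<in> c ` {a..b}"
  proof (rule ccontr)
    assume "v \<notin> c ` {a..b}"
    then obtain m m' K0 where K0: "seg K0 m m'" "K0 \<inter> c ` {a..b} = {m, m'}" "m \<noteq> m'"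
      using seg_excursion[OF S lip_path_sclosed[OF c] _ _ v] ab
      by (metis atLeastAtMost_iff image_eqI order_refl)
    then obtain s0 t0 where st0: "s0 \<in> {a..b}" "t0 \<in> {a..b}" "m = c s0" "m' = c t0" by blast
    obtain s t K where st: "s \<in> {a..b}" "t \<in> {a..b}" "s < t" and K: "seg K (c s) (c t)"
      and Kc: "K \<inter> c ` {a..b} = {c s, c t}"
    proof (cases "s0 < t0")
      case True then show thesis using that[of s0 t0 K0] st0 K0 by auto
    next
      case False
      then have "t0 < s0" using st0 K0 by (metis linorder_neqE_linordered_idom)
      then show thesis using that[of t0 s0 K0] st0 K0 seg_sym by (auto simp: insert_commute)
    qed
    have cst: "lip_path c s t" by (rule lip_path_sub[OF c]) (use st in auto)
    have sub: "u \<in> {a..b}" if "u \<in> {s..t}" for u using that st by auto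
    \<comment> \<open>The arc meets \<open>Q\<close> at most once, so both ends of \<open>K\<close>
      have the same entry point \<open>h\<close>. From either end, \<open>K\<close> reaches
      \<open>h\<close> no later than any other point of \<open>Q\<close>, which leaves
      \<open>h\<close> alone.\<close>
    have K_thin: "z1 = z2" if Q: "Q \<in> \<P>" and z: "z1 \<in> Q" "z2 \<in> Q" "z1 \<in> K" "z2 \<in> K" for Q z1 z2
    proof -
      note gQ = piece_good[OF Q]
      obtain h where h: "entry Q (c s) h" using entry_ex[OF gQ seg_in(1)[OF K] z(1)] by blast
      obtain h' where h': "entry Q (c t) h'" using entry_ex[OF gQ seg_in(2)[OF K] z(1)] by blast
      have "h = h'"
      proof (rule entry_const2[OF gQ cst _ _ h h'])
        fix u w assume "u \<in> {s..t}" "w \<in> {s..t}" "c u \<in> Q" "c w \<in> Q"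
        then have "u = w" using thin[OF Q sub sub] by blast
        then show "c u = c w" by simp
      qed (use st in auto)
      have "z = h" if zz: "z \<in> Q" "z \<in> K" for z
      proof -
        have hK: "h \<in> K" using entry_on_seg(1)[OF gQ K zz(2,1) h] .
        have 1: "d (c s) h \<le> d (c s) z" using entry_on_seg(2)[OF gQ K zz(2,1) h] .
        have 2: "d (c t) h \<le> d (c t) z" using entry_on_seg(2)[OF gQ seg_sym[OF K] zz(2,1) h'] \<open>h = h'\<close> by simp
        have "d (c s) z = d (c s) h"
          using seg_add[OF K hK] seg_add[OF K zz(2)] 1 2 commute[of "c t" h] commute[of "c t" z] by linarith
        then show ?thesis by (rule seg_inj[OF K zz(2) hK])
      qed
      then show ?thesis using z by metis
    qed
    have gK: "good K" by (rule thin_seg_good[OF K K_thin])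
    \<comment> \<open>Between \<open>c s\<close> and \<open>c t\<close> the arc avoids
      \<open>K\<close>. Splitting it at an inner point gives two paths with a single point in
      \<open>K\<close> each, as \<open>entry_const2\<close> requires.\<close>
    define u where "u = (s + t) / 2"
    have u: "s \<le> u" "u \<le> t" "s < u" "u < t" using st unfolding u_def by auto
    have only: "w = s \<or> w = t" if "w \<in> {s..t}" "c w \<in> K" for w
    proof -
      have "c w \<in> {c s, c t}" using that sub[OF that(1)] Kc by blast
      then show ?thesis using inj_onD[OF inj _ sub[OF that(1)]] st by auto
    qed
    have csM: "c s \<in> K" "c t \<in> K" using seg_ends[OF K] by auto
    have "c u \<in> M" using c sub[of u] u unfolding lip_path_def by auto
    then obtain e where e: "entry K (c u) e" using entry_ex[OF gK _ csM(1)] by blast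
    have "c s = e"
    proof (rule entry_const2[OF gK _ u(1) _ entry_self[OF gK csM(1)] e])
      show "lip_path c s u" by (rule lip_path_sub[OF c]) (use st u in auto)
      fix w w' assume "w \<in> {s..u}" "w' \<in> {s..u}" "c w \<in> K" "c w' \<in> K"
      then show "c w = c w'" using only[of w] only[of w'] u by auto
    qed
    moreover have "e = c t"
    proof (rule entry_const2[OF gK _ u(2) _ e entry_self[OF gK csM(2)]])
      show "lip_path c u t" by (rule lip_path_sub[OF c]) (use st u in auto)
      fix w w' assume "w \<in> {u..t}" "w' \<in> {u..t}" "c w \<in> K" "c w' \<in> K"
      then show "c w = c w'" using only[of w] only[of w'] u by auto
    qed
    ultimately have "s = t" using inj_onD[OF inj _ st(1,2)] by simp
    then show False using st by simp
  qed
qed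

text \<open>A point \<open>x\<close> outside \<open>Q\<close> lies on a sub-arc with only its ends
  in \<open>Q\<close>. Both ends are the entry point of \<open>x\<close>, so they coincide, against
  injectivity.\<close>

lemma loop_at_piece_in_piece:
  assumes c: "lip_path c 0 L" and inj: "inj_on c {0..<L}" and Q: "Q \<in> \<P>"
    and loop: "c 0 = c L" and c0: "c 0 \<in> Q" and t: "c t \<in> Q" "0 < t" "t < L"
  shows "c ` {0..L} \<subseteq> Q"
proof
  fix x assume "x \<in> c ` {0..L}"
  then obtain v where v: "v \<in> {0..L}" "x = c v" by blast
  show "x \<in> Q"
  proof (rule ccontr)
    assume x: "x \<notin> Q"
    note gQ = piece_good[OF Q]
    note cQ = piece_closed[OF Q]
    have "lip_path c 0 v" by (rule lip_path_sub[OF c]) (use v in auto)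
    then obtain t1 where t1: "t1 \<in> {0..v}" "c t1 \<in> Q" "\<And>w. w \<in> {t1<..v} \<Longrightarrow> c w \<notin> Q"
      by (rule lip_path_last[OF _ cQ, of _ _ _ 0]) (use v c0 in auto)
    have "lip_path c v L" by (rule lip_path_sub[OF c]) (use v in auto)
    then obtain t2 where t2: "t2 \<in> {v..L}" "c t2 \<in> Q" "\<And>w. w \<in> {v..<t2} \<Longrightarrow> c w \<notin> Q"
      by (rule lip_path_first[OF _ cQ, of _ _ _ L]) (use v c0 loop in auto)
    have ne: "t1 < v" "v < t2" using t1 t2 x v by (force simp: order_less_le)+
    have xM: "x \<in> M" using c v unfolding lip_path_def by auto
    obtain e where e: "entry Q x e" using entry_ex[OF gQ xM c0] by blast
    have "c t1 = e"
    proof (rule entry_const2[OF gQ _ _ _ entry_self[OF gQ t1(2)] e[unfolded v(2)]])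
      show "lip_path c t1 v" by (rule lip_path_sub[OF c]) (use v t1 in auto)
      fix w w' assume "w \<in> {t1..v}" "w' \<in> {t1..v}" "c w \<in> Q" "c w' \<in> Q"
      then have "w = t1" "w' = t1" using t1(3)[of w] t1(3)[of w'] by force+
      then show "c w = c w'" by simp
    qed (use ne in auto)
    moreover have "e = c t2"
    proof (rule entry_const2[OF gQ _ _ _ e[unfolded v(2)] entry_self[OF gQ t2(2)]])
      show "lip_path c v t2" by (rule lip_path_sub[OF c]) (use v t2 in auto)
      fix w w' assume "w \<in> {v..t2}" "w' \<in> {v..t2}" "c w \<in> Q" "c w' \<in> Q"
      then have "w = t2" "w' = t2" using t2(3)[of w] t2(3)[of w'] by force+
      then show "c w = c w'" by simp
    qed (use ne in auto)
    ultimately have eq: "c t1 = c t2" by simp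
    show False
    proof (cases "t2 < L")
      case True
      then show False using inj_onD[OF inj eq] t1 t2 ne v by auto
    next
      case False
      \<comment> \<open>The only coincidence that injectivity allows is that of the parameters 0 and
        \<open>L\<close>. Then the loop would have only its base point in \<open>Q\<close>, but
        \<open>c t\<close> is in \<open>Q\<close> too.\<close>
      then have "t2 = L" using t2 by auto
      then have "c t1 = c 0" using eq loop by simp
      then have "t1 = 0" using inj_onD[OF inj, of t1 0] t1 ne v t by auto
      then show False using t1(3)[of t] t2(3)[of t] t \<open>t2 = L\<close> by force
    qed
  qed
qed

lemma loop_meeting_piece_twice:
  assumes c: "lip_path c 0 L" and inj: "inj_on c {0..<L}" and Q: "Q \<in> \<P>"
    and loop: "c 0 = c L" and s: "c s \<in> Q" "0 \<le> s" and t: "c t \<in> Q" "s < t" "t < L"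
  shows "c ` {0..L} \<subseteq> Q"
proof -
  \<comment> \<open>The same loop with its base point moved from \<open>c 0\<close> to
    \<open>c s\<close>.\<close>
  define c' where "c' u = (if u \<le> L - s then c (s + u) else c (u - (L - s)))" for u
  have sL: "0 \<le> s" "s < L" using s t by auto
  have cd: "d (c u) (c w) \<le> \<bar>u - w\<bar>" "c u \<in> M" if "u \<in> {0..L}" "w \<in> {0..L}" for u w
    using c that unfolding lip_path_def by blast+
  have key: "d (c' u) (c' w) \<le> w - u" if "u \<in> {0..L}" "w \<in> {0..L}" "u \<le> w" for u w
  proof (cases "u \<le> L - s \<and> \<not> w \<le> L - s")
    case True
    then have e: "c' u = c (s + u)" "c' w = c (w - (L - s))" unfolding c'_def by auto
    have "d (c (s + u)) (c (w - (L - s))) \<le> d (c (s + u)) (c L) + d (c 0) (c (w - (L - s)))"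
      using triangle[of "c (s+u)" "c L" "c (w - (L - s))"] cd(2)[of "s+u" 0] cd(2)[of L 0] cd(2)[of "w - (L-s)" 0]
        True that sL loop by auto
    moreover have "d (c (s + u)) (c L) \<le> L - s - u" using cd(1)[of "s+u" L] True that sL by auto
    moreover have "d (c 0) (c (w - (L - s))) \<le> w - (L - s)" using cd(1)[of 0 "w - (L-s)"] True that sL by auto
    ultimately show ?thesis unfolding e by linarith
  next
    case False
    then show ?thesis
    proof (cases "w \<le> L - s")
      case True
      then show ?thesis using that cd(1)[of "s+u" "s+w"] sL unfolding c'_def by auto
    next
      case f: False
      then have "\<not> u \<le> L - s" using False by blast
      then show ?thesis using f that cd(1)[of "u - (L-s)" "w - (L-s)"] sL unfolding c'_def by auto
    qed
  qed
  have c'M: "c' u \<in> M" if "u \<in> {0..L}" for u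
    using that cd(2)[of "s+u" 0] cd(2)[of "u - (L-s)" 0] sL unfolding c'_def by auto
  have "lip_path c' 0 L"
    unfolding lip_path_def
  proof (intro conjI ballI)
    fix u w assume *: "u \<in> {0..L}" "w \<in> {0..L}"
    show "d (c' u) (c' w) \<le> \<bar>u - w\<bar>"
      using key[OF *] key[OF *(2,1)] commute[of "c' u" "c' w"] by linarith
  qed (rule c'M)
  moreover have "inj_on c' {0..<L}"
  proof (rule inj_onI)
    have r: "\<exists>v\<in>{0..<L}. c' u = c v \<and> (u < L - s \<longrightarrow> v = s + u) \<and> (u \<ge> L - s \<longrightarrow> v = u - (L - s))"
      if "u \<in> {0..<L}" for u
    proof (cases "u < L - s")
      case True then show ?thesis using that sL unfolding c'_def by (intro bexI[of _ "s+u"]) auto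
    next
      case False
      show ?thesis
      proof (cases "u = L - s")
        case True then show ?thesis using that sL loop unfolding c'_def by (intro bexI[of _ 0]) auto
      next
        case f: False then show ?thesis using that sL False unfolding c'_def by (intro bexI[of _ "u-(L-s)"]) auto
      qed
    qed
    fix u w assume *: "u \<in> {0..<L}" "w \<in> {0..<L}" "c' u = c' w"
    obtain v where v: "v \<in> {0..<L}" "c' u = c v" "u < L - s \<longrightarrow> v = s + u" "u \<ge> L - s \<longrightarrow> v = u - (L - s)"
      using r[OF *(1)] by blast
    obtain v' where v': "v' \<in> {0..<L}" "c' w = c v'" "w < L - s \<longrightarrow> v' = s + w" "w \<ge> L - s \<longrightarrow> v' = w - (L - s)"
      using r[OF *(2)] by blast
    have "v = v'" using inj_onD[OF inj _ v(1) v'(1)] *(3) v(2) v'(2) by simp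
    then show "u = w" using v(3,4) v'(3,4) *(1,2) sL by (cases "u < L - s"; cases "w < L - s") auto
  qed
  moreover have "c' 0 = c' L" using sL loop unfolding c'_def by auto
  moreover have "c' 0 \<in> Q" "c' (t - s) \<in> Q" using s t unfolding c'_def by auto
  ultimately have *: "c' ` {0..L} \<subseteq> Q"
    using loop_at_piece_in_piece[of c' L Q "t - s"] Q s t by auto
  show ?thesis
  proof
    fix x assume "x \<in> c ` {0..L}"
    then obtain v where v: "v \<in> {0..L}" "x = c v" by blast
    show "x \<in> Q"
    proof (cases "v \<ge> s")
      case True
      then have "x = c' (v - s)" using v unfolding c'_def by auto
      then show ?thesis using * True v sL by auto
    next
      case False
      show ?thesis
      proof (cases "v = 0")
        case True then have "x = c' (L - s)" using v loop unfolding c'_def by auto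
        then show ?thesis using * v sL by auto
      next
        case f: False
        then have "x = c' (v + (L - s))" using v unfolding c'_def by auto
        then show ?thesis using * False v sL by auto
      qed
    qed
  qed
qed

text \<open>If no piece contains the loop, no piece meets it twice, and each half contains every
  segment from \<open>c 0\<close> to \<open>c (L/2)\<close> by \<open>arc_contains_seg\<close>. An
  inner point of such a segment is then on both halves.\<close>

theorem simple_loop_in_piece:
  assumes c: "lip_path c 0 L" and L: "0 < L" and inj: "inj_on c {0..<L}" and loop: "c 0 = c L"
  shows "\<exists>Q\<in>\<P>. c ` {0..L} \<subseteq> Q"
proof (rule ccontr)
  assume no: "\<not> ?thesis"
  have thin: "s = t" if "Q \<in> \<P>" "s \<in> {0..<L}" "t \<in> {0..<L}" "c s \<in> Q" "c t \<in> Q" for Q s t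
  proof (rule ccontr)
    assume "s \<noteq> t"
    then consider "s < t" | "t < s" by linarith
    then show False
      using loop_meeting_piece_twice[OF c inj that(1) loop] that no by cases auto
  qed
  have M: "c 0 \<in> M" "c (L/2) \<in> M" using c L unfolding lip_path_def by auto
  obtain S where S: "seg S (c 0) (c (L/2))" using seg_ex[OF M] by blast
  have 1: "S \<subseteq> c ` {0..L/2}"
  proof (rule arc_contains_seg[OF lip_path_sub[OF c] _ inj_on_subset[OF inj] _ S])
    fix Q s t assume "Q \<in> \<P>" "s \<in> {0..L/2}" "t \<in> {0..L/2}" "c s \<in> Q" "c t \<in> Q"
    then show "s = t" using thin[of Q s t] L by auto
  qed (use L in auto)
  have inj2: "inj_on c {L/2..L}"
  proof (rule inj_onI)
    fix s t assume *: "s \<in> {L/2..L}" "t \<in> {L/2..L}" "c s = c t"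
    show "s = t"
      using inj_onD[OF inj, of s t] inj_onD[OF inj, of s 0] inj_onD[OF inj, of 0 t] * loop L
      by (cases "s = L"; cases "t = L") auto
  qed
  have 2: "S \<subseteq> c ` {L/2..L}"
  proof (rule arc_contains_seg[OF lip_path_sub[OF c] _ inj2 _ ])
    show "seg S (c (L/2)) (c L)" using seg_sym[OF S] loop by simp
    fix Q s t assume *: "Q \<in> \<P>" "s \<in> {L/2..L}" "t \<in> {L/2..L}" "c s \<in> Q" "c t \<in> Q"
    show "s = t"
      using thin[of Q s t] thin[of Q s 0] thin[of Q 0 t] * loop L by (cases "s = L"; cases "t = L") auto
  qed (use L in auto)
  have "c 0 \<noteq> c (L/2)" using inj_onD[OF inj, of 0 "L/2"] L by auto
  then have pos: "d (c 0) (c (L/2)) > 0" using M zero nonneg by (metis less_eq_real_def)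
  obtain z where z: "z \<in> S" "d (c 0) z = d (c 0) (c (L/2)) / 2"
    using seg_at[OF S, of "d (c 0) (c (L/2)) / 2"] pos by auto
  have zne: "z \<noteq> c 0" "z \<noteq> c (L/2)" using z pos M by auto
  obtain s where s: "s \<in> {0..L/2}" "z = c s" using z 1 by blast
  obtain t where t: "t \<in> {L/2..L}" "z = c t" using z 2 by blast
  have "t \<noteq> L" using t zne loop by auto
  then have "s = t" using inj_onD[OF inj, of s t] s t L by auto
  then have "s = L/2" using s t by auto
  then show False using s zne by auto
qed

end

section \<open>Linked points\<close>

context pieces
begin

text \<open>Replaces lying in one component of the complement of \<open>x\<close>. Chains are
  finite, and a piece through \<open>x\<close> counts as a single direction, whether or not
  \<open>x\<close> disconnects it.\<close>

definition link :: "'a \<Rightarrow> 'a \<Rightarrow> 'a \<Rightarrow> bool" where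
  "link x y z \<longleftrightarrow> y \<noteq> x \<and> z \<noteq> x \<and> ((\<exists>S. seg S y z \<and> x \<notin> S) \<or> (\<exists>Q\<in>\<P>. y \<in> Q \<and> z \<in> Q))"

abbreviation linked :: "'a \<Rightarrow> 'a \<Rightarrow> 'a \<Rightarrow> bool" where
  "linked x \<equiv> (link x)\<^sup>*\<^sup>*"

lemma link_sym: "link x y z \<Longrightarrow> link x z y"
  unfolding link_def by (meson seg_sym)

lemma linked_sym: "linked x y z \<Longrightarrow> linked x z y"
proof (induction rule: rtranclp_induct)
  case (step z w)
  then show ?case by (meson converse_rtranclp_into_rtranclp link_sym)
qed simp

lemma linked_seg: "seg S y z \<Longrightarrow> x \<notin> S \<Longrightarrow> linked x y z"
  by (rule r_into_rtranclp) (use seg_ends in \<open>auto simp: link_def\<close>)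

lemma linked_piece: "Q \<in> \<P> \<Longrightarrow> y \<in> Q \<Longrightarrow> z \<in> Q \<Longrightarrow> y \<noteq> x \<Longrightarrow> z \<noteq> x \<Longrightarrow> linked x y z"
  by (rule r_into_rtranclp) (auto simp: link_def)

lemma linked_ne: "linked x y z \<Longrightarrow> y \<noteq> x \<Longrightarrow> z \<noteq> x"
  by (induction rule: rtranclp_induct) (auto simp: link_def)

text \<open>Every segment between unlinked points passes through \<open>x\<close>. This additivity
  makes linking testable by distances.\<close>

lemma not_linked_dist:
  assumes "\<not> linked x y z" "y \<in> M" "z \<in> M"
  shows "d y z = d y x + d x z"
proof -
  obtain S where S: "seg S y z" using seg_ex assms by blast
  then have "x \<in> S" using linked_seg assms(1) by blast
  from seg_add[OF S this] show ?thesis by simp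
qed

text \<open>The entry point is invariant along the chain: a link is a segment avoiding
  \<open>e\<close>, or lies in a piece which contains a point outside \<open>Q\<close> and therefore
  has at most \<open>e\<close> in common with \<open>Q\<close>.\<close>

lemma linked_not_in_piece:
  assumes Q: "Q \<in> \<P>" and z: "z \<notin> Q" "entry Q z e" and l: "linked e z y"
  shows "y \<notin> Q \<and> entry Q y e"
  using l
proof (induction rule: rtranclp_induct)
  case base
  then show ?case using z by simp
next
  case (step w w')
  note gQ = piece_good[OF Q]
  have w: "w \<notin> Q" "entry Q w e" and ne: "w' \<noteq> e" using step unfolding link_def by auto
  have eQ: "e \<in> Q" using entry_in w by blast
  obtain S where S: "seg S w w'" and cond: "e \<notin> S \<or> (\<exists>Q'\<in>\<P>. Q' \<noteq> Q \<and> S \<subseteq> Q')"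
  proof (cases "\<exists>S. seg S w w' \<and> e \<notin> S")
    case True then show thesis using that by blast
  next
    case False
    then obtain Q' where Q': "Q' \<in> \<P>" "w \<in> Q'" "w' \<in> Q'" using step(2) unfolding link_def by blast
    obtain S where S: "seg S w w'" using seg_ex Q' sclosed_subset[OF piece_closed] by blast
    have "S \<subseteq> Q'" using piece_convex[OF Q'(1) S] Q' by blast
    then show thesis using that[OF S] Q' w by blast
  qed
  show ?case
  proof (cases "S \<inter> Q = {}")
    case True
    then have "w' \<notin> Q" using seg_ends[OF S] by blast
    obtain e' where e': "entry Q w' e'" using entry_ex[OF gQ seg_in(2)[OF S] eQ] by blast
    have "e = e'" by (rule entry_avoid[OF gQ S True w(2) e'])
    then show ?thesis using e' \<open>w' \<notin> Q\<close> by simp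
  next
    case False
    then obtain u where u: "u \<in> S" "u \<in> Q" by blast
    have eS: "e \<in> S" by (rule entry_on_seg(1)[OF gQ S u w(2)])
    then obtain Q' where Q': "Q' \<in> \<P>" "Q' \<noteq> Q" "S \<subseteq> Q'" using cond by blast
    have only: "v = e" if "v \<in> S" "v \<in> Q" for v
      using piece_meet[OF Q Q'(1), of v e] that eS eQ Q' by blast
    have "w' \<notin> Q" using only[of w'] seg_ends[OF S] ne by blast
    obtain e' where e': "entry Q w' e'" using entry_ex[OF gQ seg_in(2)[OF S] eQ] by blast
    have "e' \<in> S" by (rule entry_on_seg(1)[OF gQ seg_sym[OF S] u e'])
    then have "e' = e" using only entry_in[OF e'] by blast
    then show ?thesis using e' \<open>w' \<notin> Q\<close> by simp
  qed
qed

text \<open>For a segment starting at \<open>x\<close> this says, by convexity of the pieces, that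
  no piece contains a nontrivial initial part of it.\<close>

definition thin_at :: "'a \<Rightarrow> 'a set \<Rightarrow> bool" where
  "thin_at x S \<longleftrightarrow> (\<forall>Q\<in>\<P>. \<forall>y\<in>S. x \<in> Q \<longrightarrow> y \<in> Q \<longrightarrow> y = x)"

text \<open>Let \<open>v\<close> on \<open>K\<close> violate thinness. If \<open>v\<close> does not
  precede \<open>u\<close>, then \<open>u\<close> itself is in the piece. Otherwise the excursion of
  \<open>K\<close> off \<open>S\<close> around \<open>v\<close> starts at \<open>x\<close>, and the
  piece of the resulting bigon contains \<open>x\<close> and another point of
  \<open>S\<close>.\<close>

lemma thin_at_transfer:
  assumes S: "seg S x y" and K: "seg K x w" and u: "u \<in> S" "u \<in> K" "u \<noteq> x" and thin: "thin_at x S"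
  shows "thin_at x K"
  unfolding thin_at_def
proof (intro ballI impI, rule ccontr)
  fix Q v assume Q: "Q \<in> \<P>" "x \<in> Q" and v: "v \<in> K" "v \<in> Q" "v \<noteq> x"
  have Kv: "{z\<in>K. d x z \<le> d x v} \<subseteq> Q" by (rule piece_convex[OF Q(1) seg_initial[OF K v(1)]]) (use Q v in auto)
  have SQ: "z = x" if "z \<in> S" "z \<in> Q" for z using thin that Q unfolding thin_at_def by blast
  have vS: "v \<notin> S" using SQ v by blast
  show False
  proof (cases "d x u \<le> d x v")
    case True
    then have "u \<in> Q" using Kv u by blast
    then show False using SQ u by blast
  next
    case False
    define K1 where "K1 = {z\<in>K. d x z \<le> d x u}"
    have K1: "seg K1 x u" unfolding K1_def by (rule seg_initial[OF K u(2)])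
    have v1: "v \<in> K1" using v False unfolding K1_def by auto
    obtain m m' K' where m: "seg K' m m'" "K' \<subseteq> K1" "v \<in> K'" "K' \<inter> S = {m, m'}" "m \<noteq> m'"
      "m \<in> K1" "m' \<in> K1" "d x m < d x v" "d x v < d x m'"
      by (rule seg_excursion[OF K1 seg_sclosed[OF S] seg_ends(1)[OF S] u(1) v1 vS])
    have mm: "m \<in> S" "m' \<in> S" using m(4) by blast+
    have "m \<in> Q" using Kv m(6,8) unfolding K1_def by auto
    then have mx: "m = x" using SQ mm by blast
    have S': "seg {z\<in>S. d x z \<le> d x m'} x m'" by (rule seg_initial[OF S mm(2)])
    have "K' \<inter> {z\<in>S. d x z \<le> d x m'} = {x, m'}"
      using m(4) seg_ends[OF S'] mx by blast
    then obtain P where P: "P \<in> \<P>" "K' \<union> {z\<in>S. d x z \<le> d x m'} \<subseteq> P"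
      using piece_bigon[OF m(1)[unfolded mx] S'] m(5) mx by blast
    then have "x \<in> P" "m' \<in> P" using seg_ends[OF S'] by blast+
    then show False using thin P(1) mm(2) m(5) mx unfolding thin_at_def by blast
  qed
qed

text \<open>If \<open>u'\<close> is not on \<open>S\<close>, it lies in a bigon of \<open>K\<close>
  and \<open>S\<close>, hence in a piece, which by thinness avoids \<open>x\<close>. Both
  \<open>S\<close> and \<open>K'\<close> run from \<open>x\<close> to this piece, so both pass
  through the entry point of \<open>x\<close>.\<close>

lemma thin_at_meet_trans_aux:
  assumes S: "seg S x y" and K: "seg K x w" and K': "seg K' x w'" and thin: "thin_at x S"
    and u: "u \<in> S" "u \<in> K" and u': "u' \<in> K" "u' \<in> K'" "u' \<noteq> x" and le: "d x u' \<le> d x u"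
  shows "\<exists>z. z \<noteq> x \<and> z \<in> S \<and> z \<in> K'"
proof (cases "u' \<in> S")
  case True
  then show ?thesis using u' by blast
next
  case False
  define K1 where "K1 = {z\<in>K. d x z \<le> d x u}"
  have K1: "seg K1 x u" unfolding K1_def by (rule seg_initial[OF K u(2)])
  have u1: "u' \<in> K1" using u' le unfolding K1_def by auto
  obtain m m' K0 where m: "seg K0 m m'" "K0 \<subseteq> K1" "u' \<in> K0" "K0 \<inter> S = {m, m'}" "m \<noteq> m'"
    "m \<in> K1" "m' \<in> K1" "d x m < d x u'" "d x u' < d x m'"
    by (rule seg_excursion[OF K1 seg_sclosed[OF S] seg_ends(1)[OF S] u(1) u1 False])
  have mm: "m \<in> S" "m' \<in> S" using m(4) by blast+
  have S': "seg {z\<in>S. d x m \<le> d x z \<and> d x z \<le> d x m'} m m'"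
    by (rule seg_sub[OF S mm]) (use m in linarith)
  have "K0 \<inter> {z\<in>S. d x m \<le> d x z \<and> d x z \<le> d x m'} = {m, m'}"
    using m(4) seg_ends[OF S'] by blast
  then obtain P where P: "P \<in> \<P>" "K0 \<union> {z\<in>S. d x m \<le> d x z \<and> d x z \<le> d x m'} \<subseteq> P"
    using piece_bigon[OF m(1) S' m(5)] by blast
  have mP: "m \<in> P" "m' \<in> P" "u' \<in> P" using P m(3) seg_ends[OF S'] by blast+
  have "x \<notin> P"
  proof
    assume "x \<in> P"
    then have "m = x" "m' = x" using thin P(1) mm mP unfolding thin_at_def by blast+
    then show False using m(5) by blast
  qed
  obtain e where e: "entry P x e" using entry_ex[OF piece_good[OF P(1)] seg_in(1)[OF S] mP(1)] by blast
  have "e \<in> S" by (rule entry_on_seg(1)[OF piece_good[OF P(1)] S mm(1) mP(1) e])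
  moreover have "e \<in> K'" by (rule entry_on_seg(1)[OF piece_good[OF P(1)] K' u'(2) mP(3) e])
  moreover have "e \<noteq> x" using entry_in(1)[OF e] \<open>x \<notin> P\<close> by blast
  ultimately show ?thesis by blast
qed

text \<open>If \<open>u\<close> is nearer to \<open>x\<close> than \<open>u'\<close>, the outer
  segments exchange roles; thinness is carried to \<open>K'\<close> by
  \<open>thin_at_transfer\<close>.\<close>

lemma thin_at_meet_trans:
  assumes S: "seg S x y" and K: "seg K x w" and K': "seg K' x w'" and thin: "thin_at x S"
    and u: "u \<in> S" "u \<in> K" "u \<noteq> x" and u': "u' \<in> K" "u' \<in> K'" "u' \<noteq> x"
  shows "\<exists>z. z \<noteq> x \<and> z \<in> S \<and> z \<in> K'"
proof (cases "d x u' \<le> d x u")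
  case True
  then show ?thesis using thin_at_meet_trans_aux[OF S K K' thin u(1,2) u'] by blast
next
  case False
  have "thin_at x K" by (rule thin_at_transfer[OF S K u thin])
  then have "thin_at x K'" by (rule thin_at_transfer[OF K K' u'])
  then show ?thesis using thin_at_meet_trans_aux[OF K' K S _ u'(2,1) u(2,1,3)] False by force
qed

text \<open>Each link preserves meeting \<open>S\<close> away from \<open>x\<close>: if
  \<open>K\<close> and \<open>K'\<close> lead to consecutive points and meet in \<open>x\<close>
  only, they bound a simple triangle with the link, and its piece contains \<open>x\<close> and
  another point of the thin segment \<open>K\<close>.\<close>

lemma linked_thin_meet:
  assumes S: "seg S x y" and ne: "y \<noteq> x" and thin: "thin_at x S" and l: "linked x y w"
  shows "w \<noteq> x \<and> (\<forall>K. seg K x w \<longrightarrow> (\<exists>u. u \<noteq> x \<and> u \<in> S \<and> u \<in> K))"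
  using l
proof (induction rule: rtranclp_induct)
  case base
  then show ?case using ne seg_ends S by blast
next
  case (step w w')
  have w: "w \<noteq> x" "w' \<noteq> x" using step(2) unfolding link_def by auto
  obtain K where K: "seg K x w"
  proof -
    have "w \<in> M" using step(2) seg_in(1) sclosed_subset[OF piece_closed] unfolding link_def by blast
    then show thesis using that seg_ex seg_in(1)[OF S] by blast
  qed
  obtain u where u: "u \<in> S" "u \<in> K" "u \<noteq> x" using step K by blast
  have thK: "thin_at x K" by (rule thin_at_transfer[OF S K u thin])
  \<comment> \<open>A link inside a piece is also given by a segment avoiding \<open>x\<close>: the
    thin segment \<open>K\<close> ends in the piece, so \<open>x\<close> is not in it.\<close>
  obtain G where G: "seg G w w'" "x \<notin> G"
  proof (cases "\<exists>G. seg G w w' \<and> x \<notin> G")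
    case True then show thesis using that by blast
  next
    case False
    then obtain Q where Q: "Q \<in> \<P>" "w \<in> Q" "w' \<in> Q" using step(2) unfolding link_def by blast
    have "x \<notin> Q" using thK Q w seg_ends(2)[OF K] unfolding thin_at_def by blast
    moreover obtain G where G: "seg G w w'" using seg_ex Q sclosed_subset[OF piece_closed] by blast
    ultimately show thesis using that[OF G] piece_convex[OF Q(1) G Q(2,3)] by blast
  qed
  have "\<exists>z. z \<noteq> x \<and> z \<in> S \<and> z \<in> K'" if K': "seg K' x w'" for K'
  proof (cases "\<exists>z. z \<in> K \<and> z \<in> K' \<and> z \<noteq> x")
    case True
    then obtain z where "z \<in> K" "z \<in> K'" "z \<noteq> x" by blast
    then show ?thesis using thin_at_meet_trans[OF S K K' thin u] by blast
  next
    case False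
    then have KK: "K \<inter> K' = {x}" using seg_ends(1)[OF K] seg_ends(1)[OF K'] by blast
    obtain a where a: "a \<in> G" "a \<in> K" "d w' a \<le> d w' w" "seg {z\<in>G. d w' z \<le> d w' a} w' a"
      "{z\<in>G. d w' z \<le> d w' a} \<inter> K = {a}"
      by (rule first_hit[OF seg_sym[OF G(1)] seg_sclosed[OF K] seg_ends(1)[OF G(1)] seg_ends(2)[OF K]])
    define G1 where "G1 = {z\<in>G. d w' z \<le> d w' a}"
    have G1: "seg G1 a w'" "G1 \<inter> K = {a}" "G1 \<subseteq> G" using a(4,5) seg_sym unfolding G1_def by auto
    obtain c where c: "c \<in> G1" "c \<in> K'" "d a c \<le> d a w'" "seg {z\<in>G1. d a z \<le> d a c} a c"
      "{z\<in>G1. d a z \<le> d a c} \<inter> K' = {c}"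
      by (rule first_hit[OF G1(1) seg_sclosed[OF K'] seg_ends(2)[OF G1(1)] seg_ends(2)[OF K']])
    define G2 where "G2 = {z\<in>G1. d a z \<le> d a c}"
    have G2: "seg G2 a c" "G2 \<inter> K' = {c}" "G2 \<subseteq> G1" using c unfolding G2_def by auto
    have ne: "a \<noteq> x" "c \<noteq> x" using a c G G1 by blast+
    then have "a \<noteq> c" using KK a c by blast
    have Ka: "seg {z\<in>K. d x z \<le> d x a} x a" by (rule seg_initial[OF K a(2)])
    have Kc: "seg {z\<in>K'. d x z \<le> d x c} x c" by (rule seg_initial[OF K' c(2)])
    have "\<exists>Q\<in>\<P>. {z\<in>K. d x z \<le> d x a} \<union> G2 \<union> {z\<in>K'. d x z \<le> d x c} \<subseteq> Q"
    proof (rule piece_tri[OF Ka G2(1) seg_sym[OF Kc]])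
      show "{z\<in>K. d x z \<le> d x a} \<inter> G2 = {a}"
        using G1 G2 seg_ends(2)[OF Ka] seg_ends(1)[OF G2(1)] by blast
      show "G2 \<inter> {z\<in>K'. d x z \<le> d x c} = {c}"
        using G2 seg_ends(2)[OF Kc] seg_ends(2)[OF G2(1)] by blast
      show "{z\<in>K'. d x z \<le> d x c} \<inter> {z\<in>K. d x z \<le> d x a} = {x}"
        using KK seg_ends(1)[OF Ka] seg_ends(1)[OF Kc] by blast
    qed (use ne \<open>a \<noteq> c\<close> in auto)
    then obtain Q where Q: "Q \<in> \<P>" "{z\<in>K. d x z \<le> d x a} \<union> G2 \<union> {z\<in>K'. d x z \<le> d x c} \<subseteq> Q" by blast
    then have "x \<in> Q" "a \<in> Q" using seg_ends[OF Ka] by blast+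
    then show ?thesis using thK Q(1) a(2) ne unfolding thin_at_def by blast
  qed
  then show ?case using w by blast
qed

text \<open>When \<open>S\<close> starts in a piece \<open>Q\<close> and \<open>S'\<close> does not,
  \<open>x\<close> is the entry point of \<open>y'\<close> into \<open>Q\<close>, and
  \<open>linked_not_in_piece\<close> separates \<open>y'\<close> from the points of \<open>S\<close>
  in \<open>Q\<close>.\<close>

lemma linked_germs:
  assumes S: "seg S x y" and S': "seg S' x y'" and ne: "y \<noteq> x" and l: "linked x y y'"
  shows "(\<exists>u. u \<noteq> x \<and> u \<in> S \<and> u \<in> S') \<or>
    (\<exists>Q\<in>\<P>. x \<in> Q \<and> (\<exists>u\<in>S \<inter> Q. u \<noteq> x) \<and> (\<exists>u\<in>S' \<inter> Q. u \<noteq> x))"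
proof (cases "thin_at x S")
  case True
  then show ?thesis using linked_thin_meet[OF S ne True l] S' by blast
next
  case False
  then obtain Q v where Q: "Q \<in> \<P>" "x \<in> Q" and v: "v \<in> S" "v \<in> Q" "v \<noteq> x"
    unfolding thin_at_def by blast
  show ?thesis
  proof (cases "\<exists>u\<in>S' \<inter> Q. u \<noteq> x")
    case True
    then show ?thesis using Q v by blast
  next
    case False
    then have S'Q: "S' \<inter> Q = {x}" using seg_ends(1)[OF S'] Q by blast
    have "y' \<noteq> x" using linked_ne[OF l ne] .
    then have y': "y' \<notin> Q" "entry Q y' x"
      using S'Q seg_ends(2)[OF S'] seg_sym[OF S'] unfolding entry_def by blast+
    have Sv: "seg {z\<in>S. d x v \<le> d x z} v y" by (rule seg_final[OF S v(1)])
    have "d x v > 0" using v seg_in[OF S] zero nonneg by (metis less_eq_real_def)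
    then have "x \<notin> {z\<in>S. d x v \<le> d x z}" using seg_in[OF S] by auto
    then have "linked x v y" by (rule linked_seg[OF Sv])
    then have "linked x y' v" using linked_sym l by (meson rtranclp_trans)
    then show ?thesis using linked_not_in_piece[OF Q(1) y'] v by blast
  qed
qed

end

section \<open>Tree-graded spaces\<close>

definition geo_seg :: "'a set \<Rightarrow> ('a \<Rightarrow> 'a \<Rightarrow> real) \<Rightarrow> 'a set \<Rightarrow> 'a \<Rightarrow> 'a \<Rightarrow> bool" where
  "geo_seg M d S a b \<longleftrightarrow> (\<exists>g l. geodesic M d g l \<and> g 0 = a \<and> g l = b \<and> S = g ` {0..l})"

lemma geodesic_reverse: "geodesic M d g l \<Longrightarrow> geodesic M d (\<lambda>t. g (l - t)) l"
proof -
  assume g: "geodesic M d g l"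
  have "d (g (l - s)) (g (l - t)) = \<bar>s - t\<bar>" if "s \<in> {0..l}" "t \<in> {0..l}" for s t
  proof -
    have "d (g (l - s)) (g (l - t)) = \<bar>(l - s) - (l - t)\<bar>"
      using g that unfolding geodesic_def by (elim conjE) auto
    then show ?thesis by simp
  qed
  then show ?thesis using g unfolding geodesic_def by auto
qed

lemma geodesic_shift:
  assumes g: "geodesic M d g l" and "0 \<le> a" "a \<le> b" "b \<le> l"
  shows "geodesic M d (\<lambda>t. g (a + t)) (b - a)"
  unfolding geodesic_def
proof (intro conjI ballI)
  fix s t assume "s \<in> {0..b-a}" "t \<in> {0..b-a}"
  then have "d (g (a + s)) (g (a + t)) = \<bar>(a + s) - (a + t)\<bar>"
    using g assms(2-4) unfolding geodesic_def by (elim conjE) auto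
  then show "d (g (a + s)) (g (a + t)) = \<bar>s - t\<bar>" by simp
qed (use assms in \<open>auto simp: geodesic_def\<close>)

lemma image_reverse: "(\<lambda>t. g (l - t)) ` {0..l::real} = g ` {0..l}"
proof -
  have "(\<lambda>t. l - t) ` {0..l} = {0..l}" by (auto simp: image_def intro!: bexI[of _ "l - _"])
  then show ?thesis by (metis image_image)
qed

lemma image_shift: "a \<le> b \<Longrightarrow> (\<lambda>t. g (a + t)) ` {0..b - a::real} = g ` {a..b}"
proof -
  have "(\<lambda>t. a + t) ` {0..b-a} = {a..b}" by (simp add: image_add_atLeastAtMost)
  then show ?thesis by (metis image_image)
qed

lemma (in Metric_space) segment_space_geo_seg:
  assumes "geodesic_space M d"
  shows "segment_space M d (geo_seg M d)"
proof
  fix S a b assume "geo_seg M d S a b"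
  then show "\<exists>g l. geodesic M d g l \<and> g 0 = a \<and> g l = b \<and> S = g ` {0..l}"
    unfolding geo_seg_def .
next
  fix S a b assume "geo_seg M d S a b"
  then obtain g l where "geodesic M d g l" "g 0 = a" "g l = b" "S = g ` {0..l}"
    unfolding geo_seg_def by blast
  then show "geo_seg M d S b a"
    unfolding geo_seg_def using geodesic_reverse[of M d g l] image_reverse[of g l]
    by (intro exI[of _ "\<lambda>t. g (l - t)"] exI[of _ l]) auto
next
  fix S a b x y assume "geo_seg M d S a b" and xy: "x \<in> S" "y \<in> S" "d a x \<le> d a y"
  then obtain g l where g: "geodesic M d g l" "g 0 = a" "g l = b" "S = g ` {0..l}"
    unfolding geo_seg_def by blast
  have dg: "d a (g t) = t" if "t \<in> {0..l}" for t
    using g that unfolding geodesic_def by (auto simp flip: g(2))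
  obtain s t where st: "s \<in> {0..l}" "x = g s" "t \<in> {0..l}" "y = g t" using xy g by blast
  have "s \<le> t" using xy(3) dg st by simp
  have "{z\<in>S. d a x \<le> d a z \<and> d a z \<le> d a y} = g ` {s..t}"
    unfolding g(4) using dg st \<open>s \<le> t\<close> by auto
  then have e: "{z\<in>S. d a x \<le> d a z \<and> d a z \<le> d a y} = (\<lambda>u. g (s + u)) ` {0..t-s}"
    using image_shift[OF \<open>s \<le> t\<close>] by metis
  show "geo_seg M d {z\<in>S. d a x \<le> d a z \<and> d a z \<le> d a y} x y"
    unfolding geo_seg_def e
    by (intro exI[of _ "\<lambda>u. g (s + u)"] exI[of _ "t - s"] conjI geodesic_shift[OF g(1)])
      (use st \<open>s \<le> t\<close> in auto)
next
  fix a b assume "a \<in> M" "b \<in> M"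
  then obtain g l where "geodesic M d g l" "g 0 = a" "g l = b"
    using assms unfolding geodesic_space_def by blast
  then have "geo_seg M d (g ` {0..l}) a b" unfolding geo_seg_def by blast
  then show "\<exists>S. geo_seg M d S a b" ..
qed

lemma (in Metric_space) closedin_iff_sclosed: "closedin mtopology T \<longleftrightarrow> sclosed T"
proof
  assume c: "closedin mtopology T"
  show "sclosed T"
    unfolding sclosed_def
  proof (intro conjI ballI impI)
    show "T \<subseteq> M" using c closedin_metric by blast
    fix x assume x: "x \<in> M" "\<forall>e>0. \<exists>y\<in>T. d x y < e"
    show "x \<in> T"
    proof (rule ccontr)
      assume "x \<notin> T"
      then obtain r where "r > 0" "disjnt T (mball x r)" using c x closedin_metric by blast
      moreover obtain y where "y \<in> T" "d x y < r" using x \<open>r > 0\<close> by blast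
      ultimately show False using x(1) \<open>T \<subseteq> M\<close> unfolding disjnt_def by (auto simp: disjoint_iff)
    qed
  qed
next
  assume s: "sclosed T"
  show "closedin mtopology T"
    unfolding closedin_metric
  proof (intro conjI allI impI)
    show "T \<subseteq> M" by (rule sclosed_subset[OF s])
    fix x assume x: "x \<in> M - T"
    then obtain e where "e > 0" "\<forall>y\<in>T. \<not> d x y < e" using s unfolding sclosed_def by blast
    then show "\<exists>r>0. disjnt T (mball x r)" by (intro exI[of _ e]) (auto simp: disjnt_def)
  qed
qed

text \<open>A piece is only known to contain some geodesic between two of its points. A geodesic
  leaving it would form a bigon with an inner one, and the piece of that bigon would have two points
  in common with the given piece.\<close>

lemma tree_graded_pieces:
  assumes tg: "tree_graded M d I P"
  shows "pieces M d (geo_seg M d) (P ` I)"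
proof -
  interpret Metric_space M d using tg unfolding tree_graded_def by blast
  have gs: "geodesic_space M d" using tg unfolding tree_graded_def by blast
  interpret segment_space M d "geo_seg M d" by (rule segment_space_geo_seg[OF gs])
  have closed: "sclosed Q" and geo: "geodesic_space Q d" if "Q \<in> P ` I" for Q
    using tg that closedin_iff_sclosed unfolding tree_graded_def by auto
  have meet: "Q = Q'" if QQ: "Q \<in> P ` I" "Q' \<in> P ` I" and xy: "x \<noteq> y" "x \<in> Q" "x \<in> Q'" "y \<in> Q" "y \<in> Q'" for Q Q' x y
  proof -
    obtain i where i: "i \<in> I" "Q = P i" using QQ by blast
    obtain j where j: "j \<in> I" "Q' = P j" using QQ by blast
    have "\<forall>i\<in>I. \<forall>j\<in>I. i \<noteq> j \<longrightarrow> (\<forall>x\<in>P i \<inter> P j. \<forall>y\<in>P i \<inter> P j. x = y)"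
      using tg unfolding tree_graded_def by blast
    from this[rule_format, OF i(1) j(1), of x y] have "i = j" using xy i(2) j(2) by auto
    then show ?thesis using i(2) j(2) by simp
  qed
  have tri: "\<exists>Q\<in>P ` I. S1 \<union> S2 \<union> S3 \<subseteq> Q"
    if S: "geo_seg M d S1 a b" "geo_seg M d S2 b c" "geo_seg M d S3 c a"
      and ne: "a \<noteq> b" "b \<noteq> c" "c \<noteq> a"
      and int: "S1 \<inter> S2 = {b}" "S2 \<inter> S3 = {c}" "S3 \<inter> S1 = {a}" for S1 S2 S3 a b c
  proof -
    obtain g1 l1 where 1: "geodesic M d g1 l1" "g1 0 = a" "g1 l1 = b" "S1 = g1 ` {0..l1}"
      using S(1) unfolding geo_seg_def by blast
    obtain g2 l2 where 2: "geodesic M d g2 l2" "g2 0 = b" "g2 l2 = c" "S2 = g2 ` {0..l2}"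
      using S(2) unfolding geo_seg_def by blast
    obtain g3 l3 where 3: "geodesic M d g3 l3" "g3 0 = c" "g3 l3 = a" "S3 = g3 ` {0..l3}"
      using S(3) unfolding geo_seg_def by blast
    define g where "g i = (if i = 0 then g1 else if i = 1 then g2 else g3)" for i :: nat
    define l where "l i = (if i = 0 then l1 else if i = 1 then l2 else l3)" for i :: nat
    have less3: "{..<3::nat} = {0, 1, 2}" by auto
    have poly: "geodesic_polygon M d 3 g l"
      unfolding geodesic_polygon_def
    proof (intro allI impI)
      fix i :: nat assume "i < 3"
      then consider "i = 0" | "i = 1" | "i = 2" by linarith
      then show "geodesic M d (g i) (l i) \<and> g i (l i) = g (Suc i mod 3) 0"
        by cases (use 1 2 3 in \<open>auto simp: g_def l_def\<close>)
    qed
    have gi: "geodesic M d (g i) (l i)" if "i < 3" for i using poly that unfolding geodesic_polygon_def by blast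
    have inj: "inj_on (g i) {0..l i}" if "i < 3" for i
    proof (rule inj_onI)
      fix s t assume st: "s \<in> {0..l i}" "t \<in> {0..l i}" "g i s = g i t"
      have "d (g i s) (g i t) = \<bar>s - t\<bar>" using gi[OF that] st(1,2) unfolding geodesic_def by blast
      moreover have "g i t \<in> M" using gi[OF that] st(2) unfolding geodesic_def by blast
      ultimately show "s = t" unfolding st(3) by simp
    qed
    have e: "g 0 = g1" "g 1 = g2" "g 2 = g3" "l 0 = l1" "l 1 = l2" "l 2 = l3"
      by (auto simp: g_def l_def)
    have Si: "S1 = g 0 ` {0..l 0}" "S2 = g 1 ` {0..l 1}" "S3 = g 2 ` {0..l 2}" using e 1 2 3 by auto
    have ends: "b = g 0 (l 0)" "c = g 1 (l 1)" "a = g 2 (l 2)" using e 1 2 3 by auto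
    have last: "g i s \<noteq> g i (l i)" if "i < 3" "s \<in> {0..<l i}" for i s
      using inj_onD[OF inj[OF that(1)], of s "l i"] that by auto
    \<comment> \<open>Half-open edges omit their final vertex. Two edges meet in a vertex only,
      which is the omitted one for one of the two.\<close>
    have disj: "g i s \<noteq> g j t" if ij: "i < j" "j < 3" "s \<in> {0..<l i}" "t \<in> {0..<l j}" for i j s t
    proof
      assume eq: "g i s = g j t"
      consider "i = 0" "j = 1" | "i = 0" "j = 2" | "i = 1" "j = 2" using \<open>i < j\<close> \<open>j < 3\<close> by linarith
      then show False
      proof cases
        case 1
        have "g 0 s \<in> S1" using ij(3) unfolding Si 1 by auto
        moreover have "g 1 t \<in> S2" using ij(4) unfolding Si 1 by auto
        moreover have "g 0 s = g 1 t" using eq 1 by simp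
        ultimately have "g 0 s = b" using int by auto
        then show False using last[of 0 s] ij 1 ends by auto
      next
        case 2
        have "g 2 t \<in> S3" using ij(4) unfolding Si 2 by auto
        moreover have "g 0 s \<in> S1" using ij(3) unfolding Si 2 by auto
        moreover have "g 0 s = g 2 t" using eq 2 by simp
        ultimately have "g 2 t = a" using int by auto
        then show False using last[of 2 t] ij 2 ends by auto
      next
        case 3
        have "g 1 s \<in> S2" using ij(3) unfolding Si 3 by auto
        moreover have "g 2 t \<in> S3" using ij(4) unfolding Si 3 by auto
        moreover have "g 1 s = g 2 t" using eq 3 by simp
        ultimately have "g 1 s = c" using int by auto
        then show False using last[of 1 s] ij 3 ends by auto
      qed
    qed
    have simple: "simple_nontrivial_polygon 3 g l"
      unfolding simple_nontrivial_polygon_def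
    proof (intro conjI inj_onI)
      fix p q assume pq: "p \<in> (SIGMA i:{..<3}. {0..<l i})" "q \<in> (SIGMA i:{..<3}. {0..<l i})"
        and eq: "(case p of (i, t) \<Rightarrow> g i t) = (case q of (i, t) \<Rightarrow> g i t)"
      obtain i s j t where p: "p = (i, s)" "q = (j, t)" by (metis surj_pair)
      have ij: "i < 3" "j < 3" "s \<in> {0..<l i}" "t \<in> {0..<l j}" "g i s = g j t" using pq eq p by auto
      then have "i = j" using disj[of i j s t] disj[of j i t s] by (metis linorder_neqE_nat)
      then show "p = q" using inj_onD[OF inj[OF ij(1)], of s t] ij p by auto
    next
      have "l 0 \<noteq> 0" using 1 ne e by auto
      then have "0 < l 0" using gi[of 0] unfolding geodesic_def by simp
      then show "\<exists>i<3. 0 < l i" by (intro exI[of _ 0]) auto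
    qed
    have "\<forall>g l. geodesic_polygon M d 3 g l \<and> simple_nontrivial_polygon 3 g l \<longrightarrow> (\<exists>i\<in>I. edges g l {..<3} \<subseteq> P i)"
      using tg unfolding tree_graded_def by (elim conjE)
    then obtain i where i: "i \<in> I" "edges g l {..<3} \<subseteq> P i"
      using poly simple by meson
    have "edges g l {..<3} = S1 \<union> S2 \<union> S3"
      unfolding edges_def less3 Si by auto
    then show ?thesis using i by (intro bexI[of _ "P i"]) auto
  qed
  have convex: "S \<subseteq> Q" if Q: "Q \<in> P ` I" and S: "geo_seg M d S x y" and xy: "x \<in> Q" "y \<in> Q" for Q S x y
  proof
    fix v assume v: "v \<in> S"
    show "v \<in> Q"
    proof (rule ccontr)
      assume vQ: "v \<notin> Q"
      obtain m m' K where K: "geo_seg M d K m m'" "K \<subseteq> S" "v \<in> K" "K \<inter> Q = {m, m'}" "m \<noteq> m'"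
        "m \<in> S" "m' \<in> S" "d x m < d x v" "d x v < d x m'"
        by (rule seg_excursion[OF S closed[OF Q] xy v vQ])
      have mm: "m \<in> Q" "m' \<in> Q" using K(4) by blast+
      obtain h k where h: "geodesic Q d h k" "h 0 = m" "h k = m'"
        using geo[OF Q] mm unfolding geodesic_space_def by blast
      have hM: "geodesic M d h k" using h(1) sclosed_subset[OF closed[OF Q]] unfolding geodesic_def by blast
      have H: "geo_seg M d (h ` {0..k}) m m'" unfolding geo_seg_def using hM h by blast
      have HQ: "h ` {0..k} \<subseteq> Q" using h(1) unfolding geodesic_def by blast
      have int: "K \<inter> h ` {0..k} = {m, m'}" using K(4) HQ seg_ends[OF H] by blast
      have "\<exists>Q\<in>P ` I. K \<union> h ` {0..k} \<subseteq> Q" by (rule bigon_in_piece[OF tri K(1) H K(5) int])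
      then obtain Q' where Q': "Q' \<in> P ` I" "K \<union> h ` {0..k} \<subseteq> Q'" by blast
      have "m \<in> Q'" "m' \<in> Q'" using Q' seg_ends[OF H] by blast+
      then have "Q = Q'" using meet[OF Q Q'(1) K(5)] mm by blast
      then show False using Q' K(3) vQ by blast
    qed
  qed
  show ?thesis
  proof unfold_locales
  qed (fact closed convex meet tri)+
qed

text \<open>The sides need not belong to \<open>seg\<close>: the boundary is a simple Lipschitz
  loop, and that is all \<open>simple_loop_in_piece\<close> asks for.\<close>

lemma (in pieces) simple_triangle_in_piece:
  assumes poly: "geodesic_polygon M d 3 g l" and simple: "simple_nontrivial_polygon 3 g l"
  shows "\<exists>Q\<in>\<P>. edges g l {..<3} \<subseteq> Q"
proof -
  have g: "geodesic M d (g i) (l i)" "g i (l i) = g (Suc i mod 3) 0" if "i < 3" for i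
    using poly that unfolding geodesic_polygon_def by auto
  have l: "0 \<le> l 0" "0 \<le> l 1" "0 \<le> l 2" using g(1)[of 0] g(1)[of 1] g(1)[of 2] unfolding geodesic_def by auto
  have v: "g 0 (l 0) = g 1 0" "g 1 (l 1) = g 2 0" "g 2 (l 2) = g 0 0"
    using g(2)[of 0] g(2)[of 1] g(2)[of 2] by (auto simp: numeral_2_eq_2)
  have lip: "d (g i s) (g i t) = \<bar>s - t\<bar>" "g i s \<in> M" if "i < 3" "s \<in> {0..l i}" "t \<in> {0..l i}" for i s t
    using g(1)[OF that(1)] that unfolding geodesic_def by auto
  define L where "L = l 0 + l 1 + l 2"
  define c where "c t = (if t \<le> l 0 then g 0 t else if t \<le> l 0 + l 1 then g 1 (t - l 0) else g 2 (t - l 0 - l 1))" for t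
  have c0: "c t = g 0 t" if "t \<in> {0..l 0}" for t using that unfolding c_def by auto
  have c1: "c t = g 1 (t - l 0)" if "t \<in> {l 0..l 0 + l 1}" for t
  proof (cases "t = l 0")
    case True then show ?thesis using v(1) unfolding c_def by auto
  next
    case False then show ?thesis using that unfolding c_def by auto
  qed
  have c2: "c t = g 2 (t - l 0 - l 1)" if "t \<in> {l 0 + l 1..L}" for t
  proof (cases "t = l 0 + l 1")
    case True then show ?thesis using c1[of t] v l by auto
  next
    case False then show ?thesis using that l unfolding c_def by auto
  qed
  have P0: "lip_path c 0 (l 0)"
    unfolding lip_path_def using lip[of 0] by (auto simp: c0)
  have P1: "lip_path c (l 0) (l 0 + l 1)"
    unfolding lip_path_def
  proof (intro conjI ballI)
    fix s t assume "s \<in> {l 0..l 0 + l 1}" "t \<in> {l 0..l 0 + l 1}"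
    then show "d (c s) (c t) \<le> \<bar>s - t\<bar>" using lip(1)[of 1 "s - l 0" "t - l 0"] by (auto simp: c1)
  next
    fix t assume "t \<in> {l 0..l 0 + l 1}"
    then show "c t \<in> M" using lip(2)[of 1 "t - l 0" "t - l 0"] by (auto simp: c1)
  qed
  have P2: "lip_path c (l 0 + l 1) L"
    unfolding lip_path_def
  proof (intro conjI ballI)
    fix s t assume "s \<in> {l 0 + l 1..L}" "t \<in> {l 0 + l 1..L}"
    then show "d (c s) (c t) \<le> \<bar>s - t\<bar>"
      using lip(1)[of 2 "s - l 0 - l 1" "t - l 0 - l 1"] by (auto simp: c2 L_def)
  next
    fix t assume "t \<in> {l 0 + l 1..L}"
    then show "c t \<in> M" using lip(2)[of 2 "t - l 0 - l 1" "t - l 0 - l 1"] by (auto simp: c2 L_def)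
  qed
  have join: "lip_path c x z" if A: "lip_path c x y" and B: "lip_path c y z" and le: "x \<le> y" "y \<le> z" for x y z
    unfolding lip_path_def
  proof (intro conjI ballI)
    show M: "c t \<in> M" if "t \<in> {x..z}" for t using A B that unfolding lip_path_def by (cases "t \<le> y") auto
    have key: "d (c s) (c t) \<le> t - s" if st: "s \<in> {x..z}" "t \<in> {x..z}" "s \<le> t" for s t
    proof -
      have A': "d (c u) (c w) \<le> \<bar>u - w\<bar>" if "u \<in> {x..y}" "w \<in> {x..y}" for u w using A that unfolding lip_path_def by blast
      have B': "d (c u) (c w) \<le> \<bar>u - w\<bar>" if "u \<in> {y..z}" "w \<in> {y..z}" for u w using B that unfolding lip_path_def by blast
      consider "t \<le> y" | "s \<ge> y" | "s \<le> y" "y \<le> t" by linarith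
      then show ?thesis
      proof cases
        case 3
        have "d (c s) (c t) \<le> d (c s) (c y) + d (c y) (c t)" using M st le by (intro triangle) auto
        then show ?thesis using A'[of s y] B'[of y t] 3 st by auto
      qed (use A'[of s t] B'[of s t] st in auto)
    qed
    fix s t assume "s \<in> {x..z}" "t \<in> {x..z}"
    then show "d (c s) (c t) \<le> \<bar>s - t\<bar>" using key[of s t] key[of t s] commute[of "c s" "c t"] by linarith
  qed
  have lipc: "lip_path c 0 L"
    by (rule join[OF join[OF P0 P1] P2]) (use l in \<open>auto simp: L_def\<close>)
  have Lpos: "L > 0" using simple l unfolding simple_nontrivial_polygon_def L_def
    by (auto simp: less_Suc_eq numeral_3_eq_3 numeral_2_eq_2)
  \<comment> \<open>The edge and the parameter at which \<open>c t\<close> lies; injectivity of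
    \<open>c\<close> is read off from simplicity of the polygon.\<close>
  define loc where "loc t = (if t < l 0 then (0::nat, t) else if t < l 0 + l 1 then (1, t - l 0) else (2, t - l 0 - l 1))" for t
  have loc: "loc t \<in> (SIGMA i:{..<3}. {0..<l i}) \<and> c t = (case loc t of (i, t) \<Rightarrow> g i t)" if "t \<in> {0..<L}" for t
    using that c0[of t] c1[of t] c2[of t] unfolding loc_def L_def by auto
  have "inj_on c {0..<L}"
  proof (rule inj_onI)
    fix s t assume st: "s \<in> {0..<L}" "t \<in> {0..<L}" "c s = c t"
    have "loc s = loc t"
      using simple loc[OF st(1)] loc[OF st(2)] st(3) unfolding simple_nontrivial_polygon_def
      by (elim conjE) (erule inj_onD, auto)
    then show "s = t" unfolding loc_def by (auto split: if_splits)
  qed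
  moreover have "c 0 = c L" using c0[of 0] c2[of L] l v unfolding L_def by auto
  ultimately obtain Q where Q: "Q \<in> \<P>" "c ` {0..L} \<subseteq> Q"
    using simple_loop_in_piece[OF lipc Lpos] by blast
  have "g i t \<in> Q" if "i < 3" "t \<in> {0..l i}" for i t
  proof -
    consider "i = 0" | "i = 1" | "i = 2" using \<open>i < 3\<close> by linarith
    then show ?thesis
    proof cases
      case 1
      then have "g i t = c t" using c0 that by auto
      then show ?thesis using Q that 1 l unfolding L_def by auto
    next
      case 2
      then have "g i t = c (l 0 + t)" using c1[of "l 0 + t"] that by auto
      then show ?thesis using Q that 2 l unfolding L_def by auto
    next
      case 3
      then have "g i t = c (l 0 + l 1 + t)" using c2[of "l 0 + l 1 + t"] that by (auto simp: L_def)
      then show ?thesis using Q that 3 l unfolding L_def by auto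
    qed
  qed
  then show ?thesis using Q(1) unfolding edges_def by blast
qed

section \<open>Asymptotic cones\<close>

lemma (in Metric_space) nbhd_iff: "x \<in> nbhd M d r A \<longleftrightarrow> x \<in> M \<and> (\<exists>a\<in>A. d x a < r)"
  unfolding nbhd_def set_dist_def
  by (auto simp: INF_less_iff ennreal_less_iff)

lemma (in Metric_space) nbhd_mono: "r \<le> r' \<Longrightarrow> x \<in> nbhd M d r A \<Longrightarrow> x \<in> nbhd M d r' A"
  unfolding nbhd_iff by force

lemma (in Metric_space) nbhd_triangle:
  assumes "x \<in> nbhd M d r A" "y \<in> M" "d x y \<le> r'" "A \<subseteq> M"
  shows "y \<in> nbhd M d (r + r') A"
proof -
  obtain a where a: "a \<in> A" "d x a < r" "x \<in> M" using assms unfolding nbhd_iff by blast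
  have "d y a \<le> d y x + d x a" using assms a by (intro triangle) auto
  then show ?thesis using a assms commute[of x y] unfolding nbhd_iff by (intro conjI bexI[of _ a]) auto
qed

section \<open>Limits along an ultrafilter\<close>

locale ultra =
  fixes \<omega> :: "nat filter"
  assumes npu: "nonprincipal_ultrafilter \<omega>"
begin

lemma nontriv[simp]: "\<omega> \<noteq> bot" using npu unfolding nonprincipal_ultrafilter_def by blast

lemma ev_not: "\<not> eventually P \<omega> \<longleftrightarrow> eventually (\<lambda>n. \<not> P n) \<omega>"
proof -
  have "eventually P \<omega> \<or> eventually (\<lambda>n. \<not> P n) \<omega>" using npu unfolding nonprincipal_ultrafilter_def by blast
  moreover have "\<not> (eventually P \<omega> \<and> eventually (\<lambda>n. \<not> P n) \<omega>)"
  proof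
    assume "eventually P \<omega> \<and> eventually (\<lambda>n. \<not> P n) \<omega>"
    then have "eventually (\<lambda>n. P n \<and> \<not> P n) \<omega>" unfolding eventually_conj_iff by blast
    then show False by (simp add: eventually_const)
  qed
  ultimately show ?thesis by blast
qed

text \<open>Non-principality enters here: an ultrafilter that charges the single index
  \<open>k\<close> equals \<open>principal {k}\<close>.\<close>

lemma ev_ge: "eventually (\<lambda>n. k \<le> n) \<omega>"
proof (induction k)
  case (Suc k)
  have "eventually (\<lambda>n. n \<noteq> k) \<omega>"
  proof (rule ccontr)
    assume "\<not> ?thesis"
    then have ev: "eventually (\<lambda>n. n = k) \<omega>" by (simp add: ev_not)
    have "\<omega> = principal {k}"
    proof (rule filter_eq_iff[THEN iffD2], intro allI)
      fix P
      show "eventually P \<omega> \<longleftrightarrow> eventually P (principal {k})"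
      proof
        assume "eventually P \<omega>"
        with ev have "eventually (\<lambda>n. P k) \<omega>" by eventually_elim simp
        then show "eventually P (principal {k})" by (simp add: eventually_principal eventually_const)
      next
        assume "eventually P (principal {k})"
        then show "eventually P \<omega>" using ev by (auto simp: eventually_principal elim: eventually_mono)
      qed
    qed
    then show False using npu unfolding nonprincipal_ultrafilter_def by blast
  qed
  with Suc show ?case by eventually_elim simp
qed simp

lemma ev_choice: "eventually (\<lambda>n. \<exists>y. Q n y) \<omega> \<Longrightarrow> \<exists>f. eventually (\<lambda>n. Q n (f n)) \<omega>"
  by (rule exI[of _ "\<lambda>n. SOME y. Q n y"]) (auto elim!: eventually_mono intro: someI)

text \<open>Countable saturation of ultraproducts, by diagonalization.\<close>

lemma countable_saturation:
  fixes \<Phi> :: "nat \<Rightarrow> nat \<Rightarrow> 'b \<Rightarrow> bool"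
  assumes "\<And>k. eventually (\<lambda>n. \<exists>y. \<forall>j\<le>k. \<Phi> j n y) \<omega>"
  shows "\<exists>f. \<forall>k. eventually (\<lambda>n. \<Phi> k n (f n)) \<omega>"
proof -
  \<comment> \<open>At index \<open>n\<close>, as many initial conditions as possible are solved
    together, with last index at most \<open>n\<close>. By \<open>ev_ge\<close> this bound almost
    surely exceeds any given \<open>k\<close>.\<close>
  define K where "K n = {k. k \<le> n \<and> (\<exists>y. \<forall>j\<le>k. \<Phi> j n y)}" for n
  define f where "f n = (SOME y. \<forall>j\<le>Max (K n). \<Phi> j n y)" for n
  have "eventually (\<lambda>n. \<Phi> k n (f n)) \<omega>" for k
    using assms[of k] ev_ge[of k]
  proof eventually_elim
    case (elim n)
    then have k: "k \<in> K n" unfolding K_def by auto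
    have fin: "finite (K n)" unfolding K_def by (rule finite_subset[of _ "{..n}"]) auto
    have "Max (K n) \<in> K n" using Max_in[OF fin] k by blast
    then have "\<exists>y. \<forall>j\<le>Max (K n). \<Phi> j n y" unfolding K_def by blast
    then have "\<forall>j\<le>Max (K n). \<Phi> j n (f n)" unfolding f_def by (rule someI_ex)
    then show "\<Phi> k n (f n)" using Max_ge[OF fin k] by blast
  qed
  then show ?thesis by blast
qed

text \<open>A compact interval provides a cluster point, and an ultrafilter converges to its cluster
  points.\<close>

lemma bounded_limit:
  fixes f :: "nat \<Rightarrow> real"
  assumes "eventually (\<lambda>n. \<bar>f n\<bar> \<le> B) \<omega>"
  shows "\<exists>r. (f \<longlongrightarrow> r) \<omega>"
proof -
  let ?F = "filtermap f \<omega>"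
  have "compact {-B..B}" by simp
  moreover have "?F \<noteq> bot" by (simp add: filtermap_bot_iff)
  moreover have "eventually (\<lambda>x. x \<in> {-B..B}) ?F"
    using assms by (auto simp: eventually_filtermap elim: eventually_mono)
  ultimately obtain r where r: "inf (nhds r) ?F \<noteq> bot" unfolding compact_filter by blast
  have "(f \<longlongrightarrow> r) \<omega>"
  proof (rule topological_tendstoI)
    fix S assume S: "open S" "r \<in> S"
    show "eventually (\<lambda>n. f n \<in> S) \<omega>"
    proof (rule ccontr)
      assume "\<not> ?thesis"
      then have "eventually (\<lambda>x. x \<notin> S) ?F" by (simp add: ev_not eventually_filtermap)
      moreover have "eventually (\<lambda>x. x \<in> S) (nhds r)" using S eventually_nhds by blast
      ultimately have "eventually (\<lambda>x. False) (inf (nhds r) ?F)" unfolding eventually_inf by blast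
      then show False using r by (simp add: trivial_limit_def)
    qed
  qed
  then show ?thesis by blast
qed

end

section \<open>The cone as a complete metric space\<close>

locale cone_space = Metric_space X d + ultra \<omega>
  for X :: "'a set" and d and \<omega> +
  fixes e :: "nat \<Rightarrow> 'a" and s :: "nat \<Rightarrow> real"
  assumes base: "e n \<in> X" and scale_pos: "0 < s n" and scale_top: "filterlim s at_top \<omega>"
begin

abbreviation V where "V \<equiv> cone_seqs X d \<omega> e s"
abbreviation C where "C \<equiv> cone X d \<omega> e s"
abbreviation D where "D \<equiv> cone_dist X d \<omega> e s"
definition pt where "pt x = cone_rel X d \<omega> e s `` {x}"
abbreviation lims where "lims \<equiv> limit_set X d \<omega> e s"

lemma scale_ge: "eventually (\<lambda>n. B \<le> s n) \<omega>"
  using scale_top unfolding filterlim_at_top by blast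

lemma scale_gr: "eventually (\<lambda>n. B < s n) \<omega>"
  using scale_ge[of "B + 1"] by eventually_elim simp

lemma V_iff: "x \<in> V \<longleftrightarrow> (\<forall>n. x n \<in> X) \<and> (\<exists>B. eventually (\<lambda>n. d (x n) (e n) \<le> B * s n) \<omega>)"
  unfolding cone_seqs_def by (auto simp: pos_divide_le_eq[OF scale_pos])

lemma V_X: "x \<in> V \<Longrightarrow> x n \<in> X" unfolding V_iff by blast

lemma VI: "(\<And>n. x n \<in> X) \<Longrightarrow> eventually (\<lambda>n. d (x n) (e n) \<le> B * s n) \<omega> \<Longrightarrow> x \<in> V"
  unfolding V_iff by blast

lemma base_V: "e \<in> V"
  by (rule VI[where B = 0]) (use base in auto)

lemma V_near:
  assumes x: "x \<in> V" and y: "\<And>n. y n \<in> X" "eventually (\<lambda>n. d (x n) (y n) \<le> B * s n) \<omega>"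
  shows "y \<in> V"
proof -
  obtain B' where B': "eventually (\<lambda>n. d (x n) (e n) \<le> B' * s n) \<omega>" using x unfolding V_iff by blast
  show ?thesis
  proof (rule VI[OF y(1), where B = "B + B'"])
    show "eventually (\<lambda>n. d (y n) (e n) \<le> (B + B') * s n) \<omega>"
      using y(2) B'
    proof eventually_elim
      case (elim n)
      have "d (y n) (e n) \<le> d (y n) (x n) + d (x n) (e n)" using triangle y(1) V_X[OF x] base by blast
      then show ?case using elim commute[of "x n" "y n"] by (simp add: algebra_simps)
    qed
  qed
qed

lemma V_dist_bounded:
  assumes "x \<in> V" "y \<in> V" shows "\<exists>B. eventually (\<lambda>n. d (x n) (y n) \<le> B * s n) \<omega>"
proof -
  obtain B where B: "eventually (\<lambda>n. d (x n) (e n) \<le> B * s n) \<omega>" using assms unfolding V_iff by blast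
  obtain B' where B': "eventually (\<lambda>n. d (y n) (e n) \<le> B' * s n) \<omega>" using assms unfolding V_iff by blast
  have "eventually (\<lambda>n. d (x n) (y n) \<le> (B + B') * s n) \<omega>"
    using B B'
  proof eventually_elim
    case (elim n)
    have "d (x n) (y n) \<le> d (x n) (e n) + d (e n) (y n)" using triangle V_X assms base by blast
    then show ?case using elim commute[of "e n" "y n"] by (simp add: algebra_simps)
  qed
  then show ?thesis by blast
qed

lemma dist_limit:
  assumes "x \<in> V" "y \<in> V" shows "\<exists>r. ((\<lambda>n. d (x n) (y n) / s n) \<longlongrightarrow> r) \<omega>"
proof -
  obtain B where B: "eventually (\<lambda>n. d (x n) (y n) \<le> B * s n) \<omega>" using V_dist_bounded[OF assms] by blast
  show ?thesis
    by (rule bounded_limit[where B = B])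
      (use B in eventually_elim, use scale_pos nonneg in \<open>simp add: pos_divide_le_eq abs_of_nonneg less_imp_le\<close>)
qed

lemma tendsto_triangle:
  assumes x: "x \<in> V" and y: "y \<in> V" and z: "z \<in> V"
    and 1: "((\<lambda>n. d (x n) (y n) / s n) \<longlongrightarrow> a) \<omega>" and 2: "((\<lambda>n. d (y n) (z n) / s n) \<longlongrightarrow> b) \<omega>"
    and 3: "((\<lambda>n. d (x n) (z n) / s n) \<longlongrightarrow> c) \<omega>"
  shows "c \<le> a + b"
proof (rule tendsto_le[OF nontriv tendsto_add[OF 1 2] 3])
  show "eventually (\<lambda>n. d (x n) (z n) / s n \<le> d (x n) (y n) / s n + d (y n) (z n) / s n) \<omega>"
  proof (rule always_eventually, rule allI)
    fix n
    have "d (x n) (z n) \<le> d (x n) (y n) + d (y n) (z n)" using triangle V_X x y z by blast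
    then have "d (x n) (z n) / s n \<le> (d (x n) (y n) + d (y n) (z n)) / s n"
      using scale_pos[of n] by (intro divide_right_mono) auto
    then show "d (x n) (z n) / s n \<le> d (x n) (y n) / s n + d (y n) (z n) / s n"
      by (simp add: add_divide_distrib)
  qed
qed

lemma tendsto_swap: "((\<lambda>n. d (x n) (y n) / s n) \<longlongrightarrow> a) \<omega> \<Longrightarrow> ((\<lambda>n. d (y n) (x n) / s n) \<longlongrightarrow> a) \<omega>"
  by (subst commute)

lemma rel_equiv: "equiv V (cone_rel X d \<omega> e s)"
proof (rule equivI)
  show "cone_rel X d \<omega> e s \<subseteq> V \<times> V" unfolding cone_rel_def by auto
  show "refl_on V (cone_rel X d \<omega> e s)"
    unfolding refl_on_def cone_rel_def using V_X by (auto simp: tendsto_const)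
  show "sym (cone_rel X d \<omega> e s)"
    unfolding sym_def cone_rel_def using tendsto_swap by auto
  show "trans (cone_rel X d \<omega> e s)"
  proof (rule transI)
    fix x y z assume *: "(x, y) \<in> cone_rel X d \<omega> e s" "(y, z) \<in> cone_rel X d \<omega> e s"
    then have V: "x \<in> V" "y \<in> V" "z \<in> V" unfolding cone_rel_def by auto
    obtain c where c: "((\<lambda>n. d (x n) (z n) / s n) \<longlongrightarrow> c) \<omega>" using dist_limit[OF V(1,3)] by blast
    have "c \<le> 0 + 0" by (rule tendsto_triangle[OF V _ _ c]) (use * in \<open>auto simp: cone_rel_def\<close>)
    moreover have "0 \<le> c"
      by (rule tendsto_lowerbound[OF c]) (auto intro!: always_eventually divide_nonneg_pos scale_pos)
    ultimately show "(x, z) \<in> cone_rel X d \<omega> e s" using c V unfolding cone_rel_def by auto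
  qed
qed

lemma pt_in: "x \<in> V \<Longrightarrow> pt x \<in> C"
  unfolding pt_def cone_def by (rule quotientI)

lemma pt_ex: "c \<in> C \<Longrightarrow> \<exists>x\<in>V. c = pt x"
  unfolding cone_def pt_def by (auto elim: quotientE)

lemma pt_mem: "x \<in> V \<Longrightarrow> y \<in> pt x \<longleftrightarrow> y \<in> V \<and> ((\<lambda>n. d (x n) (y n) / s n) \<longlongrightarrow> 0) \<omega>"
  unfolding pt_def cone_rel_def by auto

lemma pt_eq_iff: "x \<in> V \<Longrightarrow> y \<in> V \<Longrightarrow> pt x = pt y \<longleftrightarrow> ((\<lambda>n. d (x n) (y n) / s n) \<longlongrightarrow> 0) \<omega>"
  unfolding pt_def using eq_equiv_class_iff[OF rel_equiv] by (auto simp: cone_rel_def)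

text \<open>The definite description in \<open>cone_dist\<close> is legitimate because other
  representatives have the same limit of rescaled distances.\<close>

lemma D_tendsto:
  assumes x: "x \<in> V" and y: "y \<in> V"
  shows "((\<lambda>n. d (x n) (y n) / s n) \<longlongrightarrow> D (pt x) (pt y)) \<omega>"
proof -
  obtain r where r: "((\<lambda>n. d (x n) (y n) / s n) \<longlongrightarrow> r) \<omega>" using dist_limit[OF assms] by blast
  have all: "((\<lambda>n. d (x' n) (y' n) / s n) \<longlongrightarrow> r) \<omega>" if x': "x' \<in> pt x" and y': "y' \<in> pt y" for x' y'
  proof -
    have V: "x' \<in> V" "y' \<in> V" and lx: "((\<lambda>n. d (x n) (x' n) / s n) \<longlongrightarrow> 0) \<omega>"
      and ly: "((\<lambda>n. d (y n) (y' n) / s n) \<longlongrightarrow> 0) \<omega>" using x' y' pt_mem x y by auto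
    obtain r1 where r1: "((\<lambda>n. d (x' n) (y n) / s n) \<longlongrightarrow> r1) \<omega>" using dist_limit V y by blast
    obtain r2 where r2: "((\<lambda>n. d (x' n) (y' n) / s n) \<longlongrightarrow> r2) \<omega>" using dist_limit V by blast
    have "r \<le> 0 + r1" by (rule tendsto_triangle[OF x V(1) y lx r1 r])
    moreover have "r1 \<le> 0 + r" by (rule tendsto_triangle[OF V(1) x y tendsto_swap[OF lx] r r1])
    moreover have "r1 \<le> r2 + 0" by (rule tendsto_triangle[OF V(1) V(2) y r2 tendsto_swap[OF ly] r1])
    moreover have "r2 \<le> r1 + 0" by (rule tendsto_triangle[OF V(1) y V(2) r1 ly r2])
    ultimately show ?thesis using r2 by simp
  qed
  have self: "x \<in> pt x" "y \<in> pt y" using pt_mem x y V_X[OF x] V_X[OF y] by (auto simp: tendsto_const)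
  have "(THE r. \<forall>x'\<in>pt x. \<forall>y'\<in>pt y. ((\<lambda>n. d (x' n) (y' n) / s n) \<longlongrightarrow> r) \<omega>) = r"
  proof (rule the_equality)
    show "\<forall>x'\<in>pt x. \<forall>y'\<in>pt y. ((\<lambda>n. d (x' n) (y' n) / s n) \<longlongrightarrow> r) \<omega>" using all by blast
    fix r' assume "\<forall>x'\<in>pt x. \<forall>y'\<in>pt y. ((\<lambda>n. d (x' n) (y' n) / s n) \<longlongrightarrow> r') \<omega>"
    then have "((\<lambda>n. d (x n) (y n) / s n) \<longlongrightarrow> r') \<omega>" using self by blast
    then show "r' = r" using tendsto_unique[OF nontriv _ r] by blast
  qed
  then have "D (pt x) (pt y) = r" unfolding cone_dist_def using pt_in x y by simp
  then show ?thesis using r by simp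
qed

lemma D_eqI: "x \<in> V \<Longrightarrow> y \<in> V \<Longrightarrow> ((\<lambda>n. d (x n) (y n) / s n) \<longlongrightarrow> r) \<omega> \<Longrightarrow> D (pt x) (pt y) = r"
  using tendsto_unique[OF nontriv D_tendsto] by blast

lemma D_lessD:
  assumes "D (pt x) (pt y) < r" "x \<in> V" "y \<in> V" shows "eventually (\<lambda>n. d (x n) (y n) < r * s n) \<omega>"
  using order_tendstoD(2)[OF D_tendsto[OF assms(2,3)] assms(1)]
  by eventually_elim (simp add: pos_divide_less_eq[OF scale_pos])

lemma D_greaterD:
  assumes "r < D (pt x) (pt y)" "x \<in> V" "y \<in> V" shows "eventually (\<lambda>n. r * s n < d (x n) (y n)) \<omega>"
  using order_tendstoD(1)[OF D_tendsto[OF assms(2,3)] assms(1)]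
  by eventually_elim (simp add: pos_less_divide_eq[OF scale_pos])

lemma D_leI:
  assumes "eventually (\<lambda>n. d (x n) (y n) \<le> r * s n) \<omega>" "x \<in> V" "y \<in> V" shows "D (pt x) (pt y) \<le> r"
  by (rule tendsto_upperbound[OF D_tendsto[OF assms(2,3)] _ nontriv])
    (use assms(1) in eventually_elim, simp add: pos_divide_le_eq[OF scale_pos])

lemma D_geI:
  assumes "eventually (\<lambda>n. r * s n \<le> d (x n) (y n)) \<omega>" "x \<in> V" "y \<in> V" shows "r \<le> D (pt x) (pt y)"
  by (rule tendsto_lowerbound[OF D_tendsto[OF assms(2,3)] _ nontriv])
    (use assms(1) in eventually_elim, simp add: pos_le_divide_eq[OF scale_pos])

lemma cone_metric: "Metric_space C D"
proof
  fix a b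
  have nn: "0 \<le> D a b" if ab: "a \<in> C" "b \<in> C" for a b
  proof -
    obtain x where "x \<in> V" "a = pt x" using pt_ex[OF ab(1)] by blast
    moreover obtain y where "y \<in> V" "b = pt y" using pt_ex[OF ab(2)] by blast
    ultimately
 show ?thesis using D_geI[of 0 x y] by simp
  qed
  show "0 \<le> D a b" using nn unfolding cone_dist_def by (cases "a \<in> C \<and> b \<in> C") auto
  show "D a b = D b a"
  proof (cases "a \<in> C \<and> b \<in> C")
    case True
    then obtain x where x: "x \<in> V" "a = pt x" using pt_ex by blast
    obtain y where y: "y \<in> V" "b = pt y" using pt_ex True by blast
    note xy = x(1) y(1) x(2) y(2)
    show ?thesis unfolding xy by (rule D_eqI[OF xy(1,2) tendsto_swap[OF D_tendsto[OF xy(2,1)]]])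
  qed (auto simp: cone_dist_def)
next
  fix a b assume ab: "a \<in> C" "b \<in> C"
  then obtain x where x: "x \<in> V" "a = pt x" using pt_ex by blast
  obtain y where y: "y \<in> V" "b = pt y" using pt_ex ab by blast
  note xy = x(1) y(1) x(2) y(2)
  show "D a b = 0 \<longleftrightarrow> a = b"
    unfolding xy pt_eq_iff[OF xy(1,2)] using D_tendsto[OF xy(1,2)] D_eqI[OF xy(1,2)] by metis
next
  fix a b c assume abc: "a \<in> C" "b \<in> C" "c \<in> C"
  obtain x where x: "x \<in> V" "a = pt x" using pt_ex abc(1) by blast
  obtain y where y: "y \<in> V" "b = pt y" using pt_ex abc(2) by blast
  obtain z where z: "z \<in> V" "c = pt z" using pt_ex abc(3) by blast
  note xyz = x(1) y(1) z(1) x(2) y(2) z(2)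
  show "D a c \<le> D a b + D b c"
    unfolding xyz by (rule tendsto_triangle[OF xyz(1-3) D_tendsto D_tendsto D_tendsto]) (use xyz in auto)
qed

lemma pt_eqI:
  assumes x: "x \<in> V" and y: "y \<in> V" and le: "\<And>r. r > 0 \<Longrightarrow> eventually (\<lambda>n. d (x n) (y n) \<le> r * s n) \<omega>"
  shows "pt x = pt y"
proof -
  interpret C: Metric_space C D by (rule cone_metric)
  have "D (pt x) (pt y) \<le> 0 + r" if "r > 0" for r using D_leI[OF le[OF that] x y] by simp
  then have "D (pt x) (pt y) \<le> 0" using field_le_epsilon by blast
  then show ?thesis using C.nonneg[of "pt x" "pt y"] C.zero[OF pt_in[OF x] pt_in[OF y]] by simp
qed

lemma pt_eq_const:
  assumes x: "x \<in> V" and y: "y \<in> V" and le: "eventually (\<lambda>n. d (x n) (y n) \<le> c) \<omega>"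
  shows "pt x = pt y"
proof (rule pt_eqI[OF x y])
  fix r :: real assume "r > 0"
  show "eventually (\<lambda>n. d (x n) (y n) \<le> r * s n) \<omega>"
    using le scale_ge[of "c / r"] by eventually_elim (use \<open>r > 0\<close> in \<open>simp add: field_simps\<close>)
qed

lemma pt_eqD:
  assumes "pt x = pt y" "x \<in> V" "y \<in> V" "r > 0" shows "eventually (\<lambda>n. d (x n) (y n) < r * s n) \<omega>"
proof -
  interpret C: Metric_space C D by (rule cone_metric)
  have "D (pt x) (pt y) = 0" using assms pt_in by simp
  then show ?thesis using D_lessD[of x y r] assms by simp
qed

lemma pt_cong:
  assumes x: "x \<in> V" and y: "\<And>n. y n \<in> X" and eq: "eventually (\<lambda>n. x n = y n) \<omega>"
  shows "y \<in> V" "pt x = pt y"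
proof -
  have z: "eventually (\<lambda>n. d (x n) (y n) \<le> 0) \<omega>" using eq by eventually_elim (use y in simp)
  show "y \<in> V" by (rule V_near[OF x y, where B = 0]) (use z in simp)
  then show "pt x = pt y" using pt_eq_const[OF x _ z] by blast
qed

text \<open>From right to left, saturation yields one sequence of points of \<open>A n\<close> that
  is within every positive multiple of \<open>s n\<close> of \<open>x n\<close>.\<close>

lemma lims_iff:
  assumes x: "x \<in> V" and A: "\<And>n. A n \<subseteq> X"
  shows "pt x \<in> lims A \<longleftrightarrow> (\<forall>r>0. eventually (\<lambda>n. x n \<in> nbhd X d (r * s n) (A n)) \<omega>)"
proof
  assume "pt x \<in> lims A"
  then obtain a where a: "a \<in> V" "eventually (\<lambda>n. a n \<in> A n) \<omega>" "pt x = pt a"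
    unfolding limit_set_def pt_def by blast
  show "\<forall>r>0. eventually (\<lambda>n. x n \<in> nbhd X d (r * s n) (A n)) \<omega>"
  proof (intro allI impI)
    fix r :: real assume "r > 0"
    show "eventually (\<lambda>n. x n \<in> nbhd X d (r * s n) (A n)) \<omega>"
      using pt_eqD[OF a(3) x a(1) \<open>r > 0\<close>] a(2)
      by eventually_elim (use V_X[OF x] in \<open>auto simp: nbhd_iff\<close>)
  qed
next
  assume *: "\<forall>r>0. eventually (\<lambda>n. x n \<in> nbhd X d (r * s n) (A n)) \<omega>"
  have "\<exists>f. \<forall>k. eventually (\<lambda>n. f n \<in> A n \<and> d (x n) (f n) < inverse (real (Suc k)) * s n) \<omega>"
  proof (rule countable_saturation)
    fix k
    have "eventually (\<lambda>n. x n \<in> nbhd X d (inverse (real (Suc k)) * s n) (A n)) \<omega>" using * by simp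
    then show "eventually (\<lambda>n. \<exists>y. \<forall>j\<le>k. y \<in> A n \<and> d (x n) y < inverse (real (Suc j)) * s n) \<omega>"
    proof eventually_elim
      case (elim n)
      then obtain a where a: "a \<in> A n" "d (x n) a < inverse (real (Suc k)) * s n" unfolding nbhd_iff by blast
      have "d (x n) a < inverse (real (Suc j)) * s n" if "j \<le> k" for j
        by (rule less_le_trans[OF a(2)], rule mult_right_mono)
          (use that scale_pos[of n] in \<open>auto intro!: le_imp_inverse_le\<close>)
      then show ?case using a(1) by blast
    qed
  qed
  then obtain f where f: "\<And>k. eventually (\<lambda>n. f n \<in> A n \<and> d (x n) (f n) < inverse (real (Suc k)) * s n) \<omega>" by blast
  \<comment> \<open>The fallback \<open>x n\<close> keeps the sequence in \<open>X\<close> for every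
    \<open>n\<close>; almost surely the value is \<open>f n\<close>.\<close>
  define a where "a n = (if f n \<in> X then f n else x n)" for n
  have aX: "a n \<in> X" for n unfolding a_def using V_X[OF x] by simp
  have af: "eventually (\<lambda>n. a n \<in> A n \<and> d (x n) (a n) < inverse (real (Suc k)) * s n) \<omega>" for k
    using f[of k] by eventually_elim (use A in \<open>auto simp: a_def\<close>)
  have aV: "a \<in> V"
    by (rule V_near[OF x aX, where B = 1]) (use af[of 0] in eventually_elim, simp)
  have "pt x = pt a"
  proof (rule pt_eqI[OF x aV])
    fix r :: real assume "r > 0"
    then obtain k where k: "inverse (real (Suc k)) < r" using reals_Archimedean by blast
    show "eventually (\<lambda>n. d (x n) (a n) \<le> r * s n) \<omega>"
      using af[of k]
    proof eventually_elim
      case (elim n)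
      have "inverse (real (Suc k)) * s n \<le> r * s n" using k scale_pos[of n] by (intro mult_right_mono) auto
      then show ?case using elim by linarith
    qed
  qed
  moreover have "eventually (\<lambda>n. a n \<in> A n) \<omega>" using af[of 0] by eventually_elim simp
  ultimately show "pt x \<in> lims A" unfolding limit_set_def pt_def using aV by blast
qed

lemma lims_constI:
  assumes x: "x \<in> V" and A: "\<And>n. A n \<subseteq> X" and ev: "eventually (\<lambda>n. x n \<in> nbhd X d c (A n)) \<omega>"
  shows "pt x \<in> lims A"
  unfolding lims_iff[OF x A]
proof (intro allI impI)
  fix r :: real assume "r > 0"
  show "eventually (\<lambda>n. x n \<in> nbhd X d (r * s n) (A n)) \<omega>"
    using ev scale_ge[of "c / r"]
    by eventually_elim (rule nbhd_mono, use \<open>r > 0\<close> in \<open>simp_all add: field_simps\<close>)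
qed

lemma lims_subset: "lims A \<subseteq> C"
  unfolding limit_set_def using pt_in unfolding pt_def by blast

lemma lims_sclosed:
  assumes A: "\<And>n. A n \<subseteq> X"
  shows "Metric_space.sclosed C D (lims A)"
proof -
  interpret C: Metric_space C D by (rule cone_metric)
  show ?thesis
    unfolding C.sclosed_def
  proof (intro conjI ballI impI)
    show "lims A \<subseteq> C" by (rule lims_subset)
    fix c assume "c \<in> C" and near: "\<forall>e'>0. \<exists>y\<in>lims A. D c y < e'"
    then obtain x where x: "x \<in> V" "c = pt x" using pt_ex by blast
    show "c \<in> lims A"
      unfolding x lims_iff[OF x(1) A]
    proof (intro allI impI)
      fix r :: real assume r: "r > 0"
      obtain y where y: "y \<in> lims A" "D c y < r / 2" using near r by (meson half_gt_zero)
      then obtain z where z: "z \<in> V" "y = pt z" using pt_ex lims_subset by blast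
      have 1: "eventually (\<lambda>n. z n \<in> nbhd X d (r / 2 * s n) (A n)) \<omega>"
        using y(1)[unfolded z lims_iff[OF z(1) A], rule_format, of "r/2"] r by simp
      have 2: "eventually (\<lambda>n. d (x n) (z n) < r / 2 * s n) \<omega>" using D_lessD[of x z "r/2"] y x z by simp
      show "eventually (\<lambda>n. x n \<in> nbhd X d (r * s n) (A n)) \<omega>"
        using 1 2
      proof eventually_elim
        case (elim n)
        have "x n \<in> nbhd X d (r / 2 * s n + r / 2 * s n) (A n)"
          by (rule nbhd_triangle[OF elim(1)]) (use elim V_X[OF x(1)] A commute in auto)
        then show ?case by simp
      qed
    qed
  qed
qed

text \<open>Saturation provides the limit: one sequence that is, for all \<open>j\<close> at once,
  within \<open>inverse (Suc j)\<close> of the member with index \<open>N j\<close>.\<close>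

lemma cone_complete: "Metric_space.mcomplete C D"
proof -
  interpret C: Metric_space C D by (rule cone_metric)
  show ?thesis
    unfolding C.mcomplete_def
  proof (intro allI impI)
    fix \<sigma> assume \<sigma>: "C.MCauchy \<sigma>"
    then have "\<sigma> k \<in> C" for k unfolding C.MCauchy_def by blast
    then have "\<forall>k. \<exists>x\<in>V. \<sigma> k = pt x" using pt_ex by blast
    then obtain x where x: "\<And>k. x k \<in> V" "\<And>k. \<sigma> k = pt (x k)" by metis
    have "\<forall>j. \<exists>N. \<forall>m m'. N \<le> m \<longrightarrow> N \<le> m' \<longrightarrow> D (\<sigma> m) (\<sigma> m') < inverse (real (Suc j))"
      using \<sigma> unfolding C.MCauchy_def by simp
    then obtain N where N: "\<And>j m m'. N j \<le> m \<Longrightarrow> N j \<le> m' \<Longrightarrow> D (\<sigma> m) (\<sigma> m') < inverse (real (Suc j))" by metis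
    have "\<exists>f. \<forall>j. eventually (\<lambda>n. f n \<in> X \<and> d (x (N j) n) (f n) < inverse (real (Suc j)) * s n) \<omega>"
    proof (rule countable_saturation)
      fix k
      define m where "m = Max (N ` {..k})"
      have m: "N j \<le> m" if "j \<le> k" for j unfolding m_def using that by (intro Max_ge) auto
      have "eventually (\<lambda>n. \<forall>j\<in>{..k}. d (x (N j) n) (x m n) < inverse (real (Suc j)) * s n) \<omega>"
      proof (rule eventually_ball_finite[OF finite_atMost], rule ballI)
        fix j assume "j \<in> {..k}"
        then have "D (\<sigma> (N j)) (\<sigma> m) < inverse (real (Suc j))" using N[of j "N j" m] m by auto
        then show "eventually (\<lambda>n. d (x (N j) n) (x m n) < inverse (real (Suc j)) * s n) \<omega>"
          using D_lessD[of "x (N j)" "x m"] x by simp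
      qed
      then show "eventually (\<lambda>n. \<exists>y. \<forall>j\<le>k. y \<in> X \<and> d (x (N j) n) y < inverse (real (Suc j)) * s n) \<omega>"
        by eventually_elim (use V_X[OF x(1)] in blast)
    qed
    then obtain f where f: "\<And>j. eventually (\<lambda>n. f n \<in> X \<and> d (x (N j) n) (f n) < inverse (real (Suc j)) * s n) \<omega>" by blast
    define y where "y n = (if f n \<in> X then f n else e n)" for n
    have yX: "y n \<in> X" for n unfolding y_def using base by simp
    have y: "eventually (\<lambda>n. d (x (N j) n) (y n) < inverse (real (Suc j)) * s n) \<omega>" for j
      using f[of j] by eventually_elim (simp add: y_def)
    have yV: "y \<in> V"
      by (rule V_near[OF x(1)[of "N 0"] yX, where B = 1]) (use y[of 0] in eventually_elim, simp)
    have lim: "D (\<sigma> (N j)) (pt y) \<le> inverse (real (Suc j))" for j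
      unfolding x(2) by (rule D_leI[OF _ x(1) yV]) (use y[of j] in eventually_elim, simp)
    have "limitin C.mtopology \<sigma> (pt y) sequentially"
      unfolding C.limit_metric_sequentially
    proof (intro conjI allI impI)
      show "pt y \<in> C" by (rule pt_in[OF yV])
      fix \<epsilon> :: real assume "\<epsilon> > 0"
      then obtain j where j: "inverse (real (Suc j)) < \<epsilon> / 2" using reals_Archimedean[of "\<epsilon>/2"] by auto
      have "\<sigma> n \<in> C \<and> D (\<sigma> n) (pt y) < \<epsilon>" if "n \<ge> N j" for n
      proof -
        have "D (\<sigma> n) (pt y) \<le> D (\<sigma> n) (\<sigma> (N j)) + D (\<sigma> (N j)) (pt y)"
          using pt_in x yV by (intro C.triangle) auto
        then show ?thesis using N[of j n "N j"] lim[of j] j that x pt_in by force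
      qed
      then show "\<exists>M. \<forall>n\<ge>M. \<sigma> n \<in> C \<and> D (\<sigma> n) (pt y) < \<epsilon>" by blast
    qed
    then show "\<exists>x. limitin C.mtopology \<sigma> x sequentially" by blast
  qed
qed

end

lemma geodesic_in: "geodesic M d g l \<Longrightarrow> t \<in> {0..l} \<Longrightarrow> g t \<in> M"
  unfolding geodesic_def by blast

lemma geodesic_dist: "geodesic M d g l \<Longrightarrow> s \<in> {0..l} \<Longrightarrow> t \<in> {0..l} \<Longrightarrow> d (g s) (g t) = \<bar>s - t\<bar>"
  unfolding geodesic_def by blast

lemma geodesic_nonneg: "geodesic M d g l \<Longrightarrow> 0 \<le> l"
  unfolding geodesic_def by blast

section \<open>Limit segments and limit sets\<close>

context cone_space
begin

text \<open>Arbitrary parameter sequences are used instead of rescaled times, so the set does not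
  depend on a choice of speed and is easy to cut; \<open>lseg_geodesic\<close> supplies the
  parametrization.\<close>

definition lseg :: "(nat \<Rightarrow> 'a) set set \<Rightarrow> (nat \<Rightarrow> 'a) set \<Rightarrow> (nat \<Rightarrow> 'a) set \<Rightarrow> bool" where
  "lseg S a b \<longleftrightarrow> (\<exists>g l. (\<forall>n. geodesic X d (g n) (l n)) \<and> (\<lambda>n. g n 0) \<in> V \<and> (\<lambda>n. g n (l n)) \<in> V \<and>
     a = pt (\<lambda>n. g n 0) \<and> b = pt (\<lambda>n. g n (l n)) \<and>
     S = {pt (\<lambda>n. g n (\<tau> n)) |\<tau>. \<forall>n. \<tau> n \<in> {0..l n}})"

lemma geo_seq_V:
  assumes g: "\<And>n. geodesic X d (g n) (l n)" and 0: "(\<lambda>n. g n (\<sigma> n)) \<in> V" "\<And>n. \<sigma> n \<in> {0..l n}"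
    and \<tau>: "\<And>n. \<tau> n \<in> {0..l n}" and B: "eventually (\<lambda>n. \<bar>\<sigma> n - \<tau> n\<bar> \<le> B * s n) \<omega>"
  shows "(\<lambda>n. g n (\<tau> n)) \<in> V"
proof (rule V_near[OF 0(1), where B = B])
  show "g n (\<tau> n) \<in> X" for n by (rule geodesic_in[OF g \<tau>])
  show "eventually (\<lambda>n. d (g n (\<sigma> n)) (g n (\<tau> n)) \<le> B * s n) \<omega>"
    using B by eventually_elim (simp add: geodesic_dist[OF g 0(2) \<tau>])
qed

lemma lseg_seq_V:
  assumes g: "\<And>n. geodesic X d (g n) (l n)" and V: "(\<lambda>n. g n 0) \<in> V" "(\<lambda>n. g n (l n)) \<in> V"
    and \<tau>: "\<And>n. \<tau> n \<in> {0..l n}"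
  shows "(\<lambda>n. g n (\<tau> n)) \<in> V"
proof -
  obtain B where B: "eventually (\<lambda>n. d (g n 0) (g n (l n)) \<le> B * s n) \<omega>" using V_dist_bounded[OF V] by blast
  show ?thesis
  proof (rule geo_seq_V[OF g V(1)])
    show "eventually (\<lambda>n. \<bar>0 - \<tau> n\<bar> \<le> B * s n) \<omega>"
      using B
    proof eventually_elim
      case (elim n)
      have "d (g n 0) (g n (l n)) = l n" using geodesic_dist[OF g[of n], of 0 "l n"] geodesic_nonneg[OF g[of n]] by simp
      then show ?case using elim \<tau>[of n] by auto
    qed
    show "0 \<in> {0..l n}" for n using geodesic_nonneg[OF g[of n]] by simp
  qed (rule \<tau>)
qed

lemma geo_seq_D:
  assumes g: "\<And>n. geodesic X d (g n) (l n)" and V: "(\<lambda>n. g n (\<sigma> n)) \<in> V" "(\<lambda>n. g n (\<tau> n)) \<in> V"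
    and \<tau>: "\<And>n. \<sigma> n \<in> {0..l n}" "\<And>n. \<tau> n \<in> {0..l n}"
  shows "((\<lambda>n. \<bar>\<sigma> n - \<tau> n\<bar> / s n) \<longlongrightarrow> D (pt (\<lambda>n. g n (\<sigma> n))) (pt (\<lambda>n. g n (\<tau> n)))) \<omega>"
  using D_tendsto[OF V] by (simp add: geodesic_dist[OF g \<tau>])

lemma lseg_geodesic:
  assumes "lseg S a b"
  shows "\<exists>G L. geodesic C D G L \<and> G 0 = a \<and> G L = b \<and> S = G ` {0..L}"
proof -
  interpret C: Metric_space C D by (rule cone_metric)
  obtain g l where g: "\<And>n. geodesic X d (g n) (l n)" and V: "(\<lambda>n. g n 0) \<in> V" "(\<lambda>n. g n (l n)) \<in> V"
    and ab: "a = pt (\<lambda>n. g n 0)" "b = pt (\<lambda>n. g n (l n))"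
    and S: "S = {pt (\<lambda>n. g n (\<tau> n)) |\<tau>. \<forall>n. \<tau> n \<in> {0..l n}}"
    using assms unfolding lseg_def by blast
  note VV = lseg_seq_V[OF g V]
  have l0: "0 \<le> l n" for n by (rule geodesic_nonneg[OF g])
  define L where "L = D a b"
  have T: "((\<lambda>n. \<tau> n / s n) \<longlongrightarrow> D a (pt (\<lambda>n. g n (\<tau> n)))) \<omega>" if "\<And>n. \<tau> n \<in> {0..l n}" for \<tau>
  proof -
    have "((\<lambda>n. \<bar>0 - \<tau> n\<bar> / s n) \<longlongrightarrow> D a (pt (\<lambda>n. g n (\<tau> n)))) \<omega>"
      unfolding ab by (rule geo_seq_D[OF g V(1) VV[OF that]]) (use l0 that in auto)
    moreover have "\<bar>0 - \<tau> n\<bar> = \<tau> n" for n using that[of n] by auto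
    ultimately show ?thesis by simp
  qed
  have lim_l: "((\<lambda>n. l n / s n) \<longlongrightarrow> L) \<omega>" unfolding L_def ab(2) using T[of l] l0 by simp
  have L0: "0 \<le> L" unfolding L_def by simp
  have Tle: "D a (pt (\<lambda>n. g n (\<tau> n))) \<le> L" if "\<And>n. \<tau> n \<in> {0..l n}" for \<tau>
  proof (rule tendsto_le[OF nontriv lim_l T[OF that]], rule always_eventually, rule allI)
    fix n
    show "\<tau> n / s n \<le> l n / s n" using that[of n] scale_pos[of n] by (intro divide_right_mono) auto
  qed
  show ?thesis
  proof (cases "L = 0")
    case True
    have aC: "a \<in> C" unfolding ab by (rule pt_in[OF V(1)])
    have "pt (\<lambda>n. g n (\<tau> n)) = a" if "\<forall>n. \<tau> n \<in> {0..l n}" for \<tau>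
      using Tle[of \<tau>] that True C.nonneg[of a "pt (\<lambda>n. g n (\<tau> n))"] C.zero[OF aC pt_in[OF VV[of \<tau>]]] by force
    moreover have "a \<in> S" unfolding S ab using l0 by (intro CollectI exI[of _ "\<lambda>_. 0"]) auto
    moreover have "b = a" using True C.zero[OF aC pt_in[OF V(2)]] unfolding L_def ab(2) by simp
    ultimately show ?thesis
      unfolding geodesic_def using aC
      by (intro exI[of _ "\<lambda>_. a"] exI[of _ 0]) (auto simp: S)
  next
    case False
    then have Lp: "L > 0" using L0 by simp
    \<comment> \<open>Parameters proportional to the length; the division by \<open>L\<close> is why
      the collapsed segment was treated apart.\<close>
    define G where "G t = pt (\<lambda>n. g n (t * (l n / L)))" for t
    have rng: "t * (l n / L) \<in> {0..l n}" if "t \<in> {0..L}" for t n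
      using that l0[of n] Lp by (auto simp: field_simps intro: mult_right_mono)
    have DG: "D (G t) (G u) = \<bar>t - u\<bar>" if "t \<in> {0..L}" "u \<in> {0..L}" for t u
    proof -
      have "((\<lambda>n. \<bar>t * (l n / L) - u * (l n / L)\<bar> / s n) \<longlongrightarrow> D (G t) (G u)) \<omega>"
        unfolding G_def by (rule geo_seq_D[OF g]) (use that rng VV in auto)
      moreover have "((\<lambda>n. \<bar>t - u\<bar> * (l n / s n) / L) \<longlongrightarrow> \<bar>t - u\<bar> * L / L) \<omega>"
        by (intro tendsto_intros lim_l) (use Lp in auto)
      moreover have "\<bar>t * (l n / L) - u * (l n / L)\<bar> / s n = \<bar>t - u\<bar> * (l n / s n) / L" for n
      proof -
        have "\<bar>t * (l n / L) - u * (l n / L)\<bar> = \<bar>t - u\<bar> * (l n / L)"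
          using l0[of n] Lp unfolding left_diff_distrib[symmetric] abs_mult by simp
        then show ?thesis by simp
      qed
      ultimately have "((\<lambda>n. \<bar>t - u\<bar> * (l n / s n) / L) \<longlongrightarrow> D (G t) (G u)) \<omega>"
          "((\<lambda>n. \<bar>t - u\<bar> * (l n / s n) / L) \<longlongrightarrow> \<bar>t - u\<bar> * L / L) \<omega>" by (simp_all only:)
      then have "D (G t) (G u) = \<bar>t - u\<bar> * L / L" by (rule tendsto_unique[OF nontriv])
      then show ?thesis using Lp by simp
    qed
    have "geodesic C D G L"
      unfolding geodesic_def using Lp DG pt_in VV rng by (auto simp: G_def)
    moreover have "G 0 = a" "G L = b" unfolding G_def ab using Lp by auto
    moreover have "S = G ` {0..L}"
    proof
      show "G ` {0..L} \<subseteq> S"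
      proof
        fix z assume "z \<in> G ` {0..L}"
        then obtain t where "t \<in> {0..L}" "z = pt (\<lambda>n. g n (t * (l n / L)))" unfolding G_def by blast
        then show "z \<in> S" unfolding S using rng by (intro CollectI exI[of _ "\<lambda>n. t * (l n / L)"]) auto
      qed
      show "S \<subseteq> G ` {0..L}"
      proof
        fix z assume "z \<in> S"
        then obtain \<tau> where \<tau>: "\<And>n. \<tau> n \<in> {0..l n}" "z = pt (\<lambda>n. g n (\<tau> n))" unfolding S by blast
        define t where "t = D a z"
        have t: "t \<in> {0..L}" using Tle[OF \<tau>(1)] unfolding t_def \<tau>(2) by simp
        have "((\<lambda>n. \<bar>\<tau> n - t * (l n / L)\<bar> / s n) \<longlongrightarrow> D z (G t)) \<omega>"
          unfolding G_def \<tau>(2) by (rule geo_seq_D[OF g]) (use t rng VV \<tau> in auto)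
        moreover have "((\<lambda>n. \<bar>\<tau> n / s n - t * (l n / s n) / L\<bar>) \<longlongrightarrow> \<bar>t - t * L / L\<bar>) \<omega>"
          unfolding t_def \<tau>(2) by (intro tendsto_intros lim_l T[OF \<tau>(1)]) (use Lp in auto)
        moreover have "\<bar>\<tau> n - t * (l n / L)\<bar> / s n = \<bar>\<tau> n / s n - t * (l n / s n) / L\<bar>" for n
          using scale_pos[of n] by (simp add: abs_div_pos diff_divide_distrib mult.commute[of L])
        ultimately have "D z (G t) = \<bar>t - t * L / L\<bar>" using tendsto_unique[OF nontriv] by auto
        then have "D z (G t) = 0" using Lp by simp
        then have "z = G t" using C.zero[of z "G t"] pt_in VV \<tau> t rng unfolding G_def by simp
        then show "z \<in> G ` {0..L}" using t by blast
      qed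
    qed
    ultimately show ?thesis by blast
  qed
qed

lemma lseg_sym: "lseg S a b \<Longrightarrow> lseg S b a"
proof -
  assume "lseg S a b"
  then obtain g l where g: "\<And>n. geodesic X d (g n) (l n)" and V: "(\<lambda>n. g n 0) \<in> V" "(\<lambda>n. g n (l n)) \<in> V"
    and ab: "a = pt (\<lambda>n. g n 0)" "b = pt (\<lambda>n. g n (l n))"
    and S: "S = {pt (\<lambda>n. g n (\<tau> n)) |\<tau>. \<forall>n. \<tau> n \<in> {0..l n}}"
    unfolding lseg_def by blast
  have "S = {pt (\<lambda>n. g n (l n - \<tau> n)) |\<tau>. \<forall>n. \<tau> n \<in> {0..l n}}"
  proof (intro equalityI subsetI)
    fix z assume "z \<in> S"
    then obtain \<tau> where \<tau>: "\<forall>n. \<tau> n \<in> {0..l n}" "z = pt (\<lambda>n. g n (\<tau> n))" unfolding S by blast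
    then show "z \<in> {pt (\<lambda>n. g n (l n - \<tau> n)) |\<tau>. \<forall>n. \<tau> n \<in> {0..l n}}"
      by (intro CollectI exI[of _ "\<lambda>n. l n - \<tau> n"]) auto
  next
    fix z assume "z \<in> {pt (\<lambda>n. g n (l n - \<tau> n)) |\<tau>. \<forall>n. \<tau> n \<in> {0..l n}}"
    then obtain \<tau> where \<tau>: "\<forall>n. \<tau> n \<in> {0..l n}" "z = pt (\<lambda>n. g n (l n - \<tau> n))" by blast
    then show "z \<in> S" unfolding S by (intro CollectI exI[of _ "\<lambda>n. l n - \<tau> n"]) auto
  qed
  then show ?thesis
    unfolding lseg_def using geodesic_reverse[OF g] V ab
    by (intro exI[of _ "\<lambda>n t. g n (l n - t)"] exI[of _ l]) auto
qed

lemma lseg_between: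
  assumes g: "\<And>n. geodesic X d (g n) (l n)" and \<alpha>\<beta>: "\<And>n. 0 \<le> \<alpha> n" "\<And>n. \<alpha> n \<le> \<beta> n" "\<And>n. \<beta> n \<le> l n"
    and V: "(\<lambda>n. g n (\<alpha> n)) \<in> V" "(\<lambda>n. g n (\<beta> n)) \<in> V"
  shows "lseg {pt (\<lambda>n. g n (\<tau> n)) |\<tau>. \<forall>n. \<tau> n \<in> {\<alpha> n..\<beta> n}} (pt (\<lambda>n. g n (\<alpha> n))) (pt (\<lambda>n. g n (\<beta> n)))"
proof -
  have e: "{pt (\<lambda>n. g n (\<tau> n)) |\<tau>. \<forall>n. \<tau> n \<in> {\<alpha> n..\<beta> n}} =
    {pt (\<lambda>n. g n (\<alpha> n + \<tau> n)) |\<tau>. \<forall>n. \<tau> n \<in> {0..\<beta> n - \<alpha> n}}"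
  proof (intro equalityI subsetI)
    fix z assume "z \<in> {pt (\<lambda>n. g n (\<tau> n)) |\<tau>. \<forall>n. \<tau> n \<in> {\<alpha> n..\<beta> n}}"
    then obtain \<tau> where "\<forall>n. \<tau> n \<in> {\<alpha> n..\<beta> n}" "z = pt (\<lambda>n. g n (\<tau> n))" by blast
    then show "z \<in> {pt (\<lambda>n. g n (\<alpha> n + \<tau> n)) |\<tau>. \<forall>n. \<tau> n \<in> {0..\<beta> n - \<alpha> n}}"
      by (intro CollectI exI[of _ "\<lambda>n. \<tau> n - \<alpha> n"]) auto
  next
    fix z assume "z \<in> {pt (\<lambda>n. g n (\<alpha> n + \<tau> n)) |\<tau>. \<forall>n. \<tau> n \<in> {0..\<beta> n - \<alpha> n}}"
    then obtain \<tau> where "\<forall>n. \<tau> n \<in> {0..\<beta> n - \<alpha> n}" "z = pt (\<lambda>n. g n (\<alpha> n + \<tau> n))" by blast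
    then show "z \<in> {pt (\<lambda>n. g n (\<tau> n)) |\<tau>. \<forall>n. \<tau> n \<in> {\<alpha> n..\<beta> n}}"
      by (intro CollectI exI[of _ "\<lambda>n. \<alpha> n + \<tau> n"]) (auto simp: le_diff_eq algebra_simps)
  qed
  show ?thesis
    unfolding lseg_def e
    by (intro exI[of _ "\<lambda>n t. g n (\<alpha> n + t)"] exI[of _ "\<lambda>n. \<beta> n - \<alpha> n"] conjI allI geodesic_shift[OF g \<alpha>\<beta>])
      (use V in auto)
qed

lemma lseg_sub:
  assumes S: "lseg S a b" and xy: "x \<in> S" "y \<in> S" and le: "D a x \<le> D a y"
  shows "lseg {z\<in>S. D a x \<le> D a z \<and> D a z \<le> D a y} x y"
proof -
  interpret C: Metric_space C D by (rule cone_metric)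
  obtain g l where g: "\<And>n. geodesic X d (g n) (l n)" and V: "(\<lambda>n. g n 0) \<in> V" "(\<lambda>n. g n (l n)) \<in> V"
    and ab: "a = pt (\<lambda>n. g n 0)" "b = pt (\<lambda>n. g n (l n))"
    and S: "S = {pt (\<lambda>n. g n (\<tau> n)) |\<tau>. \<forall>n. \<tau> n \<in> {0..l n}}"
    using S unfolding lseg_def by blast
  note VV = lseg_seq_V[OF g V]
  have l0: "0 \<le> l n" for n by (rule geodesic_nonneg[OF g])
  have T: "((\<lambda>n. \<tau> n / s n) \<longlongrightarrow> D a (pt (\<lambda>n. g n (\<tau> n)))) \<omega>" if "\<And>n. \<tau> n \<in> {0..l n}" for \<tau>
  proof -
    have "((\<lambda>n. \<bar>0 - \<tau> n\<bar> / s n) \<longlongrightarrow> D a (pt (\<lambda>n. g n (\<tau> n)))) \<omega>"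
      unfolding ab by (rule geo_seq_D[OF g V(1) VV[OF that]]) (use l0 that in auto)
    moreover have "\<bar>0 - \<tau> n\<bar> = \<tau> n" for n using that[of n] by auto
    ultimately show ?thesis by simp
  qed
  obtain \<tau> where \<tau>: "\<And>n. \<tau> n \<in> {0..l n}" "x = pt (\<lambda>n. g n (\<tau> n))" using xy unfolding S by blast
  obtain \<sigma> where \<sigma>: "\<And>n. \<sigma> n \<in> {0..l n}" "y = pt (\<lambda>n. g n (\<sigma> n))" using xy unfolding S by blast
  show ?thesis
  \<comment> \<open>If the distances agree, then \<open>x = y\<close>, represented by constant
    geodesics. Otherwise the parameters are almost surely in the right order.\<close>
  proof (cases "D a x = D a y")
    case True
    have pts: "z = x" if zS: "z \<in> S" and zD: "D a z = D a x" for z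
    proof -
      obtain \<rho> where \<rho>: "\<And>n. \<rho> n \<in> {0..l n}" "z = pt (\<lambda>n. g n (\<rho> n))" using zS unfolding S by blast
      have "((\<lambda>n. \<bar>\<rho> n / s n - \<tau> n / s n\<bar>) \<longlongrightarrow> \<bar>D a z - D a x\<bar>) \<omega>"
        unfolding \<tau>(2) \<rho>(2) by (intro tendsto_intros T \<tau> \<rho>)
      moreover have "((\<lambda>n. \<bar>\<rho> n - \<tau> n\<bar> / s n) \<longlongrightarrow> D z x) \<omega>"
        unfolding \<tau>(2) \<rho>(2) by (rule geo_seq_D[OF g]) (use VV \<tau> \<rho> in auto)
      moreover have "\<bar>\<rho> n - \<tau> n\<bar> / s n = \<bar>\<rho> n / s n - \<tau> n / s n\<bar>" for n
        using scale_pos[of n] by (simp add: abs_div_pos diff_divide_distrib)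
      ultimately have "D z x = \<bar>D a z - D a x\<bar>" using tendsto_unique[OF nontriv] by auto
      then show ?thesis using zD C.zero[of z x] pt_in VV \<rho> \<tau> by simp
    qed
    have "y = x" using pts[OF xy(2)] True by simp
    have "{z\<in>S. D a x \<le> D a z \<and> D a z \<le> D a y} = {x}"
    proof (intro equalityI subsetI)
      fix z assume "z \<in> {z\<in>S. D a x \<le> D a z \<and> D a z \<le> D a y}"
      then have "z \<in> S" "D a z = D a x" using True by auto
      then show "z \<in> {x}" using pts by blast
    qed (use xy True in auto)
    moreover have "lseg {x} x x"
      unfolding lseg_def
    proof (intro exI[of _ "\<lambda>n t. g n (\<tau> n)"] exI[of _ "\<lambda>n. 0"] conjI allI)
      show "geodesic X d (\<lambda>t. g n (\<tau> n)) 0" for n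
        unfolding geodesic_def using geodesic_in[OF g \<tau>(1)] by auto
    qed (use VV \<tau> in auto)
    ultimately show ?thesis using \<open>y = x\<close> by simp
  next
    case False
    then have lt: "D a x < D a y" using le by simp
    have "eventually (\<lambda>n. \<tau> n / s n < \<sigma> n / s n) \<omega>"
    proof -
      define m where "m = (D a x + D a y) / 2"
      have "eventually (\<lambda>n. \<tau> n / s n < m) \<omega>"
        using order_tendstoD(2)[OF T[OF \<tau>(1)], of m] lt unfolding m_def \<tau>(2) by simp
      moreover have "eventually (\<lambda>n. m < \<sigma> n / s n) \<omega>"
        using order_tendstoD(1)[OF T[OF \<sigma>(1)], of m] lt unfolding m_def \<sigma>(2) by simp
      ultimately show ?thesis by eventually_elim linarith
    qed
    then have ev: "eventually (\<lambda>n. \<tau> n < \<sigma> n) \<omega>"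
      by eventually_elim (use scale_pos in \<open>simp add: divide_less_cancel\<close>)
    \<comment> \<open>Minimum and maximum put the parameters in order for every \<open>n\<close>
      without changing the classes.\<close>
    define \<alpha> where "\<alpha> n = min (\<tau> n) (\<sigma> n)" for n
    define \<beta> where "\<beta> n = max (\<tau> n) (\<sigma> n)" for n
    have \<alpha>\<beta>: "0 \<le> \<alpha> n" "\<alpha> n \<le> \<beta> n" "\<beta> n \<le> l n" "\<alpha> n \<in> {0..l n}" "\<beta> n \<in> {0..l n}" for n
      unfolding \<alpha>_def \<beta>_def using \<tau>(1)[of n] \<sigma>(1)[of n] by auto
    have e\<alpha>: "eventually (\<lambda>n. g n (\<tau> n) = g n (\<alpha> n)) \<omega>" using ev by eventually_elim (simp add: \<alpha>_def)
    have e\<beta>: "eventually (\<lambda>n. g n (\<sigma> n) = g n (\<beta> n)) \<omega>" using ev by eventually_elim (simp add: \<beta>_def)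
    have x\<alpha>: "x = pt (\<lambda>n. g n (\<alpha> n))"
      unfolding \<tau>(2) by (rule pt_cong(2)[OF VV[OF \<tau>(1)] geodesic_in[OF g \<alpha>\<beta>(4)] e\<alpha>])
    have y\<beta>: "y = pt (\<lambda>n. g n (\<beta> n))"
      unfolding \<sigma>(2) by (rule pt_cong(2)[OF VV[OF \<sigma>(1)] geodesic_in[OF g \<alpha>\<beta>(5)] e\<beta>])
    have T\<alpha>: "((\<lambda>n. \<alpha> n / s n) \<longlongrightarrow> D a x) \<omega>" unfolding x\<alpha> by (rule T[OF \<alpha>\<beta>(4)])
    have T\<beta>: "((\<lambda>n. \<beta> n / s n) \<longlongrightarrow> D a y) \<omega>" unfolding y\<beta> by (rule T[OF \<alpha>\<beta>(5)])
    have "{z\<in>S. D a x \<le> D a z \<and> D a z \<le> D a y} = {pt (\<lambda>n. g n (\<rho> n)) |\<rho>. \<forall>n. \<rho> n \<in> {\<alpha> n..\<beta> n}}"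
    proof (intro equalityI subsetI)
      fix z assume "z \<in> {pt (\<lambda>n. g n (\<rho> n)) |\<rho>. \<forall>n. \<rho> n \<in> {\<alpha> n..\<beta> n}}"
      then obtain \<rho> where \<rho>: "\<And>n. \<rho> n \<in> {\<alpha> n..\<beta> n}" "z = pt (\<lambda>n. g n (\<rho> n))" by blast
      have \<rho>l: "\<rho> n \<in> {0..l n}" for n using \<rho>(1)[of n] \<alpha>\<beta>[of n] by auto
      have T\<rho>: "((\<lambda>n. \<rho> n / s n) \<longlongrightarrow> D a z) \<omega>" unfolding \<rho>(2) by (rule T[OF \<rho>l])
      have mono: "\<alpha> n / s n \<le> \<rho> n / s n" "\<rho> n / s n \<le> \<beta> n / s n" for n
        using \<rho>(1)[of n] scale_pos[of n] by (auto intro!: divide_right_mono)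
      have "D a x \<le> D a z" "D a z \<le> D a y"
        using tendsto_le[OF nontriv T\<rho> T\<alpha>] tendsto_le[OF nontriv T\<beta> T\<rho>] mono by simp_all
      then show "z \<in> {z\<in>S. D a x \<le> D a z \<and> D a z \<le> D a y}" using \<rho>(2) \<rho>l unfolding S by blast
    next
      fix z assume z: "z \<in> {z\<in>S. D a x \<le> D a z \<and> D a z \<le> D a y}"
      then obtain \<rho> where \<rho>: "\<And>n. \<rho> n \<in> {0..l n}" "z = pt (\<lambda>n. g n (\<rho> n))" unfolding S by blast
      have T\<rho>: "((\<lambda>n. \<rho> n / s n) \<longlongrightarrow> D a z) \<omega>" unfolding \<rho>(2) by (rule T[OF \<rho>(1)])
      \<comment> \<open>Clamping moves the parameter by a vanishing rescaled amount, since the limit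
        parameter already lies between those of the ends.\<close>
      define \<rho>' where "\<rho>' n = max (\<alpha> n) (min (\<rho> n) (\<beta> n))" for n
      have \<rho>': "\<rho>' n \<in> {\<alpha> n..\<beta> n}" "\<rho>' n \<in> {0..l n}" for n
        unfolding \<rho>'_def using \<alpha>\<beta>[of n] by auto
      have "((\<lambda>n. \<bar>\<rho> n - \<rho>' n\<bar> / s n) \<longlongrightarrow> D z (pt (\<lambda>n. g n (\<rho>' n)))) \<omega>"
        unfolding \<rho>(2) by (rule geo_seq_D[OF g]) (use VV \<rho> \<rho>' in auto)
      moreover have "((\<lambda>n. \<bar>\<rho> n / s n - max (\<alpha> n / s n) (min (\<rho> n / s n) (\<beta> n / s n))\<bar>)
        \<longlongrightarrow> \<bar>D a z - max (D a x) (min (D a z) (D a y))\<bar>) \<omega>"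
        by (intro tendsto_intros T\<alpha> T\<beta> T\<rho>)
      moreover have "\<bar>\<rho> n - \<rho>' n\<bar> / s n = \<bar>\<rho> n / s n - max (\<alpha> n / s n) (min (\<rho> n / s n) (\<beta> n / s n))\<bar>" for n
      proof -
        have "max (\<alpha> n / s n) (min (\<rho> n / s n) (\<beta> n / s n)) = \<rho>' n / s n"
          unfolding \<rho>'_def using scale_pos[of n]
          by (auto simp: max_def min_def divide_le_cancel)
        then show ?thesis using scale_pos[of n] by (simp add: abs_div_pos diff_divide_distrib)
      qed
      ultimately have "D z (pt (\<lambda>n. g n (\<rho>' n))) = \<bar>D a z - max (D a x) (min (D a z) (D a y))\<bar>"
        using tendsto_unique[OF nontriv] by auto
      then have "D z (pt (\<lambda>n. g n (\<rho>' n))) = 0" using z by auto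
      then have "z = pt (\<lambda>n. g n (\<rho>' n))" using C.zero[of z] pt_in VV \<rho> \<rho>' by simp
      then show "z \<in> {pt (\<lambda>n. g n (\<rho> n)) |\<rho>. \<forall>n. \<rho> n \<in> {\<alpha> n..\<beta> n}}" using \<rho>' by blast
    qed
    moreover have "lseg {pt (\<lambda>n. g n (\<rho> n)) |\<rho>. \<forall>n. \<rho> n \<in> {\<alpha> n..\<beta> n}} x y"
      unfolding x\<alpha> y\<beta> by (rule lseg_between[OF g \<alpha>\<beta>(1-3)]) (rule VV[OF \<alpha>\<beta>(4)] VV[OF \<alpha>\<beta>(5)])+
    ultimately show ?thesis by simp
  qed
qed

lemma lseg_ex:
  assumes geo: "geodesic_space X d" and x: "x \<in> V" and y: "y \<in> V"
  obtains g l where "\<And>n. geodesic X d (g n) (l n)" "\<And>n. g n 0 = x n" "\<And>n. g n (l n) = y n"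
proof -
  have "\<forall>n. \<exists>p. geodesic X d (fst p) (snd p) \<and> fst p 0 = x n \<and> fst p (snd p) = y n"
    using geo V_X[OF x] V_X[OF y] unfolding geodesic_space_def by simp
  then obtain p where "\<forall>n. geodesic X d (fst (p n)) (snd (p n)) \<and> fst (p n) 0 = x n \<and> fst (p n) (snd (p n)) = y n"
    by metis
  then show ?thesis using that[of "\<lambda>n. fst (p n)" "\<lambda>n. snd (p n)"] by blast
qed

lemma cone_segment_space:
  assumes geo: "geodesic_space X d"
  shows "segment_space C D lseg"
proof -
  interpret C: Metric_space C D by (rule cone_metric)
  show ?thesis
  proof unfold_locales
    fix a b assume ab: "a \<in> C" "b \<in> C"
    obtain x where x: "x \<in> V" "a = pt x" using pt_ex[OF ab(1)] by blast
    obtain y where y: "y \<in> V" "b = pt y" using pt_ex[OF ab(2)] by blast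
    obtain g l where g: "\<And>n. geodesic X d (g n) (l n)" "\<And>n. g n 0 = x n" "\<And>n. g n (l n) = y n"
      using lseg_ex[OF geo x(1) y(1)] by metis
    have "lseg {pt (\<lambda>n. g n (\<tau> n)) |\<tau>. \<forall>n. \<tau> n \<in> {0..l n}} a b"
      unfolding lseg_def by (intro exI[of _ g] exI[of _ l]) (use g x y in auto)
    then show "\<exists>S. lseg S a b" ..
  qed (fact lseg_geodesic lseg_sym lseg_sub)+
qed

lemma lseg_geo_seg: "lseg S a b \<Longrightarrow> geo_seg C D S a b"
  using lseg_geodesic unfolding geo_seg_def by metis

lemma cone_geodesic_space: "geodesic_space X d \<Longrightarrow> geodesic_space C D"
  using segment_space.seg_ex[OF cone_segment_space] lseg_geodesic unfolding geodesic_space_def by metis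

lemma lims_cong:
  assumes "eventually (\<lambda>n. A n = A' n) \<omega>" shows "lims A = lims A'"
proof -
  have "eventually (\<lambda>n. a n \<in> A n) \<omega> \<longleftrightarrow> eventually (\<lambda>n. a n \<in> A' n) \<omega>" for a
    by (rule eventually_cong[OF eventually_mono[OF assms]]) auto
  then show ?thesis unfolding limit_set_def by simp
qed

end

section \<open>Limit sets as a family of pieces\<close>

locale cone_coll = cone_space X d \<omega> e s for X :: "'a set" and d \<omega> e s +
  fixes \<A> :: "'a set set"
  assumes sub: "A \<in> \<A> \<Longrightarrow> A \<subseteq> X"
begin

abbreviation "seqs \<equiv> piece_seqs d \<A> \<omega> e s"
abbreviation "inds \<equiv> piece_indices d \<A> \<omega> e s"
abbreviation "P \<equiv> (\<lambda>c. \<Union>A\<in>c. lims A)"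
definition index_eq where "index_eq = {(A, A'). A \<in> seqs \<and> A' \<in> seqs \<and> (\<forall>\<^sub>F n in \<omega>. A n = A' n)}"

lemma index_eq_equiv: "equiv seqs index_eq"
proof (rule equivI)
  show "index_eq \<subseteq> seqs \<times> seqs" unfolding index_eq_def by blast
  show "refl_on seqs index_eq" unfolding index_eq_def refl_on_def by simp
  show "sym index_eq" unfolding index_eq_def sym_def by (auto elim: eventually_mono)
  show "trans index_eq" unfolding index_eq_def trans_def by (auto elim: eventually_elim2)
qed

lemma inds_eq: "inds = seqs // index_eq" unfolding piece_indices_def index_eq_def by simp

lemma P_class: "A \<in> seqs \<Longrightarrow> P (index_eq `` {A}) = lims A"
proof -
  assume A: "A \<in> seqs"
  have "lims A' = lims A" if "A' \<in> index_eq `` {A}" for A'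
    using that lims_cong[of A A'] unfolding index_eq_def by auto
  moreover have "A \<in> index_eq `` {A}" using A index_eq_equiv by (rule equiv_class_self[rotated])
  ultimately show ?thesis by blast
qed

lemma inds_ex: "c \<in> inds \<Longrightarrow> \<exists>A\<in>seqs. c = index_eq `` {A}"
  unfolding inds_eq by (auto elim: quotientE)

lemma P_image: "P ` inds = lims ` seqs"
proof (intro equalityI subsetI)
  fix Q assume "Q \<in> P ` inds"
  then obtain c where c: "c \<in> inds" "Q = P c" by blast
  then obtain A where A: "A \<in> seqs" "c = index_eq `` {A}" using inds_ex by blast
  then show "Q \<in> lims ` seqs" using P_class c by blast
next
  fix Q assume "Q \<in> lims ` seqs"
  then obtain A where A: "A \<in> seqs" "Q = lims A" by blast
  then have "index_eq `` {A} \<in> inds" unfolding inds_eq by (intro quotientI)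
  then show "Q \<in> P ` inds" using P_class[OF A(1)] A(2) by blast
qed

lemma seqs_coll: "A \<in> seqs \<Longrightarrow> A n \<in> \<A>" unfolding piece_seqs_def by blast

lemma seqs_subset: "A \<in> seqs \<Longrightarrow> A n \<subseteq> X" using seqs_coll sub by blast

text \<open>A point of the limit set bounds the rescaled distance from the base point to
  \<open>A n\<close>.\<close>

lemma seqsI:
  assumes A: "\<And>n. A n \<in> \<A>" and ne: "lims A \<noteq> {}"
  shows "A \<in> seqs"
proof -
  obtain a where a: "a \<in> V" "eventually (\<lambda>n. a n \<in> A n) \<omega>" using ne unfolding limit_set_def by blast
  obtain B where B: "eventually (\<lambda>n. d (a n) (e n) \<le> B * s n) \<omega>" using a(1) unfolding V_iff by blast
  have "eventually (\<lambda>n. set_dist d {e n} (A n) / ennreal (s n) \<le> ennreal B) \<omega>"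
    using a(2) B
  proof eventually_elim
    case (elim n)
    have "set_dist d {e n} (A n) \<le> ennreal (d (e n) (a n))"
      unfolding set_dist_def using elim(1) by (auto intro: INF_lower)
    then have "set_dist d {e n} (A n) / ennreal (s n) \<le> ennreal (d (e n) (a n)) / ennreal (s n)"
      by (rule divide_right_mono_ennreal)
    also have "\<dots> = ennreal (d (e n) (a n) / s n)" by (rule divide_ennreal) (use scale_pos in auto)
    also have "\<dots> \<le> ennreal B"
      using elim(2) commute[of "a n" "e n"] scale_pos[of n] by (intro ennreal_leI) (simp add: pos_divide_le_eq)
    finally show ?case .
  qed
  then show ?thesis unfolding piece_seqs_def using A by blast
qed

lemma piece_in: "(\<And>n. A n \<in> \<A>) \<Longrightarrow> x \<in> lims A \<Longrightarrow> lims A \<in> lims ` seqs"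
  using seqsI[of A] by auto

lemma tree_graded_cone_pieces:
  assumes "tree_graded C D inds P"
  shows "pieces C D (geo_seg C D) (lims ` seqs)"
  using tree_graded_pieces[OF assms] unfolding P_image .

text \<open>(T1) is stated for indices: sharing two points forces equal indices, which are classes
  of sequences up to almost sure equality.\<close>

lemma tree_graded_same:
  assumes tg: "tree_graded C D inds P" and A: "\<And>n. A n \<in> \<A>" "\<And>n. A' n \<in> \<A>"
    and x: "x \<in> lims A" "x \<in> lims A'" and y: "y \<in> lims A" "y \<in> lims A'" and ne: "x \<noteq> y"
  shows "eventually (\<lambda>n. A n = A' n) \<omega>"
proof -
  have "lims A \<noteq> {}" "lims A' \<noteq> {}" using x by auto
  then have s: "A \<in> seqs" "A' \<in> seqs" using seqsI[OF A(1)] seqsI[OF A(2)] by simp_all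
  then have i: "index_eq `` {A} \<in> inds" "index_eq `` {A'} \<in> inds" unfolding inds_eq by (auto intro: quotientI)
  have "\<forall>i\<in>inds. \<forall>j\<in>inds. i \<noteq> j \<longrightarrow> (\<forall>x\<in>P i \<inter> P j. \<forall>y\<in>P i \<inter> P j. x = y)"
    using tg unfolding tree_graded_def by (elim conjE)
  from this[rule_format, OF i, unfolded P_class[OF s(1)] P_class[OF s(2)]]
  have "index_eq `` {A} = index_eq `` {A'}" using x y ne by blast
  then have "(A, A') \<in> index_eq" using eq_equiv_class_iff[OF index_eq_equiv s] by simp
  then show ?thesis unfolding index_eq_def by simp
qed

end

section \<open>Fat hexagons from triangles\<close>

context Metric_space
begin

lemma le_set_dist_iff: "ennreal c \<le> set_dist d S T \<longleftrightarrow> (\<forall>x\<in>S. \<forall>y\<in>T. c \<le> d x y)"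
  unfolding set_dist_def by (simp add: le_INF_iff)

lemma set_diam_le_iff: "0 \<le> c \<Longrightarrow> set_diam d S \<le> ennreal c \<longleftrightarrow> (\<forall>x\<in>S. \<forall>y\<in>S. d x y \<le> c)"
  unfolding set_diam_def by (simp add: SUP_le_iff)

text \<open>On a geodesic, distances to the ends are read off from the parameter, so removing
  neighborhoods of the ends means restricting the parameter.\<close>

lemma fat_polygon_iff:
  "fat_polygon M d \<theta> \<nu> k g l \<longleftrightarrow> geodesic_polygon M d k g l \<and>
     (\<forall>i<k. \<forall>j<k. j \<noteq> i \<longrightarrow> (\<forall>t\<in>{0..l i}. \<forall>u\<in>{0..l j}. 2 * \<theta> \<le> t \<longrightarrow> 2 * \<theta> \<le> l i - t \<longrightarrow> \<theta> \<le> d (g i t) (g j u))) \<and>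
     (\<forall>i<k. \<forall>j<k. j \<noteq> i \<longrightarrow> j \<noteq> Suc i mod k \<longrightarrow> (\<forall>u\<in>{0..l j}. \<nu> * \<theta> \<le> d (g i (l i)) (g j u)))"
proof (cases "geodesic_polygon M d k g l")
  case True
  then have g: "geodesic M d (g i) (l i)" if "i < k" for i using that unfolding geodesic_polygon_def by blast
  have near: "g i t \<in> nbhd M d (2 * \<theta>) {g i 0, g i (l i)} \<longleftrightarrow> t < 2 * \<theta> \<or> l i - t < 2 * \<theta>"
    if "i < k" "t \<in> {0..l i}" for i t
    using that geodesic_in[OF g[OF that(1)] that(2)] geodesic_dist[OF g[OF that(1)] that(2), of 0]
      geodesic_dist[OF g[OF that(1)] that(2), of "l i"]
    unfolding nbhd_iff by auto
  have F1: "ennreal \<theta> \<le> set_dist d (edges g l {i} - nbhd M d (2 * \<theta>) {g i 0, g i (l i)}) (edges g l ({..<k} - {i}))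
    \<longleftrightarrow> (\<forall>j<k. j \<noteq> i \<longrightarrow> (\<forall>t\<in>{0..l i}. \<forall>u\<in>{0..l j}. 2 * \<theta> \<le> t \<longrightarrow> 2 * \<theta> \<le> l i - t \<longrightarrow> \<theta> \<le> d (g i t) (g j u)))"
    (is "_ \<longleftrightarrow> ?R") if "i < k" for i
    unfolding le_set_dist_iff
  proof
    assume *: "\<forall>x\<in>edges g l {i} - nbhd M d (2 * \<theta>) {g i 0, g i (l i)}. \<forall>y\<in>edges g l ({..<k} - {i}). \<theta> \<le> d x y"
    show ?R
    proof (intro allI impI ballI)
      fix j t u assume j: "j < k" "j \<noteq> i" and t: "t \<in> {0..l i}" "2 * \<theta> \<le> t" "2 * \<theta> \<le> l i - t" and u: "u \<in> {0..l j}"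
      have "g i t \<in> edges g l {i} - nbhd M d (2 * \<theta>) {g i 0, g i (l i)}"
        using near[OF that t(1)] t unfolding edges_def by auto
      moreover have "g j u \<in> edges g l ({..<k} - {i})" using j u unfolding edges_def by blast
      ultimately show "\<theta> \<le> d (g i t) (g j u)" using * by blast
    qed
  next
    assume R: ?R
    show "\<forall>x\<in>edges g l {i} - nbhd M d (2 * \<theta>) {g i 0, g i (l i)}. \<forall>y\<in>edges g l ({..<k} - {i}). \<theta> \<le> d x y"
    proof (intro ballI)
      fix x y assume x: "x \<in> edges g l {i} - nbhd M d (2 * \<theta>) {g i 0, g i (l i)}" and y: "y \<in> edges g l ({..<k} - {i})"
      obtain t where t: "t \<in> {0..l i}" "x = g i t" using x unfolding edges_def by auto
      obtain j u where j: "j < k" "j \<noteq> i" "u \<in> {0..l j}" "y = g j u" using y unfolding edges_def by blast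
      have "2 * \<theta> \<le> t" "2 * \<theta> \<le> l i - t" using x t near[OF that t(1)] by auto
      then show "\<theta> \<le> d x y" using R j t by blast
    qed
  qed
  have F2: "ennreal (\<nu> * \<theta>) \<le> set_dist d {g i (l i)} (edges g l ({..<k} - {i, Suc i mod k}))
    \<longleftrightarrow> (\<forall>j<k. j \<noteq> i \<longrightarrow> j \<noteq> Suc i mod k \<longrightarrow> (\<forall>u\<in>{0..l j}. \<nu> * \<theta> \<le> d (g i (l i)) (g j u)))" for i
    unfolding le_set_dist_iff edges_def by auto
  show ?thesis unfolding fat_polygon_def using True F1 F2 by auto
next
  case False
  then show ?thesis unfolding fat_polygon_def by blast
qed

text \<open>Even edges are the truncated sides, odd edges the chords at the corners. A chord
  realizes the distance between its two sides (\<open>C1\<close>), so a point of a side close to a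
  point of the chord is close to their common vertex, as fatness permits. All other pairs of edges
  are far apart.\<close>

lemma triangle_hexagon_fat:
  fixes q h :: "nat \<Rightarrow> real \<Rightarrow> 'a" and l t v \<eta> :: "nat \<Rightarrow> real"
  assumes q: "\<And>k. k < 3 \<Longrightarrow> geodesic M d (q k) (l k)" "\<And>k. k < 3 \<Longrightarrow> 0 \<le> t k" "\<And>k. k < 3 \<Longrightarrow> t k \<le> v k"
      "\<And>k. k < 3 \<Longrightarrow> v k \<le> l k"
    and h: "\<And>k. k < 3 \<Longrightarrow> geodesic M d (h k) (\<eta> k)" "\<And>k. k < 3 \<Longrightarrow> h k 0 = q k (v k)"
      "\<And>k. k < 3 \<Longrightarrow> h k (\<eta> k) = q (Suc k mod 3) (t (Suc k mod 3))"
    and \<theta>: "0 < \<theta>" "8 \<le> \<nu>" and N: "\<And>k. k < 3 \<Longrightarrow> \<nu> * \<theta> \<le> \<eta> k"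
    and C1: "\<And>k \<sigma> \<rho>. k < 3 \<Longrightarrow> \<sigma> \<in> {t k..v k} \<Longrightarrow> \<rho> \<in> {t (Suc k mod 3)..v (Suc k mod 3)} \<Longrightarrow>
      \<eta> k \<le> d (q k \<sigma>) (q (Suc k mod 3) \<rho>)"
    and C2: "\<And>k \<sigma> \<rho>. k < 3 \<Longrightarrow> \<sigma> \<in> {0..\<eta> k} \<Longrightarrow> \<rho> \<in> {t ((k + 2) mod 3)..v ((k + 2) mod 3)} \<Longrightarrow>
      \<nu> * \<theta> \<le> d (h k \<sigma>) (q ((k + 2) mod 3) \<rho>)"
    and C3: "\<And>j k \<sigma> \<rho>. j < 3 \<Longrightarrow> k < 3 \<Longrightarrow> j \<noteq> k \<Longrightarrow> \<sigma> \<in> {0..\<eta> j} \<Longrightarrow> \<rho> \<in> {0..\<eta> k} \<Longrightarrow>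
      \<nu> * \<theta> \<le> d (h j \<sigma>) (h k \<rho>)"
  shows "fat_polygon M d \<theta> \<nu> 6
    (\<lambda>i. if even i then (\<lambda>\<tau>. q (i div 2) (t (i div 2) + \<tau>)) else h (i div 2))
    (\<lambda>i. if even i then v (i div 2) - t (i div 2) else \<eta> (i div 2))"
proof -
  define g where "g i = (if even i then (\<lambda>\<tau>. q (i div 2) (t (i div 2) + \<tau>)) else h (i div 2))" for i
  define L where "L i = (if even i then v (i div 2) - t (i div 2) else \<eta> (i div 2))" for i
  have gL: "g (2 * a) = (\<lambda>\<tau>. q a (t a + \<tau>))" "g (2 * a + 1) = h a" "L (2 * a) = v a - t a" "L (2 * a + 1) = \<eta> a" for a
    unfolding g_def L_def by auto
  have \<theta>\<nu>: "\<theta> \<le> \<nu> * \<theta>" using \<theta> by simp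
  have s3: "Suc a mod 3 < 3" for a by simp
  have suc_mod: "Suc (2 * a) mod 6 = 2 * a + 1" "Suc (2 * a + 1) mod 6 = 2 * (Suc a mod 3)" if "a < 3" for a
    using that unfolding less_3_cases by (elim disjE; simp add: mod_Suc)+
  have split: "\<exists>a<3. i = 2 * a \<or> i = 2 * a + 1" if "i < 6" for i :: nat
    using that by (intro exI[of _ "i div 2"]) auto
  have cyc: "b = Suc a mod 3 \<or> a = Suc b mod 3" if "a < 3" "b < 3" "a \<noteq> b" for a b :: nat
    using that unfolding less_3_cases by (elim disjE; simp add: mod_Suc)
  have cyc3: "b = a \<or> b = Suc a mod 3 \<or> b = (a + 2) mod 3" if "a < 3" "b < 3" for a b :: nat
    using that unfolding less_3_cases by (elim disjE; simp add: mod_Suc)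
  have qM: "q a \<sigma> \<in> M" if "a < 3" "\<sigma> \<in> {t a..v a}" for a \<sigma>
    by (rule geodesic_in[OF q(1)]) (use that q(2,4)[of a] in auto)
  have qd: "d (q a \<sigma>) (q a \<rho>) = \<bar>\<sigma> - \<rho>\<bar>" if "a < 3" "\<sigma> \<in> {t a..v a}" "\<rho> \<in> {t a..v a}" for a \<sigma> \<rho>
    by (rule geodesic_dist[OF q(1)]) (use that q(2,4)[of a] in auto)
  have hM: "h a \<sigma> \<in> M" if "a < 3" "\<sigma> \<in> {0..\<eta> a}" for a \<sigma> using geodesic_in[OF h(1)] that by blast
  have hd: "d (h a \<sigma>) (h a \<rho>) = \<bar>\<sigma> - \<rho>\<bar>" if "a < 3" "\<sigma> \<in> {0..\<eta> a}" "\<rho> \<in> {0..\<eta> a}" for a \<sigma> \<rho>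
    using geodesic_dist[OF h(1)] that by blast
  have \<eta>0: "0 \<le> \<eta> a" if "a < 3" for a using geodesic_nonneg[OF h(1)] that by blast
  have tv: "t a \<in> {t a..v a}" "v a \<in> {t a..v a}" if "a < 3" for a using q(3) that by auto
  have far: "\<nu> * \<theta> \<le> d (q a \<sigma>) (q b \<rho>)" if "a < 3" "b < 3" "a \<noteq> b" "\<sigma> \<in> {t a..v a}" "\<rho> \<in> {t b..v b}" for a b \<sigma> \<rho>
  proof -
    consider "b = Suc a mod 3" | "a = Suc b mod 3" using cyc[OF \<open>a < 3\<close> \<open>b < 3\<close> \<open>a \<noteq> b\<close>] by blast
    then show ?thesis
    proof cases
      case 1 then show ?thesis using C1[OF that(1,4)] N[OF that(1)] that by force
    next
      case 2
      then have "\<eta> b \<le> d (q b \<rho>) (q a \<sigma>)" using C1[OF that(2,5)] that by force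
      then show ?thesis using N[OF that(2)] commute[of "q b \<rho>" "q a \<sigma>"] by linarith
    qed
  qed
  \<comment> \<open>The far end of the chord is at least \<open>\<eta> a\<close> away from the side,
    so a point of the chord within \<open>\<theta>\<close> of it has \<open>u < \<theta>\<close>.
    Going on to the near end adds up to less than \<open>2 * \<theta>\<close>.\<close>
  have cornerL: "\<theta> \<le> d (q a \<sigma>) (h a u) \<or> (v a - \<sigma> < 2 * \<theta> \<and> u < \<theta>)"
    if a: "a < 3" and \<sigma>: "\<sigma> \<in> {t a..v a}" and u: "u \<in> {0..\<eta> a}" for a \<sigma> u
  proof (rule disjCI)
    assume not: "\<not> (v a - \<sigma> < 2 * \<theta> \<and> u < \<theta>)"
    show "\<theta> \<le> d (q a \<sigma>) (h a u)"
    proof (rule ccontr)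
      assume lt: "\<not> ?thesis"
      have "\<eta> a \<le> d (q a \<sigma>) (h a (\<eta> a))" unfolding h(3)[OF a] by (rule C1[OF a \<sigma> tv(1)[OF s3]])
      also have "\<dots> \<le> d (q a \<sigma>) (h a u) + d (h a u) (h a (\<eta> a))"
        using a \<sigma> u \<eta>0 by (intro triangle qM hM) auto
      finally have "u < \<theta>" using hd[OF a u, of "\<eta> a"] lt u \<eta>0[OF a] by auto
      moreover have "d (q a \<sigma>) (h a 0) \<le> d (q a \<sigma>) (h a u) + d (h a u) (h a 0)"
        using a \<sigma> u \<eta>0 by (intro triangle qM hM) auto
      then have "v a - \<sigma> < 2 * \<theta>"
        using lt \<open>u < \<theta>\<close> hd[OF a u, of 0] qd[OF a \<sigma> tv(2)[OF a]] u \<eta>0[OF a] unfolding h(2)[OF a] by auto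
      ultimately show False using not by blast
    qed
  qed
  have cornerR: "\<theta> \<le> d (q b \<sigma>) (h a u) \<or> (\<sigma> - t b < 2 * \<theta> \<and> \<eta> a - u < \<theta>)"
    if a: "a < 3" and b: "b = Suc a mod 3" and \<sigma>: "\<sigma> \<in> {t b..v b}" and u: "u \<in> {0..\<eta> a}" for a b \<sigma> u
  proof (rule disjCI)
    have b3: "b < 3" using b by simp
    assume not: "\<not> (\<sigma> - t b < 2 * \<theta> \<and> \<eta> a - u < \<theta>)"
    show "\<theta> \<le> d (q b \<sigma>) (h a u)"
    proof (rule ccontr)
      assume lt: "\<not> ?thesis"
      have "\<eta> a \<le> d (h a 0) (q b \<sigma>)" unfolding h(2)[OF a] b using C1[OF a tv(2)[OF a]] \<sigma> b by simp
      also have "\<dots> \<le> d (h a 0) (h a u) + d (h a u) (q b \<sigma>)"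
        using a \<sigma> u \<eta>0 b3 by (intro triangle qM hM) auto
      finally have "\<eta> a - u < \<theta>" using hd[OF a _ u, of 0] lt u \<eta>0[OF a] commute[of "h a u" "q b \<sigma>"] by auto
      moreover have "d (q b \<sigma>) (h a (\<eta> a)) \<le> d (q b \<sigma>) (h a u) + d (h a u) (h a (\<eta> a))"
        using a \<sigma> u \<eta>0 b3 by (intro triangle qM hM) auto
      then have "\<sigma> - t b < 2 * \<theta>"
        using lt \<open>\<eta> a - u < \<theta>\<close> hd[OF a u, of "\<eta> a"] qd[OF b3 \<sigma> tv(1)[OF b3]] u \<eta>0[OF a]
        unfolding h(3)[OF a] b[symmetric] by auto
      ultimately show False using not by blast
    qed
  qed
  have "fat_polygon M d \<theta> \<nu> 6 g L"
    unfolding fat_polygon_iff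
  proof (intro conjI allI impI ballI)
    show "geodesic_polygon M d 6 g L"
      unfolding geodesic_polygon_def
    proof (intro allI impI)
      fix i :: nat assume "i < 6"
      then obtain a where a: "a < 3" "i = 2 * a \<or> i = 2 * a + 1" using split by blast
      from a(2) show "geodesic M d (g i) (L i) \<and> g i (L i) = g (Suc i mod 6) 0"
      proof
        assume i: "i = 2 * a"
        show ?thesis
          unfolding i suc_mod[OF a(1)] gL using geodesic_shift[OF q(1)[OF a(1)], of "t a" "v a"] q[OF a(1)] h[OF a(1)] by auto
      next
        assume i: "i = 2 * a + 1"
        show ?thesis unfolding i suc_mod[OF a(1)] gL using h[OF a(1)] by auto
      qed
    qed
  next
    fix i j :: nat and \<tau> u
    assume i: "i < 6" and j: "j < 6" and ne: "j \<noteq> i" and \<tau>: "\<tau> \<in> {0..L i}" and u: "u \<in> {0..L j}"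
      and in1: "2 * \<theta> \<le> \<tau>" and in2: "2 * \<theta> \<le> L i - \<tau>"
    obtain a where a: "a < 3" "i = 2 * a \<or> i = 2 * a + 1" using split[OF i] by blast
    obtain b where b: "b < 3" "j = 2 * b \<or> j = 2 * b + 1" using split[OF j] by blast
    show "\<theta> \<le> d (g i \<tau>) (g j u)"
    proof (cases "i = 2 * a")
      case True
      have \<tau>': "t a + \<tau> \<in> {t a..v a}" using \<tau> unfolding True gL by auto
      show ?thesis
      proof (cases "j = 2 * b")
        case jb: True
        have "u + t b \<in> {t b..v b}" using u unfolding jb gL by auto
        then show ?thesis using far[OF a(1) b(1) _ \<tau>', of "u + t b"] ne True jb \<theta>\<nu> unfolding True jb gL
          by (auto simp: add.commute)
      next
        case False
        then have jb: "j = 2 * b + 1" using b by blast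
        have u': "u \<in> {0..\<eta> b}" using u unfolding jb gL by auto
        consider "a = b" | "a = Suc b mod 3" | "a = (b + 2) mod 3" using cyc3[OF b(1) a(1)] by blast
        then show ?thesis
        proof cases
          case 1
          then show ?thesis using cornerL[OF a(1) \<tau>', of u] u' in2 unfolding True jb gL by auto
        next
          case 2
          then show ?thesis using cornerR[OF b(1) 2 \<tau>' u'] in1 unfolding True jb gL by auto
        next
          case 3
          then show ?thesis using C2[OF b(1) u', of "t a + \<tau>"] \<tau>' \<theta>\<nu> commute unfolding True jb gL by force
        qed
      qed
    next
      case False
      then have ia: "i = 2 * a + 1" using a by blast
      have \<tau>': "\<tau> \<in> {0..\<eta> a}" using \<tau> unfolding ia gL by auto
      have in': "2 * \<theta> \<le> \<eta> a - \<tau>" using in2 unfolding ia gL .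
      show ?thesis
      proof (cases "j = 2 * b")
        case jb: True
        have u': "t b + u \<in> {t b..v b}" using u unfolding jb gL by auto
        consider "b = a" | "b = Suc a mod 3" | "b = (a + 2) mod 3" using cyc3[OF a(1) b(1)] by blast
        then have "\<theta> \<le> d (h a \<tau>) (q b (t b + u))"
        proof cases
          case 1
          then show ?thesis using cornerL[OF a(1) _ \<tau>', of "t b + u"] u' in1 commute[of "h a \<tau>"] \<theta> by auto
        next
          case 2
          then show ?thesis using cornerR[OF a(1) 2 u' \<tau>'] in' commute[of "h a \<tau>"] \<theta> by auto
        next
          case 3
          then show ?thesis using C2[OF a(1) \<tau>', of "t b + u"] u' \<theta>\<nu> by auto
        qed
        then show ?thesis unfolding ia jb gL .
      next
        case False
        then have jb: "j = 2 * b + 1" using b by blast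
        have "u \<in> {0..\<eta> b}" using u unfolding jb gL by auto
        then show ?thesis using C3[OF a(1) b(1) _ \<tau>', of u] ne \<theta>\<nu> unfolding ia jb gL by auto
      qed
    qed
  next
    fix i j :: nat and u
    assume i: "i < 6" and j: "j < 6" and ne: "j \<noteq> i" "j \<noteq> Suc i mod 6" and u: "u \<in> {0..L j}"
    obtain a where a: "a < 3" "i = 2 * a \<or> i = 2 * a + 1" using split[OF i] by blast
    obtain b where b: "b < 3" "j = 2 * b \<or> j = 2 * b + 1" using split[OF j] by blast
    show "\<nu> * \<theta> \<le> d (g i (L i)) (g j u)"
    proof (cases "i = 2 * a")
      case True
      have e: "g i (L i) = q a (v a)" "g i (L i) = h a 0" unfolding True gL using h(2)[OF a(1)] by auto
      have ba: "b \<noteq> a" using ne b(2) unfolding True suc_mod[OF a(1)] by auto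
      show ?thesis
      proof (cases "j = 2 * b")
        case jb: True
        have "t b + u \<in> {t b..v b}" using u unfolding jb gL by auto
        then show ?thesis using far[OF a(1) b(1) _ tv(2)[OF a(1)]] ba unfolding e(1) unfolding jb gL by auto
      next
        case False
        then have jb: "j = 2 * b + 1" using b by blast
        have "u \<in> {0..\<eta> b}" using u unfolding jb gL by auto
        then show ?thesis using C3[OF a(1) b(1), of 0 u] \<eta>0[OF a(1)] ba unfolding e(2) unfolding jb gL by auto
      qed
    next
      case False
      then have ia: "i = 2 * a + 1" using a by blast
      have e: "g i (L i) = h a (\<eta> a)" "g i (L i) = q (Suc a mod 3) (t (Suc a mod 3))" unfolding ia gL using h(3)[OF a(1)] by auto
      show ?thesis
      proof (cases "j = 2 * b")
        case jb: True
        then have "b \<noteq> Suc a mod 3" using ne(2) suc_mod(2)[OF a(1)] ia by simp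
        moreover have "t b + u \<in> {t b..v b}" using u unfolding jb gL by auto
        ultimately show ?thesis using far[OF s3 b(1) _ tv(1)[OF s3], of a "t b + u"] unfolding e(2) unfolding jb gL by auto
      next
        case False
        then have jb: "j = 2 * b + 1" using b by blast
        then have "b \<noteq> a" using ne(1) ia by simp
        moreover have "u \<in> {0..\<eta> b}" using u unfolding jb gL by auto
        ultimately show ?thesis using C3[OF a(1) b(1), of "\<eta> a" u] \<eta>0[OF a(1)] unfolding e(1) unfolding jb gL by auto
      qed
    qed
  qed
  then show ?thesis unfolding g_def L_def .
qed

text \<open>The chord has to be shortest between the remaining parts and at least \<open>N\<close>
  long. If the sides come as close as \<open>N\<close>, they are cut at the last such place of
  \<open>q\<close>, where the distance to \<open>q'\<close> is exactly \<open>N\<close>; if not, at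
  their closest points.\<close>

lemma corner_truncation:
  assumes q: "geodesic M d q l" and q': "geodesic M d q' l'"
    and far: "\<And>u. u \<in> {0..l'} \<Longrightarrow> N \<le> d (q l) (q' u)"
  shows "\<exists>t\<in>{0..l}. \<exists>t'\<in>{0..l'}. N \<le> d (q t) (q' t') \<and> d (q t) (q' t') \<le> max N (d (q 0) (q' 0)) \<and>
    (\<forall>u\<in>{t..l}. \<forall>u'\<in>{t'..l'}. d (q t) (q' t') \<le> d (q u) (q' u'))"
proof -
  have l0: "0 \<le> l" "0 \<le> l'" using geodesic_nonneg q q' by auto
  define B where "B = {0..l} \<times> {0..l'}"
  have "compact B" unfolding B_def by (intro compact_Times compact_Icc)
  define f where "f p = d (q (fst p)) (q' (snd p))" for p :: "real \<times> real"
  have lip: "f p \<le> f p' + \<bar>fst p - fst p'\<bar> + \<bar>snd p - snd p'\<bar>" if "p \<in> B" "p' \<in> B" for p p'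
  proof -
    have r: "fst p \<in> {0..l}" "fst p' \<in> {0..l}" "snd p \<in> {0..l'}" "snd p' \<in> {0..l'}" using that unfolding B_def by auto
    have m: "q (fst p) \<in> M" "q (fst p') \<in> M" "q' (snd p) \<in> M" "q' (snd p') \<in> M" using geodesic_in q q' r by blast+
    have "f p \<le> d (q (fst p)) (q (fst p')) + d (q (fst p')) (q' (snd p))" unfolding f_def using m by (intro triangle)
    also have "d (q (fst p')) (q' (snd p)) \<le> f p' + d (q' (snd p')) (q' (snd p))" unfolding f_def using m by (intro triangle)
    finally show ?thesis using geodesic_dist[OF q r(1,2)] geodesic_dist[OF q' r(4,3)] by linarith
  qed
  have "2-lipschitz_on B f"
  proof (rule lipschitz_onI)
    fix p p' assume *: "p \<in> B" "p' \<in> B"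
    have "\<bar>fst p - fst p'\<bar> \<le> dist p p'" "\<bar>snd p - snd p'\<bar> \<le> dist p p'"
      using dist_fst_le[of p p'] dist_snd_le[of p p'] by (auto simp: dist_real_def)
    then show "dist (f p) (f p') \<le> 2 * dist p p'"
      using lip[OF *] lip[OF *(2,1)] by (auto simp: dist_real_def)
  qed simp
  then have cont: "continuous_on B f" by (rule lipschitz_on_continuous_on)
  show ?thesis
  proof (cases "\<exists>p\<in>B. f p \<le> N")
    case True
    define K where "K = {p\<in>B. f p \<le> N}"
    have "closedin (top_of_set B) K"
      unfolding K_def using continuous_closedin_preimage[OF cont, of "{..N}"] by (simp add: vimage_def Int_def)
    then have "compact K" using \<open>compact B\<close> closedin_compact by blast
    moreover have "K \<noteq> {}" using True unfolding K_def by blast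
    ultimately obtain p where p: "p \<in> K" "\<forall>p'\<in>K. fst p' \<le> fst p"
      using continuous_attains_sup[of K fst] continuous_on_fst[OF continuous_on_id, of K] by blast
    define t where "t = fst p"
    have t: "t \<in> {0..l}" "snd p \<in> {0..l'}" using p unfolding K_def B_def t_def by auto
    have ge: "N \<le> d (q t) (q' u)" if u: "u \<in> {0..l'}" for u
    proof (rule ccontr)
      assume lt: "\<not> ?thesis"
      then have "t \<noteq> l" using far[OF u] by auto
      then have "t < l" using t by auto
      \<comment> \<open>The distance changes at most as fast as the parameter, so a distance below
        \<open>N\<close> at \<open>t\<close> would still be at most \<open>N\<close> at
        \<open>t + h\<close>, against the choice of the last place.\<close>
      define h where "h = min (l - t) (N - d (q t) (q' u))"
      have h: "h > 0" "t + h \<in> {0..l}" using \<open>t < l\<close> lt t unfolding h_def by auto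
      have "f (t + h, u) \<le> f (t, u) + h" using lip[of "(t+h,u)" "(t,u)"] h u t unfolding B_def by auto
      then have "f (t + h, u) \<le> N" unfolding f_def h_def by auto
      then have "(t + h, u) \<in> K" unfolding K_def B_def using h u by auto
      then show False using p(2) h(1) unfolding t_def by force
    qed
    have "f p = N" using ge[OF t(2)] p(1) unfolding f_def t_def K_def by auto
    then have eq: "d (q t) (q' (snd p)) = N" unfolding f_def t_def .
    show ?thesis
    proof (rule bexI[OF _ t(1)], rule bexI[OF _ t(2)], unfold eq, intro conjI ballI)
      fix u u' assume u: "u \<in> {t..l}" "u' \<in> {snd p..l'}"
      show "N \<le> d (q u) (q' u')"
      proof (cases "u = t")
        case True then show ?thesis using ge u t by auto
      next
        case False
        then have "(u, u') \<notin> K" using p(2) u unfolding t_def by force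
        then show ?thesis using u t unfolding K_def B_def f_def by auto
      qed
    qed auto
  next
    case False
    have "B \<noteq> {}" unfolding B_def using l0 by auto
    then obtain p where p: "p \<in> B" "\<forall>p'\<in>B. f p \<le> f p'"
      using continuous_attains_inf[OF \<open>compact B\<close> _ cont] by blast
    show ?thesis
    proof (rule bexI[of _ "fst p"], rule bexI[of _ "snd p"], intro conjI ballI)
      show "N \<le> d (q (fst p)) (q' (snd p))" using False p(1) unfolding f_def by force
      have "(0, 0) \<in> B" using l0 unfolding B_def by auto
      then show "d (q (fst p)) (q' (snd p)) \<le> max N (d (q 0) (q' 0))" using p(2) unfolding f_def by force
      fix u u' assume "u \<in> {fst p..l}" "u' \<in> {snd p..l'}"
      then have "(u, u') \<in> B" using p(1) unfolding B_def by auto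
      then show "d (q (fst p)) (q' (snd p)) \<le> d (q u) (q' u')" using p(2) unfolding f_def by force
    qed (use p(1) in \<open>auto simp: B_def\<close>)
  qed
qed

end

section \<open>Tree-graded cones\<close>

context cone_space
begin

text \<open>Points at distance below the constant \<open>N\<close> have the same limit, which would
  be common to \<open>SU\<close> and \<open>SW\<close>.\<close>

lemma disjoint_limits_separate:
  assumes ne: "\<And>n. U n \<noteq> {}" "\<And>n. W n \<noteq> {}"
    and U: "\<And>u. (\<And>n. u n \<in> U n) \<Longrightarrow> u \<in> V \<and> pt u \<in> SU" and W: "\<And>w. (\<And>n. w n \<in> W n) \<Longrightarrow> w \<in> V \<and> pt w \<in> SW"
    and disj: "SU \<inter> SW = {}"
  shows "eventually (\<lambda>n. \<forall>u\<in>U n. \<forall>w\<in>W n. N \<le> d u w) \<omega>"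
proof (rule ccontr)
  assume "\<not> ?thesis"
  then have "eventually (\<lambda>n. \<exists>p. fst p \<in> U n \<and> snd p \<in> W n \<and> d (fst p) (snd p) < N) \<omega>"
    unfolding ev_not by eventually_elim (auto simp: not_le)
  then obtain p where p: "eventually (\<lambda>n. fst (p n) \<in> U n \<and> snd (p n) \<in> W n \<and> d (fst (p n)) (snd (p n)) < N) \<omega>"
    using ev_choice[of "\<lambda>n p. fst p \<in> U n \<and> snd p \<in> W n \<and> d (fst p) (snd p) < N"] by blast
  define u where "u n = (if fst (p n) \<in> U n then fst (p n) else (SOME x. x \<in> U n))" for n
  define w where "w n = (if snd (p n) \<in> W n then snd (p n) else (SOME x. x \<in> W n))" for n
  have "u n \<in> U n" "w n \<in> W n" for n
    unfolding u_def w_def using ne some_in_eq by auto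
  then have uw: "u \<in> V" "pt u \<in> SU" "w \<in> V" "pt w \<in> SW" using U W by blast+
  have "eventually (\<lambda>n. d (u n) (w n) \<le> N) \<omega>"
    using p by eventually_elim (simp add: u_def w_def)
  then have "pt u = pt w" using pt_eq_const uw by blast
  then show False using uw disj by auto
qed

end

context cone_coll
begin

text \<open>Two common limit points are joined by geodesics longer than
  \<open>\<delta> * s n\<close> with both ends close to both members. By
  \<open>(\<beta>\<^sub>2)\<close> the middle thirds are in both neighborhoods, and their lengths
  outgrow the bound of \<open>(\<alpha>\<^sub>1)\<close>.\<close>

lemma lims_meet:
  assumes geo: "geodesic_space X d"
    and \<alpha>1: "\<forall>\<delta>>0. \<exists>D0::real. \<forall>A\<in>\<A>. \<forall>A'\<in>\<A>. A \<noteq> A' \<longrightarrow> set_diam d (nbhd X d \<delta> A \<inter> nbhd X d \<delta> A') \<le> ennreal D0"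
    and \<epsilon>: "\<epsilon> > 0" and M: "M \<ge> 0"
    and \<beta>2: "\<forall>g l. \<forall>A\<in>\<A>. geodesic X d g l \<and> g 0 \<in> nbhd X d (\<epsilon> * l) A \<and> g l \<in> nbhd X d (\<epsilon> * l) A \<longrightarrow>
       g ` {l / 3..2 * l / 3} \<subseteq> nbhd X d M A"
    and A: "\<And>n. A n \<in> \<A>" "\<And>n. A' n \<in> \<A>"
    and x: "x \<in> lims A \<inter> lims A'" and y: "y \<in> lims A \<inter> lims A'" and ne: "x \<noteq> y"
  shows "eventually (\<lambda>n. A n = A' n) \<omega>"
proof (rule ccontr)
  assume "\<not> ?thesis"
  then have diff: "eventually (\<lambda>n. A n \<noteq> A' n) \<omega>" by (simp add: ev_not)
  interpret C: Metric_space C D by (rule cone_metric)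
  have AX: "A n \<subseteq> X" "A' n \<subseteq> X" for n using A sub by auto
  have xC: "x \<in> C" "y \<in> C" using x y lims_subset by blast+
  obtain u where u: "u \<in> V" "x = pt u" using pt_ex[OF xC(1)] by blast
  obtain v where v: "v \<in> V" "y = pt v" using pt_ex[OF xC(2)] by blast
  obtain g l where g: "\<And>n. geodesic X d (g n) (l n)" "\<And>n. g n 0 = u n" "\<And>n. g n (l n) = v n"
    using lseg_ex[OF geo u(1) v(1)] by metis
  have l: "l n = d (u n) (v n)" for n
    using geodesic_dist[OF g(1)[of n], of 0 "l n"] geodesic_nonneg[OF g(1)[of n]] g(2,3) by simp
  define \<delta> where "\<delta> = D x y / 2"
  have \<delta>: "\<delta> > 0" "\<delta> < D x y" using ne xC C.nonneg[of x y] C.zero[OF xC] unfolding \<delta>_def by linarith+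
  have big: "eventually (\<lambda>n. \<delta> * s n < l n) \<omega>"
    using D_greaterD[of \<delta> u v] \<delta> u v unfolding l by simp
  have \<epsilon>\<delta>: "\<epsilon> * \<delta> > 0" using \<epsilon> \<delta> by simp
  have near: "eventually (\<lambda>n. u n \<in> nbhd X d (\<epsilon> * \<delta> * s n) (B n)) \<omega>" "eventually (\<lambda>n. v n \<in> nbhd X d (\<epsilon> * \<delta> * s n) (B n)) \<omega>"
    if "B = A \<or> B = A'" for B
  proof -
    have BX: "B n \<subseteq> X" for n using that AX by blast
    have "pt u \<in> lims B" "pt v \<in> lims B" using that x y u v by auto
    then show "eventually (\<lambda>n. u n \<in> nbhd X d (\<epsilon> * \<delta> * s n) (B n)) \<omega>" "eventually (\<lambda>n. v n \<in> nbhd X d (\<epsilon> * \<delta> * s n) (B n)) \<omega>"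
      using lims_iff[where A = B, OF u(1) BX] lims_iff[where A = B, OF v(1) BX] \<epsilon>\<delta> by blast+
  qed
  \<comment> \<open>\<open>M\<close> may be 0, whereas \<open>(\<alpha>\<^sub>1)\<close> needs a
    positive radius.\<close>
  obtain D0 where D0: "\<forall>A\<in>\<A>. \<forall>A'\<in>\<A>. A \<noteq> A' \<longrightarrow> set_diam d (nbhd X d (M+1) A \<inter> nbhd X d (M+1) A') \<le> ennreal D0"
    using \<alpha>1 M by (meson add_nonneg_pos zero_less_one)
  have third: "g n ` {l n / 3..2 * l n / 3} \<subseteq> nbhd X d (M+1) B"
    if "B \<in> \<A>" "\<delta> * s n < l n" "u n \<in> nbhd X d (\<epsilon> * \<delta> * s n) B" "v n \<in> nbhd X d (\<epsilon> * \<delta> * s n) B" for n B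
  proof -
    have "\<epsilon> * \<delta> * s n \<le> \<epsilon> * l n" using that(2) \<epsilon> by simp
    then have "g n 0 \<in> nbhd X d (\<epsilon> * l n) B" "g n (l n) \<in> nbhd X d (\<epsilon> * l n) B"
      unfolding g(2,3) using that nbhd_mono by blast+
    then have *: "g n ` {l n / 3..2 * l n / 3} \<subseteq> nbhd X d M B" using \<beta>2 g(1) that(1) by blast
    have "nbhd X d M B \<subseteq> nbhd X d (M+1) B" using nbhd_mono[of M "M+1"] by auto
    then show ?thesis using * by blast
  qed
  have "eventually (\<lambda>n. l n / 3 \<le> max 0 D0) \<omega>"
    using diff big near[OF disjI1[OF refl]] near[OF disjI2[OF refl]]
  proof eventually_elim
    case (elim n)
    have l0: "0 \<le> l n" unfolding l by simp
    have "g n (l n / 3) \<in> nbhd X d (M+1) B" "g n (2 * l n / 3) \<in> nbhd X d (M+1) B" if "B = A n \<or> B = A' n" for B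
    proof -
      have m: "l n / 3 \<in> {l n / 3..2 * l n / 3}" "2 * l n / 3 \<in> {l n / 3..2 * l n / 3}" using l0 by simp_all
      have "g n ` {l n / 3..2 * l n / 3} \<subseteq> nbhd X d (M+1) B"
        using that
      proof
        assume B: "B = A n" show ?thesis unfolding B by (rule third[OF A(1) elim(2,3,4)])
      next
        assume B: "B = A' n" show ?thesis unfolding B by (rule third[OF A(2) elim(2,5,6)])
      qed
      then show "g n (l n / 3) \<in> nbhd X d (M+1) B" "g n (2 * l n / 3) \<in> nbhd X d (M+1) B" using m by blast+
    qed
    then have "g n (l n / 3) \<in> nbhd X d (M+1) (A n) \<inter> nbhd X d (M+1) (A' n)"
      "g n (2 * l n / 3) \<in> nbhd X d (M+1) (A n) \<inter> nbhd X d (M+1) (A' n)" by auto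
    moreover have "set_diam d (nbhd X d (M+1) (A n) \<inter> nbhd X d (M+1) (A' n)) \<le> ennreal (max 0 D0)"
      using D0[rule_format, OF A(1) A(2) elim(1)] by (rule order_trans) (simp add: ennreal_leI)
    ultimately have "d (g n (l n / 3)) (g n (2 * l n / 3)) \<le> max 0 D0"
      using set_diam_le_iff[of "max 0 D0"] by auto
    moreover have "d (g n (l n / 3)) (g n (2 * l n / 3)) = l n / 3"
      using geodesic_dist[OF g(1)[of n], of "l n / 3" "2 * l n / 3"] l0 by (simp add: field_simps)
    ultimately show ?case by simp
  qed
  moreover have "eventually (\<lambda>n. 3 * max 0 D0 < \<delta> * s n) \<omega>"
    using scale_gr[of "3 * max 0 D0 / \<delta>"] by eventually_elim (use \<delta> in \<open>simp add: field_simps\<close>)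
  ultimately have "eventually (\<lambda>n. False) \<omega>" using big by eventually_elim linarith
  then show False by simp
qed

text \<open>The midpoint of an excursion is a limit of midpoints of geodesics, which
  \<open>(\<beta>\<^sub>2)\<close> keeps within \<open>M\<close> of \<open>A n\<close>. So it would
  be in the limit set without being an end of the excursion.\<close>

lemma lims_convex:
  assumes geo: "geodesic_space X d" and \<epsilon>: "\<epsilon> > 0"
    and \<beta>2: "\<forall>g l. \<forall>A\<in>\<A>. geodesic X d g l \<and> g 0 \<in> nbhd X d (\<epsilon> * l) A \<and> g l \<in> nbhd X d (\<epsilon> * l) A \<longrightarrow>
       g ` {l / 3..2 * l / 3} \<subseteq> nbhd X d M A"
    and A: "\<And>n. A n \<in> \<A>" and S: "lseg S x y" and xy: "x \<in> lims A" "y \<in> lims A"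
  shows "S \<subseteq> lims A"
proof
  interpret C: segment_space C D lseg by (rule cone_segment_space[OF geo])
  have AX: "A n \<subseteq> X" for n using A sub by auto
  fix v assume v: "v \<in> S"
  show "v \<in> lims A"
  proof (rule ccontr)
    assume vA: "v \<notin> lims A"
    obtain m m' K where K: "lseg K m m'" "K \<subseteq> S" "v \<in> K" "K \<inter> lims A = {m, m'}" "m \<noteq> m'"
      "m \<in> S" "m' \<in> S" "D x m < D x v" "D x v < D x m'"
      by (rule C.seg_excursion[OF S lims_sclosed[OF AX] xy v vA])
    obtain g l where g: "\<And>n. geodesic X d (g n) (l n)" and V: "(\<lambda>n. g n 0) \<in> V" "(\<lambda>n. g n (l n)) \<in> V"
      and mm: "m = pt (\<lambda>n. g n 0)" "m' = pt (\<lambda>n. g n (l n))"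
      and Ke: "K = {pt (\<lambda>n. g n (\<tau> n)) |\<tau>. \<forall>n. \<tau> n \<in> {0..l n}}"
      using K(1) unfolding lseg_def by blast
    have l0: "0 \<le> l n" for n by (rule geodesic_nonneg[OF g])
    have l: "d (g n 0) (g n (l n)) = l n" for n using geodesic_dist[OF g, of 0 n "l n"] l0[of n] by simp
    have mC: "m \<in> C" "m' \<in> C" using C.seg_in[OF K(1)] by auto
    define \<delta> where "\<delta> = D m m' / 2"
    have \<delta>: "\<delta> > 0" "\<delta> < D m m'" using K(5) mC C.nonneg[of m m'] C.zero[OF mC] unfolding \<delta>_def by linarith+
    have big: "eventually (\<lambda>n. \<delta> * s n < l n) \<omega>" using D_greaterD[of \<delta>, OF _ V] \<delta> unfolding l mm by simp
    have "m \<in> lims A" "m' \<in> lims A" using K(4) by blast+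
    then have near: "eventually (\<lambda>n. g n 0 \<in> nbhd X d (\<epsilon> * \<delta> * s n) (A n)) \<omega>"
      "eventually (\<lambda>n. g n (l n) \<in> nbhd X d (\<epsilon> * \<delta> * s n) (A n)) \<omega>"
      using lims_iff[where A = A, OF V(1) AX] lims_iff[where A = A, OF V(2) AX] \<epsilon> \<delta> unfolding mm by simp_all
    define z where "z = pt (\<lambda>n. g n (l n / 2))"
    have half: "l n / 2 \<in> {0..l n}" for n using l0[of n] by simp
    have zV: "(\<lambda>n. g n (l n / 2)) \<in> V" by (rule lseg_seq_V[OF g V half])
    have "eventually (\<lambda>n. g n (l n / 2) \<in> nbhd X d M (A n)) \<omega>"
      using big near
    proof eventually_elim
      case (elim n)
      have "\<epsilon> * \<delta> * s n \<le> \<epsilon> * l n" using elim(1) \<epsilon> by simp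
      then have "g n 0 \<in> nbhd X d (\<epsilon> * l n) (A n)" "g n (l n) \<in> nbhd X d (\<epsilon> * l n) (A n)"
        using elim nbhd_mono by blast+
      then have "g n ` {l n / 3..2 * l n / 3} \<subseteq> nbhd X d M (A n)" using \<beta>2 g A by blast
      moreover have "l n / 2 \<in> {l n / 3..2 * l n / 3}" using l0[of n] by simp
      ultimately show ?case by blast
    qed
    then have "z \<in> lims A" unfolding z_def by (rule lims_constI[where A = A, OF zV AX])
    moreover have "z \<in> K" unfolding Ke z_def using half by (intro CollectI exI[of _ "\<lambda>n. l n / 2"]) auto
    ultimately have "z = m \<or> z = m'" using K(4) by blast
    moreover have "\<delta> / 2 \<le> D z m"
      unfolding z_def mm
    proof (rule D_geI[OF _ zV V(1)])
      show "eventually (\<lambda>n. \<delta> / 2 * s n \<le> d (g n (l n / 2)) (g n 0)) \<omega>"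
        using big by eventually_elim (use geodesic_dist[OF g half, of 0] l0 in simp)
    qed
    moreover have "\<delta> / 2 \<le> D z m'"
      unfolding z_def mm
    proof (rule D_geI[OF _ zV V(2)])
      show "eventually (\<lambda>n. \<delta> / 2 * s n \<le> d (g n (l n / 2)) (g n (l n))) \<omega>"
        using big
      proof eventually_elim
        case (elim n)
        then show ?case using geodesic_dist[OF g half, of "l n" n] l0[of n] by simp
      qed
    qed
    ultimately show False using \<delta> mC by auto
  qed
qed

text \<open>The chords that cut the corners are at least as long as the constant \<open>N\<close>
  and negligible against \<open>s n\<close>: long enough for a fat hexagon, yet invisible in the
  cone, where the hexagon has the triangle as its limit.\<close>

lemma limit_triangle_in_lims:
  fixes S :: "nat \<Rightarrow> (nat \<Rightarrow> 'a) set set" and a :: "nat \<Rightarrow> (nat \<Rightarrow> 'a) set"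
  assumes geo: "geodesic_space X d" and \<theta>: "0 < \<theta>" "8 \<le> \<nu>"
    and \<beta>3: "\<forall>g l. fat_polygon X d \<theta> \<nu> 6 g l \<longrightarrow> (\<exists>A\<in>\<A>. edges g l {..<6} \<subseteq> nbhd X d K A)"
    and S: "\<And>k. k < 3 \<Longrightarrow> lseg (S k) (a k) (a (Suc k mod 3))"
    and int: "\<And>k. k < 3 \<Longrightarrow> S k \<inter> S (Suc k mod 3) = {a (Suc k mod 3)}"
    and ne: "\<And>k. k < 3 \<Longrightarrow> a k \<noteq> a (Suc k mod 3)"
  shows "\<exists>A. (\<forall>n. A n \<in> \<A>) \<and> (\<forall>k<3. S k \<subseteq> lims A)"
proof -
  interpret C: segment_space C D lseg by (rule cone_segment_space[OF geo])
  define N where "N = \<nu> * \<theta>"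
  have s3: "Suc k mod 3 < 3" "(k + 2) mod 3 < 3" for k :: nat by simp_all
  have sp: "Suc ((k + 2) mod 3) mod 3 = k" if "k < 3" for k :: nat using that unfolding less_3_cases by (elim disjE; simp add: mod_Suc)
  have ss: "Suc (Suc k mod 3) mod 3 = (k + 2) mod 3" if "k < 3" for k :: nat using that unfolding less_3_cases by (elim disjE; simp add: mod_Suc)
  have "\<forall>k. \<exists>q l. k < 3 \<longrightarrow> (\<forall>n. geodesic X d (q n) (l n)) \<and> (\<lambda>n. q n 0) \<in> V \<and> (\<lambda>n. q n (l n)) \<in> V \<and>
      a k = pt (\<lambda>n. q n 0) \<and> a (Suc k mod 3) = pt (\<lambda>n. q n (l n)) \<and>
      S k = {pt (\<lambda>n. q n (\<tau> n)) |\<tau>. \<forall>n. \<tau> n \<in> {0..l n}}" (is "\<forall>k. ?P k")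
  proof
    fix k
    show "?P k"
    proof (cases "k < 3")
      case True
      show ?thesis using S[OF True] unfolding lseg_def by (elim exE) (intro exI impI, assumption)
    qed simp
  qed
  from choice[OF this] obtain q where "\<forall>k. \<exists>l. k < 3 \<longrightarrow> (\<forall>n. geodesic X d (q k n) (l n)) \<and> (\<lambda>n. q k n 0) \<in> V \<and> (\<lambda>n. q k n (l n)) \<in> V \<and>
      a k = pt (\<lambda>n. q k n 0) \<and> a (Suc k mod 3) = pt (\<lambda>n. q k n (l n)) \<and>
      S k = {pt (\<lambda>n. q k n (\<tau> n)) |\<tau>. \<forall>n. \<tau> n \<in> {0..l n}}"
    ..
  from choice[OF this] obtain l where ql: "\<forall>k. k < 3 \<longrightarrow> (\<forall>n. geodesic X d (q k n) (l k n)) \<and> (\<lambda>n. q k n 0) \<in> V \<and> (\<lambda>n. q k n (l k n)) \<in> V \<and>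
      a k = pt (\<lambda>n. q k n 0) \<and> a (Suc k mod 3) = pt (\<lambda>n. q k n (l k n)) \<and>
      S k = {pt (\<lambda>n. q k n (\<tau> n)) |\<tau>. \<forall>n. \<tau> n \<in> {0..l k n}}"
    ..
  have q: "geodesic X d (q k n) (l k n)" if "k < 3" for k n using ql that by blast
  have qV: "(\<lambda>n. q k n 0) \<in> V" "(\<lambda>n. q k n (l k n)) \<in> V" if "k < 3" for k using ql that by blast+
  have qa: "a k = pt (\<lambda>n. q k n 0)" "a (Suc k mod 3) = pt (\<lambda>n. q k n (l k n))" if "k < 3" for k using ql that by blast+
  have qS: "S k = {pt (\<lambda>n. q k n (\<tau> n)) |\<tau>. \<forall>n. \<tau> n \<in> {0..l k n}}" if "k < 3" for k using ql that by blast
  have l0: "0 \<le> l k n" if "k < 3" for k n by (rule geodesic_nonneg[OF q[OF that]])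
  have VV: "(\<lambda>n. q k n (\<tau> n)) \<in> V" "pt (\<lambda>n. q k n (\<tau> n)) \<in> S k" if "k < 3" "\<And>n. \<tau> n \<in> {0..l k n}" for k \<tau>
    using lseg_seq_V[OF q[OF that(1)] qV[OF that(1)] that(2)] that unfolding qS[OF that(1)] by blast+
  have aS: "a k \<in> S k" "a (Suc k mod 3) \<in> S k" if "k < 3" for k using C.seg_ends[OF S[OF that]] by auto
  have opp: "a k \<notin> S (Suc k mod 3)" if "k < 3" for k using aS[OF that] int[OF that] ne[OF that] by blast
  have opp2: "a (Suc k mod 3) \<notin> S ((k + 2) mod 3)" if "k < 3" for k
    using aS[OF that] int[OF s3(2), of k] ne[OF that] sp[OF that] by auto
  \<comment> \<open>The vertex \<open>a k\<close> is not on the opposite side. This is the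
    hypothesis under which \<open>corner_truncation\<close> can cut the corner
    \<open>a (Suc k mod 3)\<close>.\<close>
  have far: "eventually (\<lambda>n. \<forall>u\<in>{0..l (Suc k mod 3) n}. N \<le> d (q k n 0) (q (Suc k mod 3) n u)) \<omega>" if k: "k < 3" for k
  proof -
    have "eventually (\<lambda>n. \<forall>x\<in>{q k n 0}. \<forall>w\<in>q (Suc k mod 3) n ` {0..l (Suc k mod 3) n}. N \<le> d x w) \<omega>"
    proof (rule disjoint_limits_separate[where SU = "{a k}" and SW = "S (Suc k mod 3)"])
      fix u assume "\<And>n. u n \<in> {q k n 0}"
      then have "u = (\<lambda>n. q k n 0)" by auto
      then show "u \<in> V \<and> pt u \<in> {a k}" using qV[OF k] qa[OF k] by simp
    next
      fix w assume "\<And>n. w n \<in> q (Suc k mod 3) n ` {0..l (Suc k mod 3) n}"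
      then have "\<forall>n. \<exists>t. t \<in> {0..l (Suc k mod 3) n} \<and> w n = q (Suc k mod 3) n t" by blast
      then obtain \<tau> where "\<And>n. \<tau> n \<in> {0..l (Suc k mod 3) n}" "\<And>n. w n = q (Suc k mod 3) n (\<tau> n)" by metis
      then show "w \<in> V \<and> pt w \<in> S (Suc k mod 3)" using VV[OF s3(1), of \<tau> k] by (metis (no_types, lifting) ext)
    qed (use opp[OF k] l0[OF s3(1)] in auto)
    then show ?thesis by eventually_elim auto
  qed
  \<comment> \<open>Both sides at a corner are parametrized from the corner, hence
    \<open>l k n - t\<close> on side \<open>k\<close>.\<close>
  define trunc where "trunc k n t t' \<longleftrightarrow> N \<le> d (q k n (l k n - t)) (q (Suc k mod 3) n t') \<and>
      d (q k n (l k n - t)) (q (Suc k mod 3) n t') \<le> max N (d (q k n (l k n)) (q (Suc k mod 3) n 0)) \<and>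
      (\<forall>u\<in>{t..l k n}. \<forall>u'\<in>{t'..l (Suc k mod 3) n}.
        d (q k n (l k n - t)) (q (Suc k mod 3) n t') \<le> d (q k n (l k n - u)) (q (Suc k mod 3) n u'))" for k n t t'
  have "\<exists>p. k < 3 \<longrightarrow> fst p \<in> {0..l k n} \<and> snd p \<in> {0..l (Suc k mod 3) n} \<and>
      ((\<forall>u\<in>{0..l (Suc k mod 3) n}. N \<le> d (q k n 0) (q (Suc k mod 3) n u)) \<longrightarrow> trunc k n (fst p) (snd p))" for k n
  proof (cases "k < 3 \<and> (\<forall>u\<in>{0..l (Suc k mod 3) n}. N \<le> d (q k n 0) (q (Suc k mod 3) n u))")
    case True
    then have k: "k < 3" by blast
    obtain t t' where "t \<in> {0..l k n}" "t' \<in> {0..l (Suc k mod 3) n}" "trunc k n t t'"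
      using corner_truncation[OF geodesic_reverse[OF q[OF k, of n]] q[OF s3(1)[of k], of n], of N] True
      unfolding trunc_def by auto
    then show ?thesis by (intro exI[of _ "(t, t')"]) auto
  next
    case False
    then show ?thesis by (intro exI[of _ "(0, 0)"]) (use l0[of k n] l0[OF s3(1)[of k], of n] in auto)
  qed
  then obtain p where p: "\<And>k n. k < 3 \<Longrightarrow> fst (p k n) \<in> {0..l k n}" "\<And>k n. k < 3 \<Longrightarrow> snd (p k n) \<in> {0..l (Suc k mod 3) n}"
    "\<And>k n. k < 3 \<Longrightarrow> (\<forall>u\<in>{0..l (Suc k mod 3) n}. N \<le> d (q k n 0) (q (Suc k mod 3) n u)) \<Longrightarrow> trunc k n (fst (p k n)) (snd (p k n))"
    by metis
  \<comment> \<open>Side \<open>k\<close> is kept between \<open>T k\<close> and \<open>v k\<close>.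
    Since \<open>W k\<close> is the cut on the next side, \<open>T k\<close> is the \<open>W\<close>
    of the preceding corner, whose index is \<open>k + 2\<close> modulo 3.\<close>
  define v where "v k n = l k n - fst (p k n)" for k n
  define W where "W k n = snd (p k n)" for k n
  define T where "T k n = W ((k + 2) mod 3) n" for k n
  have vr: "v k n \<in> {0..l k n}" if "k < 3" for k n using p(1)[OF that, of n] unfolding v_def by auto
  have Wr: "W k n \<in> {0..l (Suc k mod 3) n}" if "k < 3" for k n using p(2)[OF that, of n] unfolding W_def by auto
  have TS: "T (Suc k mod 3) n = W k n" if "k < 3" for k n
  proof -
    have "(Suc k mod 3 + 2) mod 3 = k" using that unfolding less_3_cases by (elim disjE; simp add: mod_Suc)
    then show ?thesis unfolding T_def by simp
  qed
  have Tr: "T k n \<in> {0..l k n}" if "k < 3" for k n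
    unfolding T_def using Wr[OF s3(2)[of k], of n] unfolding sp[OF that] .
  define \<eta> where "\<eta> k n = d (q k n (v k n)) (q (Suc k mod 3) n (W k n))" for k n
  have evtr: "eventually (\<lambda>n. trunc k n (fst (p k n)) (W k n)) \<omega>" if "k < 3" for k
    using far[OF that] by eventually_elim (use p(3)[OF that] in \<open>simp add: W_def\<close>)
  have \<eta>small: "eventually (\<lambda>n. \<eta> k n \<le> r * s n) \<omega>" if k: "k < 3" and r: "r > 0" for k r
  proof -
    have V2: "(\<lambda>n. q (Suc k mod 3) n 0) \<in> V" using qV[OF s3(1)] by blast
    have "pt (\<lambda>n. q k n (l k n)) = pt (\<lambda>n. q (Suc k mod 3) n 0)" using qa[OF k] qa[OF s3(1)] by metis
    then have "eventually (\<lambda>n. d (q k n (l k n)) (q (Suc k mod 3) n 0) < r * s n) \<omega>"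
      using pt_eqD[OF _ qV(2)[OF k] V2 r] by simp
    then show ?thesis using evtr[OF k] scale_ge[of "N / r"]
    proof eventually_elim
      case (elim n)
      have "N \<le> r * s n" using elim(3) r by (simp add: field_simps)
      then show ?case using elim(1,2) unfolding \<eta>_def v_def trunc_def by linarith
    qed
  qed
  have vV: "(\<lambda>n. q k n (v k n)) \<in> V" "pt (\<lambda>n. q k n (v k n)) \<in> S k" if "k < 3" for k
    using VV[OF that vr[OF that]] by auto
  have WV: "(\<lambda>n. q (Suc k mod 3) n (W k n)) \<in> V" "pt (\<lambda>n. q (Suc k mod 3) n (W k n)) \<in> S (Suc k mod 3)" if "k < 3" for k
    using VV[OF s3(1) Wr[OF that]] by auto
  have vW: "pt (\<lambda>n. q k n (v k n)) = pt (\<lambda>n. q (Suc k mod 3) n (W k n))" if "k < 3" for k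
    by (rule pt_eqI[OF vV(1)[OF that] WV(1)[OF that]]) (use \<eta>small[OF that] in \<open>simp add: \<eta>_def\<close>)
  have va: "pt (\<lambda>n. q k n (v k n)) = a (Suc k mod 3)" if "k < 3" for k
    using vV(2)[OF that] WV(2)[OF that] vW[OF that] int[OF that] by auto
  have Ta: "pt (\<lambda>n. q k n (T k n)) = a k" if "k < 3" for k
    using va[OF s3(2)[of k]] vW[OF s3(2)[of k]] unfolding sp[OF that] T_def by simp
  have TV: "(\<lambda>n. q k n (T k n)) \<in> V" if "k < 3" for k using VV(1)[OF that Tr[OF that]] .
  have Tsmall: "eventually (\<lambda>n. T k n < r * s n) \<omega>" if k: "k < 3" and r: "r > 0" for k r
  proof -
    have "pt (\<lambda>n. q k n 0) = pt (\<lambda>n. q k n (T k n))" using qa(1)[OF k] Ta[OF k] by simp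
    then show ?thesis using pt_eqD[OF _ qV(1)[OF k] TV[OF k] r] Tr[OF k] l0[OF k]
      by (simp add: geodesic_dist[OF q[OF k] _ Tr[OF k]])
  qed
  have Usmall: "eventually (\<lambda>n. l k n - v k n < r * s n) \<omega>" if k: "k < 3" and r: "r > 0" for k r
  proof -
    have "pt (\<lambda>n. q k n (l k n)) = pt (\<lambda>n. q k n (v k n))" using qa(2)[OF k] va[OF k] by simp
    moreover have "d (q k n (l k n)) (q k n (v k n)) = l k n - v k n" for n
      using geodesic_dist[OF q[OF k] _ vr[OF k], of "l k n" n] l0[OF k, of n] vr[OF k, of n] by auto
    ultimately show ?thesis using pt_eqD[OF _ qV(2)[OF k] vV(1)[OF k] r] by simp
  qed
  \<comment> \<open>The cut-off parts are negligible, the whole side is not, as its ends are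
    different points of the cone.\<close>
  have Tv: "eventually (\<lambda>n. T k n \<le> v k n) \<omega>" if k: "k < 3" for k
  proof -
    have aC: "a k \<in> C" "a (Suc k mod 3) \<in> C" using C.seg_in[OF S[OF k]] by auto
    define \<delta> where "\<delta> = D (a k) (a (Suc k mod 3))"
    have \<delta>: "\<delta> > 0" using ne[OF k] C.nonneg[of "a k" "a (Suc k mod 3)"] C.zero[OF aC] unfolding \<delta>_def by linarith
    have "\<delta> / 4 > 0" using \<delta> by simp
    have "eventually (\<lambda>n. \<delta> / 2 * s n < d (q k n 0) (q k n (l k n))) \<omega>"
      by (rule D_greaterD[OF _ qV[OF k]]) (use \<delta> qa[OF k] in \<open>simp add: \<delta>_def\<close>)
    then show ?thesis using Tsmall[OF k \<open>\<delta> / 4 > 0\<close>] Usmall[OF k \<open>\<delta> / 4 > 0\<close>]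
    proof eventually_elim
      case (elim n)
      have "d (q k n 0) (q k n (l k n)) = l k n"
        using geodesic_dist[OF q[OF k], of 0 n "l k n"] l0[OF k, of n] by simp
      then show ?case using elim \<delta> by (auto simp: algebra_simps)
    qed
  qed
  have "\<forall>k. \<exists>h. k < 3 \<longrightarrow> (\<forall>n. geodesic X d (h n) (\<eta> k n) \<and> h n 0 = q k n (v k n) \<and> h n (\<eta> k n) = q (Suc k mod 3) n (W k n))"
  proof
    fix k
    show "\<exists>h. k < 3 \<longrightarrow> (\<forall>n. geodesic X d (h n) (\<eta> k n) \<and> h n 0 = q k n (v k n) \<and> h n (\<eta> k n) = q (Suc k mod 3) n (W k n))"
    proof (cases "k < 3")
      case True
      obtain h L where h: "\<And>n. geodesic X d (h n) (L n)" "\<And>n. h n 0 = q k n (v k n)" "\<And>n. h n (L n) = q (Suc k mod 3) n (W k n)"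
        using lseg_ex[OF geo vV(1)[OF True] WV(1)[OF True]] by metis
      have "L n = \<eta> k n" for n
        using geodesic_dist[OF h(1)[of n], of 0 "L n"] geodesic_nonneg[OF h(1)[of n]] unfolding h \<eta>_def by simp
      then show ?thesis using h by (intro exI[of _ h]) metis
    qed blast
  qed
  from choice[OF this] obtain h where h: "\<forall>k. k < 3 \<longrightarrow> (\<forall>n. geodesic X d (h k n) (\<eta> k n) \<and> h k n 0 = q k n (v k n) \<and> h k n (\<eta> k n) = q (Suc k mod 3) n (W k n))"
    ..
  have hg: "geodesic X d (h k n) (\<eta> k n)" "h k n 0 = q k n (v k n)" "h k n (\<eta> k n) = q (Suc k mod 3) n (W k n)" if "k < 3" for k n
    using h that by blast+
  \<comment> \<open>In the cone a chord shrinks to its corner, so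
    \<open>disjoint_limits_separate\<close> keeps it away from the other chords and from the
    opposite side.\<close>
  have hshadow: "x \<in> V \<and> pt x \<in> {a (Suc k mod 3)}" if k: "k < 3" and x: "\<And>n. x n \<in> h k n ` {0..\<eta> k n}" for k x
  proof -
    have xX: "x n \<in> X" for n using x[of n] geodesic_in[OF hg(1)[OF k, of n]] by auto
    have dx: "d (q k n (v k n)) (x n) \<le> \<eta> k n" for n
    proof -
      obtain t where t: "t \<in> {0..\<eta> k n}" "x n = h k n t" using x[of n] by blast
      then show ?thesis using geodesic_dist[OF hg(1)[OF k], of 0 n t] hg(2)[OF k, of n] by auto
    qed
    have small: "eventually (\<lambda>n. d (q k n (v k n)) (x n) \<le> r * s n) \<omega>" if "r > 0" for r
      using \<eta>small[OF k that] by eventually_elim (use dx order_trans in blast)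
    have xV: "x \<in> V" by (rule V_near[OF vV(1)[OF k] xX small[of 1]]) simp
    have "pt (\<lambda>n. q k n (v k n)) = pt x" by (rule pt_eqI[OF vV(1)[OF k] xV small])
    then show ?thesis using xV va[OF k] by simp
  qed
  have \<eta>0: "0 \<le> \<eta> k n" for k n unfolding \<eta>_def by simp
  have hne: "h k n ` {0..\<eta> k n} \<noteq> {}" for k n using \<eta>0[of k n] by simp
  have C2: "eventually (\<lambda>n. \<forall>x\<in>h k n ` {0..\<eta> k n}. \<forall>y\<in>q ((k + 2) mod 3) n ` {0..l ((k + 2) mod 3) n}. N \<le> d x y) \<omega>"
    if k: "k < 3" for k
  proof (rule disjoint_limits_separate[where SU = "{a (Suc k mod 3)}" and SW = "S ((k + 2) mod 3)"])
    fix w assume "\<And>n. w n \<in> q ((k + 2) mod 3) n ` {0..l ((k + 2) mod 3) n}"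
    then have "\<forall>n. \<exists>t. t \<in> {0..l ((k + 2) mod 3) n} \<and> w n = q ((k + 2) mod 3) n t" by blast
    then obtain \<tau> where "\<And>n. \<tau> n \<in> {0..l ((k + 2) mod 3) n}" "\<And>n. w n = q ((k + 2) mod 3) n (\<tau> n)" by metis
    then show "w \<in> V \<and> pt w \<in> S ((k + 2) mod 3)" using VV[OF s3(2), of \<tau> k] by (metis (no_types, lifting) ext)
  qed (use hshadow[OF k] hne opp2[OF k] l0[OF s3(2)] in auto)
  have inj: "a (Suc j mod 3) \<noteq> a (Suc k mod 3)" if "j < 3" "k < 3" "j \<noteq> k" for j k
  proof -
    have "Suc k mod 3 = Suc (Suc j mod 3) mod 3 \<or> Suc j mod 3 = Suc (Suc k mod 3) mod 3" using that unfolding less_3_cases by (elim disjE; simp add: mod_Suc)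
    then show ?thesis using ne[OF s3(1)[of j]] ne[OF s3(1)[of k]] by metis
  qed
  have C3: "eventually (\<lambda>n. \<forall>x\<in>h j n ` {0..\<eta> j n}. \<forall>y\<in>h k n ` {0..\<eta> k n}. N \<le> d x y) \<omega>"
    if "j < 3" "k < 3" "j \<noteq> k" for j k
    by (rule disjoint_limits_separate[where SU = "{a (Suc j mod 3)}" and SW = "{a (Suc k mod 3)}", OF hne hne hshadow[OF that(1)] hshadow[OF that(2)]])
      (use inj[OF that] in auto)
  have all3: "eventually (\<lambda>n. \<forall>k<3. Q k n) \<omega>" if "\<And>k. k < 3 \<Longrightarrow> eventually (\<lambda>n. Q k n) \<omega>" for Q :: "nat \<Rightarrow> nat \<Rightarrow> bool"
  proof -
    have "eventually (\<lambda>n. \<forall>k\<in>{..<3}. Q k n) \<omega>" by (rule eventually_ball_finite) (use that in auto)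
    then show ?thesis by (rule eventually_mono) auto
  qed
  have ev3: "eventually (\<lambda>n. \<forall>j<3. \<forall>k<3. j \<noteq> k \<longrightarrow> (\<forall>x\<in>h j n ` {0..\<eta> j n}. \<forall>y\<in>h k n ` {0..\<eta> k n}. N \<le> d x y)) \<omega>"
  proof (rule all3, rule all3)
    fix j k :: nat assume "j < 3" "k < 3"
    then show "eventually (\<lambda>n. j \<noteq> k \<longrightarrow> (\<forall>x\<in>h j n ` {0..\<eta> j n}. \<forall>y\<in>h k n ` {0..\<eta> k n}. N \<le> d x y)) \<omega>"
      using C3[of j k] by (cases "j = k") auto
  qed
  have E1: "eventually (\<lambda>n. \<forall>k<3. trunc k n (fst (p k n)) (W k n)) \<omega>" by (rule all3, rule evtr)
  have E2: "eventually (\<lambda>n. \<forall>k<3. T k n \<le> v k n) \<omega>" by (rule all3, rule Tv)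
  have E3: "eventually (\<lambda>n. \<forall>k<3. \<forall>x\<in>h k n ` {0..\<eta> k n}. \<forall>y\<in>q ((k + 2) mod 3) n ` {0..l ((k + 2) mod 3) n}. N \<le> d x y) \<omega>"
    by (rule all3, rule C2)
  have "eventually (\<lambda>n. \<exists>A. A \<in> \<A> \<and> (\<forall>k<3. \<forall>\<tau>\<in>{T k n..v k n}. q k n \<tau> \<in> nbhd X d K A)) \<omega>"
    using E1 E2 E3 ev3
  proof eventually_elim
    case (elim n)
    define g where "g = (\<lambda>i. if even i then (\<lambda>\<tau>. q (i div 2) n (T (i div 2) n + \<tau>)) else h (i div 2) n)"
    define L where "L = (\<lambda>i. if even i then v (i div 2) n - T (i div 2) n else \<eta> (i div 2) n)"
    have sub: "x \<in> {0..l k n}" if "k < 3" "x \<in> {T k n..v k n}" for x k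
      using Tr[OF that(1), of n] vr[OF that(1), of n] that(2) by auto
    have "fat_polygon X d \<theta> \<nu> 6 g L"
      unfolding g_def L_def
    proof (rule triangle_hexagon_fat[where l = "\<lambda>k. l k n"])
      fix k :: nat assume k: "k < 3"
      show "geodesic X d (q k n) (l k n)" by (rule q[OF k])
      show "0 \<le> T k n" "v k n \<le> l k n" using Tr[OF k, of n] vr[OF k, of n] by auto
      show "T k n \<le> v k n" using elim(2) k by blast
      show "geodesic X d (h k n) (\<eta> k n)" "h k n 0 = q k n (v k n)"
        "h k n (\<eta> k n) = q (Suc k mod 3) n (T (Suc k mod 3) n)" using hg[OF k] TS[OF k] by auto
      show "\<nu> * \<theta> \<le> \<eta> k n" using elim(1)[rule_format, OF k] unfolding trunc_def \<eta>_def v_def N_def by auto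
    next
      fix k \<sigma> \<rho> assume k: "k < (3::nat)" and \<sigma>: "\<sigma> \<in> {T k n..v k n}"
        and \<rho>: "\<rho> \<in> {T (Suc k mod 3) n..v (Suc k mod 3) n}"
      have "l k n - \<sigma> \<in> {fst (p k n)..l k n}" using \<sigma> sub[OF k \<sigma>] unfolding v_def by auto
      moreover have "\<rho> \<in> {W k n..l (Suc k mod 3) n}" using \<rho> TS[OF k] vr[OF s3(1), of k n] by auto
      ultimately have "\<eta> k n \<le> d (q k n (l k n - (l k n - \<sigma>))) (q (Suc k mod 3) n \<rho>)"
        using elim(1)[rule_format, OF k] unfolding trunc_def \<eta>_def v_def by blast
      then show "\<eta> k n \<le> d (q k n \<sigma>) (q (Suc k mod 3) n \<rho>)" by simp
    next
      fix k \<sigma> \<rho> assume k: "k < (3::nat)" and \<sigma>: "\<sigma> \<in> {0..\<eta> k n}"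
        and \<rho>: "\<rho> \<in> {T ((k+2) mod 3) n..v ((k+2) mod 3) n}"
      show "\<nu> * \<theta> \<le> d (h k n \<sigma>) (q ((k+2) mod 3) n \<rho>)"
        using elim(3)[rule_format, OF k] \<sigma> sub[OF s3(2) \<rho>] unfolding N_def by blast
    next
      fix j k \<sigma> \<rho> assume "j < (3::nat)" "k < (3::nat)" "j \<noteq> k" "\<sigma> \<in> {0..\<eta> j n}" "\<rho> \<in> {0..\<eta> k n}"
      then show "\<nu> * \<theta> \<le> d (h j n \<sigma>) (h k n \<rho>)" using elim(4) unfolding N_def by blast
    qed (use \<theta> in auto)
    then obtain A where A: "A \<in> \<A>" "edges g L {..<6} \<subseteq> nbhd X d K A" using \<beta>3 by blast
    have "q k n \<tau> \<in> nbhd X d K A" if k: "k < 3" and \<tau>: "\<tau> \<in> {T k n..v k n}" for k \<tau>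
    proof -
      have "q k n \<tau> = g (2 * k) (\<tau> - T k n)" unfolding g_def by simp
      moreover have "\<tau> - T k n \<in> {0..L (2 * k)}" unfolding L_def using \<tau> by auto
      moreover have "2 * k \<in> {..<6}" using k by simp
      ultimately have "q k n \<tau> \<in> edges g L {..<6}" unfolding edges_def by blast
      then show ?thesis using A(2) by blast
    qed
    then show ?case using A(1) by blast
  qed
  from ev_choice[OF this] obtain A' where A': "eventually (\<lambda>n. A' n \<in> \<A> \<and> (\<forall>k<3. \<forall>\<tau>\<in>{T k n..v k n}. q k n \<tau> \<in> nbhd X d K (A' n))) \<omega>"
    ..
  \<comment> \<open>A default member for the indices at which no fat hexagon is available.\<close>
  have "\<exists>A0. A0 \<in> \<A>"
  proof (rule ccontr)
    assume "\<not> ?thesis"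
    then have "eventually (\<lambda>n. False) \<omega>" using A' by (auto elim: eventually_mono)
    then show False by simp
  qed
  then obtain A0 where A0: "A0 \<in> \<A>" ..
  define A where "A n = (if A' n \<in> \<A> then A' n else A0)" for n
  have A: "A n \<in> \<A>" for n unfolding A_def using A0 by simp
  have AX: "A n \<subseteq> X" for n using A sub by blast
  have evA: "eventually (\<lambda>n. \<forall>k<3. \<forall>\<tau>\<in>{T k n..v k n}. q k n \<tau> \<in> nbhd X d K (A n)) \<omega>"
    using A' by eventually_elim (simp add: A_def)
  have "S k \<subseteq> lims A" if k: "k < 3" for k
  proof
    fix z assume "z \<in> S k"
    then obtain \<tau> where \<tau>: "\<And>n. \<tau> n \<in> {0..l k n}" "z = pt (\<lambda>n. q k n (\<tau> n))" unfolding qS[OF k] by blast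
    \<comment> \<open>Parameters in the cut-off parts are moved to the cut, which does not change
      the point of the cone.\<close>
    define \<tau>' where "\<tau>' n = max (T k n) (min (\<tau> n) (v k n))" for n
    have \<tau>': "\<tau>' n \<in> {0..l k n}" for n
      unfolding \<tau>'_def using \<tau>(1)[of n] Tr[OF k, of n] vr[OF k, of n] by auto
    have V': "(\<lambda>n. q k n (\<tau> n)) \<in> V" "(\<lambda>n. q k n (\<tau>' n)) \<in> V" using VV(1)[OF k] \<tau>(1) \<tau>' by blast+
    have "z = pt (\<lambda>n. q k n (\<tau>' n))"
      unfolding \<tau>(2)
    proof (rule pt_eqI[OF V'])
      fix r :: real assume r: "r > 0"
      show "eventually (\<lambda>n. d (q k n (\<tau> n)) (q k n (\<tau>' n)) \<le> r * s n) \<omega>"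
        using Tsmall[OF k r] Usmall[OF k r] Tv[OF k]
      proof eventually_elim
        case (elim n)
        have "\<bar>\<tau> n - \<tau>' n\<bar> \<le> max (T k n) (l k n - v k n)"
          unfolding \<tau>'_def using \<tau>(1)[of n] elim(3) Tr[OF k, of n] vr[OF k, of n] by auto
        then show ?case using elim geodesic_dist[OF q[OF k] \<tau>(1) \<tau>', of n] by auto
      qed
    qed
    moreover have "eventually (\<lambda>n. q k n (\<tau>' n) \<in> nbhd X d K (A n)) \<omega>"
      using evA Tv[OF k]
    proof eventually_elim
      case (elim n)
      have "\<tau>' n \<in> {T k n..v k n}" unfolding \<tau>'_def using elim(2) by auto
      then show ?case using elim(1) k by blast
    qed
    ultimately show "z \<in> lims A" using lims_constI[where A = A, OF V'(2) AX] by simp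
  qed
  then show ?thesis using A by blast
qed

lemma cone_pieces:
  assumes geo: "geodesic_space X d"
    and \<alpha>1: "\<forall>\<delta>>0. \<exists>D0::real. \<forall>A\<in>\<A>. \<forall>A'\<in>\<A>. A \<noteq> A' \<longrightarrow> set_diam d (nbhd X d \<delta> A \<inter> nbhd X d \<delta> A') \<le> ennreal D0"
    and \<epsilon>: "\<epsilon> > 0" "M \<ge> 0"
    and \<beta>2: "\<forall>g l. \<forall>A\<in>\<A>. geodesic X d g l \<and> g 0 \<in> nbhd X d (\<epsilon> * l) A \<and> g l \<in> nbhd X d (\<epsilon> * l) A \<longrightarrow>
       g ` {l / 3..2 * l / 3} \<subseteq> nbhd X d M A"
    and \<theta>: "0 < \<theta>" "8 \<le> \<nu>"
    and \<beta>3: "\<forall>g l. fat_polygon X d \<theta> \<nu> 6 g l \<longrightarrow> (\<exists>A\<in>\<A>. edges g l {..<6} \<subseteq> nbhd X d K A)"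
  shows "pieces C D lseg (lims ` seqs)"
proof -
  interpret C: segment_space C D lseg by (rule cone_segment_space[OF geo])
  show ?thesis
  proof unfold_locales
    fix Q assume "Q \<in> lims ` seqs"
    then show "C.sclosed Q" using lims_sclosed seqs_subset by blast
  next
    fix Q S x y assume Q: "Q \<in> lims ` seqs" and S: "lseg S x y" "x \<in> Q" "y \<in> Q"
    obtain A where "A \<in> seqs" "Q = lims A" using Q by blast
    then show "S \<subseteq> Q" using lims_convex[OF geo \<epsilon>(1) \<beta>2 _ S(1), of A] seqs_coll S by blast
  next
    fix Q Q' x y assume Q: "Q \<in> lims ` seqs" "Q' \<in> lims ` seqs" and xy: "x \<noteq> y" "x \<in> Q" "x \<in> Q'" "y \<in> Q" "y \<in> Q'"
    obtain A where A: "A \<in> seqs" "Q = lims A" using Q by blast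
    obtain A' where A': "A' \<in> seqs" "Q' = lims A'" using Q by blast
    have "eventually (\<lambda>n. A n = A' n) \<omega>"
      by (rule lims_meet[OF geo \<alpha>1 \<epsilon> \<beta>2, of A A' x y]) (use A A' xy seqs_coll in auto)
    then show "Q = Q'" using lims_cong A A' by blast
  next
    fix S1 S2 S3 a b c
    assume S: "lseg S1 a b" "lseg S2 b c" "lseg S3 c a" and ne: "a \<noteq> b" "b \<noteq> c" "c \<noteq> a"
      and int: "S1 \<inter> S2 = {b}" "S2 \<inter> S3 = {c}" "S3 \<inter> S1 = {a}"
    define S where "S k = (if k = 0 then S1 else if k = 1 then S2 else S3)" for k :: nat
    define v where "v k = (if k = 0 then a else if k = 1 then b else c)" for k :: nat
    have less3: "k = 0 \<or> k = 1 \<or> k = 2" if "k < 3" for k :: nat using that by linarith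
    have "\<exists>A. (\<forall>n. A n \<in> \<A>) \<and> (\<forall>k<3. S k \<subseteq> lims A)"
    proof (rule limit_triangle_in_lims[OF geo \<theta> \<beta>3])
      fix k :: nat assume "k < 3"
      then have k: "k = 0 \<or> k = 1 \<or> k = 2" by (rule less3)
      have vals: "S 0 = S1" "S 1 = S2" "S 2 = S3" "v 0 = a" "v 1 = b" "v 2 = c" unfolding S_def v_def by simp_all
      have m: "Suc 0 mod 3 = 1" "Suc 1 mod 3 = 2" "Suc 2 mod 3 = 0" by simp_all
      show "lseg (S k) (v k) (v (Suc k mod 3))"
        using k by (elim disjE) (simp_all only: vals m S)
      show "S k \<inter> S (Suc k mod 3) = {v (Suc k mod 3)}"
        using k by (elim disjE) (simp_all only: vals m int)
      show "v k \<noteq> v (Suc k mod 3)"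
        using k ne by (elim disjE) (simp_all only: vals m, simp_all)
    qed
    then obtain A where A: "\<forall>n. A n \<in> \<A>" "\<forall>k<3. S k \<subseteq> lims A" by blast
    have "S 0 \<subseteq> lims A" "S 1 \<subseteq> lims A" "S 2 \<subseteq> lims A" using A(2) by simp_all
    then have "S1 \<union> S2 \<union> S3 \<subseteq> lims A" unfolding S_def by simp
    moreover from this have "lims A \<in> lims ` seqs" using piece_in[of A a] A(1) C.seg_ends(1)[OF S(1)] by blast
    ultimately show "\<exists>Q\<in>lims ` seqs. S1 \<union> S2 \<union> S3 \<subseteq> Q" by blast
  qed
qed

text \<open>(T2) is required for all geodesics while \<open>cone_pieces\<close> speaks of limit
  segments; \<open>simple_triangle_in_piece\<close> closes the gap.\<close>

lemma cone_tree_graded: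
  assumes geo: "geodesic_space X d"
    and \<alpha>1: "\<forall>\<delta>>0. \<exists>D0::real. \<forall>A\<in>\<A>. \<forall>A'\<in>\<A>. A \<noteq> A' \<longrightarrow> set_diam d (nbhd X d \<delta> A \<inter> nbhd X d \<delta> A') \<le> ennreal D0"
    and \<epsilon>: "\<epsilon> > 0" "M \<ge> 0"
    and \<beta>2: "\<forall>g l. \<forall>A\<in>\<A>. geodesic X d g l \<and> g 0 \<in> nbhd X d (\<epsilon> * l) A \<and> g l \<in> nbhd X d (\<epsilon> * l) A \<longrightarrow>
       g ` {l / 3..2 * l / 3} \<subseteq> nbhd X d M A"
    and \<theta>: "0 < \<theta>" "8 \<le> \<nu>"
    and \<beta>3: "\<forall>g l. fat_polygon X d \<theta> \<nu> 6 g l \<longrightarrow> (\<exists>A\<in>\<A>. edges g l {..<6} \<subseteq> nbhd X d K A)"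
  shows "tree_graded C D inds P"
proof -
  interpret C: pieces C D lseg "lims ` seqs" by (rule cone_pieces[OF assms])
  have piece: "P c \<in> lims ` seqs" if "c \<in> inds" for c using that P_image by blast
  show ?thesis
    unfolding tree_graded_def
  proof (intro conjI ballI impI allI)
    show "Metric_space C D" by (rule cone_metric)
    show "C.mcomplete" by (rule cone_complete)
    show "geodesic_space C D" by (rule cone_geodesic_space[OF geo])
  next
    fix c assume c: "c \<in> inds"
    show "closedin C.mtopology (P c)"
      unfolding C.closedin_iff_sclosed by (rule C.piece_closed[OF piece[OF c]])
    show "geodesic_space (P c) D"
      unfolding geodesic_space_def
    proof (intro ballI)
      fix x y assume xy: "x \<in> P c" "y \<in> P c"
      then obtain S where S: "lseg S x y" using C.seg_ex lims_subset by blast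
      have SP: "S \<subseteq> P c" by (rule C.piece_convex[OF piece[OF c] S xy])
      obtain G L where G: "geodesic C D G L" "G 0 = x" "G L = y" "S = G ` {0..L}" using lseg_geodesic[OF S] by blast
      then have "geodesic (P c) D G L" using SP unfolding geodesic_def by blast
      then show "\<exists>g l. geodesic (P c) D g l \<and> g 0 = x \<and> g l = y" using G by blast
    qed
  next
    fix c c' x y assume c: "c \<in> inds" "c' \<in> inds" "c \<noteq> c'" and x: "x \<in> P c \<inter> P c'" and y: "y \<in> P c \<inter> P c'"
    obtain A where A: "A \<in> seqs" "c = index_eq `` {A}" using inds_ex[OF c(1)] by blast
    obtain A' where A': "A' \<in> seqs" "c' = index_eq `` {A'}" using inds_ex[OF c(2)] by blast
    show "x = y"
    proof (rule ccontr)
      assume ne: "x \<noteq> y"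
      have xy: "x \<in> lims A \<inter> lims A'" "y \<in> lims A \<inter> lims A'"
        using x y P_class[OF A(1)] P_class[OF A'(1)] A(2) A'(2) by simp_all
      have "eventually (\<lambda>n. A n = A' n) \<omega>"
        by (rule lims_meet[OF geo \<alpha>1 \<epsilon> \<beta>2 seqs_coll[OF A(1)] seqs_coll[OF A'(1)] xy ne])
      then have "(A, A') \<in> index_eq" unfolding index_eq_def using A(1) A'(1) by simp
      then have "index_eq `` {A} = index_eq `` {A'}" by (rule equiv_class_eq[OF index_eq_equiv])
      then show False using A(2) A'(2) c(3) by blast
    qed
  next
    fix g l assume "geodesic_polygon C D 3 g l \<and> simple_nontrivial_polygon 3 g l"
    then obtain Q where Q: "Q \<in> lims ` seqs" "edges g l {..<3} \<subseteq> Q" using C.simple_triangle_in_piece by blast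
    then obtain c where "c \<in> inds" "Q = P c" using P_image by blast
    then show "\<exists>i\<in>inds. edges g l {..<3} \<subseteq> P i" using Q by blast
  qed
qed

end

section \<open>Consequences of tree-graded cones\<close>

lemma (in ultra) filterlim_ge_nat:
  assumes "\<And>n. real n \<le> s n" shows "filterlim s at_top \<omega>"
  unfolding filterlim_at_top
proof
  fix Z :: real
  obtain k :: nat where k: "Z \<le> real k" using real_arch_simple by blast
  show "eventually (\<lambda>n. Z \<le> s n) \<omega>"
    using ev_ge[of k]
  proof eventually_elim
    case (elim n)
    then have "real k \<le> real n" by simp
    then show ?case using assms[of n] k by linarith
  qed
qed

context Metric_space
begin

text \<open>A real-valued distance, meaningful for non-empty \<open>A\<close>, which can serve as a
  scale and be maximized along a geodesic.\<close>

definition dist_to :: "'a \<Rightarrow> 'a set \<Rightarrow> real" where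
  "dist_to x A = Inf (d x ` A)"

lemma dist_to_less_iff: "A \<noteq> {} \<Longrightarrow> dist_to x A < r \<longleftrightarrow> (\<exists>a\<in>A. d x a < r)"
  unfolding dist_to_def by (subst cInf_less_iff) (auto intro: bdd_belowI[of _ 0])

lemma nbhd_iff_dist_to: "x \<in> M \<Longrightarrow> A \<noteq> {} \<Longrightarrow> x \<in> nbhd M d r A \<longleftrightarrow> dist_to x A < r"
  unfolding nbhd_iff using dist_to_less_iff by simp

lemma dist_to_triangle:
  assumes "x \<in> M" "y \<in> M" "A \<subseteq> M" "A \<noteq> {}"
  shows "dist_to x A \<le> d x y + dist_to y A"
proof (rule field_le_epsilon)
  fix e :: real assume "e > 0"
  then obtain a where a: "a \<in> A" "d y a < dist_to y A + e" using dist_to_less_iff[of A y "dist_to y A + e"] assms by auto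
  have "dist_to x A \<le> d x a" unfolding dist_to_def using a by (intro cInf_lower bdd_belowI[of _ 0]) auto
  also have "\<dots> \<le> d x y + d y a" using assms a by (intro triangle) auto
  finally show "dist_to x A \<le> d x y + dist_to y A + e" using a by linarith
qed

end

locale atg_cone = cone_coll X d \<omega> e s \<A> for X :: "'a set" and d \<omega> e s \<A> +
  assumes geo: "geodesic_space X d" and tg: "tree_graded C D inds P"

sublocale atg_cone \<subseteq> Pc: pieces C D "geo_seg C D" "lims ` seqs"
  by (rule tree_graded_cone_pieces[OF tg])

section \<open>Rescaled points on sequences of geodesics\<close>

context cone_space
begin

text \<open>The minimum keeps the parameter admissible for every \<open>n\<close>; when the
  geodesics are long enough, it is almost surely \<open>t * s n\<close> by
  \<open>path_ev\<close>.\<close>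

lemma path_seq_V:
  assumes p: "\<And>n. geodesic X d (p n) (l n)" and 0: "(\<lambda>n. p n 0) \<in> V" and t: "0 \<le> t"
  shows "(\<lambda>n. p n (min (l n) (t * s n))) \<in> V"
proof (rule geo_seq_V[OF p 0])
  show "0 \<in> {0..l n}" "min (l n) (t * s n) \<in> {0..l n}" for n
    using geodesic_nonneg[OF p[of n]] t scale_pos[of n] by auto
  show "eventually (\<lambda>n. \<bar>0 - min (l n) (t * s n)\<bar> \<le> t * s n) \<omega>"
    by (rule always_eventually) (use geodesic_nonneg[OF p] t scale_pos in \<open>auto simp: min_def less_imp_le\<close>)
qed

lemma path_geodesic:
  assumes p: "\<And>n. geodesic X d (p n) (l n)" and 0: "(\<lambda>n. p n 0) \<in> V"
    and c: "0 \<le> c" "eventually (\<lambda>n. c * s n \<le> l n) \<omega>"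
  shows "geodesic C D (\<lambda>t. pt (\<lambda>n. p n (min (l n) (t * s n)))) c"
  unfolding geodesic_def
proof (intro conjI ballI)
  show "0 \<le> c" by (rule c)
  show "(\<lambda>t. pt (\<lambda>n. p n (min (l n) (t * s n)))) ` {0..c} \<subseteq> C"
    using pt_in[OF path_seq_V[OF p 0]] by auto
  fix t u assume t: "t \<in> {0..c}" and u: "u \<in> {0..c}"
  have V: "(\<lambda>n. p n (min (l n) (t * s n))) \<in> V" "(\<lambda>n. p n (min (l n) (u * s n))) \<in> V"
    using path_seq_V[OF p 0] t u by auto
  show "D (pt (\<lambda>n. p n (min (l n) (t * s n)))) (pt (\<lambda>n. p n (min (l n) (u * s n)))) = \<bar>t - u\<bar>"
  proof (rule D_eqI[OF V], rule tendsto_eventually)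
    show "eventually (\<lambda>n. d (p n (min (l n) (t * s n))) (p n (min (l n) (u * s n))) / s n = \<bar>t - u\<bar>) \<omega>"
      using c(2)
    proof eventually_elim
      case (elim n)
      have "t * s n \<le> c * s n" "u * s n \<le> c * s n" using t u scale_pos[of n] by auto
      then have m: "min (l n) (t * s n) = t * s n" "min (l n) (u * s n) = u * s n" using elim by auto
      have "d (p n (t * s n)) (p n (u * s n)) = \<bar>t * s n - u * s n\<bar>"
      proof (rule geodesic_dist[OF p])
        have "0 \<le> t * s n" "0 \<le> u * s n" using t u scale_pos[of n] by auto
        then show "t * s n \<in> {0..l n}" "u * s n \<in> {0..l n}"
          using \<open>t * s n \<le> c * s n\<close> \<open>u * s n \<le> c * s n\<close> elim by auto
      qed
      also have "\<dots> = \<bar>t - u\<bar> * s n" using scale_pos[of n] by (simp flip: left_diff_distrib add: abs_mult)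
      finally show ?case unfolding m using scale_pos[of n] by simp
    qed
  qed
qed

lemma path_ev:
  assumes c: "eventually (\<lambda>n. c * s n \<le> l n) \<omega>" and t: "t \<le> c"
  shows "eventually (\<lambda>n. min (l n) (t * s n) = t * s n) \<omega>"
  using c
proof eventually_elim
  case (elim n)
  have "t * s n \<le> c * s n" using t scale_pos[of n] by simp
  then show ?case using elim by simp
qed

end

context atg_cone
begin

lemma lims_piece: "(\<And>n. A n \<in> \<A>) \<Longrightarrow> x \<in> lims A \<Longrightarrow> lims A \<in> lims ` seqs"
  by (rule piece_in)

lemma lims_good: "(\<And>n. A n \<in> \<A>) \<Longrightarrow> x \<in> lims A \<Longrightarrow> Pc.good (lims A)"
  by (rule Pc.piece_good[OF lims_piece])

text \<open>Keeping away from \<open>x n\<close> by a fixed multiple of the scale means avoiding it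
  in the limit, so the limit segment is a link.\<close>

lemma linked_along:
  assumes g: "\<And>n. geodesic X d (g n) (l n)" and \<alpha>\<beta>: "\<And>n. 0 \<le> \<alpha> n" "\<And>n. \<alpha> n \<le> \<beta> n" "\<And>n. \<beta> n \<le> l n"
    and V: "(\<lambda>n. g n (\<alpha> n)) \<in> V" "(\<lambda>n. g n (\<beta> n)) \<in> V" and x: "x \<in> V"
    and \<tau>: "0 < \<tau>" "eventually (\<lambda>n. \<forall>t\<in>{\<alpha> n..\<beta> n}. \<tau> * s n \<le> d (x n) (g n t)) \<omega>"
  shows "Pc.linked (pt x) (pt (\<lambda>n. g n (\<alpha> n))) (pt (\<lambda>n. g n (\<beta> n)))"
proof -
  let ?S = "{pt (\<lambda>n. g n (\<sigma> n)) |\<sigma>. \<forall>n. \<sigma> n \<in> {\<alpha> n..\<beta> n}}"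
  have S: "geo_seg C D ?S (pt (\<lambda>n. g n (\<alpha> n))) (pt (\<lambda>n. g n (\<beta> n)))"
    by (rule lseg_geo_seg[OF lseg_between[OF g \<alpha>\<beta> V]])
  have "pt x \<notin> ?S"
  proof
    assume xS: "pt x \<in> ?S"
    then obtain \<sigma> where \<sigma>: "\<And>n. \<sigma> n \<in> {\<alpha> n..\<beta> n}" "pt x = pt (\<lambda>n. g n (\<sigma> n))" by blast
    have \<sigma>V: "(\<lambda>n. g n (\<sigma> n)) \<in> V"
    proof -
      obtain B where B: "eventually (\<lambda>n. d (g n (\<alpha> n)) (g n (\<beta> n)) \<le> B * s n) \<omega>" using V_dist_bounded[OF V] by blast
      show ?thesis
      proof (rule geo_seq_V[OF g V(1), where B = B])
        show "\<alpha> n \<in> {0..l n}" "\<sigma> n \<in> {0..l n}" for n using \<alpha>\<beta>[of n] \<sigma>(1)[of n] by auto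
        show "eventually (\<lambda>n. \<bar>\<alpha> n - \<sigma> n\<bar> \<le> B * s n) \<omega>"
          using B
        proof eventually_elim
          case (elim n)
          have "d (g n (\<alpha> n)) (g n (\<beta> n)) = \<bar>\<alpha> n - \<beta> n\<bar>" by (rule geodesic_dist[OF g]) (use \<alpha>\<beta>[of n] in auto)
          then show ?case using elim \<sigma>(1)[of n] by auto
        qed
      qed
    qed
    have "eventually (\<lambda>n. d (x n) (g n (\<sigma> n)) < \<tau> * s n) \<omega>" by (rule pt_eqD[OF \<sigma>(2) x \<sigma>V \<tau>(1)])
    then have "eventually (\<lambda>n. False) \<omega>" using \<tau>(2) by eventually_elim (use \<sigma>(1) in force)
    then show False by simp
  qed
  then show ?thesis by (rule Pc.linked_seg[OF S])
qed

end

text \<open>The ultrafilter is fixed once, whereas base point and scale are chosen anew in each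
  argument; therefore cones are interpreted inside the proofs.\<close>

locale atg = Metric_space X d + ultra \<omega> for X :: "'a set" and d \<omega> +
  fixes \<A> :: "'a set set"
  assumes geo_space: "geodesic_space X d" and coll_sub: "A \<in> \<A> \<Longrightarrow> A \<subseteq> X"
    and atg: "asymptotically_tree_graded X d \<A>"
begin

lemma atg_cone:
  assumes "\<And>n. e n \<in> X" "\<And>n. 0 < s n" "filterlim s at_top \<omega>"
  shows "atg_cone X d \<omega> e s \<A>"
proof -
  interpret cone_coll X d \<omega> e s \<A> by unfold_locales (use assms coll_sub in auto)
  show ?thesis
  proof unfold_locales
    show "geodesic_space X d" by (rule geo_space)
    show "tree_graded C D inds P"
      using atg assms npu unfolding asymptotically_tree_graded_def by blast
  qed
qed

text \<open>Rescaling by the distance of two far apart common points gives a cone in which two limit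
  sets share two different points.\<close>

lemma intersections_bounded:
  assumes "\<delta> > 0"
  shows "\<exists>D0::real. \<forall>A\<in>\<A>. \<forall>A'\<in>\<A>. A \<noteq> A' \<longrightarrow> set_diam d (nbhd X d \<delta> A \<inter> nbhd X d \<delta> A') \<le> ennreal D0"
proof (rule ccontr)
  assume not: "\<not> ?thesis"
  have "\<exists>A A' x y. A \<in> \<A> \<and> A' \<in> \<A> \<and> A \<noteq> A' \<and> x \<in> nbhd X d \<delta> A \<inter> nbhd X d \<delta> A' \<and>
      y \<in> nbhd X d \<delta> A \<inter> nbhd X d \<delta> A' \<and> real n + 1 < d x y" for n :: nat
  proof -
    obtain A A' where A: "A \<in> \<A>" "A' \<in> \<A>" "A \<noteq> A'" "\<not> set_diam d (nbhd X d \<delta> A \<inter> nbhd X d \<delta> A') \<le> ennreal (real n + 1)"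
      using not by blast
    from A(4) obtain x y where "x \<in> nbhd X d \<delta> A \<inter> nbhd X d \<delta> A'" "y \<in> nbhd X d \<delta> A \<inter> nbhd X d \<delta> A'" "\<not> d x y \<le> real n + 1"
      by (subst (asm) set_diam_le_iff) auto
    then show ?thesis using A by (meson not_le)
  qed
  then obtain A A' x y where *: "\<And>n. A n \<in> \<A>" "\<And>n. A' n \<in> \<A>" "\<And>n. A n \<noteq> A' n"
    "\<And>n::nat. x n \<in> nbhd X d \<delta> (A n) \<inter> nbhd X d \<delta> (A' n)" "\<And>n. y n \<in> nbhd X d \<delta> (A n) \<inter> nbhd X d \<delta> (A' n)"
    "\<And>n::nat. real n + 1 < d (x n) (y n)" by metis
  define s where "s n = d (x n) (y n)" for n
  have s: "real n \<le> s n" "0 < s n" for n using *(6)[of n] unfolding s_def by linarith+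
  have xy: "x n \<in> X" "y n \<in> X" for n using *(4,5)[of n] by (auto simp: nbhd_iff)
  interpret E: atg_cone X d \<omega> x s \<A> by (rule atg_cone[OF xy(1) s(2) filterlim_ge_nat[OF s(1)]])
  have V: "x \<in> E.V" "y \<in> E.V"
    by (rule E.base_V) (rule E.VI[where B = 1], use xy commute in \<open>auto simp: s_def\<close>)
  have "E.D (E.pt x) (E.pt y) \<ge> 1" by (rule E.D_geI[OF _ V]) (simp add: s_def)
  then have ne: "E.pt x \<noteq> E.pt y" using E.pt_in[OF V(1)] by auto
  have AX: "A n \<subseteq> X" "A' n \<subseteq> X" for n using * coll_sub by auto
  have "eventually (\<lambda>n. A n = A' n) \<omega>"
    by (rule E.tree_graded_same[OF E.tg *(1,2) _ _ _ _ ne]; rule E.lims_constI[where c = \<delta>])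
      (use * V AX in auto)
  then have "eventually (\<lambda>n. False) \<omega>" using *(3) by simp
  then show False by simp
qed

text \<open>This is \<open>mid_in_good\<close> in the cone with scale \<open>l n\<close>, where the
  geodesic has length 1 and the limit point is exactly in the limit set.\<close>

lemma middle_near:
  assumes \<rho>: "0 < \<rho>" "\<rho> < 1/2" and \<eta>: "0 < \<eta>"
  shows "\<exists>L>0. \<forall>g l A t. L \<le> l \<longrightarrow> geodesic X d g l \<longrightarrow> A \<in> \<A> \<longrightarrow> g 0 \<in> nbhd X d (\<rho> * l) A \<longrightarrow>
    g l \<in> nbhd X d (\<rho> * l) A \<longrightarrow> t \<in> {\<rho> * l..l - \<rho> * l} \<longrightarrow> g t \<in> nbhd X d (\<eta> * l) A"
proof (rule ccontr)
  assume not: "\<not> ?thesis"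
  have "\<exists>g l A t. real n + 1 \<le> l \<and> geodesic X d g l \<and> A \<in> \<A> \<and> g 0 \<in> nbhd X d (\<rho> * l) A \<and>
    g l \<in> nbhd X d (\<rho> * l) A \<and> t \<in> {\<rho> * l..l - \<rho> * l} \<and> g t \<notin> nbhd X d (\<eta> * l) A" for n :: nat
    using not[unfolded not_ex, rule_format, of "real n + 1"] by auto
  then obtain g l A t where *: "\<And>n::nat. real n + 1 \<le> l n" "\<And>n. geodesic X d (g n) (l n)" "\<And>n. A n \<in> \<A>"
    "\<And>n. g n 0 \<in> nbhd X d (\<rho> * l n) (A n)" "\<And>n. g n (l n) \<in> nbhd X d (\<rho> * l n) (A n)"
    "\<And>n. t n \<in> {\<rho> * l n..l n - \<rho> * l n}" "\<And>n. g n (t n) \<notin> nbhd X d (\<eta> * l n) (A n)" by metis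
  have l: "real n \<le> l n" "0 < l n" for n using *(1)[of n] by linarith+
  have r: "t n \<in> {0..l n}" "0 \<in> {0..l n}" "l n \<in> {0..l n}" for n
    using *(6)[of n] l(2)[of n] \<rho> mult_pos_pos[OF \<rho>(1) l(2)[of n]] by auto
  have gX: "g n 0 \<in> X" "g n (l n) \<in> X" "g n (t n) \<in> X" for n using geodesic_in[OF *(2)] r by blast+
  have dl: "d (g n 0) (g n (l n)) = l n" for n using geodesic_dist[OF *(2) r(2,3)] l(2)[of n] by simp
  interpret E: atg_cone X d \<omega> "\<lambda>n. g n 0" l \<A> by (rule atg_cone[OF gX(1) l(2) filterlim_ge_nat[OF l(1)]])
  have AX: "A n \<subseteq> X" for n using * coll_sub by auto
  obtain a where a: "\<And>n. a n \<in> A n" "\<And>n. d (g n 0) (a n) < \<rho> * l n" using *(4) unfolding nbhd_iff by metis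
  obtain b where b: "\<And>n. b n \<in> A n" "\<And>n. d (g n (l n)) (b n) < \<rho> * l n" using *(5) unfolding nbhd_iff by metis
  have V: "(\<lambda>n. g n 0) \<in> E.V" "(\<lambda>n. g n (l n)) \<in> E.V"
    by (rule E.base_V) (rule E.V_near[OF E.base_V, where B = 1], use gX dl in auto)
  have aV: "a \<in> E.V" by (rule E.V_near[OF V(1), where B = \<rho>]) (use a AX in \<open>auto intro!: always_eventually less_imp_le\<close>)
  have bV: "b \<in> E.V" by (rule E.V_near[OF V(2), where B = \<rho>]) (use b AX in \<open>auto intro!: always_eventually less_imp_le\<close>)
  have ab: "E.pt a \<in> E.lims A" "E.pt b \<in> E.lims A"
    unfolding limit_set_def E.pt_def using aV bV a b by (auto intro!: always_eventually)
  let ?S = "{E.pt (\<lambda>n. g n (\<tau> n)) |\<tau>. \<forall>n. \<tau> n \<in> {0..l n}}"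
  have S: "geo_seg E.C E.D ?S (E.pt (\<lambda>n. g n 0)) (E.pt (\<lambda>n. g n (l n)))"
    by (rule E.lseg_geo_seg[OF E.lseg_between[OF *(2)]]) (use V l in \<open>auto intro: less_imp_le\<close>)
  have tV: "(\<lambda>n. g n (t n)) \<in> E.V" by (rule E.lseg_seq_V[OF *(2) V r(1)])
  have D1: "E.D (E.pt (\<lambda>n. g n 0)) (E.pt (\<lambda>n. g n (l n))) = 1"
    by (rule E.D_eqI[OF V]) (use l dl in \<open>simp add: less_imp_neq[symmetric]\<close>)
  have Dt: "d (g n 0) (g n (t n)) = t n" for n using geodesic_dist[OF *(2) r(2,1)] r(1)[of n] by simp
  have "E.pt (\<lambda>n. g n (t n)) \<in> E.lims A"
  proof (rule E.Pc.mid_in_good[OF E.lims_good[OF *(3) ab(1)] S ab])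
    show "E.D (E.pt (\<lambda>n. g n 0)) (E.pt a) \<le> \<rho>"
      by (rule E.D_leI[OF _ V(1) aV]) (use a in \<open>auto intro!: always_eventually less_imp_le\<close>)
    show "E.D (E.pt (\<lambda>n. g n (l n))) (E.pt b) \<le> \<rho>"
      by (rule E.D_leI[OF _ V(2) bV]) (use b in \<open>auto intro!: always_eventually less_imp_le\<close>)
    show "2 * \<rho> < E.D (E.pt (\<lambda>n. g n 0)) (E.pt (\<lambda>n. g n (l n)))" unfolding D1 using \<rho> by simp
    show "E.pt (\<lambda>n. g n (t n)) \<in> ?S" using r(1) by blast
    show "\<rho> \<le> E.D (E.pt (\<lambda>n. g n 0)) (E.pt (\<lambda>n. g n (t n)))"
      by (rule E.D_geI[OF _ V(1) tV]) (use *(6) Dt in \<open>auto intro!: always_eventually\<close>)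
    show "E.D (E.pt (\<lambda>n. g n 0)) (E.pt (\<lambda>n. g n (t n))) \<le> E.D (E.pt (\<lambda>n. g n 0)) (E.pt (\<lambda>n. g n (l n))) - \<rho>"
      unfolding D1 by (rule E.D_leI[OF _ V(1) tV]) (use *(6) Dt in \<open>auto intro!: always_eventually simp: algebra_simps\<close>)
  qed
  then have "eventually (\<lambda>n. g n (t n) \<in> nbhd X d (\<eta> * l n) (A n)) \<omega>"
    using E.lims_iff[where A = A, OF tV AX] \<eta> by blast
  then have "eventually (\<lambda>n. False) \<omega>" using *(7) by simp
  then show False by simp
qed

text \<open>A point of the geodesic at maximal distance from \<open>A\<close>, up to a penalty of slope \<open>1/6\<close>, is the
  midpoint of a segment of length \<open>10\<delta>\<close> that stays within \<open>2\<delta>\<close> of \<open>A\<close>, where \<open>\<delta>\<close> is its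
  distance to \<open>A\<close>. This contradicts \<open>middle_near\<close> unless \<open>\<delta>\<close> is bounded.\<close>

lemma middle_third_near:
  "\<exists>\<epsilon>>0. \<exists>M\<ge>0. \<forall>g l. \<forall>A\<in>\<A>. geodesic X d g l \<and> g 0 \<in> nbhd X d (\<epsilon> * l) A \<and> g l \<in> nbhd X d (\<epsilon> * l) A \<longrightarrow>
       g ` {l / 3..2 * l / 3} \<subseteq> nbhd X d M A"
proof -
  \<comment> \<open>For the whole geodesic: it stays within \<open>1/50 * l\<close> of
    \<open>A\<close>, so a segment of length \<open>10 * \<delta>\<close> about the maximum fits
    into it.\<close>
  obtain L1 where L1: "L1 > 0" "\<And>g l A t. L1 \<le> l \<Longrightarrow> geodesic X d g l \<Longrightarrow> A \<in> \<A> \<Longrightarrow> g 0 \<in> nbhd X d (1/100 * l) A \<Longrightarrow>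
    g l \<in> nbhd X d (1/100 * l) A \<Longrightarrow> t \<in> {1/100 * l..l - 1/100 * l} \<Longrightarrow> g t \<in> nbhd X d (1/50 * l) A"
    using middle_near[of "1/100" "1/50"] by auto
  \<comment> \<open>For the segment of length \<open>10 * \<delta>\<close>: ends within
    \<open>2 * \<delta>\<close> of \<open>A\<close> force the midpoint to be within less than
    \<open>\<delta>\<close>.\<close>
  obtain L2 where L2: "L2 > 0" "\<And>g l A t. L2 \<le> l \<Longrightarrow> geodesic X d g l \<Longrightarrow> A \<in> \<A> \<Longrightarrow> g 0 \<in> nbhd X d (1/5 * l) A \<Longrightarrow>
    g l \<in> nbhd X d (1/5 * l) A \<Longrightarrow> t \<in> {1/5 * l..l - 1/5 * l} \<Longrightarrow> g t \<in> nbhd X d (1/10 * l) A"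
    using middle_near[of "1/5" "1/10"] by auto
  \<comment> \<open>A point at distance \<open>M\<close> makes the geodesic longer than
    \<open>L1\<close> and the segment longer than \<open>L2\<close>.\<close>
  define M where "M = L1 + L2"
  have "g ` {l / 3..2 * l / 3} \<subseteq> nbhd X d M A"
    if A: "A \<in> \<A>" and g: "geodesic X d g l" and g0: "g 0 \<in> nbhd X d (1/100 * l) A" and gl: "g l \<in> nbhd X d (1/100 * l) A" for g l A
  proof (rule image_subsetI, rule ccontr)
    fix t0 assume t0: "t0 \<in> {l/3..2*l/3}" and far: "g t0 \<notin> nbhd X d M A"
    have AX: "A \<subseteq> X" and Ane: "A \<noteq> {}" using coll_sub[OF A] g0 unfolding nbhd_iff by auto
    have l0: "0 \<le> l" by (rule geodesic_nonneg[OF g])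
    have gX: "g t \<in> X" if "t \<in> {0..l}" for t by (rule geodesic_in[OF g that])
    define f where "f t = dist_to (g t) A" for t
    have fn: "g t \<in> nbhd X d r A \<longleftrightarrow> f t < r" if "t \<in> {0..l}" for t r
      unfolding f_def by (rule nbhd_iff_dist_to[OF gX[OF that] Ane])
    have f_lip: "f t \<le> \<bar>t - u\<bar> + f u" if "t \<in> {0..l}" "u \<in> {0..l}" for t u
      using dist_to_triangle[OF gX[OF that(1)] gX[OF that(2)] AX Ane] geodesic_dist[OF g that] unfolding f_def by simp
    have t0l: "t0 \<in> {0..l}" using t0 l0 by auto
    have ft0: "M \<le> f t0" using far fn[OF t0l] by auto
    have e: "f 0 < 1/100 * l" "f l < 1/100 * l" using g0 gl fn[of 0] fn[of l] l0 by auto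
    have "L1 \<le> l"
    proof (rule ccontr)
      assume "\<not> ?thesis"
      then show False using f_lip[OF t0l, of 0] e t0 l0 ft0 L2(1) unfolding M_def by auto
    qed
    have small: "f t < 1/50 * l" if t: "t \<in> {0..l}" for t
    proof -
      consider "t < 1/100 * l" | "t > l - 1/100 * l" | "t \<in> {1/100 * l..l - 1/100 * l}" by fastforce
      then show ?thesis
      proof cases
        case 1 then show ?thesis using f_lip[OF t, of 0] e t l0 by auto
      next
        case 2 then show ?thesis using f_lip[OF t, of l] e t l0 by auto
      next
        case 3 then show ?thesis using L1(2)[OF \<open>L1 \<le> l\<close> g A g0 gl 3] fn[OF t] by simp
      qed
    qed
    \<comment> \<open>The slope keeps the maximum within \<open>6 * \<delta>\<close> of
      \<open>t0\<close>, and lets \<open>f\<close> exceed \<open>\<delta>\<close> by at most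
      \<open>5/6 * \<delta>\<close> at parameters within \<open>5 * \<delta>\<close> of it.\<close>
    define \<phi> where "\<phi> t = f t - \<bar>t - t0\<bar> / 6" for t
    have "2-lipschitz_on {0..l} \<phi>"
    proof (rule lipschitz_onI)
      fix t u assume *: "t \<in> {0..l}" "u \<in> {0..l}"
      show "dist (\<phi> t) (\<phi> u) \<le> 2 * dist t u"
      proof -
        have "\<bar>u - t0\<bar> \<le> \<bar>t - u\<bar> + \<bar>t - t0\<bar>" "\<bar>t - t0\<bar> \<le> \<bar>t - u\<bar> + \<bar>u - t0\<bar>" "\<bar>u - t\<bar> = \<bar>t - u\<bar>" "0 \<le> \<bar>t - u\<bar>"
          by arith+
        then have "\<phi> t - \<phi> u \<le> 2 * \<bar>t - u\<bar>" "\<phi> u - \<phi> t \<le> 2 * \<bar>t - u\<bar>"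
          using f_lip[OF *] f_lip[OF *(2,1)] unfolding \<phi>_def by linarith+
        then show ?thesis unfolding dist_real_def by linarith
      qed
    qed simp
    then have "continuous_on {0..l} \<phi>" by (rule lipschitz_on_continuous_on)
    then obtain t where t: "t \<in> {0..l}" "\<And>u. u \<in> {0..l} \<Longrightarrow> \<phi> u \<le> \<phi> t"
      using continuous_attains_sup[OF compact_Icc[of 0 l] _ ] l0 by force
    define \<delta> where "\<delta> = f t"
    have \<delta>: "M + \<bar>t - t0\<bar> / 6 \<le> \<delta>" using t(2)[OF t0l] ft0 unfolding \<phi>_def \<delta>_def by simp
    define w where "w = \<bar>t - t0\<bar>"
    have w: "0 \<le> w" "M + w / 6 \<le> \<delta>" using \<delta> unfolding w_def by simp_all
    have "0 < M" using L1(1) L2(1) unfolding M_def by simp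
    then have "M \<le> \<delta>" "0 < \<delta>" "w \<le> 6 * \<delta>" using w by linarith+
    moreover have "\<delta> < 1/50 * l" using small[OF t(1)] unfolding \<delta>_def .
    ultimately have \<delta>pos: "M \<le> \<delta>" "0 < \<delta>" "\<bar>t - t0\<bar> \<le> 6 * \<delta>" "\<delta> < 1/50 * l" unfolding w_def by simp_all
    have in0: "0 \<le> t - 5 * \<delta>" "t + 5 * \<delta> \<le> l" using \<delta>pos t0 by auto
    have f2: "f u < 2 * \<delta>" if "u \<in> {0..l}" "\<bar>u - t\<bar> \<le> 5 * \<delta>" for u
    proof -
      have arith: "fu < 2 * \<delta>" if "fu - a / 6 \<le> \<delta> - b / 6" "a \<le> c + b" "c \<le> 5 * \<delta>" for fu a b c :: real
        using that \<delta>pos(2) by linarith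
      show ?thesis
      proof (rule arith)
        show "f u - \<bar>u - t0\<bar> / 6 \<le> \<delta> - \<bar>t - t0\<bar> / 6" using t(2)[OF that(1)] unfolding \<phi>_def \<delta>_def .
        show "\<bar>u - t0\<bar> \<le> \<bar>u - t\<bar> + \<bar>t - t0\<bar>" by arith
      qed (rule that(2))
    qed
    define h where "h u = g ((t - 5 * \<delta>) + u)" for u
    have h: "geodesic X d h (10 * \<delta>)"
    proof -
      have "geodesic X d h ((t + 5 * \<delta>) - (t - 5 * \<delta>))"
        unfolding h_def by (rule geodesic_shift[OF g]) (use in0 \<delta>pos in auto)
      then show ?thesis by simp
    qed
    have "h (5 * \<delta>) \<in> nbhd X d (1/10 * (10 * \<delta>)) A"
    proof (rule L2(2)[OF _ h A])
      show "L2 \<le> 10 * \<delta>" using \<delta>pos L1 unfolding M_def by linarith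
      have "t - 5 * \<delta> \<in> {0..l}" "t + 5 * \<delta> \<in> {0..l}" using in0 \<delta>pos by auto
      moreover have "1/5 * (10 * \<delta>) = 2 * \<delta>" by simp
      ultimately show "h 0 \<in> nbhd X d (1/5 * (10 * \<delta>)) A" "h (10 * \<delta>) \<in> nbhd X d (1/5 * (10 * \<delta>)) A"
        unfolding h_def using fn[of "t - 5 * \<delta>" "2*\<delta>"] fn[of "t + 5 * \<delta>" "2*\<delta>"] f2[of "t - 5 * \<delta>"] f2[of "t + 5 * \<delta>"] \<delta>pos
        by (auto simp: algebra_simps)
    qed (use \<delta>pos in auto)
    then have "f t < \<delta>" using fn[OF t(1), of \<delta>] unfolding h_def by simp
    then show False unfolding \<delta>_def by simp
  qed
  moreover have "M \<ge> 0" unfolding M_def using L1 L2 by simp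
  ultimately show ?thesis by (intro exI[of _ "1/100"] conjI exI[of _ M]) auto
qed

end

section \<open>Linked geodesics and change of scale\<close>

text \<open>A point \<open>p u\<close> off the neighborhood forces \<open>p (3/2 * u)\<close> off
  it, because \<open>u\<close> ends the middle third of the initial part of length
  \<open>3/2 * u\<close>. The iterates grow geometrically and run out of the geodesic.\<close>

lemma (in Metric_space) quasi_convex:
  assumes \<epsilon>: "\<epsilon> > 0" and M: "M' \<ge> 0"
    and \<beta>2: "\<forall>g l. \<forall>A\<in>\<A>. geodesic M d g l \<and> g 0 \<in> nbhd M d (\<epsilon> * l) A \<and> g l \<in> nbhd M d (\<epsilon> * l) A \<longrightarrow>
       g ` {l / 3..2 * l / 3} \<subseteq> nbhd M d M' A"
    and p: "geodesic M d p l" and A: "A \<in> \<A>" and E: "M' \<le> E" "p 0 \<in> nbhd M d E A" "p l \<in> nbhd M d (\<epsilon> * l) A"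
    and t: "E \<le> \<epsilon> * t" "0 < t" "t \<le> 2 * l / 3"
  shows "p t \<in> nbhd M d M' A"
proof (rule ccontr)
  assume bad: "p t \<notin> nbhd M d M' A"
  have first: "p u \<in> nbhd M d M' A" if u: "t \<le> u" "l / 3 \<le> u" "u \<le> 2 * l / 3" for u
  proof -
    have "t \<le> l" using t by linarith
    then have "\<epsilon> * t \<le> \<epsilon> * l" using \<epsilon> by simp
    then have "E \<le> \<epsilon> * l" using t(1) by linarith
    then have "p 0 \<in> nbhd M d (\<epsilon> * l) A" using nbhd_mono E(2) by blast
    then have "p ` {l / 3..2 * l / 3} \<subseteq> nbhd M d M' A" using \<beta>2 p A E(3) by blast
    then show ?thesis using u by auto
  qed
  have step: "3 / 2 * u \<le> 2 * l / 3 \<and> p (3 / 2 * u) \<notin> nbhd M d M' A"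
    if u: "t \<le> u" "u \<le> 2 * l / 3" "p u \<notin> nbhd M d M' A" for u
  proof (rule conjI)
    show le: "3 / 2 * u \<le> 2 * l / 3"
    proof (rule ccontr)
      assume "\<not> ?thesis"
      then have "l / 3 \<le> u" using t by linarith
      then show False using first[OF u(1) _ u(2)] u(3) by blast
    qed
    show "p (3 / 2 * u) \<notin> nbhd M d M' A"
    proof
      assume "p (3 / 2 * u) \<in> nbhd M d M' A"
      have "t \<le> 3 / 2 * u" using t u by linarith
      then have "\<epsilon> * t \<le> \<epsilon> * (3 / 2 * u)" using \<epsilon> by simp
      then have "E \<le> \<epsilon> * (3 / 2 * u)" using t(1) by linarith
      then have "p 0 \<in> nbhd M d (\<epsilon> * (3 / 2 * u)) A" "p (3 / 2 * u) \<in> nbhd M d (\<epsilon> * (3 / 2 * u)) A"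
        using nbhd_mono E \<open>p (3 / 2 * u) \<in> nbhd M d M' A\<close> by (blast, meson order_trans)
      moreover have "geodesic M d p (3 / 2 * u)"
        using geodesic_shift[OF p, of 0 "3/2*u"] le t u by (simp add: field_simps)
      ultimately have "p ` {(3 / 2 * u) / 3..2 * (3 / 2 * u) / 3} \<subseteq> nbhd M d M' A" using \<beta>2 A by blast
      moreover have "u \<in> {(3 / 2 * u) / 3..2 * (3 / 2 * u) / 3}" using t u by simp
      ultimately show False using u by blast
    qed
  qed
  have pow: "(3/2)^k * t \<le> 2 * l / 3 \<and> p ((3/2)^k * t) \<notin> nbhd M d M' A" for k :: nat
  proof (induction k)
    case 0
    then show ?case using t bad by simp
  next
    case (Suc k)
    have "t \<le> (3/2)^k * t" using t(2) by simp
    from step[OF this] Suc show ?case by (simp add: mult.assoc)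
  qed
  obtain k :: nat where "2 * l / 3 / t < (3/2)^k" using real_arch_pow[of "3/2"] by auto
  then show False using pow[of k] t(2) by (simp add: field_simps)
qed

abbreviation path_at :: "(nat \<Rightarrow> real \<Rightarrow> 'a) \<Rightarrow> (nat \<Rightarrow> real) \<Rightarrow> (nat \<Rightarrow> real) \<Rightarrow> real \<Rightarrow> nat \<Rightarrow> 'a" where
  "path_at p l s t \<equiv> (\<lambda>n. p n (min (l n) (t * s n)))"

text \<open>The parameter is the distance from the common starting point, so it is the same on both
  paths.\<close>

lemma (in cone_space) path_common:
  assumes p: "\<And>n. geodesic X d (p n) (l n)" "(\<lambda>n. p n 0) \<in> V" "eventually (\<lambda>n. c * s n \<le> l n) \<omega>"
    and p': "\<And>n. geodesic X d (p' n) (l' n)" "(\<lambda>n. p' n 0) \<in> V" "eventually (\<lambda>n. c * s n \<le> l' n) \<omega>"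
    and eq: "pt (\<lambda>n. p n 0) = pt (\<lambda>n. p' n 0)" and c: "0 \<le> c"
    and z: "z \<in> (\<lambda>t. pt (path_at p l s t)) ` {0..c}" "z \<in> (\<lambda>t. pt (path_at p' l' s t)) ` {0..c}"
  obtains t where "t \<in> {0..c}" "z = pt (path_at p l s t)" "z = pt (path_at p' l' s t)"
proof -
  have 0: "path_at p l s 0 = (\<lambda>n. p n 0)" "path_at p' l' s 0 = (\<lambda>n. p' n 0)"
    using geodesic_nonneg[OF p(1)] geodesic_nonneg[OF p'(1)] by (simp_all add: min_absorb2)
  obtain t where t: "t \<in> {0..c}" "z = pt (path_at p l s t)" using z by blast
  obtain u where u: "u \<in> {0..c}" "z = pt (path_at p' l' s u)" using z by blast
  have "D (pt (path_at p l s 0)) z = t"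
    unfolding t(2) using geodesic_dist[OF path_geodesic[OF p(1,2) c p(3)], of 0 t] t c by simp
  moreover have "D (pt (path_at p' l' s 0)) z = u"
    unfolding u(2) using geodesic_dist[OF path_geodesic[OF p'(1,2) c p'(3)], of 0 u] u c by simp
  ultimately have "t = u" using eq unfolding 0 by simp
  then show ?thesis using that t u by blast
qed

lemma (in cone_space) path_seg:
  assumes p: "\<And>n. geodesic X d (p n) (l n)" "(\<lambda>n. p n 0) \<in> V" "eventually (\<lambda>n. c * s n \<le> l n) \<omega>" and c: "0 \<le> c"
  shows "geo_seg C D ((\<lambda>t. pt (path_at p l s t)) ` {0..c}) (pt (\<lambda>n. p n 0)) (pt (path_at p l s c))"
proof -
  have "path_at p l s 0 = (\<lambda>n. p n 0)"
    using geodesic_nonneg[OF p(1)] by (simp add: min_absorb2)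
  then show ?thesis
    unfolding geo_seg_def
    by (intro exI[of _ "\<lambda>t. pt (path_at p l s t)"] exI[of _ c] conjI path_geodesic[OF p(1,2) c p(3)]) auto
qed

locale atg_quasi_convex = atg X d \<omega> \<A> for X :: "'a set" and d \<omega> \<A> +
  fixes \<epsilon> M :: real
  assumes \<epsilon>: "0 < \<epsilon>" and M0: "0 \<le> M"
    and \<beta>2: "\<forall>g l. \<forall>A\<in>\<A>. geodesic X d g l \<and> g 0 \<in> nbhd X d (\<epsilon> * l) A \<and> g l \<in> nbhd X d (\<epsilon> * l) A \<longrightarrow>
       g ` {l / 3..2 * l / 3} \<subseteq> nbhd X d M A"
begin

text \<open>\<open>x\<close> is both the base point of the cone and the point to be avoided. The
  cone is spelled out, with its scale as an argument, because the same geodesics are compared at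
  several scales.\<close>

definition cone_linked :: "(nat \<Rightarrow> 'a) \<Rightarrow> (nat \<Rightarrow> real) \<Rightarrow> (nat \<Rightarrow> 'a) \<Rightarrow> (nat \<Rightarrow> 'a) \<Rightarrow> bool" where
  "cone_linked x s u v \<longleftrightarrow> (pieces.link (geo_seg (cone X d \<omega> x s) (cone_dist X d \<omega> x s))
     (limit_set X d \<omega> x s ` piece_seqs d \<A> \<omega> x s) (cone_space.pt X d \<omega> x s x))\<^sup>*\<^sup>*
     (cone_space.pt X d \<omega> x s u) (cone_space.pt X d \<omega> x s v)"

lemma cone_linked_trans: "cone_linked x s u v \<Longrightarrow> cone_linked x s v w \<Longrightarrow> cone_linked x s u w"
  unfolding cone_linked_def by (rule rtranclp_trans)

lemma cone_linked_sym:
  assumes "\<And>n. x n \<in> X" "\<And>n. 0 < s n" "filterlim s at_top \<omega>" "cone_linked x s u v"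
  shows "cone_linked x s v u"
proof -
  interpret E: atg_cone X d \<omega> x s \<A> by (rule atg_cone[OF assms(1-3)])
  show ?thesis using E.Pc.linked_sym assms(4) unfolding cone_linked_def by blast
qed

text \<open>\<open>quasi_convex\<close> across two scales: the start is within a multiple of
  \<open>s' n\<close> of \<open>A n\<close>, the far end within a negligible part of
  \<open>S n\<close>, and in between the distance drops to the constant \<open>M\<close> already at
  scale \<open>s'\<close>.\<close>

lemma near_along:
  assumes p: "\<And>n. geodesic X d (p n) (l n)" and A: "\<And>n. A n \<in> \<A>"
    and start: "eventually (\<lambda>n. p n 0 \<in> nbhd X d (E * s' n) (A n)) \<omega>" and E: "0 < E"
    and s': "\<And>Z. eventually (\<lambda>n. Z \<le> s' n) \<omega>" and S: "\<And>Z. eventually (\<lambda>n. Z * s' n \<le> S n) \<omega>"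
    and m: "0 < m" "eventually (\<lambda>n. m * S n \<le> l n) \<omega>"
    and endp: "\<And>\<eta>. 0 < \<eta> \<Longrightarrow> eventually (\<lambda>n. p n (m * S n) \<in> nbhd X d (\<eta> * S n) (A n)) \<omega>"
    and c: "E / \<epsilon> \<le> c" "0 < c"
  shows "eventually (\<lambda>n. p n (c * s' n) \<in> nbhd X d M (A n)) \<omega>"
  using start s'[of "max 1 (M / E)"] S[of "3 * c / (2 * m)"] m(2) endp[OF mult_pos_pos[OF \<epsilon> m(1)]]
proof eventually_elim
  case (elim n)
  have s0: "0 < s' n" "M / E \<le> s' n" using elim(2) by auto
  have t: "c * s' n \<le> 2 * (m * S n) / 3" using elim(3) m(1) by (simp add: field_simps)
  have pos: "0 < c * s' n" using s0 c by simp
  have "geodesic X d (p n) (m * S n)"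
    using geodesic_shift[OF p, of 0 "m * S n" n] elim(4) t pos by simp
  then show ?case
  proof (rule quasi_convex[OF \<epsilon> M0 \<beta>2 _ A[of n]])
    show "M \<le> E * s' n" using s0 E by (simp add: field_simps)
    show "p n 0 \<in> nbhd X d (E * s' n) (A n)" by (rule elim(1))
    show "p n (m * S n) \<in> nbhd X d (\<epsilon> * (m * S n)) (A n)" using elim(5) \<epsilon> m by (simp add: mult.assoc)
    have "E \<le> \<epsilon> * c" using c \<epsilon> by (simp add: field_simps)
    then show "E * s' n \<le> \<epsilon> * (c * s' n)" using s0 by (simp flip: mult.assoc)
  qed (use t pos in auto)
qed

text \<open>If two geodesics are linked at the large scale \<open>S\<close>, they must be linked at the small
  scale \<open>r\<close>: otherwise they diverge from the start, so at scale \<open>S\<close> they start in a common piece,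
  and their first entries into it are close. The entries occur at distance \<open>dist_to (x n) (A n)\<close>;
  depending on its size this contradicts divergence at that scale, or links them at scale \<open>r\<close>.\<close>

lemma linked_descent_core:
  assumes x: "\<And>n. x n \<in> X" and r: "\<And>n. 0 < r n" "filterlim r at_top \<omega>" and S: "\<And>n. 0 < S n" "\<And>Z. eventually (\<lambda>n. Z * r n \<le> S n) \<omega>"
    and p: "\<And>n. geodesic X d (p n) (l n)" "\<And>n. p n 0 = x n" and p': "\<And>n. geodesic X d (p' n) (l' n)"
    and B: "0 \<le> B" "eventually (\<lambda>n. d (x n) (p' n 0) \<le> B * r n) \<omega>"
    and c: "0 < c" "eventually (\<lambda>n. c * S n \<le> l n) \<omega>" "eventually (\<lambda>n. c * S n \<le> l' n) \<omega>"
    and F: "eventually (\<lambda>n. \<forall>t. K * r n \<le> t \<longrightarrow> t \<le> c * S n \<longrightarrow> t \<le> d (p n t) (p' n t)) \<omega>"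
    and nl: "\<And>a a'. 0 < a \<Longrightarrow> B < a' \<Longrightarrow> \<not> cone_linked x r (path_at p l r a) (path_at p' l' r a')"
    and lS: "cone_linked x S (path_at p l S c) (path_at p' l' S c)"
  shows False
proof -
  have r_ge: "eventually (\<lambda>n. Z \<le> r n) \<omega>" for Z using r(2) unfolding filterlim_at_top by blast
  have "filterlim S at_top \<omega>"
    unfolding filterlim_at_top
  proof
    fix Z show "eventually (\<lambda>n. Z \<le> S n) \<omega>" using r_ge[of Z] S(2)[of 1] by eventually_elim simp
  qed
  then interpret S: atg_cone X d \<omega> x S \<A> by (rule atg_cone[OF x S(1)])
  have p'X: "p' n 0 \<in> X" for n using geodesic_in[OF p'] geodesic_nonneg[OF p'] by simp
  have start': "eventually (\<lambda>n. d (x n) (p' n 0) \<le> \<rho> * s' n) \<omega>" if "\<And>Z. eventually (\<lambda>n. Z * r n \<le> s' n) \<omega>" "0 < \<rho>" for \<rho> s'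
    using B(2) that(1)[of "B / \<rho>"] by eventually_elim (use that(2) in \<open>simp add: field_simps\<close>)
  \<comment> \<open>Being closer to each other than the time elapsed, at a time between
    \<open>K * r n\<close> and \<open>c * S n\<close>, is what \<open>F\<close> forbids.\<close>
  have meet_false: False
    if "eventually (\<lambda>n. d (p n (t * s' n)) (p' n (t * s' n)) < t * s' n) \<omega>"
      "eventually (\<lambda>n. K * r n \<le> t * s' n) \<omega>" "eventually (\<lambda>n. t * s' n \<le> c * S n) \<omega>" for t s'
  proof -
    have "eventually (\<lambda>n. False) \<omega>" using that F by eventually_elim force
    then show False by simp
  qed
  have pV: "(\<lambda>n. p n 0) \<in> S.V" using S.base_V p(2) by simp
  have p'V: "(\<lambda>n. p' n 0) \<in> S.V" by (rule S.V_near[OF S.base_V p'X start'[OF S(2), of 1]]) simp_all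
  have p'x: "S.pt (\<lambda>n. p' n 0) = S.pt x"
    using S.pt_eqI[OF S.base_V p'V start'[OF S(2)]] by simp
  have px: "S.pt (\<lambda>n. p n 0) = S.pt x" using p(2) by simp
  have c0: "0 \<le> c" using c by simp
  define G where "G = (\<lambda>t. S.pt (path_at p l S t))"
  define G' where "G' = (\<lambda>t. S.pt (path_at p' l' S t))"
  have geoG: "geodesic S.C S.D G c" unfolding G_def by (rule S.path_geodesic[OF p(1) pV c0 c(2)])
  have geoG': "geodesic S.C S.D G' c" unfolding G'_def by (rule S.path_geodesic[OF p' p'V c0 c(3)])
  have segG: "geo_seg S.C S.D (G ` {0..t}) (S.pt x) (G t)" if "t \<in> {0..c}" for t
    unfolding G_def px[symmetric]
  proof (rule S.path_seg[OF p(1) pV])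
    show "eventually (\<lambda>n. t * S n \<le> l n) \<omega>" using c(2)
      by eventually_elim (use that S(1) in \<open>meson atLeastAtMost_iff mult_right_mono less_imp_le order_trans\<close>)
  qed (use that in auto)
  have segG': "geo_seg S.C S.D (G' ` {0..t}) (S.pt x) (G' t)" if "t \<in> {0..c}" for t
    unfolding G'_def p'x[symmetric]
  proof (rule S.path_seg[OF p' p'V])
    show "eventually (\<lambda>n. t * S n \<le> l' n) \<omega>" using c(3)
      by eventually_elim (use that S(1) in \<open>meson atLeastAtMost_iff mult_right_mono less_imp_le order_trans\<close>)
  qed (use that in auto)
  have xC: "S.pt x \<in> S.C" by (rule S.pt_in[OF S.base_V])
  have G0: "G 0 = S.pt x" "G' 0 = S.pt x"
    using S.Pc.seg_dist[OF segG[of 0]] S.Pc.seg_ends[OF segG[of 0]] S.Pc.seg_ends[OF segG'[of 0]] c by auto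
  have Gc: "G c \<noteq> S.pt x"
    using geodesic_dist[OF geoG, of 0 c] G0(1) c xC by auto
  have cin: "c \<in> {0..c}" using c0 by simp
  have lG: "S.Pc.linked (S.pt x) (G c) (G' c)" using lS unfolding cone_linked_def G_def G'_def .
  have germs: "(\<exists>u. u \<noteq> S.pt x \<and> u \<in> G ` {0..c} \<and> u \<in> G' ` {0..c}) \<or>
    (\<exists>Q\<in>S.lims ` S.seqs. S.pt x \<in> Q \<and> (\<exists>u\<in>G ` {0..c} \<inter> Q. u \<noteq> S.pt x) \<and> (\<exists>u\<in>G' ` {0..c} \<inter> Q. u \<noteq> S.pt x))"
    by (rule S.Pc.linked_germs[OF segG[OF cin] segG'[OF cin] Gc lG])
  from germs show False
  proof
    assume "\<exists>u. u \<noteq> S.pt x \<and> u \<in> G ` {0..c} \<and> u \<in> G' ` {0..c}"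
    then obtain u where meet: "u \<noteq> S.pt x" "u \<in> G ` {0..c}" "u \<in> G' ` {0..c}" by (elim exE conjE)
    have "S.pt (\<lambda>n. p n 0) = S.pt (\<lambda>n. p' n 0)" using px p'x by simp
    then obtain t where "t \<in> {0..c}" "u = S.pt (path_at p l S t)" "u = S.pt (path_at p' l' S t)"
      by (rule S.path_common[OF p(1) pV c(2) p' p'V c(3) _ c0 meet(2,3)[unfolded G_def G'_def]])
    then have t: "t \<in> {0..c}" "u = G t" "u = G' t" unfolding G_def G'_def by blast+
    have "t \<noteq> 0" using t meet G0 by auto
    then have t0: "0 < t" using t by simp
    have V: "path_at p l S t \<in> S.V" "path_at p' l' S t \<in> S.V" using S.path_seq_V[OF p(1) pV] S.path_seq_V[OF p' p'V] t0 by auto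
    have "S.pt (path_at p l S t) = S.pt (path_at p' l' S t)" using t unfolding G_def G'_def by simp
    note tt = S.pt_eqD[OF this V t0]
    have tc: "t \<le> c" using t by simp
    have "eventually (\<lambda>n. d (p n (t * S n)) (p' n (t * S n)) < t * S n) \<omega>"
      using tt S.path_ev[OF c(2) tc] S.path_ev[OF c(3) tc] by eventually_elim simp
    then show False
    proof (rule meet_false)
      show "eventually (\<lambda>n. K * r n \<le> t * S n) \<omega>"
        using S(2)[of "K / t"] by eventually_elim (use t0 in \<open>simp add: field_simps\<close>)
      show "eventually (\<lambda>n. t * S n \<le> c * S n) \<omega>" using t S(1) by (auto intro!: always_eventually mult_right_mono less_imp_le)
    qed
  next
    assume "\<exists>Q\<in>S.lims ` S.seqs. S.pt x \<in> Q \<and> (\<exists>u\<in>G ` {0..c} \<inter> Q. u \<noteq> S.pt x) \<and> (\<exists>u\<in>G' ` {0..c} \<inter> Q. u \<noteq> S.pt x)"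
    then obtain Q where Q: "Q \<in> S.lims ` S.seqs" "S.pt x \<in> Q" "\<exists>u\<in>G ` {0..c} \<inter> Q. u \<noteq> S.pt x" "\<exists>u\<in>G' ` {0..c} \<inter> Q. u \<noteq> S.pt x"
      by (elim bexE conjE) blast
    obtain u where u: "u \<in> G ` {0..c} \<inter> Q" "u \<noteq> S.pt x" using Q(3) by (elim bexE)
    obtain u' where u': "u' \<in> G' ` {0..c} \<inter> Q" "u' \<noteq> S.pt x" using Q(4) by (elim bexE)
    note piece = Q(1,2) IntD1[OF u(1)] IntD2[OF u(1)] u(2) IntD1[OF u'(1)] IntD2[OF u'(1)] u'(2)
    obtain A where A: "A \<in> S.seqs" "Q = S.lims A" using piece by blast
    have A\<A>: "A n \<in> \<A>" for n using S.seqs_coll A by blast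
    have AX: "A n \<subseteq> X" for n using coll_sub A\<A> by blast
    obtain t1 where t1: "t1 \<in> {0..c}" "u = G t1" using piece by blast
    obtain t2 where t2: "t2 \<in> {0..c}" "u' = G' t2" using piece by blast
    \<comment> \<open>A common positive time at which both limit geodesics are still in the piece,
      by convexity.\<close>
    define m where "m = min t1 t2"
    have m: "0 < m" "m \<le> c" "m \<in> {0..t1}" "m \<in> {0..t2}"
    proof -
      have "t1 \<noteq> 0" "t2 \<noteq> 0" using t1(2) t2(2) piece(5,8) G0 by metis+
      then show "0 < m" "m \<le> c" "m \<in> {0..t1}" "m \<in> {0..t2}" using t1(1) t2(1) unfolding m_def by auto
    qed
    have "G ` {0..t1} \<subseteq> Q"
      by (rule S.Pc.piece_convex[OF piece(1) segG[OF t1(1)] piece(2) piece(4)[unfolded t1(2)]])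
    then have "G m \<in> S.lims A" using m(3) A(2) by auto
    have "G' ` {0..t2} \<subseteq> Q"
      by (rule S.Pc.piece_convex[OF piece(1) segG'[OF t2(1)] piece(2) piece(7)[unfolded t2(2)]])
    then have "G' m \<in> S.lims A" using m(4) A(2) by auto
    have mS: "eventually (\<lambda>n. m * S n \<le> l n) \<omega>" "eventually (\<lambda>n. m * S n \<le> l' n) \<omega>"
    proof -
      show "eventually (\<lambda>n. m * S n \<le> l n) \<omega>" using S.path_ev[OF c(2) m(2)] by eventually_elim linarith
      show "eventually (\<lambda>n. m * S n \<le> l' n) \<omega>" using S.path_ev[OF c(3) m(2)] by eventually_elim linarith
    qed
    have Vm: "path_at p l S m \<in> S.V" "path_at p' l' S m \<in> S.V"
      using S.path_seq_V[OF p(1) pV] S.path_seq_V[OF p' p'V] m by auto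
    have endp: "eventually (\<lambda>n. p n (m * S n) \<in> nbhd X d (\<eta> * S n) (A n)) \<omega>" if "0 < \<eta>" for \<eta>
    proof -
      have "eventually (\<lambda>n. p n (min (l n) (m * S n)) \<in> nbhd X d (\<eta> * S n) (A n)) \<omega>"
        using \<open>G m \<in> S.lims A\<close> that unfolding G_def S.lims_iff[where A = A, OF Vm(1) AX] by blast
      then show ?thesis using S.path_ev[OF c(2) m(2)] by eventually_elim simp
    qed
    have endp': "eventually (\<lambda>n. p' n (m * S n) \<in> nbhd X d (\<eta> * S n) (A n)) \<omega>" if "0 < \<eta>" for \<eta>
    proof -
      have "eventually (\<lambda>n. p' n (min (l' n) (m * S n)) \<in> nbhd X d (\<eta> * S n) (A n)) \<omega>"
        using \<open>G' m \<in> S.lims A\<close> that unfolding G'_def S.lims_iff[where A = A, OF Vm(2) AX] by blast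
      then show ?thesis using S.path_ev[OF c(3) m(2)] by eventually_elim simp
    qed
    have nearx: "eventually (\<lambda>n. x n \<in> nbhd X d (\<eta> * S n) (A n)) \<omega>" if "0 < \<eta>" for \<eta>
      using piece(2) that unfolding A S.lims_iff[where A = A, OF S.base_V AX] by blast
    have Ane: "eventually (\<lambda>n. A n \<noteq> {}) \<omega>"
      using nearx[OF zero_less_one] by eventually_elim (auto simp: nbhd_iff)
    define \<delta> where "\<delta> n = dist_to (x n) (A n)" for n
    have n\<delta>: "eventually (\<lambda>n. \<forall>q. x n \<in> nbhd X d q (A n) \<longleftrightarrow> \<delta> n < q) \<omega>"
      using Ane by eventually_elim (simp add: nbhd_iff_dist_to[OF x] \<delta>_def)
    show False
    \<comment> \<open>Either \<open>x\<close> is within a multiple of \<open>r\<close> of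
      \<open>A\<close>, and both geodesics are near \<open>A\<close> already at scale
      \<open>r\<close>; or the distance to \<open>A\<close> is itself a scale strictly between
      \<open>r\<close> and \<open>S\<close>.\<close>
    proof (cases "\<exists>B2. eventually (\<lambda>n. \<delta> n \<le> B2 * r n) \<omega>")
      case True
      then obtain B2 where B2: "eventually (\<lambda>n. \<delta> n \<le> B2 * r n) \<omega>" by blast
      define E where "E = max B2 0 + 1 + B"
      have E0: "0 < E" unfolding E_def using B by simp
      have near1: "eventually (\<lambda>n. x n \<in> nbhd X d ((max B2 0 + 1) * r n) (A n)) \<omega>"
        using B2 n\<delta>
      proof eventually_elim
        case (elim n)
        have "B2 * r n \<le> max B2 0 * r n" using r(1)[of n] by simp
        moreover have "(max B2 0 + 1) * r n = max B2 0 * r n + r n" by (simp add: distrib_right)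
        ultimately have "\<delta> n < (max B2 0 + 1) * r n" using elim(1) r(1)[of n] by linarith
        then show ?case using elim by blast
      qed
      have st: "eventually (\<lambda>n. p n 0 \<in> nbhd X d (E * r n) (A n)) \<omega>"
        using near1
      proof eventually_elim
        case (elim n)
        have "(max B2 0 + 1) * r n \<le> E * r n" unfolding E_def using B r(1)[of n] by simp
        then show ?case using elim nbhd_mono p(2) by metis
      qed
      have st': "eventually (\<lambda>n. p' n 0 \<in> nbhd X d (E * r n) (A n)) \<omega>"
        using near1 B(2)
      proof eventually_elim
        case (elim n)
        have "p' n 0 \<in> nbhd X d ((max B2 0 + 1) * r n + B * r n) (A n)"
          by (rule nbhd_triangle[OF elim(1) p'X elim(2) AX])
        then show ?case unfolding E_def by (simp add: distrib_right)
      qed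
      \<comment> \<open>At least \<open>E / \<epsilon>\<close> for \<open>near_along\<close>, and
        beyond \<open>B\<close> so that the point of \<open>p'\<close> differs from \<open>x\<close>
        although \<open>p'\<close> may start \<open>B * r n\<close> away from it.\<close>
      define b where "b = max (E / \<epsilon>) (B + 1)"
      have b: "E / \<epsilon> \<le> b" "B < b" "0 < b" unfolding b_def using B E0 \<epsilon> by auto
      have nM: "eventually (\<lambda>n. p n (b * r n) \<in> nbhd X d M (A n)) \<omega>"
        by (rule near_along[OF p(1) A\<A> st E0 r_ge S(2) m(1) mS(1) endp b(1,3)])
      have nM': "eventually (\<lambda>n. p' n (b * r n) \<in> nbhd X d M (A n)) \<omega>"
        by (rule near_along[OF p' A\<A> st' E0 r_ge S(2) m(1) mS(2) endp' b(1,3)])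
      interpret R: atg_cone X d \<omega> x r \<A> by (rule atg_cone[OF x r])
      have long: "eventually (\<lambda>n. b * r n \<le> l n) \<omega>" "eventually (\<lambda>n. b * r n \<le> l' n) \<omega>"
        using S(2)[of "b / m"] mS by (eventually_elim, use m in \<open>simp add: field_simps\<close>)+
      have RV: "(\<lambda>n. p n 0) \<in> R.V" "(\<lambda>n. p' n 0) \<in> R.V"
        using R.base_V p(2) R.V_near[OF R.base_V p'X B(2)] by simp_all
      have bV: "path_at p l r b \<in> R.V" "path_at p' l' r b \<in> R.V"
        using R.path_seq_V[OF p(1) RV(1)] R.path_seq_V[OF p' RV(2)] b by auto
      have "eventually (\<lambda>n. path_at p l r b n \<in> nbhd X d M (A n)) \<omega>"
        using nM R.path_ev[OF long(1) order_refl] by eventually_elim simp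
      then have in1: "R.pt (path_at p l r b) \<in> R.lims A" by (rule R.lims_constI[where A = A, OF bV(1) AX])
      have "eventually (\<lambda>n. path_at p' l' r b n \<in> nbhd X d M (A n)) \<omega>"
        using nM' R.path_ev[OF long(2) order_refl] by eventually_elim simp
      then have in2: "R.pt (path_at p' l' r b) \<in> R.lims A" by (rule R.lims_constI[where A = A, OF bV(2) AX])
      have "b \<le> R.D (R.pt x) (R.pt (path_at p l r b))"
      proof (rule R.D_geI[OF _ R.base_V bV(1)])
        show "eventually (\<lambda>n. b * r n \<le> d (x n) (path_at p l r b n)) \<omega>"
          using long(1)
        proof eventually_elim
          case (elim n)
          have "0 \<le> b * r n" using b r(1)[of n] by simp
          then have "d (p n 0) (p n (b * r n)) = b * r n" using geodesic_dist[OF p(1)[of n], of 0 "b * r n"] elim by simp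
          then show ?case using p(2)[of n] elim by (simp add: min_absorb2)
        qed
      qed
      then have ne1: "R.pt (path_at p l r b) \<noteq> R.pt x" using b R.pt_in[OF R.base_V] by auto
      have "b - B \<le> R.D (R.pt x) (R.pt (path_at p' l' r b))"
      proof (rule R.D_geI[OF _ R.base_V bV(2)])
        show "eventually (\<lambda>n. (b - B) * r n \<le> d (x n) (path_at p' l' r b n)) \<omega>"
          using long(2) B(2)
        proof eventually_elim
          case (elim n)
          have "0 \<le> b * r n" using b r(1)[of n] by simp
          then have in': "0 \<in> {0..l' n}" "b * r n \<in> {0..l' n}" using elim by auto
          have "b * r n = d (p' n 0) (p' n (b * r n))" using geodesic_dist[OF p' in'] \<open>0 \<le> b * r n\<close> by simp
          also have "\<dots> \<le> d (p' n 0) (x n) + d (x n) (p' n (b * r n))"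
            using geodesic_in[OF p' in'(1)] geodesic_in[OF p' in'(2)] x by (intro triangle)
          finally show ?case using elim commute[of "p' n 0" "x n"] by (simp add: min_absorb2 left_diff_distrib)
        qed
      qed
      then have ne2: "R.pt (path_at p' l' r b) \<noteq> R.pt x" using b R.pt_in[OF R.base_V] by auto
      have "cone_linked x r (path_at p l r b) (path_at p' l' r b)"
        unfolding cone_linked_def by (rule R.Pc.linked_piece[OF R.lims_piece[OF A\<A> in1] in1 in2 ne1 ne2])
      then show False using nl b by blast
    next
      case False
      then have big: "eventually (\<lambda>n. Z * r n < \<delta> n) \<omega>" for Z
      proof -
        have "\<not> eventually (\<lambda>n. \<delta> n \<le> Z * r n) \<omega>" using False by simp
        then have "eventually (\<lambda>n. \<not> \<delta> n \<le> Z * r n) \<omega>" by (simp only: ev_not)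
        then show ?thesis by eventually_elim simp
      qed
      \<comment> \<open>The maximum makes the scale positive for every \<open>n\<close>; almost
        surely it is \<open>\<delta> n\<close>.\<close>
      define s' where "s' n = max 1 (\<delta> n)" for n
      have s'pos: "0 < s' n" for n unfolding s'_def by simp
      have s'\<delta>: "eventually (\<lambda>n. s' n = \<delta> n) \<omega>"
        using big[of 1] r_ge[of 1] by eventually_elim (simp add: s'_def)
      have s'r: "eventually (\<lambda>n. Z * r n \<le> s' n) \<omega>" for Z
        using big[of Z] by eventually_elim (simp add: s'_def)
      have s'_ge: "eventually (\<lambda>n. Z \<le> s' n) \<omega>" for Z
        using s'r[of 1] r_ge[of Z] by eventually_elim simp
      have Ss': "eventually (\<lambda>n. Z * s' n \<le> S n) \<omega>" for Z
      proof -
        have z: "0 < 1 / (\<bar>Z\<bar> + 1)" by simp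
        show ?thesis
          using nearx[OF z] n\<delta> s'\<delta>
        proof eventually_elim
          case (elim n)
          then have "\<delta> n < 1 / (\<bar>Z\<bar> + 1) * S n" by blast
          then have "(\<bar>Z\<bar> + 1) * \<delta> n < S n" by (simp add: field_simps)
          moreover have "Z * s' n \<le> (\<bar>Z\<bar> + 1) * s' n" using s'pos[of n] by (intro mult_right_mono) auto
          ultimately show ?case using elim by simp
        qed
      qed
      have "filterlim s' at_top \<omega>" unfolding filterlim_at_top using s'_ge by blast
      then interpret T: atg_cone X d \<omega> x s' \<A> by (rule atg_cone[OF x s'pos])
      have st: "eventually (\<lambda>n. p n 0 \<in> nbhd X d (2 * s' n) (A n)) \<omega>"
        using n\<delta> s'\<delta>
      proof eventually_elim
        case (elim n)
        have "\<delta> n < 2 * s' n" using elim s'pos[of n] by simp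
        then show ?case using elim p(2) by simp
      qed
      have st': "eventually (\<lambda>n. p' n 0 \<in> nbhd X d (3 * s' n) (A n)) \<omega>"
        using st start'[OF s'r zero_less_one]
      proof eventually_elim
        case (elim n)
        have "p' n 0 \<in> nbhd X d (2 * s' n + 1 * s' n) (A n)"
          by (rule nbhd_triangle[OF elim(1) p'X _ AX]) (use elim p(2) in simp)
        then show ?case by simp
      qed
      have st: "eventually (\<lambda>n. p n 0 \<in> nbhd X d (3 * s' n) (A n)) \<omega>"
        using st by eventually_elim (rule nbhd_mono, use s'pos in \<open>auto intro: less_imp_le\<close>)
      define b where "b = 3 / \<epsilon>"
      have b: "3 / \<epsilon> \<le> b" "0 < b" "0 \<le> b" unfolding b_def using \<epsilon> by auto
      have nM: "eventually (\<lambda>n. p n (b * s' n) \<in> nbhd X d M (A n)) \<omega>"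
        by (rule near_along[OF p(1) A\<A> st _ s'_ge Ss' m(1) mS(1) endp b(1,2)]) simp
      have nM': "eventually (\<lambda>n. p' n (b * s' n) \<in> nbhd X d M (A n)) \<omega>"
        by (rule near_along[OF p' A\<A> st' _ s'_ge Ss' m(1) mS(2) endp' b(1,2)]) simp
      have long: "eventually (\<lambda>n. b * s' n \<le> l n) \<omega>" "eventually (\<lambda>n. b * s' n \<le> l' n) \<omega>"
        using Ss'[of "b / m"] mS by (eventually_elim, use m in \<open>simp add: field_simps\<close>)+
      have TV: "(\<lambda>n. p n 0) \<in> T.V" "(\<lambda>n. p' n 0) \<in> T.V"
        using T.base_V p(2) T.V_near[OF T.base_V p'X start'[OF s'r zero_less_one]] by simp_all
      have bV: "path_at p l s' b \<in> T.V" "path_at p' l' s' b \<in> T.V"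
        using T.path_seq_V[OF p(1) TV(1)] T.path_seq_V[OF p' TV(2)] b by auto
      have Tp'x: "T.pt (\<lambda>n. p' n 0) = T.pt x"
        using T.pt_eqI[OF T.base_V TV(2) start'[OF s'r]] by simp
      have Tpx: "T.pt (\<lambda>n. p n 0) = T.pt x" using p(2) by simp
      have "eventually (\<lambda>n. path_at p l s' b n \<in> nbhd X d M (A n)) \<omega>"
        using nM T.path_ev[OF long(1) order_refl] by eventually_elim simp
      then have in1: "T.pt (path_at p l s' b) \<in> T.lims A" by (rule T.lims_constI[where A = A, OF bV(1) AX])
      have "eventually (\<lambda>n. path_at p' l' s' b n \<in> nbhd X d M (A n)) \<omega>"
        using nM' T.path_ev[OF long(2) order_refl] by eventually_elim simp
      then have in2: "T.pt (path_at p' l' s' b) \<in> T.lims A" by (rule T.lims_constI[where A = A, OF bV(2) AX])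
      note good = T.lims_good[OF A\<A> in1]
      note seg1 = T.path_seg[OF p(1) TV(1) long(1) b(3), unfolded Tpx]
      note seg2 = T.path_seg[OF p' TV(2) long(2) b(3), unfolded Tp'x]
      have xnot: "T.pt x \<notin> T.lims A"
      proof
        assume "T.pt x \<in> T.lims A"
        then have "eventually (\<lambda>n. x n \<in> nbhd X d (1 / 2 * s' n) (A n)) \<omega>"
          unfolding T.lims_iff[where A = A, OF T.base_V AX] by (meson half_gt_zero_iff zero_less_one)
        then have "eventually (\<lambda>n. False) \<omega>" using n\<delta> s'\<delta>
        proof eventually_elim
          case (elim n)
          then have "\<delta> n < 1 / 2 * s' n" by blast
          then show False using elim(3) s'pos[of n] by simp
        qed
        then show False by simp
      qed
      \<comment> \<open>At scale \<open>s'\<close> the point \<open>x\<close> is off the limit set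
        and both geodesics reach it, so both pass through the entry point of \<open>x\<close>, at
        the same positive time.\<close>
      obtain e where e: "T.Pc.entry (T.lims A) (T.pt x) e"
        using T.Pc.entry_ex[OF good T.pt_in[OF T.base_V] in1] by blast
      have e1: "e \<in> (\<lambda>t. T.pt (path_at p l s' t)) ` {0..b}"
        by (rule T.Pc.entry_on_seg(1)[OF good seg1 T.Pc.seg_ends(2)[OF seg1] in1 e])
      have e2: "e \<in> (\<lambda>t. T.pt (path_at p' l' s' t)) ` {0..b}"
        by (rule T.Pc.entry_on_seg(1)[OF good seg2 T.Pc.seg_ends(2)[OF seg2] in2 e])
      obtain t where t: "t \<in> {0..b}" "e = T.pt (path_at p l s' t)" "e = T.pt (path_at p' l' s' t)"
        by (rule T.path_common[OF p(1) TV(1) long(1) p' TV(2) long(2) _ b(3) e1 e2]) (use Tpx Tp'x in auto)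
      have "t \<noteq> 0"
      proof
        assume "t = 0"
        then have "e = T.pt x" using t(2) Tpx geodesic_nonneg[OF p(1)] by (simp add: min_absorb2)
        then show False using xnot T.Pc.entry_in(1)[OF e] by simp
      qed
      then have t0: "0 < t" using t by simp
      have V: "path_at p l s' t \<in> T.V" "path_at p' l' s' t \<in> T.V"
        using T.path_seq_V[OF p(1) TV(1)] T.path_seq_V[OF p' TV(2)] t0 by auto
      have "T.pt (path_at p l s' t) = T.pt (path_at p' l' s' t)" using t by simp
      note tt = T.pt_eqD[OF this V t0]
      have tb: "t \<le> b" using t by simp
      have "eventually (\<lambda>n. d (p n (t * s' n)) (p' n (t * s' n)) < t * s' n) \<omega>"
        using tt T.path_ev[OF long(1) tb] T.path_ev[OF long(2) tb] by eventually_elim simp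
      then show False
      proof (rule meet_false)
        show "eventually (\<lambda>n. K * r n \<le> t * s' n) \<omega>"
          using s'r[of "K / t"] by eventually_elim (use t0 in \<open>simp add: field_simps\<close>)
        show "eventually (\<lambda>n. t * s' n \<le> c * S n) \<omega>"
          using Ss'[of "t / c"] by eventually_elim (use c in \<open>simp add: field_simps\<close>)
      qed
    qed
  qed
qed

end

context cone_space
begin

lemma path_from:
  assumes p: "\<And>n. geodesic X d (p n) (l n)" "(\<lambda>n. p n 0) \<in> V" "eventually (\<lambda>n. c * s n \<le> l n) \<omega>" and t: "0 \<le> t" "t \<le> c"
  shows "D (pt (\<lambda>n. p n 0)) (pt (path_at p l s t)) = t"
proof -
  have 0: "path_at p l s 0 = (\<lambda>n. p n 0)" using geodesic_nonneg[OF p(1)] by (simp add: min_absorb2)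
  have c: "0 \<le> c" using t by simp
  show ?thesis
    using geodesic_dist[OF path_geodesic[OF p(1,2) c p(3)], of 0 t] t unfolding 0 by simp
qed

end

section \<open>Linking across scales\<close>

context atg_quasi_convex
begin

text \<open>The divergence required by \<open>linked_descent_core\<close> is gained by passing to
  the first time \<open>S\<close>, up to a factor, at which the paths are closer than
  \<open>3/2 * t\<close>. Unlinked paths would be about \<open>2 * t\<close> apart, so at scale
  \<open>S\<close> they are linked. If there is no such time, the paths diverge up to the scale
  \<open>R\<close> itself.\<close>

lemma linked_descent:
  assumes x: "\<And>n. x n \<in> X" and r: "\<And>n. 0 < r n" "filterlim r at_top \<omega>" and R: "\<And>n. 0 < R n" "\<And>Z. eventually (\<lambda>n. Z * r n \<le> R n) \<omega>"
    and p: "\<And>n. geodesic X d (p n) (l n)" "\<And>n. p n 0 = x n" and p': "\<And>n. geodesic X d (p' n) (l' n)"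
    and B: "0 \<le> B" "eventually (\<lambda>n. d (x n) (p' n 0) \<le> B * r n) \<omega>"
    and c: "0 < c" "eventually (\<lambda>n. c * R n \<le> l n) \<omega>" "eventually (\<lambda>n. c * R n \<le> l' n) \<omega>"
    and lR: "cone_linked x R (path_at p l R c) (path_at p' l' R c)"
  shows "\<exists>a a'. 0 < a \<and> B < a' \<and> cone_linked x r (path_at p l r a) (path_at p' l' r a')"
proof (rule ccontr)
  assume "\<not> ?thesis"
  then have nl: "\<not> cone_linked x r (path_at p l r a) (path_at p' l' r a')" if "0 < a" "B < a'" for a a' using that by blast
  \<comment> \<open>For \<open>t > 2 * B\<close> one has \<open>2 * t - B > 3/2 * t\<close>; this
    separates the distance of unlinked points from that at a violating time.\<close>
  define K where "K = 2 * B + 1"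
  have K: "1 \<le> K" "2 * B < K" unfolding K_def using B by auto
  define viol where "viol n = {t. K * r n \<le> t \<and> t \<le> c * R n \<and> d (p n t) (p' n t) < 3 / 2 * t}" for n
  have Kr: "0 < K * r n" for n using K r(1)[of n] by simp
  show False
  proof (cases "eventually (\<lambda>n. viol n \<noteq> {}) \<omega>")
    case False
    then have "eventually (\<lambda>n. viol n = {}) \<omega>" by (simp add: ev_not)
    then have F: "eventually (\<lambda>n. \<forall>t. K * r n \<le> t \<longrightarrow> t \<le> c * R n \<longrightarrow> t \<le> d (p n t) (p' n t)) \<omega>"
    proof eventually_elim
      case (elim n)
      show ?case
      proof (intro allI impI)
        fix t assume t: "K * r n \<le> t" "t \<le> c * R n"
        then have "t \<notin> viol n" using elim by blast
        then show "t \<le> d (p n t) (p' n t)" using t Kr[of n] unfolding viol_def by auto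
      qed
    qed
    show False by (rule linked_descent_core[OF x r R p p' B c F nl lR])
  next
    case True
    \<comment> \<open>A first violation up to the factor \<open>9/10\<close>, as the infimum need
      not be attained.\<close>
    have "\<exists>t. viol n \<noteq> {} \<longrightarrow> t \<in> viol n \<and> (\<forall>u\<in>viol n. 9/10 * t < u)" for n
    proof (cases "viol n = {}")
      case False
      have bdd: "bdd_below (viol n)" unfolding viol_def by (intro bdd_belowI[of _ "K * r n"]) auto
      have "K * r n \<le> Inf (viol n)" using False by (intro cInf_greatest) (auto simp: viol_def)
      then have "Inf (viol n) < 10/9 * Inf (viol n)" using Kr[of n] by linarith
      then obtain t where t: "t \<in> viol n" "t < 10/9 * Inf (viol n)" using cInf_lessD[OF False] by blast
      have "9/10 * t < u" if "u \<in> viol n" for u using cInf_lower[OF that bdd] t by linarith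
      then show ?thesis using t by blast
    qed blast
    then obtain \<sigma> where \<sigma>: "\<And>n. viol n \<noteq> {} \<Longrightarrow> \<sigma> n \<in> viol n \<and> (\<forall>u\<in>viol n. 9/10 * \<sigma> n < u)" by metis
    define S where "S n = (if viol n \<noteq> {} then \<sigma> n else R n)" for n
    have evS: "eventually (\<lambda>n. S n \<in> viol n \<and> (\<forall>u\<in>viol n. 9/10 * S n < u)) \<omega>"
      using True by eventually_elim (use \<sigma> in \<open>simp add: S_def\<close>)
    have Spos: "0 < S n" for n
    proof (cases "viol n = {}")
      case False
      then have "\<sigma> n \<in> viol n" using \<sigma> by blast
      then show ?thesis using False Kr[of n] unfolding S_def by (auto simp: viol_def)
    qed (simp add: S_def R(1))
    have SR: "eventually (\<lambda>n. S n \<le> c * R n) \<omega>" and SK: "eventually (\<lambda>n. K * r n \<le> S n) \<omega>"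
      and SF: "eventually (\<lambda>n. d (p n (S n)) (p' n (S n)) < 3/2 * S n) \<omega>"
      using evS by (eventually_elim, simp add: viol_def)+
    have Sl: "eventually (\<lambda>n. 1 * S n \<le> l n) \<omega>" "eventually (\<lambda>n. 1 * S n \<le> l' n) \<omega>"
      using SR c(2,3) by (eventually_elim, linarith)+
    have p'X: "p' n 0 \<in> X" for n using geodesic_in[OF p'] geodesic_nonneg[OF p'] by simp
    \<comment> \<open>Otherwise \<open>S n / r n\<close> has a finite limit \<open>t\<close>, and
      the violation would be visible at scale \<open>r\<close>, where the paths are
      unlinked.\<close>
    have Sr: "eventually (\<lambda>n. Z * r n \<le> S n) \<omega>" for Z
    proof (rule ccontr)
      assume "\<not> ?thesis"
      then have lt: "eventually (\<lambda>n. S n < Z * r n) \<omega>" by (simp add: ev_not not_le)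
      interpret Q: atg_cone X d \<omega> x r \<A> by (rule atg_cone[OF x r])
      have "eventually (\<lambda>n. \<bar>S n / r n\<bar> \<le> Z) \<omega>"
        using lt
      proof eventually_elim
        case (elim n)
        then have "S n / r n < Z" using r(1)[of n] by (simp add: pos_divide_less_eq)
        moreover have "0 \<le> S n / r n" using Spos[of n] r(1)[of n] by simp
        ultimately show ?case by simp
      qed
      from bounded_limit[OF this] obtain t where t: "((\<lambda>n. S n / r n) \<longlongrightarrow> t) \<omega>" ..
      have "K \<le> t"
      proof (rule tendsto_lowerbound[OF t _ nontriv])
        show "eventually (\<lambda>n. K \<le> S n / r n) \<omega>" using SK
          by eventually_elim (use r(1) in \<open>simp add: pos_le_divide_eq\<close>)
      qed
      then have t0: "0 < t" "2 * B < t" "0 \<le> t" "B < t" using K B by auto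
      have long: "eventually (\<lambda>n. t * r n \<le> l n) \<omega>" "eventually (\<lambda>n. t * r n \<le> l' n) \<omega>"
        using R(2)[of "t / c"] c(2,3) by (eventually_elim, use c(1) in \<open>simp add: field_simps\<close>)+
      have V0: "(\<lambda>n. p n 0) \<in> Q.V" "(\<lambda>n. p' n 0) \<in> Q.V"
        using Q.base_V p(2) Q.V_near[OF Q.base_V p'X B(2)] by simp_all
      have V: "path_at p l r t \<in> Q.V" "path_at p' l' r t \<in> Q.V"
        using Q.path_seq_V[OF p(1) V0(1)] Q.path_seq_V[OF p' V0(2)] t0 by auto
      have d1: "Q.D (Q.pt x) (Q.pt (path_at p l r t)) = t"
        using Q.path_from[OF p(1) V0(1) long(1) t0(3)] p(2) by simp
      have "Q.D (Q.pt (\<lambda>n. p' n 0)) (Q.pt (path_at p' l' r t)) = t"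
        by (rule Q.path_from[OF p' V0(2) long(2) t0(3)]) simp
      moreover have "Q.D (Q.pt x) (Q.pt (\<lambda>n. p' n 0)) \<le> B" by (rule Q.D_leI[OF B(2) Q.base_V V0(2)])
      moreover have "Q.D (Q.pt (\<lambda>n. p' n 0)) (Q.pt (path_at p' l' r t)) \<le>
        Q.D (Q.pt (\<lambda>n. p' n 0)) (Q.pt x) + Q.D (Q.pt x) (Q.pt (path_at p' l' r t))"
        by (rule Q.Pc.triangle) (rule Q.pt_in[OF V0(2)] Q.pt_in[OF Q.base_V] Q.pt_in[OF V(2)])+
      ultimately have d2: "t - B \<le> Q.D (Q.pt x) (Q.pt (path_at p' l' r t))"
        using Q.Pc.commute[of "Q.pt x" "Q.pt (\<lambda>n. p' n 0)"] by linarith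
      have "\<not> Q.Pc.linked (Q.pt x) (Q.pt (path_at p l r t)) (Q.pt (path_at p' l' r t))"
        using nl[OF t0(1,4)] unfolding cone_linked_def .
      from Q.Pc.not_linked_dist[OF this Q.pt_in[OF V(1)] Q.pt_in[OF V(2)]]
      have ge: "2 * t - B \<le> Q.D (Q.pt (path_at p l r t)) (Q.pt (path_at p' l' r t))"
        using d1 d2 Q.Pc.commute[of "Q.pt x" "Q.pt (path_at p l r t)"] by linarith
      \<comment> \<open>The violation is known at time \<open>S n\<close>, not at
        \<open>t * r n\<close>. Passing from one to the other on both paths costs twice the
        difference, which vanishes in the limit.\<close>
      have "((\<lambda>n. 3/2 * (S n / r n) + 2 * \<bar>S n / r n - t\<bar>) \<longlongrightarrow> 3/2 * t + 2 * \<bar>t - t\<bar>) \<omega>"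
        by (intro tendsto_intros t)
      then have "Q.D (Q.pt (path_at p l r t)) (Q.pt (path_at p' l' r t)) \<le> 3/2 * t + 2 * \<bar>t - t\<bar>"
      proof (rule tendsto_le[OF nontriv _ Q.D_tendsto[OF V]])
        show "eventually (\<lambda>n. d (path_at p l r t n) (path_at p' l' r t n) / r n \<le> 3/2 * (S n / r n) + 2 * \<bar>S n / r n - t\<bar>) \<omega>"
          using long Sl SF
        proof eventually_elim
          case (elim n)
          have tr: "0 \<le> t * r n" using t0 r(1)[of n] by simp
          have m: "min (l n) (t * r n) = t * r n" "min (l' n) (t * r n) = t * r n" using elim by auto
          have in': "t * r n \<in> {0..l n}" "S n \<in> {0..l n}" "t * r n \<in> {0..l' n}" "S n \<in> {0..l' n}"
            using elim tr Spos[of n] by auto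
          note X' = geodesic_in[OF p(1) in'(1)] geodesic_in[OF p(1) in'(2)] geodesic_in[OF p' in'(3)] geodesic_in[OF p' in'(4)]
          have "d (p n (t * r n)) (p' n (t * r n)) \<le> d (p n (t * r n)) (p n (S n)) + d (p n (S n)) (p' n (t * r n))"
            using X' by (intro triangle)
          also have "d (p n (S n)) (p' n (t * r n)) \<le> d (p n (S n)) (p' n (S n)) + d (p' n (S n)) (p' n (t * r n))"
            using X' by (intro triangle)
          finally have tri: "d (p n (t * r n)) (p' n (t * r n)) \<le>
            d (p n (t * r n)) (p n (S n)) + (d (p n (S n)) (p' n (S n)) + d (p' n (S n)) (p' n (t * r n)))" by simp
          define w where "w = \<bar>S n - t * r n\<bar>"
          have "d (p n (t * r n)) (p n (S n)) = w" "d (p' n (S n)) (p' n (t * r n)) = w"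
            using geodesic_dist[OF p(1) in'(1,2)] geodesic_dist[OF p' in'(4,3)] abs_minus_commute[of "t * r n" "S n"]
            unfolding w_def by simp_all
          then have "d (p n (t * r n)) (p' n (t * r n)) \<le> 3/2 * S n + 2 * w" using tri elim(5) by linarith
          then have "d (p n (t * r n)) (p' n (t * r n)) \<le> 3/2 * S n + 2 * \<bar>S n - t * r n\<bar>" unfolding w_def .
          then have "d (p n (t * r n)) (p' n (t * r n)) / r n \<le> (3/2 * S n + 2 * \<bar>S n - t * r n\<bar>) / r n"
            using r(1)[of n] by (intro divide_right_mono) auto
          also have "\<dots> = 3/2 * (S n / r n) + 2 * (\<bar>S n - t * r n\<bar> / r n)" by (simp add: add_divide_distrib)
          also have "\<bar>S n - t * r n\<bar> / r n = \<bar>S n / r n - t\<bar>"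
            using r(1)[of n] by (simp add: abs_div_pos diff_divide_distrib)
          finally show ?case unfolding m .
        qed
      qed
      then show False using ge t0 by simp
    qed
    have "filterlim S at_top \<omega>"
      unfolding filterlim_at_top
    proof
      fix Z
      have "eventually (\<lambda>n. Z \<le> r n) \<omega>" using r(2) unfolding filterlim_at_top by blast
      then show "eventually (\<lambda>n. Z \<le> S n) \<omega>" using Sr[of 1] by eventually_elim simp
    qed
    then interpret S: atg_cone X d \<omega> x S \<A> by (rule atg_cone[OF x Spos])
    have F: "eventually (\<lambda>n. \<forall>t. K * r n \<le> t \<longrightarrow> t \<le> 1 * S n \<longrightarrow> t \<le> d (p n t) (p' n t)) \<omega>"
      using evS Sr[of "10/9 * K"] Sl SR
    proof eventually_elim
      case (elim n)
      have notv: "3/2 * t \<le> d (p n t) (p' n t)" if "K * r n \<le> t" "t \<le> 9/10 * S n" for t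
      proof -
        have "t \<notin> viol n" using elim(1) that by force
        then show ?thesis using that elim(5) Spos[of n] unfolding viol_def by auto
      qed
      show ?case
      proof (intro allI impI)
        fix t assume t: "K * r n \<le> t" "t \<le> 1 * S n"
        show "t \<le> d (p n t) (p' n t)"
        proof (cases "t \<le> 9/10 * S n")
          case True
          then show ?thesis using notv[OF t(1) True] t(1) Kr[of n] by linarith
        next
          case False
          \<comment> \<open>At time \<open>u\<close> the distance is at least
            \<open>1.35 * S n\<close>, and up to time \<open>S n\<close> it drops by at most
            \<open>0.2 * S n\<close>.\<close>
          define u where "u = 9/10 * S n"
          have "K * r n \<le> u" using elim(2) unfolding u_def by simp
          then have fu: "3/2 * u \<le> d (p n u) (p' n u)" using notv unfolding u_def by blast
          have in': "t \<in> {0..l n}" "u \<in> {0..l n}" "t \<in> {0..l' n}" "u \<in> {0..l' n}"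
            using t elim(3,4) False Spos[of n] unfolding u_def by auto
          note X' = geodesic_in[OF p(1) in'(1)] geodesic_in[OF p(1) in'(2)] geodesic_in[OF p' in'(3)] geodesic_in[OF p' in'(4)]
          have "d (p n u) (p' n u) \<le> d (p n u) (p n t) + d (p n t) (p' n u)" using X' by (intro triangle)
          also have "d (p n t) (p' n u) \<le> d (p n t) (p' n t) + d (p' n t) (p' n u)" using X' by (intro triangle)
          finally have "d (p n u) (p' n u) \<le> d (p n t) (p' n t) + 2 * (t - u)"
            using geodesic_dist[OF p(1) in'(2,1)] geodesic_dist[OF p' in'(3,4)] False unfolding u_def by auto
          then show ?thesis using fu t False unfolding u_def by simp
        qed
      qed
    qed
    have V0: "(\<lambda>n. p n 0) \<in> S.V" using S.base_V p(2) by simp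
    have start': "eventually (\<lambda>n. d (x n) (p' n 0) \<le> \<rho> * S n) \<omega>" if "0 < \<rho>" for \<rho>
      using B(2) Sr[of "B / \<rho>"] by eventually_elim (use that in \<open>simp add: field_simps\<close>)
    have V0': "(\<lambda>n. p' n 0) \<in> S.V" by (rule S.V_near[OF S.base_V p'X start'[OF zero_less_one]])
    have eq: "S.pt (\<lambda>n. p' n 0) = S.pt x" using S.pt_eqI[OF S.base_V V0' start'] by simp
    have V: "path_at p l S 1 \<in> S.V" "path_at p' l' S 1 \<in> S.V"
      by (rule S.path_seq_V[OF p(1) V0 zero_le_one] S.path_seq_V[OF p' V0' zero_le_one])+
    have lS: "cone_linked x S (path_at p l S 1) (path_at p' l' S 1)"
    proof (rule ccontr)
      assume "\<not> ?thesis"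
      then have "\<not> S.Pc.linked (S.pt x) (S.pt (path_at p l S 1)) (S.pt (path_at p' l' S 1))" unfolding cone_linked_def .
      from S.Pc.not_linked_dist[OF this S.pt_in[OF V(1)] S.pt_in[OF V(2)]]
      have "S.D (S.pt (path_at p l S 1)) (S.pt (path_at p' l' S 1)) =
        S.D (S.pt x) (S.pt (path_at p l S 1)) + S.D (S.pt x) (S.pt (path_at p' l' S 1))"
        using S.Pc.commute[of "S.pt x" "S.pt (path_at p l S 1)"] by simp
      moreover have "S.D (S.pt x) (S.pt (path_at p l S 1)) = 1"
        using S.path_from[OF p(1) V0 Sl(1), of 1] p(2) by simp
      moreover have "S.D (S.pt x) (S.pt (path_at p' l' S 1)) = 1"
        using S.path_from[OF p' V0' Sl(2), of 1] eq by simp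
      moreover have "S.D (S.pt (path_at p l S 1)) (S.pt (path_at p' l' S 1)) \<le> 3/2"
      proof (rule S.D_leI[OF _ V])
        show "eventually (\<lambda>n. d (path_at p l S 1 n) (path_at p' l' S 1 n) \<le> 3/2 * S n) \<omega>"
          using SF Sl by eventually_elim (simp add: min_absorb2)
      qed
      ultimately show False by simp
    qed
    show False by (rule linked_descent_core[OF x r Spos Sr p p' B zero_less_one Sl F nl lS])
  qed
qed

lemma cone_linked_along:
  assumes x: "\<And>n. x n \<in> X" and r: "\<And>n. 0 < r n" "filterlim r at_top \<omega>"
    and g: "\<And>n. geodesic X d (g n) (l n)" and \<alpha>\<beta>: "\<And>n. 0 \<le> \<alpha> n" "\<And>n. \<alpha> n \<le> \<beta> n" "\<And>n. \<beta> n \<le> l n"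
    and V: "(\<lambda>n. g n (\<alpha> n)) \<in> cone_seqs X d \<omega> x r" "(\<lambda>n. g n (\<beta> n)) \<in> cone_seqs X d \<omega> x r"
    and \<tau>: "0 < \<tau>" "eventually (\<lambda>n. \<forall>t\<in>{\<alpha> n..\<beta> n}. \<tau> * r n \<le> d (x n) (g n t)) \<omega>"
  shows "cone_linked x r (\<lambda>n. g n (\<alpha> n)) (\<lambda>n. g n (\<beta> n))"
proof -
  interpret Q: atg_cone X d \<omega> x r \<A> by (rule atg_cone[OF x r])
  show ?thesis unfolding cone_linked_def by (rule Q.linked_along[OF g \<alpha>\<beta> V Q.base_V \<tau>])
qed

lemma cone_linked_path:
  assumes x: "\<And>n. x n \<in> X" and r: "\<And>n. 0 < r n" "filterlim r at_top \<omega>"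
    and p: "\<And>n. geodesic X d (p n) (l n)" "eventually (\<lambda>n. d (x n) (p n 0) \<le> B * r n) \<omega>"
    and a: "0 \<le> a" "a \<le> b"
    and \<tau>: "0 < \<tau>" "eventually (\<lambda>n. \<forall>t\<in>{0..l n}. a * r n \<le> t \<longrightarrow> \<tau> * r n \<le> d (x n) (p n t)) \<omega>"
    and long: "eventually (\<lambda>n. a * r n \<le> l n) \<omega>"
  shows "cone_linked x r (path_at p l r a) (path_at p l r b)"
proof -
  interpret Q: atg_cone X d \<omega> x r \<A> by (rule atg_cone[OF x r])
  have l0: "0 \<le> l n" for n by (rule geodesic_nonneg[OF p(1)])
  have p0: "(\<lambda>n. p n 0) \<in> Q.V"
    by (rule Q.V_near[OF Q.base_V _ p(2)]) (rule geodesic_in[OF p(1)], use l0 in auto)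
  have m: "min (l n) (a * r n) \<le> min (l n) (b * r n)" for n
    using a r(1)[of n] by (intro min.mono) (auto intro: mult_right_mono)
  show ?thesis
  proof (rule cone_linked_along[OF x r p(1) _ m _ Q.path_seq_V[OF p(1) p0] Q.path_seq_V[OF p(1) p0] \<tau>(1)])
    show "0 \<le> min (l n) (a * r n)" for n using l0[of n] a r(1)[of n] by auto
    show "eventually (\<lambda>n. \<forall>t\<in>{min (l n) (a * r n)..min (l n) (b * r n)}. \<tau> * r n \<le> d (x n) (p n t)) \<omega>"
      using \<tau>(2) long
    proof eventually_elim
      case (elim n)
      have "0 \<le> a * r n" using a r(1)[of n] by simp
      then show ?case using elim by (auto simp: min_absorb2)
    qed
  qed (use a in auto)
qed

lemma cone_linked_path_from:
  assumes x: "\<And>n. x n \<in> X" and r: "\<And>n. 0 < r n" "filterlim r at_top \<omega>"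
    and p: "\<And>n. geodesic X d (p n) (l n)" "\<And>n. p n 0 = x n"
    and ab: "0 < a" "0 < b" and long: "eventually (\<lambda>n. a * r n \<le> l n) \<omega>" "eventually (\<lambda>n. b * r n \<le> l n) \<omega>"
  shows "cone_linked x r (path_at p l r a) (path_at p l r b)"
proof -
  have *: "cone_linked x r (path_at p l r u) (path_at p l r v)" if "0 < u" "u \<le> v" "eventually (\<lambda>n. u * r n \<le> l n) \<omega>" for u v
  proof (rule cone_linked_path[OF x r p(1) _ _ that(2) that(1) _ that(3), where B = 0])
    show "eventually (\<lambda>n. \<forall>t\<in>{0..l n}. u * r n \<le> t \<longrightarrow> u * r n \<le> d (x n) (p n t)) \<omega>"
    proof (rule always_eventually, intro allI ballI impI)
      fix n t assume t: "t \<in> {0..l n}" "u * r n \<le> t"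
      have "d (p n 0) (p n t) = t" using geodesic_dist[OF p(1) _ t(1), of 0] t(1) by simp
      then show "u * r n \<le> d (x n) (p n t)" using p(2)[of n] t by simp
    qed
  qed (use that x p(2) in auto)
  show ?thesis
    by (cases "a \<le> b") (use *[of a b] *[of b a] cone_linked_sym[of x r, OF x r] ab long in \<open>simp_all\<close>)
qed

text \<open>If \<open>l n\<close> is at most a multiple of \<open>r n\<close>, the common end is a
  point of the cone and a direct chain exists. Otherwise the end is seen at scale
  \<open>l n\<close>, where \<open>g\<close> starts at \<open>x\<close>, and
  \<open>linked_descent\<close> brings the link down to scale \<open>r\<close>.\<close>

lemma linked_foot:
  assumes x: "\<And>n. x n \<in> X" and r: "\<And>n. 0 < r n" "filterlim r at_top \<omega>"
    and p: "\<And>n. geodesic X d (p n) (l n)" "\<And>n. p n 0 = x n"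
    and g: "\<And>n. geodesic X d (g n) (k n)" "\<And>n. g n (k n) = p n (l n)"
    and B: "0 \<le> B" "eventually (\<lambda>n. d (x n) (g n 0) \<le> B * r n) \<omega>"
    and \<tau>: "0 < \<tau>" "eventually (\<lambda>n. \<forall>t\<in>{0..k n}. \<tau> * r n \<le> d (x n) (g n t)) \<omega>"
  shows "cone_linked x r (path_at p l r \<tau>) (\<lambda>n. g n 0)"
proof -
  interpret Q: atg_cone X d \<omega> x r \<A> by (rule atg_cone[OF x r])
  have l0: "0 \<le> l n" and k0: "0 \<le> k n" for n by (rule geodesic_nonneg[OF p(1)], rule geodesic_nonneg[OF g(1)])
  have lx: "d (x n) (p n (l n)) = l n" for n
    using geodesic_dist[OF p(1), of 0 n "l n"] l0[of n] p(2)[of n] by simp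
  have dk: "d (g n 0) (p n (l n)) = k n" for n
    using geodesic_dist[OF g(1), of 0 n "k n"] k0[of n] g(2)[of n] by simp
  have gX: "g n 0 \<in> X" "p n (l n) \<in> X" for n using geodesic_in[OF g(1)] geodesic_in[OF p(1)] k0 l0 by simp_all
  have \<tau>l: "eventually (\<lambda>n. \<tau> * r n \<le> l n) \<omega>"
    using \<tau>(2)
  proof eventually_elim
    case (elim n)
    then have "\<tau> * r n \<le> d (x n) (g n (k n))" using k0 by simp
    then show ?case using lx[of n] g(2)[of n] by simp
  qed
  have pV: "(\<lambda>n. p n 0) \<in> Q.V" using Q.base_V p(2) by simp
  have gV: "(\<lambda>n. g n 0) \<in> Q.V" by (rule Q.V_near[OF Q.base_V gX(1) B(2)])
  show ?thesis
  proof (cases "\<exists>Z. eventually (\<lambda>n. l n \<le> Z * r n) \<omega>")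
    case True
    then obtain Z where Z: "eventually (\<lambda>n. l n \<le> Z * r n) \<omega>" by blast
    have eV: "(\<lambda>n. p n (l n)) \<in> Q.V" by (rule Q.V_near[OF Q.base_V gX(2)]) (use Z lx in simp)
    have eV': "(\<lambda>n. g n (k n)) \<in> Q.V" using eV g(2) by simp
    have \<tau>V: "path_at p l r \<tau> \<in> Q.V" using Q.path_seq_V[OF p(1) pV] \<tau>(1) by simp
    have "cone_linked x r (path_at p l r \<tau>) (\<lambda>n. p n (l n))"
    proof (rule cone_linked_along[OF x r p(1) _ _ _ \<tau>V eV \<tau>(1)])
      show "0 \<le> min (l n) (\<tau> * r n)" for n using l0[of n] \<tau>(1) r(1)[of n] by auto
      show "eventually (\<lambda>n. \<forall>t\<in>{min (l n) (\<tau> * r n)..l n}. \<tau> * r n \<le> d (x n) (p n t)) \<omega>"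
        using \<tau>l
      proof eventually_elim
        case (elim n)
        show ?case
        proof
          fix t assume "t \<in> {min (l n) (\<tau> * r n)..l n}"
          then have t: "\<tau> * r n \<le> t" "t \<le> l n" using elim by auto
          then have "0 \<le> t" using \<tau>(1) r(1)[of n] by (smt (verit) mult_pos_pos)
          then have "d (p n 0) (p n t) = t" using geodesic_dist[OF p(1), of 0 n t] t by simp
          then show "\<tau> * r n \<le> d (x n) (p n t)" using t p(2)[of n] by simp
        qed
      qed
    qed auto
    moreover have "cone_linked x r (\<lambda>n. g n 0) (\<lambda>n. p n (l n))"
      using cone_linked_along[OF x r g(1) order_refl k0 order_refl gV eV' \<tau>] unfolding g(2) .
    ultimately show ?thesis using cone_linked_trans[OF _ cone_linked_sym[of x r, OF x r]] by blast
  next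
    case False
    have big: "eventually (\<lambda>n. Z * r n \<le> l n) \<omega>" for Z
    proof -
      have "\<not> eventually (\<lambda>n. l n \<le> Z * r n) \<omega>" using False by simp
      then have "eventually (\<lambda>n. \<not> l n \<le> Z * r n) \<omega>" by (simp only: ev_not)
      then show ?thesis by eventually_elim simp
    qed
    define R where "R n = (if 0 < l n then l n else 1)" for n
    have R0: "0 < R n" for n unfolding R_def by simp
    have Rl: "eventually (\<lambda>n. R n = l n) \<omega>"
      using big[of 1]
    proof eventually_elim
      case (elim n)
      then show ?case using r(1)[of n] unfolding R_def by simp
    qed
    have Rr: "eventually (\<lambda>n. Z * r n \<le> R n) \<omega>" for Z using big[of Z] Rl by eventually_elim simp
    have r_ge: "eventually (\<lambda>n. Z \<le> r n) \<omega>" for Z using r(2) unfolding filterlim_at_top by blast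
    have Rtop: "filterlim R at_top \<omega>"
      unfolding filterlim_at_top
    proof
      fix Z show "eventually (\<lambda>n. Z \<le> R n) \<omega>" using Rr[of 1] r_ge[of Z] by eventually_elim simp
    qed
    interpret E: atg_cone X d \<omega> x R \<A> by (rule atg_cone[OF x R0 Rtop])
    have BR: "eventually (\<lambda>n. d (x n) (g n 0) \<le> \<rho> * R n) \<omega>" if "0 < \<rho>" for \<rho>
      using B(2) Rr[of "B / \<rho>"] by eventually_elim (use that in \<open>simp add: field_simps\<close>)
    have pV': "(\<lambda>n. p n 0) \<in> E.V" using E.base_V p(2) by simp
    have gV': "(\<lambda>n. g n 0) \<in> E.V" by (rule E.V_near[OF E.base_V gX(1) BR[OF zero_less_one]])
    have eV: "(\<lambda>n. p n (l n)) \<in> E.V"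
      by (rule E.V_near[OF E.base_V gX(2), where B = 1]) (use Rl in eventually_elim, simp add: lx)
    have eV': "(\<lambda>n. g n (k n)) \<in> E.V" using eV g(2) by simp
    \<comment> \<open>At scale \<open>R\<close> the start of \<open>g\<close> is within
      \<open>1/4\<close> of \<open>x\<close>, so \<open>g\<close> is still \<open>1/4\<close> away
      from \<open>x\<close> from time \<open>1/2\<close> on.\<close>
    have q4: "(0::real) < 1/4" by simp
    have klo: "eventually (\<lambda>n. 3/4 * R n \<le> k n) \<omega>"
      using BR[OF q4] Rl
    proof eventually_elim
      case (elim n)
      have "l n \<le> d (x n) (g n 0) + k n" using triangle[of "x n" "g n 0" "p n (l n)"] gX x lx dk by metis
      then show ?case using elim by simp
    qed
    have 1: "cone_linked x R (path_at p l R (1/2)) (\<lambda>n. p n (l n))"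
    proof (rule cone_linked_along[OF x R0 Rtop p(1) _ _ _ E.path_seq_V[OF p(1) pV'] eV, where \<tau> = "1/2"])
      show "0 \<le> min (l n) (1/2 * R n)" for n using l0[of n] R0[of n] by auto
      show "eventually (\<lambda>n. \<forall>t\<in>{min (l n) (1/2 * R n)..l n}. 1/2 * R n \<le> d (x n) (p n t)) \<omega>"
        using Rl
      proof eventually_elim
        case (elim n)
        show ?case
        proof
          fix t assume "t \<in> {min (l n) (1/2 * R n)..l n}"
          then have t: "1/2 * R n \<le> t" "t \<le> l n" using elim l0[of n] by auto
          then have "0 \<le> t" using R0[of n] by linarith
          then have "d (p n 0) (p n t) = t" using geodesic_dist[OF p(1), of 0 n t] t by simp
          then show "1/2 * R n \<le> d (x n) (p n t)" using t p(2)[of n] by simp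
        qed
      qed
    qed auto
    have 2: "cone_linked x R (path_at g k R (1/2)) (\<lambda>n. g n (k n))"
    proof (rule cone_linked_along[OF x R0 Rtop g(1) _ _ _ E.path_seq_V[OF g(1) gV'] eV', where \<tau> = "1/4"])
      show "0 \<le> min (k n) (1/2 * R n)" for n using k0[of n] R0[of n] by auto
      show "eventually (\<lambda>n. \<forall>t\<in>{min (k n) (1/2 * R n)..k n}. 1/4 * R n \<le> d (x n) (g n t)) \<omega>"
        using klo BR[OF q4]
      proof eventually_elim
        case (elim n)
        show ?case
        proof
          fix t assume "t \<in> {min (k n) (1/2 * R n)..k n}"
          then have t: "1/2 * R n \<le> t" "t \<le> k n" using elim R0[of n] by auto
          then have "0 \<le> t" using R0[of n] by linarith
          then have in': "t \<in> {0..k n}" using t by simp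
          have "t = d (g n 0) (g n t)" using geodesic_dist[OF g(1), of 0 n t] t \<open>0 \<le> t\<close> by simp
          also have "\<dots> \<le> d (g n 0) (x n) + d (x n) (g n t)"
            using gX x geodesic_in[OF g(1) in'] by (intro triangle)
          finally show "1/4 * R n \<le> d (x n) (g n t)" using t elim commute[of "x n" "g n 0"] by linarith
        qed
      qed
    qed auto
    have l12: "cone_linked x R (path_at p l R (1/2)) (path_at g k R (1/2))"
      by (rule cone_linked_trans[OF 1 cone_linked_sym[of x R, OF x R0 Rtop 2[unfolded g(2)]]])
    have half: "(0::real) < 1/2" by simp
    have c2: "eventually (\<lambda>n. 1/2 * R n \<le> l n) \<omega>" using Rl by eventually_elim (use l0 in simp)
    have c3: "eventually (\<lambda>n. 1/2 * R n \<le> k n) \<omega>"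
      using klo
    proof eventually_elim
      case (elim n)
      then show ?case using R0[of n] by linarith
    qed
    obtain a a' where a: "0 < a" "B < a'" "cone_linked x r (path_at p l r a) (path_at g k r a')"
      using linked_descent[OF x r R0 Rr p g(1) B half c2 c3 l12] by blast
    have "cone_linked x r (path_at p l r \<tau>) (path_at p l r a)"
      by (rule cone_linked_path_from[OF x r p \<tau>(1) a(1) \<tau>l big])
    moreover have "cone_linked x r (\<lambda>n. g n 0) (path_at g k r a')"
    proof -
      have "path_at g k r 0 = (\<lambda>n. g n 0)" using k0 by (simp add: min_absorb2)
      moreover have "cone_linked x r (path_at g k r 0) (path_at g k r a')"
        by (rule cone_linked_path[OF x r g(1) B(2) order_refl _ \<tau>(1)]) (use a B \<tau>(2) k0 in \<open>auto elim: eventually_mono\<close>)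
      ultimately show ?thesis by simp
    qed
    ultimately show ?thesis using cone_linked_trans cone_linked_sym[of x r, OF x r] a(3) by blast
  qed
qed

text \<open>\<open>g\<close> is cut at its point \<open>y\<close> nearest to \<open>x\<close>, and
  \<open>linked_foot\<close> is applied to both halves. If \<open>y\<close> is too far away for
  scale \<open>r\<close>, this is done at the scale of its distance, from which all of
  \<open>g\<close> keeps at distance 1, and \<open>linked_descent\<close> follows.\<close>

lemma linked_sides:
  assumes x: "\<And>n. x n \<in> X" and r: "\<And>n. 0 < r n" "filterlim r at_top \<omega>"
    and p: "\<And>n. geodesic X d (p n) (l n)" "\<And>n. p n 0 = x n"
    and p': "\<And>n. geodesic X d (p' n) (l' n)" "\<And>n. p' n 0 = x n"
    and g: "\<And>n. geodesic X d (g n) (k n)" "\<And>n. g n 0 = p n (l n)" "\<And>n. g n (k n) = p' n (l' n)"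
    and \<tau>: "0 < \<tau>" "eventually (\<lambda>n. \<forall>t\<in>{0..k n}. \<tau> * r n \<le> d (x n) (g n t)) \<omega>"
  shows "cone_linked x r (path_at p l r \<tau>) (path_at p' l' r \<tau>)"
proof -
  have k0: "0 \<le> k n" for n by (rule geodesic_nonneg[OF g(1)])
  have l0: "0 \<le> l n" "0 \<le> l' n" for n by (rule geodesic_nonneg[OF p(1)], rule geodesic_nonneg[OF p'(1)])
  have gX: "g n t \<in> X" if "t \<in> {0..k n}" for n t by (rule geodesic_in[OF g(1) that])
  have "\<exists>t\<in>{0..k n}. \<forall>u\<in>{0..k n}. d (x n) (g n t) \<le> d (x n) (g n u)" for n
  proof (rule continuous_attains_inf)
    have "1-lipschitz_on {0..k n} (\<lambda>t. d (x n) (g n t))"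
    proof (rule lipschitz_onI)
      fix t u assume *: "t \<in> {0..k n}" "u \<in> {0..k n}"
      have "d (x n) (g n t) \<le> d (x n) (g n u) + d (g n u) (g n t)" "d (x n) (g n u) \<le> d (x n) (g n t) + d (g n t) (g n u)"
        using x gX * by (blast intro: triangle)+
      then show "dist (d (x n) (g n t)) (d (x n) (g n u)) \<le> 1 * dist t u"
        using geodesic_dist[OF g(1) *] geodesic_dist[OF g(1) *(2,1)] unfolding dist_real_def by (simp add: abs_minus_commute abs_le_iff)
    qed simp
    then show "continuous_on {0..k n} (\<lambda>t. d (x n) (g n t))" by (rule lipschitz_on_continuous_on)
  qed (use k0 in auto)
  then obtain m where m: "\<And>n. m n \<in> {0..k n}" "\<And>n u. u \<in> {0..k n} \<Longrightarrow> d (x n) (g n (m n)) \<le> d (x n) (g n u)" by metis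
  define y where "y n = g n (m n)" for n
  define g1 where "g1 n t = g n (m n - t)" for n t
  define g2 where "g2 n t = g n (m n + t)" for n t
  have G1: "geodesic X d (g1 n) (m n)" for n
  proof -
    have "geodesic X d (g n) (m n)" using geodesic_shift[OF g(1), of 0 "m n" n] m(1)[of n] by simp
    then show ?thesis unfolding g1_def by (rule geodesic_reverse)
  qed
  have G2: "geodesic X d (g2 n) (k n - m n)" for n
    unfolding g2_def by (rule geodesic_shift[OF g(1)]) (use m(1)[of n] in auto)
  have ends: "g1 n 0 = y n" "g1 n (m n) = p n (l n)" "g2 n 0 = y n" "g2 n (k n - m n) = p' n (l' n)" for n
    unfolding g1_def g2_def y_def using g by simp_all
  have foot: "cone_linked x s (path_at p l s \<rho>) y \<and> cone_linked x s (path_at p' l' s \<rho>) y"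
    if s: "\<And>n. 0 < s n" "filterlim s at_top \<omega>" and B: "0 \<le> B" "eventually (\<lambda>n. d (x n) (y n) \<le> B * s n) \<omega>"
      and \<rho>: "0 < \<rho>" "eventually (\<lambda>n. \<forall>t\<in>{0..k n}. \<rho> * s n \<le> d (x n) (g n t)) \<omega>" for s B \<rho>
  proof -
    have "cone_linked x s (path_at p l s \<rho>) (\<lambda>n. g1 n 0)"
    proof (rule linked_foot[OF x s p G1 ends(2) B(1) _ \<rho>(1)])
      show "eventually (\<lambda>n. d (x n) (g1 n 0) \<le> B * s n) \<omega>" using B(2) unfolding ends .
      show "eventually (\<lambda>n. \<forall>t\<in>{0..m n}. \<rho> * s n \<le> d (x n) (g1 n t)) \<omega>"
        using \<rho>(2)
      proof eventually_elim
        case (elim n)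
        then show ?case unfolding g1_def using m(1)[of n] by auto
      qed
    qed
    moreover have "cone_linked x s (path_at p' l' s \<rho>) (\<lambda>n. g2 n 0)"
    proof (rule linked_foot[OF x s p' G2 ends(4) B(1) _ \<rho>(1)])
      show "eventually (\<lambda>n. d (x n) (g2 n 0) \<le> B * s n) \<omega>" using B(2) unfolding ends .
      show "eventually (\<lambda>n. \<forall>t\<in>{0..k n - m n}. \<rho> * s n \<le> d (x n) (g2 n t)) \<omega>"
        using \<rho>(2)
      proof eventually_elim
        case (elim n)
        then show ?case unfolding g2_def using m(1)[of n] by auto
      qed
    qed
    ultimately show ?thesis unfolding ends by simp
  qed
  show ?thesis
  proof (cases "\<exists>B. eventually (\<lambda>n. d (x n) (y n) \<le> B * r n) \<omega>")
    case True
    then obtain B where B: "eventually (\<lambda>n. d (x n) (y n) \<le> B * r n) \<omega>" by blast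
    have "eventually (\<lambda>n. d (x n) (y n) \<le> max 0 B * r n) \<omega>"
      using B
    proof eventually_elim
      case (elim n)
      have "B * r n \<le> max 0 B * r n" using r(1)[of n] by (intro mult_right_mono) auto
      then show ?case using elim by linarith
    qed
    then have "cone_linked x r (path_at p l r \<tau>) y" "cone_linked x r (path_at p' l' r \<tau>) y" using foot[OF r _ _ \<tau>, of "max 0 B"] by auto
    then show ?thesis using cone_linked_trans cone_linked_sym[of x r, OF x r] by blast
  next
    case False
    have big: "eventually (\<lambda>n. Z * r n \<le> d (x n) (y n)) \<omega>" for Z
    proof -
      have "\<not> eventually (\<lambda>n. d (x n) (y n) \<le> Z * r n) \<omega>" using False by simp
      then have "eventually (\<lambda>n. \<not> d (x n) (y n) \<le> Z * r n) \<omega>" by (simp only: ev_not)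
      then show ?thesis by eventually_elim simp
    qed
    define R where "R n = (if 0 < d (x n) (y n) then d (x n) (y n) else 1)" for n
    have R0: "0 < R n" for n unfolding R_def by simp
    have Rd: "eventually (\<lambda>n. R n = d (x n) (y n)) \<omega>"
      using big[of 1]
    proof eventually_elim
      case (elim n)
      then show ?case using r(1)[of n] unfolding R_def by simp
    qed
    have Rr: "eventually (\<lambda>n. Z * r n \<le> R n) \<omega>" for Z using big[of Z] Rd by eventually_elim simp
    have r_ge: "eventually (\<lambda>n. Z \<le> r n) \<omega>" for Z using r(2) unfolding filterlim_at_top by blast
    have Rtop: "filterlim R at_top \<omega>"
      unfolding filterlim_at_top
    proof
      fix Z show "eventually (\<lambda>n. Z \<le> R n) \<omega>" using Rr[of 1] r_ge[of Z] by eventually_elim simp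
    qed
    have far: "eventually (\<lambda>n. \<forall>t\<in>{0..k n}. 1 * R n \<le> d (x n) (g n t)) \<omega>"
      using Rd by eventually_elim (use m(2) in \<open>simp add: y_def\<close>)
    have "cone_linked x R (path_at p l R 1) y \<and> cone_linked x R (path_at p' l' R 1) y"
    proof (rule foot[OF R0 Rtop zero_le_one _ zero_less_one far])
      show "eventually (\<lambda>n. d (x n) (y n) \<le> 1 * R n) \<omega>" using Rd by eventually_elim simp
    qed
    then have lR: "cone_linked x R (path_at p l R 1) (path_at p' l' R 1)" using cone_linked_trans cone_linked_sym[of x R, OF x R0 Rtop] by blast
    have dl: "d (x n) (p n (l n)) = l n" "d (x n) (p' n (l' n)) = l' n" for n
      using geodesic_dist[OF p(1), of 0 n "l n"] geodesic_dist[OF p'(1), of 0 n "l' n"] l0[of n] p(2)[of n] p'(2)[of n] by auto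
    have c: "eventually (\<lambda>n. 1 * R n \<le> l n) \<omega>" "eventually (\<lambda>n. 1 * R n \<le> l' n) \<omega>"
    proof -
      have far': "eventually (\<lambda>n. R n \<le> d (x n) (g n 0) \<and> R n \<le> d (x n) (g n (k n))) \<omega>"
        using far by eventually_elim (use k0 in auto)
      show "eventually (\<lambda>n. 1 * R n \<le> l n) \<omega>"
        using far' by eventually_elim (simp add: g(2) dl(1))
      show "eventually (\<lambda>n. 1 * R n \<le> l' n) \<omega>"
        using far' by eventually_elim (simp add: g(3) dl(2))
    qed
    have B0: "eventually (\<lambda>n. d (x n) (p' n 0) \<le> 0 * r n) \<omega>" using x p'(2) by simp
    obtain a a' where a: "0 < a" "0 < a'" "cone_linked x r (path_at p l r a) (path_at p' l' r a')"
      using linked_descent[OF x r R0 Rr p p'(1) order_refl B0 zero_less_one c lR] by blast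
    have long: "eventually (\<lambda>n. Z * r n \<le> l n) \<omega>" "eventually (\<lambda>n. Z * r n \<le> l' n) \<omega>" for Z
      using Rr[of Z] c by (eventually_elim, linarith)+
    have "cone_linked x r (path_at p l r \<tau>) (path_at p l r a)" by (rule cone_linked_path_from[OF x r p \<tau>(1) a(1) long(1) long(1)])
    moreover have "cone_linked x r (path_at p' l' r a') (path_at p' l' r \<tau>)" by (rule cone_linked_path_from[OF x r p' a(2) \<tau>(1) long(2) long(2)])
    ultimately show ?thesis using cone_linked_trans a(3) by blast
  qed
qed

text \<open>Auxiliary geodesics from \<open>x\<close> to the vertices of the chain reduce it to
  single edges.\<close>

lemma linked_chain:
  assumes x: "\<And>n. x n \<in> X" and r: "\<And>n. 0 < r n" "filterlim r at_top \<omega>"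
    and p: "\<And>n. geodesic X d (p n) (l n)" "\<And>n. p n 0 = x n" "\<And>n. p n (l n) = h 0 n 0"
    and h: "\<And>j n. j \<le> k \<Longrightarrow> geodesic X d (h j n) (\<eta> j n)" "\<And>j n. j < k \<Longrightarrow> h j n (\<eta> j n) = h (Suc j) n 0"
    and \<tau>: "0 < \<tau>" "\<And>j. j \<le> k \<Longrightarrow> eventually (\<lambda>n. \<forall>t\<in>{0..\<eta> j n}. \<tau> * r n \<le> d (x n) (h j n t)) \<omega>"
    and p': "\<And>n. geodesic X d (p' n) (l' n)" "\<And>n. p' n 0 = x n" "\<And>n. p' n (l' n) = h k n (\<eta> k n)"
  shows "cone_linked x r (path_at p l r \<tau>) (path_at p' l' r \<tau>)"
  using h \<tau>(2) p'
proof (induction k arbitrary: p' l')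
  case 0
  show ?case
    by (rule linked_sides[OF x r p(1,2) 0(4,5) 0(1)[OF order_refl] _ _ \<tau>(1) 0(3)[OF order_refl]]) (use p(3) 0(6) in auto)
next
  case (Suc k)
  have "\<exists>q m. geodesic X d q m \<and> q 0 = x n \<and> q m = h k n (\<eta> k n)" for n
  proof -
    have "h k n (\<eta> k n) \<in> X" using geodesic_in[OF Suc.prems(1)[of k n]] geodesic_nonneg[OF Suc.prems(1)[of k n]] by simp
    then show ?thesis using geo_space x[of n] unfolding geodesic_space_def by blast
  qed
  then obtain q m where q: "\<And>n. geodesic X d (q n) (m n)" "\<And>n. q n 0 = x n" "\<And>n. q n (m n) = h k n (\<eta> k n)" by metis
  have "cone_linked x r (path_at p l r \<tau>) (path_at q m r \<tau>)"
  proof (rule Suc.IH[OF _ _ _ q])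
    fix j n assume "j \<le> k" then show "geodesic X d (h j n) (\<eta> j n)" using Suc.prems(1) by simp
  next
    fix j n assume "j < k" then show "h j n (\<eta> j n) = h (Suc j) n 0" using Suc.prems(2) by simp
  next
    fix j assume "j \<le> k"
    then show "eventually (\<lambda>n. \<forall>t\<in>{0..\<eta> j n}. \<tau> * r n \<le> d (x n) (h j n t)) \<omega>" using Suc.prems(3) by simp
  qed
  moreover have "cone_linked x r (path_at q m r \<tau>) (path_at p' l' r \<tau>)"
    by (rule linked_sides[OF x r q(1,2) Suc.prems(4,5) Suc.prems(1)[OF order_refl] _ _ \<tau>(1) Suc.prems(3)[OF order_refl]])
      (use q(3) Suc.prems(2,6) in auto)
  ultimately show ?case by (rule cone_linked_trans)
qed

end

section \<open>Fat hexagons near pieces\<close>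

context Metric_space
begin

lemma fat_polygonD:
  assumes "fat_polygon M d \<theta> \<nu> k g l"
  shows "\<And>i. i < k \<Longrightarrow> geodesic M d (g i) (l i)" "\<And>i. i < k \<Longrightarrow> g i (l i) = g (Suc i mod k) 0"
    "\<And>i j t u. i < k \<Longrightarrow> j < k \<Longrightarrow> j \<noteq> i \<Longrightarrow> t \<in> {0..l i} \<Longrightarrow> u \<in> {0..l j} \<Longrightarrow> 2 * \<theta> \<le> t \<Longrightarrow> 2 * \<theta> \<le> l i - t \<Longrightarrow> \<theta> \<le> d (g i t) (g j u)"
    "\<And>i j u. i < k \<Longrightarrow> j < k \<Longrightarrow> j \<noteq> i \<Longrightarrow> j \<noteq> Suc i mod k \<Longrightarrow> u \<in> {0..l j} \<Longrightarrow> \<nu> * \<theta> \<le> d (g i (l i)) (g j u)"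
  using assms unfolding fat_polygon_iff geodesic_polygon_def by blast+

text \<open>Lets edge 0, or the corner after it, stand for every other one.\<close>

lemma fat_hexagon_rotate:
  assumes fat: "fat_polygon M d \<theta> \<nu> 6 g l"
  shows "fat_polygon M d \<theta> \<nu> 6 (\<lambda>j. g ((j + i) mod 6)) (\<lambda>j. l ((j + i) mod 6))"
proof -
  note F = fat_polygonD[OF fat]
  have m: "(j + i) mod 6 < 6" for j by simp
  have s: "(Suc j mod 6 + i) mod 6 = Suc ((j + i) mod 6) mod 6" for j by (simp add: mod_add_left_eq mod_Suc_eq)
  have less: "(j + i) mod 6 \<noteq> (k + i) mod 6" if "j < k" "k < 6" for j k
  proof
    assume "(j + i) mod 6 = (k + i) mod 6"
    then have "6 dvd (k + i) - (j + i)" using that by (subst mod_eq_dvd_iff_nat[symmetric]) simp_all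
    then show False using that by (auto dest: dvd_imp_le)
  qed
  have inj: "(j + i) mod 6 \<noteq> (k + i) mod 6" if "j < 6" "k < 6" "j \<noteq> k" for j k
    using less[of j k] less[of k j] that by (metis nat_neq_iff)
  have inj2: "(j + i) mod 6 \<noteq> Suc ((k + i) mod 6) mod 6" if "j < 6" "k < 6" "j \<noteq> Suc k mod 6" for j k
    using inj[of j "Suc k mod 6"] that unfolding s by simp
  show ?thesis
    unfolding fat_polygon_iff geodesic_polygon_def
  proof (intro conjI allI impI ballI)
    fix j assume "j < (6::nat)"
    show "geodesic M d (g ((j + i) mod 6)) (l ((j + i) mod 6))" by (rule F(1)[OF m])
    show "g ((j + i) mod 6) (l ((j + i) mod 6)) = g ((Suc j mod 6 + i) mod 6) 0" unfolding s by (rule F(2)[OF m])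
  next
    fix j k t u assume "j < (6::nat)" "k < (6::nat)" "k \<noteq> j" "t \<in> {0..l ((j + i) mod 6)}" "u \<in> {0..l ((k + i) mod 6)}"
      "2 * \<theta> \<le> t" "2 * \<theta> \<le> l ((j + i) mod 6) - t"
    then show "\<theta> \<le> d (g ((j + i) mod 6) t) (g ((k + i) mod 6) u)" by (intro F(3)[OF m m inj])
  next
    fix j k u assume "j < (6::nat)" "k < (6::nat)" "k \<noteq> j" "k \<noteq> Suc j mod 6" "u \<in> {0..l ((k + i) mod 6)}"
    then show "\<nu> * \<theta> \<le> d (g ((j + i) mod 6) (l ((j + i) mod 6))) (g ((k + i) mod 6) u)"
      by (intro F(4)[OF m m inj inj2])
  qed
qed

text \<open>The end of edge \<open>j\<close> lies on the following edge, from which the start of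
  edge \<open>j\<close> is \<open>\<nu> * \<theta>\<close> away by (F2).\<close>

lemma fat_hexagon_length:
  assumes fat: "fat_polygon M d \<theta> \<nu> 6 g l" and j: "j < 6"
  shows "\<nu> * \<theta> \<le> l j"
proof -
  note F = fat_polygonD[OF fat]
  define i where "i = (j + 5) mod 6"
  have i: "i < 6" "Suc i mod 6 = j" "Suc j mod 6 < 6" "Suc j mod 6 \<noteq> i" "Suc j mod 6 \<noteq> Suc i mod 6"
    using j unfolding i_def less_6_cases by (elim disjE; simp add: mod_Suc)+
  have g: "geodesic M d (g j) (l j)" by (rule F(1)[OF j])
  have "\<nu> * \<theta> \<le> d (g i (l i)) (g (Suc j mod 6) 0)"
    by (rule F(4)[OF i(1,3-5)]) (use geodesic_nonneg[OF F(1)[OF i(3)]] in simp)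
  also have "\<dots> = d (g j 0) (g j (l j))" using F(2)[OF i(1)] F(2)[OF j] i(2) by simp
  also have "\<dots> = l j" using geodesic_dist[OF g, of 0 "l j"] geodesic_nonneg[OF g] by simp
  finally show ?thesis .
qed

end

context atg_quasi_convex
begin

text \<open>At scale \<theta> around a point of the edge, the other five edges stay at distance 1 or
  more by (F1) and link the two directions of the edge. The two directions of a geodesic never meet
  again, so both start in one limit set, and \<open>(\<beta>\<^sub>2)\<close> turns this into a
  window of nearness \<open>M\<close>.\<close>

lemma fat_edge_window:
  "\<exists>c>0. c \<le> 1 \<and> (\<exists>\<theta>0>0. \<forall>\<theta>\<ge>\<theta>0. \<forall>g l t. fat_polygon X d \<theta> 8 6 g l \<longrightarrow> t \<in> {2 * \<theta>..l 0 - 2 * \<theta>} \<longrightarrow>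
     (\<exists>A\<in>\<A>. \<forall>u\<in>{0..l 0}. \<bar>u - t\<bar> \<le> c * \<theta> \<longrightarrow> g 0 u \<in> nbhd X d M A))"
proof (rule ccontr)
  assume not: "\<not> ?thesis"
  have "\<exists>\<theta> g l t. real n + 1 \<le> \<theta> \<and> fat_polygon X d \<theta> 8 6 g l \<and> t \<in> {2 * \<theta>..l 0 - 2 * \<theta>} \<and>
    \<not> (\<exists>A\<in>\<A>. \<forall>u\<in>{0..l 0}. \<bar>u - t\<bar> \<le> 1 / (real n + 1) * \<theta> \<longrightarrow> g 0 u \<in> nbhd X d M A)" for n :: nat
  proof (rule ccontr)
    assume a: "\<not> ?thesis"
    \<comment> \<open>Window radius and threshold for \<theta> are refuted together, with
      \<open>1 / (real n + 1)\<close> and \<open>real n + 1\<close>.\<close>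
    have "\<exists>c>0. c \<le> 1 \<and> (\<exists>\<theta>0>0. \<forall>\<theta>\<ge>\<theta>0. \<forall>g l t. fat_polygon X d \<theta> 8 6 g l \<longrightarrow> t \<in> {2 * \<theta>..l 0 - 2 * \<theta>} \<longrightarrow>
     (\<exists>A\<in>\<A>. \<forall>u\<in>{0..l 0}. \<bar>u - t\<bar> \<le> c * \<theta> \<longrightarrow> g 0 u \<in> nbhd X d M A))"
      by (rule exI[of _ "1 / (real n + 1)"], intro conjI exI[of _ "real n + 1"]) (use a in auto)
    then show False using not by contradiction
  qed
  then obtain \<theta> g l t where *: "\<And>n::nat. real n + 1 \<le> \<theta> n" "\<And>n. fat_polygon X d (\<theta> n) 8 6 (g n) (l n)"
    "\<And>n. t n \<in> {2 * \<theta> n..l n 0 - 2 * \<theta> n}"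
    "\<And>n. \<not> (\<exists>A\<in>\<A>. \<forall>u\<in>{0..l n 0}. \<bar>u - t n\<bar> \<le> 1 / (real n + 1) * \<theta> n \<longrightarrow> g n 0 u \<in> nbhd X d M A)"
    by metis
  note F = fat_polygonD[OF *(2)]
  have \<theta>: "0 < \<theta> n" "real n \<le> \<theta> n" for n using *(1)[of n] by linarith+
  have \<theta>top: "filterlim \<theta> at_top \<omega>" by (rule filterlim_ge_nat[OF \<theta>(2)])
  have g0: "geodesic X d (g n 0) (l n 0)" for n by (rule F(1)) simp
  have t: "0 \<le> t n" "t n \<le> l n 0" "t n \<in> {0..l n 0}" "2 * \<theta> n \<le> t n" "2 * \<theta> n \<le> l n 0 - t n" for n
    using *(3)[of n] \<theta>(1)[of n] by auto
  define x where "x n = g n 0 (t n)" for n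
  have x: "x n \<in> X" for n unfolding x_def by (rule geodesic_in[OF g0 t(3)])
  define p where "p n \<tau> = g n 0 (t n + \<tau>)" for n \<tau>
  define lp where "lp n = l n 0 - t n" for n
  define p' where "p' n \<tau> = g n 0 (t n - \<tau>)" for n \<tau>
  have p: "geodesic X d (p n) (lp n)" for n
    unfolding p_def lp_def by (rule geodesic_shift[OF g0]) (use t[of n] in auto)
  have p': "geodesic X d (p' n) (t n)" for n
  proof -
    have "geodesic X d (g n 0) (t n)" using geodesic_shift[OF g0, of 0 "t n" n] t[of n] by simp
    then show ?thesis unfolding p'_def by (rule geodesic_reverse)
  qed
  have p0: "p n 0 = x n" "p' n 0 = x n" for n unfolding p_def p'_def x_def by simp_all
  have "cone_linked x \<theta> (path_at p lp \<theta> 1) (path_at p' t \<theta> 1)"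
  proof (rule linked_chain[OF x \<theta>(1) \<theta>top p p0(1) _ _ _ zero_less_one _ p' p0(2),
        where h = "\<lambda>j n. g n (Suc j)" and k = 4 and \<eta> = "\<lambda>j n. l n (Suc j)"])
    show "p n (lp n) = g n (Suc 0) 0" for n unfolding p_def lp_def using F(2)[of 0 n] by simp
    show "p' n (t n) = g n (Suc 4) (l n (Suc 4))" for n unfolding p'_def using F(2)[of 5 n] by simp
    show "geodesic X d (g n (Suc j)) (l n (Suc j))" if "j \<le> 4" for j n by (rule F(1)) (use that in simp)
    show "g n (Suc j) (l n (Suc j)) = g n (Suc (Suc j)) 0" if "j < 4" for j n using F(2)[of "Suc j" n] that by simp
    fix j :: nat assume "j \<le> 4"
    then show "eventually (\<lambda>n. \<forall>u\<in>{0..l n (Suc j)}. 1 * \<theta> n \<le> d (x n) (g n (Suc j) u)) \<omega>"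
      unfolding x_def using F(3)[of 0 "Suc j"] t(3-5) by (auto intro!: always_eventually)
  qed
  interpret Q: atg_cone X d \<omega> x \<theta> \<A> by (rule atg_cone[OF x \<theta>(1) \<theta>top])
  have pV: "(\<lambda>n. p n 0) \<in> Q.V" "(\<lambda>n. p' n 0) \<in> Q.V" using Q.base_V p0 by simp_all
  have long: "eventually (\<lambda>n. 1 * \<theta> n \<le> lp n) \<omega>" "eventually (\<lambda>n. 1 * \<theta> n \<le> t n) \<omega>"
    using t(4,5) \<theta>(1) by (auto intro!: always_eventually simp: lp_def) (smt (verit))+
  define G where "G = (\<lambda>\<tau>. Q.pt (path_at p lp \<theta> \<tau>))"
  define G' where "G' = (\<lambda>\<tau>. Q.pt (path_at p' t \<theta> \<tau>))"
  have px: "Q.pt (\<lambda>n. p n 0) = Q.pt x" "Q.pt (\<lambda>n. p' n 0) = Q.pt x" using p0 by simp_all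
  have seg: "geo_seg Q.C Q.D (G ` {0..\<tau>}) (Q.pt x) (G \<tau>)" if "0 \<le> \<tau>" "\<tau> \<le> 1" for \<tau>
    unfolding G_def px(1)[symmetric]
  proof (rule Q.path_seg[OF p pV(1) _ that(1)])
    show "eventually (\<lambda>n. \<tau> * \<theta> n \<le> lp n) \<omega>" using Q.path_ev[OF long(1) that(2)] by eventually_elim linarith
  qed
  have seg': "geo_seg Q.C Q.D (G' ` {0..\<tau>}) (Q.pt x) (G' \<tau>)" if "0 \<le> \<tau>" "\<tau> \<le> 1" for \<tau>
    unfolding G'_def px(2)[symmetric]
  proof (rule Q.path_seg[OF p' pV(2) _ that(1)])
    show "eventually (\<lambda>n. \<tau> * \<theta> n \<le> t n) \<omega>" using Q.path_ev[OF long(2) that(2)] by eventually_elim linarith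
  qed
  have from_x: "Q.D (Q.pt x) (G \<tau>) = \<tau>" "Q.D (Q.pt x) (G' \<tau>) = \<tau>" if "0 \<le> \<tau>" "\<tau> \<le> 1" for \<tau>
    using Q.path_from[OF p pV(1) long(1) that] Q.path_from[OF p' pV(2) long(2) that] unfolding G_def G'_def px by simp_all
  have xC: "Q.pt x \<in> Q.C" by (rule Q.pt_in[OF Q.base_V])
  have ne: "G 1 \<noteq> Q.pt x" using from_x(1)[of 1] xC by auto
  have GV: "path_at p lp \<theta> \<tau> \<in> Q.V" "path_at p' t \<theta> \<tau> \<in> Q.V" if "0 \<le> \<tau>" for \<tau>
    by (rule Q.path_seq_V[OF p pV(1) that] Q.path_seq_V[OF p' pV(2) that])+
  have "Q.Pc.linked (Q.pt x) (G 1) (G' 1)"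
    using \<open>cone_linked x \<theta> (path_at p lp \<theta> 1) (path_at p' t \<theta> 1)\<close> unfolding cone_linked_def G_def G'_def .
  from Q.Pc.linked_germs[OF seg[OF zero_le_one order_refl] seg'[OF zero_le_one order_refl] ne this]
  show False
  proof
    assume "\<exists>u. u \<noteq> Q.pt x \<and> u \<in> G ` {0..1} \<and> u \<in> G' ` {0..1}"
    then obtain u where u: "u \<noteq> Q.pt x" "u \<in> G ` {0..1}" "u \<in> G' ` {0..1}" by (elim exE conjE)
    obtain \<tau> where \<tau>: "\<tau> \<in> {0..1}" "u = G \<tau>" using u(2) by blast
    obtain \<sigma> where \<sigma>: "\<sigma> \<in> {0..1}" "u = G' \<sigma>" using u(3) by blast
    have "\<tau> = \<sigma>" using from_x(1)[of \<tau>] from_x(2)[of \<sigma>] \<tau> \<sigma> by simp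
    \<comment> \<open>The parameters \<open>t n + \<tau> * \<theta> n\<close> and
      \<open>t n - \<tau> * \<theta> n\<close> belong to one geodesic, so a common point has
      \<open>\<tau> = 0\<close>.\<close>
    have "2 * \<tau> \<le> Q.D (G \<tau>) (G' \<tau>)"
      unfolding G_def G'_def
    proof (rule Q.D_geI[OF _ GV])
      show "eventually (\<lambda>n. 2 * \<tau> * \<theta> n \<le> d (path_at p lp \<theta> \<tau> n) (path_at p' t \<theta> \<tau> n)) \<omega>"
        using long
      proof eventually_elim
        case (elim n)
        have "0 \<le> \<tau> * \<theta> n" "\<tau> * \<theta> n \<le> \<theta> n" using \<tau>(1) \<theta>(1)[of n] by (auto simp: mult_left_le_one_le)
        then have r: "0 \<le> \<tau> * \<theta> n" "\<tau> * \<theta> n \<le> lp n" "\<tau> * \<theta> n \<le> t n" using elim by simp_all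
        have "d (g n 0 (t n + \<tau> * \<theta> n)) (g n 0 (t n - \<tau> * \<theta> n)) = \<bar>(t n + \<tau> * \<theta> n) - (t n - \<tau> * \<theta> n)\<bar>"
          by (rule geodesic_dist[OF g0]) (use r t[of n] in \<open>auto simp: lp_def\<close>)
        then show ?case using r unfolding p_def p'_def by (simp add: min_absorb2)
      qed
    qed (use \<tau> in auto)
    then have "\<tau> = 0" using \<tau> \<sigma> \<open>\<tau> = \<sigma>\<close> Q.Pc.zero[of u u] Q.pt_in[OF GV(1), of \<tau>] unfolding G_def by force
    then have "Q.D (Q.pt x) u = 0" using from_x(1)[of 0] \<tau> by simp
    moreover have "u \<in> Q.C" using \<tau> Q.pt_in[OF GV(1), of \<tau>] unfolding G_def by simp
    ultimately show False using u(1) Q.Pc.zero[OF xC] by simp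
  next
    assume "\<exists>Q0\<in>Q.lims ` Q.seqs. Q.pt x \<in> Q0 \<and> (\<exists>u\<in>G ` {0..1} \<inter> Q0. u \<noteq> Q.pt x) \<and> (\<exists>u\<in>G' ` {0..1} \<inter> Q0. u \<noteq> Q.pt x)"
    then obtain Q0 where Q0: "Q0 \<in> Q.lims ` Q.seqs" "Q.pt x \<in> Q0" "\<exists>u\<in>G ` {0..1} \<inter> Q0. u \<noteq> Q.pt x" "\<exists>u\<in>G' ` {0..1} \<inter> Q0. u \<noteq> Q.pt x"
      by (elim bexE conjE) blast
    obtain u where u: "u \<in> G ` {0..1} \<inter> Q0" "u \<noteq> Q.pt x" using Q0(3) by (elim bexE)
    obtain u' where u': "u' \<in> G' ` {0..1} \<inter> Q0" "u' \<noteq> Q.pt x" using Q0(4) by (elim bexE)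
    obtain t1 where t1: "0 \<le> t1" "t1 \<le> 1" "u = G t1" using u(1) by auto
    obtain t2 where t2: "0 \<le> t2" "t2 \<le> 1" "u' = G' t2" using u'(1) by auto
    obtain A where A: "A \<in> Q.seqs" "Q0 = Q.lims A" using Q0(1) by blast
    have A\<A>: "A n \<in> \<A>" for n by (rule Q.seqs_coll[OF A(1)])
    have AX: "A n \<subseteq> X" for n by (rule coll_sub[OF A\<A>])
    have G0: "G 0 = Q.pt x" "G' 0 = Q.pt x"
      using from_x[of 0] xC Q.Pc.zero[OF xC Q.pt_in[OF GV(1)[of 0]]] Q.Pc.zero[OF xC Q.pt_in[OF GV(2)[of 0]]]
      unfolding G_def G'_def by auto
    define m where "m = min t1 t2"
    have m: "0 < m" "m \<le> 1" "m \<in> {0..t1}" "m \<in> {0..t2}"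
    proof -
      have "t1 \<noteq> 0" "t2 \<noteq> 0" using t1(3) t2(3) u(2) u'(2) G0 by metis+
      then show "0 < m" "m \<le> 1" "m \<in> {0..t1}" "m \<in> {0..t2}" using t1 t2 unfolding m_def by auto
    qed
    have "G ` {0..t1} \<subseteq> Q0"
      by (rule Q.Pc.piece_convex[OF Q0(1) seg[OF t1(1,2)] Q0(2)]) (use u t1 in auto)
    then have in1: "Q.pt (path_at p lp \<theta> m) \<in> Q.lims A" using m(3) A(2) unfolding G_def by auto
    have "G' ` {0..t2} \<subseteq> Q0"
      by (rule Q.Pc.piece_convex[OF Q0(1) seg'[OF t2(1,2)] Q0(2)]) (use u' t2 in auto)
    then have in2: "Q.pt (path_at p' t \<theta> m) \<in> Q.lims A" using m(4) A(2) unfolding G'_def by auto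
    have m0: "0 \<le> m" using m by simp
    have pos: "0 < \<epsilon> * (2 * m)" using \<epsilon> m by simp
    have ev1: "eventually (\<lambda>n. path_at p lp \<theta> m n \<in> nbhd X d (\<epsilon> * (2 * m) * \<theta> n) (A n)) \<omega>"
      using in1 pos unfolding Q.lims_iff[where A = A, OF GV(1)[OF m0] AX] by blast
    have ev2: "eventually (\<lambda>n. path_at p' t \<theta> m n \<in> nbhd X d (\<epsilon> * (2 * m) * \<theta> n) (A n)) \<omega>"
      using in2 pos unfolding Q.lims_iff[where A = A, OF GV(2)[OF m0] AX] by blast
    \<comment> \<open>From \<open>k\<close> on, the window of radius
      \<open>\<theta> n / (n + 1)\<close> is inside the middle third of the part between
      \<open>t n - m * \<theta> n\<close> and \<open>t n + m * \<theta> n\<close>.\<close>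
    obtain k :: nat where k: "3 / m \<le> real k" using real_arch_simple by blast
    have "eventually (\<lambda>n. False) \<omega>"
      using ev1 ev2 Q.path_ev[OF long(1) m(2)] Q.path_ev[OF long(2) m(2)] ev_ge[of k]
    proof eventually_elim
      case (elim n)
      have m\<theta>: "0 < m * \<theta> n" "m * \<theta> n \<le> \<theta> n" using m \<theta>(1)[of n] by (auto simp: mult_left_le_one_le)
      define h where "h u = g n 0 ((t n - m * \<theta> n) + u)" for u
      have "geodesic X d h ((t n + m * \<theta> n) - (t n - m * \<theta> n))"
        unfolding h_def by (rule geodesic_shift[OF g0]) (use m\<theta> t[of n] in auto)
      then have h: "geodesic X d h (2 * m * \<theta> n)" by (simp add: algebra_simps)
      have "h 0 \<in> nbhd X d (\<epsilon> * (2 * m * \<theta> n)) (A n)" "h (2 * m * \<theta> n) \<in> nbhd X d (\<epsilon> * (2 * m * \<theta> n)) (A n)"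
        using elim unfolding h_def p_def p'_def by (simp_all add: algebra_simps)
      then have mid: "h ` {2 * m * \<theta> n / 3..2 * (2 * m * \<theta> n) / 3} \<subseteq> nbhd X d M (A n)" using \<beta>2 h A\<A> by blast
      have "g n 0 u \<in> nbhd X d M (A n)" if u: "u \<in> {0..l n 0}" "\<bar>u - t n\<bar> \<le> 1 / (real n + 1) * \<theta> n" for u
      proof -
        have "3 / m \<le> real n + 1" using k elim(5) by linarith
        then have "1 / (real n + 1) \<le> m / 3" using m(1) by (simp add: field_simps)
        then have "1 / (real n + 1) * \<theta> n \<le> m / 3 * \<theta> n" using \<theta>(1)[of n] by (intro mult_right_mono) auto
        then have w: "\<bar>u - t n\<bar> \<le> m * \<theta> n / 3" using u(2) by linarith
        have "- (m * \<theta> n / 3) \<le> u - t n" "u - t n \<le> m * \<theta> n / 3" using w unfolding abs_le_iff by linarith+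
        then have "u - (t n - m * \<theta> n) \<in> {2 * m * \<theta> n / 3..2 * (2 * m * \<theta> n) / 3}" by auto
        then have "h (u - (t n - m * \<theta> n)) \<in> nbhd X d M (A n)" using mid by blast
        then show ?thesis unfolding h_def by simp
      qed
      then show False using *(4)[of n] A\<A> by blast
    qed
    then show False by simp
  qed
qed

text \<open>Neighboring windows overlap in a stretch of length \<open>c * \<theta>\<close>, which
  exceeds the bound of \<open>(\<alpha>\<^sub>1)\<close> for large \<theta>; so the member of the
  collection cannot change along the edge.\<close>

lemma fat_edge_near:
  "\<exists>\<theta>0>0. \<forall>\<theta>\<ge>\<theta>0. \<forall>g l. fat_polygon X d \<theta> 8 6 g l \<longrightarrow>
     (\<exists>A\<in>\<A>. \<forall>t\<in>{2 * \<theta>..l 0 - 2 * \<theta>}. g 0 t \<in> nbhd X d M A)"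
proof -
  obtain c \<theta>0 where c: "0 < c" "c \<le> 1" and \<theta>0: "0 < \<theta>0" and win: "\<And>\<theta> g l t. \<theta>0 \<le> \<theta> \<Longrightarrow> fat_polygon X d \<theta> 8 6 g l \<Longrightarrow>
    t \<in> {2 * \<theta>..l 0 - 2 * \<theta>} \<Longrightarrow> \<exists>A\<in>\<A>. \<forall>u\<in>{0..l 0}. \<bar>u - t\<bar> \<le> c * \<theta> \<longrightarrow> g 0 u \<in> nbhd X d M A"
    using fat_edge_window by metis
  obtain D0 :: real where D0: "\<forall>A\<in>\<A>. \<forall>A'\<in>\<A>. A \<noteq> A' \<longrightarrow> set_diam d (nbhd X d (M+1) A \<inter> nbhd X d (M+1) A') \<le> ennreal D0"
    using intersections_bounded[of "M+1"] M0 by auto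
  define \<theta>1 where "\<theta>1 = max \<theta>0 ((max 0 D0 + 1) / c)"
  have "\<exists>A\<in>\<A>. \<forall>t\<in>{2 * \<theta>..l 0 - 2 * \<theta>}. g 0 t \<in> nbhd X d M A"
    if \<theta>: "\<theta>1 \<le> \<theta>" and fat: "fat_polygon X d \<theta> 8 6 g l" for \<theta> g l
  proof -
    have th: "\<theta>0 \<le> \<theta>" "(max 0 D0 + 1) / c \<le> \<theta>" using \<theta> unfolding \<theta>1_def by auto
    then have big: "max 0 D0 < c * \<theta>"
    proof -
      have "max 0 D0 + 1 \<le> c * \<theta>" using th(2) c(1) by (simp only: pos_divide_le_eq mult.commute)
      then show ?thesis by linarith
    qed
    have pos: "0 < \<theta>" using th \<theta>0 by linarith
    have g0: "geodesic X d (g 0) (l 0)" by (rule fat_polygonD(1)[OF fat]) simp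
    have len: "8 * \<theta> \<le> l 0" by (rule fat_hexagon_length[OF fat]) simp
    have t0: "2 * \<theta> \<in> {2 * \<theta>..l 0 - 2 * \<theta>}" using len pos by auto
    obtain A where A: "A \<in> \<A>" "\<forall>u\<in>{0..l 0}. \<bar>u - 2 * \<theta>\<bar> \<le> c * \<theta> \<longrightarrow> g 0 u \<in> nbhd X d M A"
      using win[OF th(1) fat t0] by blast
    have c\<theta>: "0 < c * \<theta>" "c * \<theta> \<le> \<theta>" using c pos by (auto simp: mult_left_le_one_le)
    have step: "\<forall>u\<in>{0..l 0}. \<bar>u - y\<bar> \<le> c * \<theta> \<longrightarrow> g 0 u \<in> nbhd X d M A"
      if x: "x \<in> {2 * \<theta>..l 0 - 2 * \<theta>}" and y: "y \<in> {2 * \<theta>..l 0 - 2 * \<theta>}" and xy: "\<bar>x - y\<bar> \<le> c * \<theta> / 2"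
        and Ax: "\<forall>u\<in>{0..l 0}. \<bar>u - x\<bar> \<le> c * \<theta> \<longrightarrow> g 0 u \<in> nbhd X d M A" for x y
    proof -
      obtain A' where A': "A' \<in> \<A>" "\<forall>u\<in>{0..l 0}. \<bar>u - y\<bar> \<le> c * \<theta> \<longrightarrow> g 0 u \<in> nbhd X d M A'"
        using win[OF th(1) fat y] by blast
      have "A' = A"
      proof (rule ccontr)
        assume ne: "A' \<noteq> A"
        \<comment> \<open>Both \<open>u\<close> and \<open>u + c * \<theta>\<close> are in the
          window about \<open>x\<close> and in the window about \<open>y\<close>.\<close>
        define u where "u = max x y - c * \<theta>"
        have u: "u \<in> {0..l 0}" "u + c * \<theta> \<in> {0..l 0}" "\<bar>u - x\<bar> \<le> c * \<theta>" "\<bar>u - y\<bar> \<le> c * \<theta>"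
          "\<bar>u + c * \<theta> - x\<bar> \<le> c * \<theta>" "\<bar>u + c * \<theta> - y\<bar> \<le> c * \<theta>"
          using x y xy c\<theta> unfolding u_def by (auto simp: max_def)
        have "nbhd X d M B \<subseteq> nbhd X d (M+1) B" for B using nbhd_mono[of M "M+1"] by auto
        then have "g 0 u \<in> nbhd X d (M+1) A' \<inter> nbhd X d (M+1) A" "g 0 (u + c * \<theta>) \<in> nbhd X d (M+1) A' \<inter> nbhd X d (M+1) A"
          using u Ax A'(2) by blast+
        moreover have "set_diam d (nbhd X d (M+1) A' \<inter> nbhd X d (M+1) A) \<le> ennreal (max 0 D0)"
          using D0[rule_format, OF A'(1) A(1) ne] by (rule order_trans) (simp add: ennreal_leI)
        ultimately have "d (g 0 u) (g 0 (u + c * \<theta>)) \<le> max 0 D0" using set_diam_le_iff[of "max 0 D0"] by auto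
        then show False using geodesic_dist[OF g0 u(1,2)] big c\<theta> by simp
      qed
      then show ?thesis using A'(2) by simp
    qed
    have all: "\<forall>u\<in>{0..l 0}. \<bar>u - t\<bar> \<le> c * \<theta> \<longrightarrow> g 0 u \<in> nbhd X d M A" if t: "t \<in> {2 * \<theta>..l 0 - 2 * \<theta>}" for t
    proof (rule interval_local_induct[where P = "\<lambda>x. \<forall>u\<in>{0..l 0}. \<bar>u - x\<bar> \<le> c * \<theta> \<longrightarrow> g 0 u \<in> nbhd X d M A", OF t0 A(2) t])
      fix s assume s: "s \<in> {2 * \<theta>..l 0 - 2 * \<theta>}"
      show "\<exists>\<delta>>0. \<forall>x\<in>{2 * \<theta>..l 0 - 2 * \<theta>}. \<forall>y\<in>{2 * \<theta>..l 0 - 2 * \<theta>}. \<bar>x - s\<bar> < \<delta> \<longrightarrow> \<bar>y - s\<bar> < \<delta> \<longrightarrow>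
        (\<forall>u\<in>{0..l 0}. \<bar>u - x\<bar> \<le> c * \<theta> \<longrightarrow> g 0 u \<in> nbhd X d M A) \<longrightarrow> (\<forall>u\<in>{0..l 0}. \<bar>u - y\<bar> \<le> c * \<theta> \<longrightarrow> g 0 u \<in> nbhd X d M A)"
      proof (rule exI[of _ "c * \<theta> / 4"], rule conjI, use c\<theta> in simp, intro ballI impI)
        fix x y u assume xy: "x \<in> {2 * \<theta>..l 0 - 2 * \<theta>}" "y \<in> {2 * \<theta>..l 0 - 2 * \<theta>}" and ds: "\<bar>x - s\<bar> < c * \<theta> / 4" "\<bar>y - s\<bar> < c * \<theta> / 4"
          and Ax: "\<forall>u\<in>{0..l 0}. \<bar>u - x\<bar> \<le> c * \<theta> \<longrightarrow> g 0 u \<in> nbhd X d M A" and u: "u \<in> {0..l 0}" "\<bar>u - y\<bar> \<le> c * \<theta>"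
        have "\<bar>x - y\<bar> \<le> c * \<theta> / 2" using ds by linarith
        then show "g 0 u \<in> nbhd X d M A" using step[OF xy _ Ax] u by blast
      qed
    qed
    have "g 0 t \<in> nbhd X d M A" if "t \<in> {2 * \<theta>..l 0 - 2 * \<theta>}" for t
      using all[OF that] that pos c\<theta> by auto
    then show ?thesis using A(1) by blast
  qed
  moreover have "0 < \<theta>1" unfolding \<theta>1_def using \<theta>0 by simp
  ultimately show ?thesis by blast
qed

text \<open>\<open>x\<close> is a point of the cone, so taking it as base point gives the same cone.
  \<open>cone_linked\<close> has base point \<open>x\<close>, while the corner argument is carried
  out in the cone at the corner.\<close>

lemma linked_rebase:
  assumes e: "\<And>n. e n \<in> X" and s: "\<And>n. 0 < s n" "filterlim s at_top \<omega>" and x: "x \<in> cone_seqs X d \<omega> e s"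
    and l: "cone_linked x s u v"
  shows "(pieces.link (geo_seg (cone X d \<omega> e s) (cone_dist X d \<omega> e s))
     (limit_set X d \<omega> e s ` piece_seqs d \<A> \<omega> e s) (cone_space.pt X d \<omega> e s x))\<^sup>*\<^sup>*
     (cone_space.pt X d \<omega> e s u) (cone_space.pt X d \<omega> e s v)"
proof -
  interpret E: atg_cone X d \<omega> e s \<A> by (rule atg_cone[OF e s])
  have xX: "x n \<in> X" for n by (rule E.V_X[OF x])
  interpret F: atg_cone X d \<omega> x s \<A> by (rule atg_cone[OF xX s])
  have V: "F.V = E.V"
  proof (intro equalityI subsetI)
    fix y assume y: "y \<in> F.V"
    then obtain B where B: "eventually (\<lambda>n. d (y n) (x n) \<le> B * s n) \<omega>" unfolding F.V_iff by blast
    show "y \<in> E.V"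
      by (rule E.V_near[OF x F.V_X[OF y], where B = B]) (use B commute in simp)
  next
    fix y assume y: "y \<in> E.V"
    obtain B where B: "eventually (\<lambda>n. d (y n) (x n) \<le> B * s n) \<omega>" using E.V_dist_bounded[OF y x] by blast
    show "y \<in> F.V" by (rule F.VI[OF E.V_X[OF y] B])
  qed
  have rel: "cone_rel X d \<omega> x s = cone_rel X d \<omega> e s" unfolding cone_rel_def V ..
  have C: "F.C = E.C" unfolding cone_def V rel ..
  have D: "F.D = E.D" unfolding cone_dist_def C ..
  have pt: "F.pt = E.pt" unfolding F.pt_def E.pt_def rel ..
  have lims: "F.lims = E.lims" unfolding limit_set_def V rel ..
  have "E.Pc.link (E.pt x) a b" if ab: "F.Pc.link (F.pt x) a b" for a b
  proof -
    have "a \<noteq> E.pt x" "b \<noteq> E.pt x" using ab[unfolded F.Pc.link_def] unfolding pt by blast+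
    moreover have "(\<exists>S. geo_seg E.C E.D S a b \<and> E.pt x \<notin> S) \<or> (\<exists>Q\<in>E.lims ` E.seqs. a \<in> Q \<and> b \<in> Q)"
    proof (cases "\<exists>S. geo_seg E.C E.D S a b \<and> E.pt x \<notin> S")
      case False
      then obtain A where A: "A \<in> F.seqs" "a \<in> E.lims A" "b \<in> E.lims A"
        using ab[unfolded F.Pc.link_def] unfolding pt C D lims by blast
      have "E.lims A \<in> E.lims ` E.seqs" by (rule E.lims_piece[OF F.seqs_coll[OF A(1)] A(2)])
      then show ?thesis using A by blast
    qed blast
    ultimately show ?thesis unfolding E.Pc.link_def by blast
  qed
  then have "F.Pc.link (F.pt x) \<le> E.Pc.link (E.pt x)" by blast
  from rtranclp_mono[OF this] show ?thesis using l unfolding cone_linked_def pt by blast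
qed

text \<open>If two consecutive edges were near different pieces, consider the cone at their corner, and let \<open>e\<close>
  be the entry point of a point of the second edge into the limit piece of the first one. The
  hexagon links the two edges relative to \<open>e\<close>, which \<open>linked_not_in_piece\<close> forbids.\<close>

lemma fat_corner_same:
  "\<exists>\<theta>0>0. \<forall>\<theta>\<ge>\<theta>0. \<forall>g l A A'. fat_polygon X d \<theta> 8 6 g l \<longrightarrow> A \<in> \<A> \<longrightarrow> A' \<in> \<A> \<longrightarrow>
     (\<forall>t\<in>{2 * \<theta>..l 0 - 2 * \<theta>}. g 0 t \<in> nbhd X d M A) \<longrightarrow> (\<forall>t\<in>{2 * \<theta>..l 1 - 2 * \<theta>}. g 1 t \<in> nbhd X d M A') \<longrightarrow> A = A'"
proof (rule ccontr)
  assume not: "\<not> ?thesis"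
  have "\<exists>\<theta> g l A A'. real n + 1 \<le> \<theta> \<and> fat_polygon X d \<theta> 8 6 g l \<and> A \<in> \<A> \<and> A' \<in> \<A> \<and>
     (\<forall>t\<in>{2 * \<theta>..l 0 - 2 * \<theta>}. g 0 t \<in> nbhd X d M A) \<and> (\<forall>t\<in>{2 * \<theta>..l 1 - 2 * \<theta>}. g 1 t \<in> nbhd X d M A') \<and> A \<noteq> A'" for n :: nat
    using not[unfolded not_ex, rule_format, of "real n + 1"] by auto
  then obtain \<theta> g l A A' where *: "\<And>n::nat. real n + 1 \<le> \<theta> n" "\<And>n. fat_polygon X d (\<theta> n) 8 6 (g n) (l n)"
    "\<And>n. A n \<in> \<A>" "\<And>n. A' n \<in> \<A>" "\<And>n. \<forall>t\<in>{2 * \<theta> n..l n 0 - 2 * \<theta> n}. g n 0 t \<in> nbhd X d M (A n)"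
    "\<And>n. \<forall>t\<in>{2 * \<theta> n..l n 1 - 2 * \<theta> n}. g n 1 t \<in> nbhd X d M (A' n)" "\<And>n. A n \<noteq> A' n"
    by metis
  note F = fat_polygonD[OF *(2)]
  have \<theta>: "0 < \<theta> n" "real n \<le> \<theta> n" for n using *(1)[of n] by linarith+
  have \<theta>top: "filterlim \<theta> at_top \<omega>" by (rule filterlim_ge_nat[OF \<theta>(2)])
  have AX: "A n \<subseteq> X" "A' n \<subseteq> X" for n by (rule coll_sub[OF *(3)], rule coll_sub[OF *(4)])
  have gg: "geodesic X d (g n i) (l n i)" if "i < 6" for n i using F(1)[OF that] .
  have len: "8 * \<theta> n \<le> l n i" if "i < 6" for n i by (rule fat_hexagon_length[OF *(2) that])
  have l0: "8 * \<theta> n \<le> l n 0" "8 * \<theta> n \<le> l n 1" for n using len[of 0 n] len[of 1 n] by simp_all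
  define v where "v n = g n 0 (l n 0)" for n
  have v1: "v n = g n 1 0" for n unfolding v_def using F(2)[of 0 n] by simp
  define q where "q n \<tau> = g n 0 (l n 0 - \<tau>)" for n \<tau>
  have q: "geodesic X d (q n) (l n 0)" for n unfolding q_def by (rule geodesic_reverse[OF gg]) simp
  have q': "geodesic X d (g n 1) (l n 1)" for n by (rule gg) simp
  have q0: "q n 0 = v n" for n unfolding q_def v_def by simp
  have vX: "v n \<in> X" for n
    unfolding v_def by (rule geodesic_in[OF gg]) (use l0(1)[of n] \<theta>(1)[of n] in auto)
  interpret E: atg_cone X d \<omega> v \<theta> \<A> by (rule atg_cone[OF vX \<theta>(1) \<theta>top])
  define G where "G = (\<lambda>\<tau>. E.pt (path_at q (\<lambda>n. l n 0) \<theta> \<tau>))"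
  define G' where "G' = (\<lambda>\<tau>. E.pt (path_at (\<lambda>n. g n 1) (\<lambda>n. l n 1) \<theta> \<tau>))"
  have min8: "min (l n 0) (\<tau> * \<theta> n) = \<tau> * \<theta> n" "min (l n 1) (\<tau> * \<theta> n) = \<tau> * \<theta> n" if "\<tau> \<le> 8" for \<tau> n
  proof -
    have "\<tau> * \<theta> n \<le> 8 * \<theta> n" using that \<theta>(1)[of n] by simp
    then show "min (l n 0) (\<tau> * \<theta> n) = \<tau> * \<theta> n" "min (l n 1) (\<tau> * \<theta> n) = \<tau> * \<theta> n" using l0[of n] by auto
  qed
  have V0: "(\<lambda>n. q n 0) \<in> E.V" "(\<lambda>n. g n 1 0) \<in> E.V"
    unfolding q0 v1[symmetric] by (rule E.base_V)+
  have long: "eventually (\<lambda>n. 8 * \<theta> n \<le> l n 0) \<omega>" "eventually (\<lambda>n. 8 * \<theta> n \<le> l n 1) \<omega>" using l0 by simp_all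
  have GV: "path_at q (\<lambda>n. l n 0) \<theta> \<tau> \<in> E.V" "path_at (\<lambda>n. g n 1) (\<lambda>n. l n 1) \<theta> \<tau> \<in> E.V" if "0 \<le> \<tau>" for \<tau>
    by (rule E.path_seq_V[OF q V0(1) that] E.path_seq_V[OF q' V0(2) that])+
  have px: "E.pt (\<lambda>n. q n 0) = E.pt v" "E.pt (\<lambda>n. g n 1 0) = E.pt v" unfolding q0 v1[symmetric] by (rule refl)+
  have le8: "eventually (\<lambda>n. \<tau> * \<theta> n \<le> l n 0) \<omega>" "eventually (\<lambda>n. \<tau> * \<theta> n \<le> l n 1) \<omega>" if "\<tau> \<le> 8" for \<tau>
    using E.path_ev[OF long(1) that] E.path_ev[OF long(2) that] by (eventually_elim, linarith)+
  have seg: "geo_seg E.C E.D (G ` {0..\<tau>}) (E.pt v) (G \<tau>)" if "0 \<le> \<tau>" "\<tau> \<le> 8" for \<tau>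
    unfolding G_def px(1)[symmetric] by (rule E.path_seg[OF q V0(1) le8(1)[OF that(2)] that(1)])
  have seg': "geo_seg E.C E.D (G' ` {0..\<tau>}) (E.pt v) (G' \<tau>)" if "0 \<le> \<tau>" "\<tau> \<le> 8" for \<tau>
    unfolding G'_def px(2)[symmetric] by (rule E.path_seg[OF q' V0(2) le8(2)[OF that(2)] that(1)])
  have geoG: "geodesic E.C E.D G 8" unfolding G_def by (rule E.path_geodesic[OF q V0(1) _ long(1)]) simp
  have geoG': "geodesic E.C E.D G' 8" unfolding G'_def by (rule E.path_geodesic[OF q' V0(2) _ long(2)]) simp
  have GA: "G \<tau> \<in> E.lims A" if "2 \<le> \<tau>" "\<tau> \<le> 6" for \<tau>
    unfolding G_def
  proof (rule E.lims_constI[where A = A and c = M, OF GV(1) AX(1)])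
    show "eventually (\<lambda>n. path_at q (\<lambda>n. l n 0) \<theta> \<tau> n \<in> nbhd X d M (A n)) \<omega>"
    proof (rule always_eventually, rule allI)
      fix n
      have "2 * \<theta> n \<le> \<tau> * \<theta> n" "\<tau> * \<theta> n \<le> 6 * \<theta> n" using that \<theta>(1)[of n] by simp_all
      then have "l n 0 - \<tau> * \<theta> n \<in> {2 * \<theta> n..l n 0 - 2 * \<theta> n}" using l0(1)[of n] by auto
      then show "path_at q (\<lambda>n. l n 0) \<theta> \<tau> n \<in> nbhd X d M (A n)" using *(5) min8(1)[of \<tau> n] that unfolding q_def by simp
    qed
  qed (use that in simp)
  have GA': "G' \<tau> \<in> E.lims A'" if "2 \<le> \<tau>" "\<tau> \<le> 6" for \<tau>
    unfolding G'_def
  proof (rule E.lims_constI[where A = A' and c = M, OF GV(2) AX(2)])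
    show "eventually (\<lambda>n. path_at (\<lambda>n. g n 1) (\<lambda>n. l n 1) \<theta> \<tau> n \<in> nbhd X d M (A' n)) \<omega>"
    proof (rule always_eventually, rule allI)
      fix n
      have "2 * \<theta> n \<le> \<tau> * \<theta> n" "\<tau> * \<theta> n \<le> 6 * \<theta> n" using that \<theta>(1)[of n] by simp_all
      then have "\<tau> * \<theta> n \<in> {2 * \<theta> n..l n 1 - 2 * \<theta> n}" using l0(2)[of n] by auto
      then show "path_at (\<lambda>n. g n 1) (\<lambda>n. l n 1) \<theta> \<tau> n \<in> nbhd X d M (A' n)" using *(6) min8(2)[of \<tau> n] that by simp
    qed
  qed (use that in simp)
  have meet: "y = z" if "y \<in> E.lims A" "y \<in> E.lims A'" "z \<in> E.lims A" "z \<in> E.lims A'" for y z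
  proof (rule ccontr)
    assume "y \<noteq> z"
    then have "eventually (\<lambda>n. A n = A' n) \<omega>" by (rule E.tree_graded_same[OF E.tg *(3,4) that])
    then have "eventually (\<lambda>n. False) \<omega>" using *(7) by simp
    then show False by simp
  qed
  have "G' 3 \<noteq> G' 4"
  proof
    assume "G' 3 = G' 4"
    moreover have "E.D (G' 3) (G' 4) = 1" using geodesic_dist[OF geoG', of 3 4] by simp
    ultimately show False using geodesic_in[OF geoG', of 4] by simp
  qed
  \<comment> \<open>Two candidates, because one of the two points may be the only common point of
    the limit sets.\<close>
  then obtain \<zeta> where \<zeta>: "\<zeta> = 3 \<or> \<zeta> = 4" "G' \<zeta> \<notin> E.lims A"
    using meet[of "G' 3" "G' 4"] GA'[of 3] GA'[of 4] by auto
  have \<zeta>r: "3 \<le> \<zeta>" "\<zeta> \<le> 4" "0 \<le> \<zeta>" "\<zeta> \<le> 8" using \<zeta>(1) by auto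
  have G2: "G 2 \<in> E.lims A" "G 3 \<in> E.lims A" using GA[of 2] GA[of 3] by simp_all
  note good = E.lims_good[OF *(3) G2(1)]
  have zC: "G' \<zeta> \<in> E.C" using geodesic_in[OF geoG', of \<zeta>] \<zeta>r by simp
  obtain e where e: "E.Pc.entry (E.lims A) (G' \<zeta>) e" using E.Pc.entry_ex[OF good zC G2(1)] by blast
  have eA: "e \<in> E.lims A" by (rule E.Pc.entry_in(1)[OF e])
  \<comment> \<open>The contradiction, once \<open>e\<close> is represented by a sequence
    \<open>b\<close> from which the rest of the hexagon keeps away at scale \<theta>. The rest omits
    the corner and runs from \<open>G' \<zeta>\<close> over the edges 2 to 5 to
    \<open>G 3\<close>.\<close>
  have final: False
    if b: "b \<in> E.V" "e = E.pt b" and \<tau>: "0 < \<tau>" and ne: "e \<noteq> G 3"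
      and far1: "\<And>n u. u \<in> {\<zeta> * \<theta> n..l n 1} \<Longrightarrow> \<tau> * \<theta> n \<le> d (b n) (g n 1 u)"
      and far2: "\<And>n i u. 2 \<le> i \<Longrightarrow> i \<le> 5 \<Longrightarrow> u \<in> {0..l n i} \<Longrightarrow> \<tau> * \<theta> n \<le> d (b n) (g n i u)"
      and far3: "\<And>n u. u \<in> {0..l n 0 - 3 * \<theta> n} \<Longrightarrow> \<tau> * \<theta> n \<le> d (b n) (g n 0 u)" for b \<tau>
  proof -
    have bX: "b n \<in> X" for n by (rule E.V_X[OF b(1)])
    define h where "h j n u = (if j = 0 then g n 1 (\<zeta> * \<theta> n + u) else if j = 5 then g n 0 u else g n (Suc j) u)" for j n u
    define \<eta> where "\<eta> j n = (if j = 0 then l n 1 - \<zeta> * \<theta> n else if j = 5 then l n 0 - 3 * \<theta> n else l n (Suc j))" for j n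
    have \<zeta>\<theta>: "0 \<le> \<zeta> * \<theta> n" "\<zeta> * \<theta> n \<le> l n 1" for n
      using \<zeta>r \<theta>(1)[of n] min8(2)[of \<zeta> n] by (auto simp: min_def split: if_splits)
    have g03: "0 \<le> l n 0 - 3 * \<theta> n" for n using l0(1)[of n] \<theta>(1)[of n] by linarith
    have hg: "geodesic X d (h j n) (\<eta> j n)" if "j \<le> 5" for j n
    proof -
      have "Suc j < 6" if "j \<noteq> 5" using that \<open>j \<le> 5\<close> by simp
      then consider "j = 0" | "j = 5" | "j \<noteq> 0" "j \<noteq> 5" "Suc j < 6" by blast
      then show ?thesis
      proof cases
        case 1
        then show ?thesis unfolding h_def \<eta>_def using geodesic_shift[OF q' \<zeta>\<theta>(1,2) order_refl] by simp
      next
        case 2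
        have "geodesic X d (\<lambda>u. g n 0 (0 + u)) ((l n 0 - 3 * \<theta> n) - 0)"
          by (rule geodesic_shift[OF gg]) (use g03[of n] \<theta>(1)[of n] in auto)
        then show ?thesis unfolding h_def \<eta>_def using 2 by simp
      next
        case 3 then show ?thesis unfolding h_def \<eta>_def using gg[of "Suc j" n] by simp
      qed
    qed
    have hs: "h j n (\<eta> j n) = h (Suc j) n 0" if "j < 5" for j n
    proof -
      have "Suc j < 5" if "j \<noteq> 4" using that \<open>j < 5\<close> by simp
      then consider "j = 0" | "j = 4" | "j \<noteq> 0" "Suc j < 5" by blast
      then show ?thesis
      proof cases
        case 1 then show ?thesis unfolding h_def \<eta>_def using F(2)[of 1 n] by (simp add: numeral_2_eq_2)
      next
        case 2 then show ?thesis unfolding h_def \<eta>_def using F(2)[of 5 n] by simp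
      next
        case 3
        then have "Suc (Suc j) mod 6 = Suc (Suc j)" by simp
        then show ?thesis unfolding h_def \<eta>_def using F(2)[of "Suc j" n] 3 by simp
      qed
    qed
    have far: "\<tau> * \<theta> n \<le> d (b n) (h j n u)" if "j \<le> 5" "u \<in> {0..\<eta> j n}" for j n u
    proof -
      have "Suc j \<le> 5" if "j \<noteq> 5" using that \<open>j \<le> 5\<close> by simp
      moreover have "2 \<le> Suc j" if "j \<noteq> 0" using that by simp
      ultimately consider "j = 0" | "j = 5" | "j \<noteq> 0" "j \<noteq> 5" "2 \<le> Suc j" "Suc j \<le> 5" by blast
      then show ?thesis
      proof cases
        case 1 then show ?thesis using that far1[of "\<zeta> * \<theta> n + u" n] \<zeta>\<theta>(1)[of n] unfolding h_def \<eta>_def by simp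
      next
        case 2 then show ?thesis using that far3[of u n] unfolding h_def \<eta>_def by simp
      next
        case 3 then show ?thesis using that far2[OF 3(3,4), of u n] unfolding h_def \<eta>_def by simp
      qed
    qed
    define z where "z n = h 0 n 0" for n
    define y where "y n = h 5 n (\<eta> 5 n)" for n
    have zX: "z n \<in> X" "y n \<in> X" for n
      unfolding z_def y_def using geodesic_in[OF hg] geodesic_nonneg[OF hg] by simp_all
    have "z = path_at (\<lambda>n. g n 1) (\<lambda>n. l n 1) \<theta> \<zeta>" unfolding z_def h_def using min8(2)[OF \<zeta>r(4)] by (simp add: fun_eq_iff)
    then have z: "z \<in> E.V" "E.pt z = G' \<zeta>" using GV(2)[OF \<zeta>r(3)] unfolding G'_def by simp_all
    have "y = path_at q (\<lambda>n. l n 0) \<theta> 3" unfolding y_def h_def \<eta>_def q_def using min8(1)[of 3] by (simp add: fun_eq_iff)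
    then have y: "y \<in> E.V" "E.pt y = G 3" using GV(1)[of 3] unfolding G_def by simp_all
    obtain p lp where p: "\<And>n. geodesic X d (p n) (lp n)" "\<And>n. p n 0 = b n" "\<And>n. p n (lp n) = z n"
      using E.lseg_ex[OF geo_space b(1) z(1)] by metis
    obtain p' lp' where p': "\<And>n. geodesic X d (p' n) (lp' n)" "\<And>n. p' n 0 = b n" "\<And>n. p' n (lp' n) = y n"
      using E.lseg_ex[OF geo_space b(1) y(1)] by metis
    have "cone_linked b \<theta> (path_at p lp \<theta> \<tau>) (path_at p' lp' \<theta> \<tau>)"
    proof (rule linked_chain[where h = h and \<eta> = \<eta> and k = 5, OF bX \<theta>(1) \<theta>top p(1,2) _ hg hs \<tau> _ p'(1,2)])
      show "p n (lp n) = h 0 n 0" for n using p(3) unfolding z_def .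
      show "p' n (lp' n) = h 5 n (\<eta> 5 n)" for n using p'(3) unfolding y_def .
      fix j :: nat assume "j \<le> 5"
      then show "eventually (\<lambda>n. \<forall>t\<in>{0..\<eta> j n}. \<tau> * \<theta> n \<le> d (b n) (h j n t)) \<omega>" using far by (auto intro!: always_eventually)
    qed
    from linked_rebase[OF vX \<theta>(1) \<theta>top b(1) this]
    have mid: "E.Pc.linked e (E.pt (path_at p lp \<theta> \<tau>)) (E.pt (path_at p' lp' \<theta> \<tau>))" unfolding b(2) .
    \<comment> \<open>\<open>linked_chain\<close> links points at distance \<open>\<tau>\<close> on
      auxiliary geodesics issuing from \<open>b\<close>; the remaining parts of these geodesics link
      them to their ends.\<close>
    have to_end: "E.Pc.linked e (E.pt (path_at r lr \<theta> \<tau>)) (E.pt w)"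
      if r: "\<And>n. geodesic X d (r n) (lr n)" "\<And>n. r n 0 = b n" "\<And>n. r n (lr n) = w n" and w: "w \<in> E.V"
        and fw: "\<And>n. \<tau> * \<theta> n \<le> d (b n) (w n)" for r lr w
    proof -
      have lr0: "0 \<le> lr n" for n by (rule geodesic_nonneg[OF r(1)])
      have dw: "d (b n) (w n) = lr n" for n
        using geodesic_dist[OF r(1), of 0 n "lr n"] lr0[of n] r(2,3)[of n] by simp
      have m: "min (lr n) (\<tau> * \<theta> n) = \<tau> * \<theta> n" for n using fw[of n] dw[of n] by simp
      have \<tau>\<theta>: "0 \<le> \<tau> * \<theta> n" for n using \<tau> \<theta>(1)[of n] by simp
      have r0: "(\<lambda>n. r n 0) \<in> E.V" "(\<lambda>n. r n (lr n)) \<in> E.V" using b(1) w r by simp_all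
      have "E.Pc.linked (E.pt b) (E.pt (\<lambda>n. r n (min (lr n) (\<tau> * \<theta> n)))) (E.pt (\<lambda>n. r n (lr n)))"
      proof (rule E.linked_along[OF r(1) _ _ _ E.path_seq_V[OF r(1) r0(1)] r0(2) b(1) \<tau>])
        show "0 \<le> min (lr n) (\<tau> * \<theta> n)" "min (lr n) (\<tau> * \<theta> n) \<le> lr n" for n using \<tau>\<theta>[of n] lr0[of n] by auto
        show "eventually (\<lambda>n. \<forall>t\<in>{min (lr n) (\<tau> * \<theta> n)..lr n}. \<tau> * \<theta> n \<le> d (b n) (r n t)) \<omega>"
        proof (rule always_eventually, intro allI ballI)
          fix n t assume "t \<in> {min (lr n) (\<tau> * \<theta> n)..lr n}"
          then have t: "\<tau> * \<theta> n \<le> t" "t \<le> lr n" using m[of n] by auto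
          have "d (r n 0) (r n t) = t" using geodesic_dist[OF r(1), of 0 n t] t \<tau>\<theta>[of n] by simp
          then show "\<tau> * \<theta> n \<le> d (b n) (r n t)" using t r(2)[of n] by simp
        qed
      qed (use \<tau> in auto)
      then show ?thesis using r(3) b(2) by simp
    qed
    have z_far: "\<tau> * \<theta> n \<le> d (b n) (z n)" for n
      unfolding z_def using far[of 0 0 n] geodesic_nonneg[OF hg[of 0 n]] by simp
    have y_far: "\<tau> * \<theta> n \<le> d (b n) (y n)" for n
      unfolding y_def using far[of 5 "\<eta> 5 n" n] geodesic_nonneg[OF hg[of 5 n]] by simp
    have "E.Pc.linked e (G' \<zeta>) (G 3)"
      using E.Pc.linked_sym[OF to_end[OF p z(1) z_far]] mid to_end[OF p' y(1) y_far]
      unfolding z(2) y(2) by (meson rtranclp_trans)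
    from E.Pc.linked_not_in_piece[OF E.lims_piece[OF *(3) G2(1)] \<zeta>(2) e this]
    show False using G2(2) by blast
  qed
  have dv: "d (v n) (g n 0 u) = l n 0 - u" if "u \<in> {0..l n 0}" for n u
    unfolding v_def using geodesic_dist[OF gg[of 0 n], of "l n 0" u] that by auto
  have dv': "d (v n) (g n 1 u) = u" if "u \<in> {0..l n 1}" for n u
    unfolding v1 using geodesic_dist[OF q', of 0 n u] that by auto
  have dv2: "8 * \<theta> n \<le> d (v n) (g n i u)" if "2 \<le> i" "i \<le> 5" "u \<in> {0..l n i}" for n i u
    unfolding v_def using F(4)[of 0 i u n] that by simp
  have gX: "g n i u \<in> X" if "i < 6" "u \<in> {0..l n i}" for n i u by (rule geodesic_in[OF gg[OF that(1)] that(2)])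
  have tri: "d (v n) w \<le> d (v n) (b n) + d (b n) w" if "b n \<in> X" "w \<in> X" for n b w
    using triangle[OF vX that] .
  show False
  \<comment> \<open>If edge 1 does not meet the limit set before \<open>G' \<zeta>\<close>, the
    corner has the same entry point \<open>e\<close>, which lies on edge 0. If it does,
    \<open>e\<close> lies on edge 1.\<close>
  proof (cases "G' ` {0..\<zeta>} \<inter> E.lims A = {}")
    case True
    have s2: "geo_seg E.C E.D (G ` {0..2}) (E.pt v) (G 2)" by (rule seg) simp_all
    obtain e2 where e2: "E.Pc.entry (E.lims A) (E.pt v) e2"
      using E.Pc.entry_ex[OF good E.pt_in[OF E.base_V] G2(1)] by blast
    have "e2 = e" by (rule E.Pc.entry_avoid[OF good seg'[OF \<zeta>r(3,4)] True e2 e])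
    moreover have "e2 \<in> G ` {0..2}"
      by (rule E.Pc.entry_on_seg(1)[OF good s2 E.Pc.seg_ends(2)[OF s2] G2(1) e2])
    ultimately obtain t where t: "0 \<le> t" "t \<le> 2" "e = G t" by auto
    define b where "b = path_at q (\<lambda>n. l n 0) \<theta> t"
    have bn: "b n = g n 0 (l n 0 - t * \<theta> n)" "l n 0 - t * \<theta> n \<in> {0..l n 0}" "t * \<theta> n \<le> 2 * \<theta> n" for n
    proof -
      show "b n = g n 0 (l n 0 - t * \<theta> n)" unfolding b_def q_def using min8(1)[of t n] t by simp
      show "t * \<theta> n \<le> 2 * \<theta> n" using t \<theta>(1)[of n] by simp
      moreover have "0 \<le> t * \<theta> n" using t \<theta>(1)[of n] by simp
      ultimately show "l n 0 - t * \<theta> n \<in> {0..l n 0}" using l0(1)[of n] \<theta>(1)[of n] unfolding atLeastAtMost_iff by linarith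
    qed
    have bX: "b n \<in> X" for n unfolding bn(1) by (rule gX[OF _ bn(2)]) simp
    \<comment> \<open>\<open>b n\<close> is within \<open>2 * \<theta> n\<close> of the corner,
      while the rest of edge 1 is at least \<open>3 * \<theta> n\<close> and the edges 2 to 5, by
      (F2), are at least \<open>8 * \<theta> n\<close> away from it.\<close>
    have db: "d (v n) (b n) \<le> 2 * \<theta> n" for n unfolding bn(1) dv[OF bn(2)] using bn(3)[of n] by simp
    show False
    proof (rule final[of b 1])
      show "b \<in> E.V" "e = E.pt b" using GV(1)[OF t(1)] t(3) unfolding b_def G_def by auto
      show "e \<noteq> G 3"
      proof
        assume "e = G 3"
        then have "E.D (G t) (G 3) = 0" using t(3) geodesic_in[OF geoG, of 3] by simp
        then show False using geodesic_dist[OF geoG, of t 3] t by simp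
      qed
    next
      fix n u assume u: "u \<in> {\<zeta> * \<theta> n..l n 1}"
      have "3 * \<theta> n \<le> \<zeta> * \<theta> n" using \<zeta>r \<theta>(1)[of n] by simp
      then have "3 * \<theta> n \<le> u" "u \<in> {0..l n 1}" using u \<theta>(1)[of n] unfolding atLeastAtMost_iff by linarith+
      then show "1 * \<theta> n \<le> d (b n) (g n 1 u)"
        using tri[of b n "g n 1 u"] bX gX[of 1 u n] dv'[of u n] db[of n] by simp
    next
      fix n i u assume i: "2 \<le> (i::nat)" "i \<le> 5" "u \<in> {0..l n i}"
      then show "1 * \<theta> n \<le> d (b n) (g n i u)"
        using tri[of b n "g n i u"] bX gX[of i u n] dv2[OF i] db[of n] \<theta>(1)[of n] by simp
    next
      fix n u assume u: "u \<in> {0..l n 0 - 3 * \<theta> n}"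
      then have u': "u \<in> {0..l n 0}" using \<theta>(1)[of n] by auto
      have "\<theta> n \<le> \<bar>l n 0 - t * \<theta> n - u\<bar>" using u bn(3)[of n] by (intro order_trans[OF _ abs_ge_self]) auto
      then show "1 * \<theta> n \<le> d (b n) (g n 0 u)"
        unfolding bn(1) using geodesic_dist[OF gg[of 0 n] bn(2) u'] by simp
    qed simp
  next
    case False
    then obtain w where w: "w \<in> G' ` {0..\<zeta>}" "w \<in> E.lims A" by blast
    have "e \<in> G' ` {0..\<zeta>}"
      by (rule E.Pc.entry_on_seg(1)[OF good E.Pc.seg_sym[OF seg'[OF \<zeta>r(3,4)]] w e])
    then obtain t where t0: "0 \<le> t" "t \<le> \<zeta>" "e = G' t" by auto
    have "t \<noteq> \<zeta>" using t0 eA \<zeta>(2) by auto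
    then have t: "0 \<le> t" "t < \<zeta>" "e = G' t" "t \<le> 4" "t \<le> 8" using t0 \<zeta>r by auto
    define b where "b = path_at (\<lambda>n. g n 1) (\<lambda>n. l n 1) \<theta> t"
    have bn: "b n = g n 1 (t * \<theta> n)" "t * \<theta> n \<in> {0..l n 1}" "t * \<theta> n \<le> 4 * \<theta> n" for n
    proof -
      show "b n = g n 1 (t * \<theta> n)" unfolding b_def using min8(2)[OF t(5), of n] by simp
      show "t * \<theta> n \<le> 4 * \<theta> n" using t \<theta>(1)[of n] by simp
      moreover have "0 \<le> t * \<theta> n" using t \<theta>(1)[of n] by simp
      ultimately show "t * \<theta> n \<in> {0..l n 1}" using l0(2)[of n] \<theta>(1)[of n] unfolding atLeastAtMost_iff by linarith
    qed
    have bX: "b n \<in> X" for n unfolding bn(1) by (rule gX[OF _ bn(2)]) simp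
    have db: "d (v n) (b n) = t * \<theta> n" for n unfolding bn(1) by (rule dv'[OF bn(2)])
    \<comment> \<open>\<open>e\<close> may be close to \<open>G' \<zeta>\<close> on edge 1, so the
      clearance depends on \<open>\<zeta> - t\<close>.\<close>
    define \<tau> where "\<tau> = min 1 (\<zeta> - t)"
    have \<tau>: "0 < \<tau>" "\<tau> \<le> 1" "\<tau> \<le> \<zeta> - t" unfolding \<tau>_def using t by auto
    have \<tau>\<theta>: "\<tau> * \<theta> n \<le> \<theta> n" "\<tau> * \<theta> n \<le> \<zeta> * \<theta> n - t * \<theta> n" for n
      using \<tau>(2,3) \<theta>(1)[of n] by (auto simp flip: left_diff_distrib)
    have far3: "\<tau> * \<theta> n \<le> d (b n) (g n 0 u)" if u: "u \<in> {0..l n 0 - 3 * \<theta> n}" for n u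
    proof -
      have u': "u \<in> {0..l n 0}" using u \<theta>(1)[of n] by auto
      show ?thesis
      \<comment> \<open>For \<open>t \<ge> 2\<close> the point is far enough inside edge 1 for (F1);
        for smaller \<open>t\<close> it is nearer to the corner than the rest of edge 0 by at least
        \<open>\<theta> n\<close>.\<close>
      proof (cases "2 \<le> t")
        case True
        then have "2 * \<theta> n \<le> t * \<theta> n" using \<theta>(1)[of n] by simp
        moreover have "2 * \<theta> n \<le> l n 1 - t * \<theta> n" using bn(3)[of n] l0(2)[of n] \<theta>(1)[of n] by linarith
        ultimately have "\<theta> n \<le> d (b n) (g n 0 u)"
          unfolding bn(1) using F(3)[of 1 0 "t * \<theta> n" n u] bn(2)[of n] u' by simp
        then show ?thesis using \<tau>\<theta>(1)[of n] by linarith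
      next
        case False
        then have "t * \<theta> n \<le> 2 * \<theta> n" using \<theta>(1)[of n] by simp
        then have "\<theta> n \<le> d (b n) (g n 0 u)"
          using tri[of b n "g n 0 u"] bX gX[of 0 u n] dv[OF u'] db[of n] u u' by simp
        then show ?thesis using \<tau>\<theta>(1)[of n] by linarith
      qed
    qed
    show False
    proof (rule final[OF _ _ \<tau>(1) _ _ _ far3])
      show "b \<in> E.V" "e = E.pt b" using GV(2)[OF t(1)] t(3) unfolding b_def G'_def by auto
      show "e \<noteq> G 3"
      proof
        assume eG: "e = G 3"
        have "eventually (\<lambda>n. d (b n) (path_at q (\<lambda>n. l n 0) \<theta> 3 n) < \<tau> * \<theta> n) \<omega>"
          by (rule E.pt_eqD[OF _ _ GV(1) \<tau>(1)]) (use eG t(3) GV(2)[OF t(1)] in \<open>auto simp: b_def G_def G'_def\<close>)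
        then have "eventually (\<lambda>n. False) \<omega>"
        proof eventually_elim
          case (elim n)
          have "l n 0 - 3 * \<theta> n \<in> {0..l n 0 - 3 * \<theta> n}" using l0(1)[of n] \<theta>(1)[of n] by auto
          from far3[OF this] show False using elim min8(1)[of 3 n] unfolding q_def by simp
        qed
        then show False by simp
      qed
    next
      fix n u assume u: "u \<in> {\<zeta> * \<theta> n..l n 1}"
      have "0 \<le> \<zeta> * \<theta> n" using \<zeta>r \<theta>(1)[of n] by simp
      then have u': "u \<in> {0..l n 1}" using u by auto
      show "\<tau> * \<theta> n \<le> d (b n) (g n 1 u)"
        unfolding bn(1) using geodesic_dist[OF q' bn(2) u'] u \<tau>\<theta>(2)[of n] by auto
    next
      fix n i u assume i: "2 \<le> (i::nat)" "i \<le> 5" "u \<in> {0..l n i}"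
      then have "4 * \<theta> n \<le> d (b n) (g n i u)"
        using tri[of b n "g n i u"] bX gX[of i u n] dv2[OF i] db[of n] bn(3)[of n] by simp
      then show "\<tau> * \<theta> n \<le> d (b n) (g n i u)" using \<tau>\<theta>(1)[of n] \<theta>(1)[of n] by linarith
    qed
  qed
qed

text \<open>Rotations carry the statements about the edges 0 and 1 around the hexagon, so that one
  member serves all edges. The end parts of length \<open>2 * \<theta>\<close> are absorbed in
  \<open>K\<close>.\<close>

lemma fat_hexagons_near:
  "\<exists>\<theta>>0. \<exists>\<nu>\<ge>8. \<exists>K>0. \<forall>g l. fat_polygon X d \<theta> \<nu> 6 g l \<longrightarrow> (\<exists>A\<in>\<A>. edges g l {..<6} \<subseteq> nbhd X d K A)"
proof -
  obtain \<theta>1 where \<theta>1: "0 < \<theta>1" "\<And>\<theta> g l. \<theta>1 \<le> \<theta> \<Longrightarrow> fat_polygon X d \<theta> 8 6 g l \<Longrightarrow>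
    \<exists>A\<in>\<A>. \<forall>t\<in>{2 * \<theta>..l 0 - 2 * \<theta>}. g 0 t \<in> nbhd X d M A"
    using fat_edge_near by metis
  obtain \<theta>2 where \<theta>2: "0 < \<theta>2" "\<And>\<theta> g l A A'. \<theta>2 \<le> \<theta> \<Longrightarrow> fat_polygon X d \<theta> 8 6 g l \<Longrightarrow> A \<in> \<A> \<Longrightarrow> A' \<in> \<A> \<Longrightarrow>
    (\<forall>t\<in>{2 * \<theta>..l 0 - 2 * \<theta>}. g 0 t \<in> nbhd X d M A) \<Longrightarrow> (\<forall>t\<in>{2 * \<theta>..l 1 - 2 * \<theta>}. g 1 t \<in> nbhd X d M A') \<Longrightarrow> A = A'"
    using fat_corner_same by metis
  define \<theta> where "\<theta> = max \<theta>1 \<theta>2"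
  have \<theta>: "0 < \<theta>" "\<theta>1 \<le> \<theta>" "\<theta>2 \<le> \<theta>" unfolding \<theta>_def using \<theta>1(1) by auto
  have "\<exists>A\<in>\<A>. edges g l {..<6} \<subseteq> nbhd X d (M + 2 * \<theta>) A" if fat: "fat_polygon X d \<theta> 8 6 g l" for g l
  proof -
    have "\<exists>A\<in>\<A>. \<forall>t\<in>{2 * \<theta>..l (i mod 6) - 2 * \<theta>}. g (i mod 6) t \<in> nbhd X d M A" for i
      using \<theta>1(2)[OF \<theta>(2) fat_hexagon_rotate[OF fat, of i]] by simp
    then obtain A where A: "\<And>i. A i \<in> \<A>" "\<And>i. \<forall>t\<in>{2 * \<theta>..l (i mod 6) - 2 * \<theta>}. g (i mod 6) t \<in> nbhd X d M (A i)"
      by metis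
    have next_eq: "A i = A (Suc i)" for i
      by (rule \<theta>2(2)[OF \<theta>(3) fat_hexagon_rotate[OF fat, of i] A(1) A(1)]) (use A(2)[of i] A(2)[of "Suc i"] in simp_all)
    have A0: "A i = A 0" for i by (induction i) (use next_eq in simp_all)
    have "g i u \<in> nbhd X d (M + 2 * \<theta>) (A 0)" if i: "i < 6" and u: "u \<in> {0..l i}" for i u
    proof -
      have gi: "geodesic X d (g i) (l i)" by (rule fat_polygonD(1)[OF fat i])
      have len: "8 * \<theta> \<le> l i" by (rule fat_hexagon_length[OF fat i])
      define t where "t = max (2 * \<theta>) (min u (l i - 2 * \<theta>))"
      have t: "t \<in> {2 * \<theta>..l i - 2 * \<theta>}" "t \<in> {0..l i}" "\<bar>t - u\<bar> \<le> 2 * \<theta>" unfolding t_def using len \<theta>(1) u by auto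
      have "g i t \<in> nbhd X d M (A 0)" using A(2)[of i] A0[of i] i t(1) by simp
      then show ?thesis
        by (rule nbhd_triangle[OF _ geodesic_in[OF gi u] _ coll_sub[OF A(1)]])
          (use geodesic_dist[OF gi t(2) u] t(3) in simp)
    qed
    then have "edges g l {..<6} \<subseteq> nbhd X d (M + 2 * \<theta>) (A 0)" unfolding edges_def by auto
    then show ?thesis using A(1) by blast
  qed
  moreover have "0 < M + 2 * \<theta>" using M0 \<theta>(1) by simp
  ultimately show ?thesis using \<theta>(1) by (intro exI[of _ \<theta>] conjI exI[of _ "8::real"] exI[of _ "M + 2 * \<theta>"]) auto
qed

end

text \<open>Zorn's lemma for the reversed order gives a minimal filter other than \<open>bot\<close>
  below \<open>sequentially\<close>.\<close>

lemma nonprincipal_ultrafilter_exists: "\<exists>\<omega>. nonprincipal_ultrafilter \<omega>"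
proof -
  define A where "A = {F :: nat filter. F \<noteq> bot \<and> F \<le> sequentially}"
  have "\<exists>m\<in>A. \<forall>F\<in>A. F \<le> m \<longrightarrow> F = m"
  proof (rule predicate_Zorn[where P = "\<lambda>F G. G \<le> F"])
    show "partial_order_on A (relation_of (\<lambda>F G. G \<le> F) A)"
      by (rule partial_order_on_relation_ofI) auto
    fix C assume C: "C \<in> Chains (relation_of (\<lambda>F G. G \<le> F) A)"
    show "\<exists>u\<in>A. \<forall>a\<in>C. u \<le> a"
    proof (cases "C = {}")
      case True
      have "sequentially \<in> A" unfolding A_def by simp
      then show ?thesis using True by blast
    next
      case False
      have CA: "C \<subseteq> A" using C by (rule Chains_relation_of)
      have "\<exists>x\<in>C. x \<le> inf F G" if FG: "F \<in> C" "G \<in> C" for F G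
      proof -
        have "F \<le> G \<or> G \<le> F" using C FG unfolding Chains_def relation_of_def by auto
        then show ?thesis using FG by (metis inf.absorb1 inf.absorb2 order_refl)
      qed
      then have ev: "eventually P (Inf C) \<longleftrightarrow> (\<exists>F\<in>C. eventually P F)" for P
        using False by (intro eventually_Inf_base) auto
      have "Inf C \<noteq> bot" using ev[of "\<lambda>_. False"] CA unfolding A_def trivial_limit_def by auto
      moreover obtain F where "F \<in> C" using False by blast
      then have "Inf C \<le> sequentially" using CA Inf_lower[of F C] unfolding A_def by auto
      ultimately show ?thesis using Inf_lower unfolding A_def by blast
    qed
  qed
  then obtain m where m: "m \<noteq> bot" "m \<le> sequentially" "\<And>F. F \<noteq> bot \<Longrightarrow> F \<le> sequentially \<Longrightarrow> F \<le> m \<Longrightarrow> F = m"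
    unfolding A_def by auto
  have "eventually P m \<or> eventually (\<lambda>n. \<not> P n) m" for P
  proof (rule disjCI)
    assume not: "\<not> eventually (\<lambda>n. \<not> P n) m"
    \<comment> \<open>Adding \<open>P\<close> gives a filter other than \<open>bot\<close>, since
      the negation of \<open>P\<close> does not hold eventually; by minimality it is
      \<open>m\<close> itself.\<close>
    have "inf m (principal {n. P n}) \<noteq> bot"
      using not unfolding trivial_limit_def eventually_inf_principal by simp
    moreover have "inf m (principal {n. P n}) \<le> sequentially" using m(2) by (simp add: le_infI1)
    ultimately have "inf m (principal {n. P n}) = m" using m(3) by simp
    moreover have "eventually P (inf m (principal {n. P n}))" unfolding eventually_inf_principal by simp
    ultimately show "eventually P m" by simp
  qed
  moreover have "m \<noteq> principal {k}" for k
  proof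
    assume "m = principal {k}"
    moreover have "eventually (\<lambda>n. k < n) m" by (rule filter_leD[OF m(2) eventually_gt_at_top])
    ultimately show False by (simp add: eventually_principal)
  qed
  ultimately show ?thesis using m(1) unfolding nonprincipal_ultrafilter_def by blast
qed

theorem theorem1p6:
  fixes X :: "'a set" and d :: "'a \<Rightarrow> 'a \<Rightarrow> real" and \<A> :: "'a set set"
  assumes "Metric_space X d" and "geodesic_space X d"
    and "\<forall>A\<in>\<A>. A \<subseteq> X"
    and "\<forall>A\<in>\<A>. \<forall>r\<ge>0. \<not> X \<subseteq> nbhd X d r A"
  shows "asymptotically_tree_graded X d \<A> \<longleftrightarrow>
    (\<forall>\<delta>>0. \<exists>D::real. \<forall>A\<in>\<A>. \<forall>A'\<in>\<A>. A \<noteq> A' \<longrightarrow>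
       set_diam d (nbhd X d \<delta> A \<inter> nbhd X d \<delta> A') \<le> ennreal D) \<and>
    (\<exists>\<epsilon>>0. \<exists>M\<ge>0. \<forall>g l. \<forall>A\<in>\<A>. geodesic X d g l \<and>
       g 0 \<in> nbhd X d (\<epsilon> * l) A \<and> g l \<in> nbhd X d (\<epsilon> * l) A \<longrightarrow>
       g ` {l / 3..2 * l / 3} \<subseteq> nbhd X d M A) \<and>
    (\<exists>\<theta>>0. \<exists>\<nu>\<ge>8. \<exists>K>0. \<forall>g l. fat_polygon X d \<theta> \<nu> 6 g l \<longrightarrow>
       (\<exists>A\<in>\<A>. edges g l {..<6} \<subseteq> nbhd X d K A))"
    (is "_ \<longleftrightarrow> ?\<alpha> \<and> ?\<beta>2 \<and> ?\<beta>3")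
proof
  assume tg: "asymptotically_tree_graded X d \<A>"
  \<comment> \<open>A single ultrafilter is enough to derive the three properties.\<close>
  obtain \<omega> where \<omega>: "nonprincipal_ultrafilter \<omega>" using nonprincipal_ultrafilter_exists by blast
  interpret Metric_space X d by (rule assms(1))
  interpret atg X d \<omega> \<A>
    by unfold_locales (use \<omega> assms tg in auto)
  have \<alpha>: ?\<alpha> by (intro allI impI) (rule intersections_bounded)
  have mid: ?\<beta>2 by (rule middle_third_near)
  then obtain \<epsilon> M where \<epsilon>M: "\<epsilon> > 0" "M \<ge> 0" "\<forall>g l. \<forall>A\<in>\<A>. geodesic X d g l \<and>
       g 0 \<in> nbhd X d (\<epsilon> * l) A \<and> g l \<in> nbhd X d (\<epsilon> * l) A \<longrightarrow> g ` {l / 3..2 * l / 3} \<subseteq> nbhd X d M A"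
    by (elim conjE exE)
  interpret atg_quasi_convex X d \<omega> \<A> \<epsilon> M by unfold_locales (fact \<epsilon>M)+
  show "?\<alpha> \<and> ?\<beta>2 \<and> ?\<beta>3" by (rule conjI[OF \<alpha> conjI[OF mid fat_hexagons_near]])
next
  assume R: "?\<alpha> \<and> ?\<beta>2 \<and> ?\<beta>3"
  note \<alpha> = R[THEN conjunct1] and R2 = R[THEN conjunct2, THEN conjunct1] and R3 = R[THEN conjunct2, THEN conjunct2]
  from R2 obtain \<epsilon> M where \<epsilon>M: "\<epsilon> > 0" "M \<ge> 0" "\<forall>g l. \<forall>A\<in>\<A>. geodesic X d g l \<and>
       g 0 \<in> nbhd X d (\<epsilon> * l) A \<and> g l \<in> nbhd X d (\<epsilon> * l) A \<longrightarrow> g ` {l / 3..2 * l / 3} \<subseteq> nbhd X d M A"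
    by (elim conjE exE)
  from R3 obtain \<theta> \<nu> K where \<theta>: "\<theta> > 0" "\<nu> \<ge> 8" "K > 0" "\<forall>g l. fat_polygon X d \<theta> \<nu> 6 g l \<longrightarrow>
       (\<exists>A\<in>\<A>. edges g l {..<6} \<subseteq> nbhd X d K A)"
    by (elim conjE exE)
  show "asymptotically_tree_graded X d \<A>"
    unfolding asymptotically_tree_graded_def
  proof (intro allI impI, elim conjE)
    fix \<omega> and e :: "nat \<Rightarrow> 'a" and s :: "nat \<Rightarrow> real"
    assume "nonprincipal_ultrafilter \<omega>" "\<forall>n. e n \<in> X" "\<forall>n. 0 < s n" "filterlim s at_top \<omega>"
    then interpret cone_coll X d \<omega> e s \<A>
      using assms(1,3) by (unfold_locales; (auto simp: Metric_space_def)?)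
    show "tree_graded C D inds P"
      by (rule cone_tree_graded[OF assms(2) \<alpha> \<epsilon>M \<theta>(1,2,4)])
  qed
qed

end
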